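(* Let $T_\sigma$ be a pseudo-differential operator with symbol $\sigma\in S^0_{1,0}(\mathbb{T}\times\mathbb{Z})$ and let $1<p<\infty$. Then $T_\sigma$ is a Riesz operator on $L^p(\mathbb{T})$ if and only if $$d'_\sigma:=\lim_{|k|\to\infty}\Big\{\sup_{x\in\mathbb{T}}|\sigma(x,k)|\Big\}=0.$$
   Context: $\mathbb{T}=\mathbb{R}/2\pi\mathbb{Z}$ with normalized Haar measure $dx$; $\widehat f(k)=\int_{\mathbb{T}}f(x)e^{-ixk}\,dx$ for $k\in\mathbb{Z}$. For $m\in\mathbb{R}$ and $0\le\rho,\delta\le1$, the class $S^m_{\rho,\delta}(\mathbb{T}\times\mathbb{Z})$ consists of the functions $\sigma:\mathbb{T}\times\mathbb{Z}\to\mathbb{C}$, smooth in $x$, such that for all integers $t,r\ge0$ there is a constant $C_{t,r}>0$ with $|\Delta_k^tD_x^r\sigma(x,k)|\le C_{t,r}\langle k\rangle^{m-\rho t+\delta r}$ for all $(x,k)$, where $\langle k\rangle=(1+k^2)^{1/2}$, $\Delta_k^t\varphi(k)=\sum_{h=0}^t(-1)^{t-h}\binom{t}{h}\varphi(k+h)$, and $D_x^rf=(-i)^r\partial_x^rf$. The operator $T_\sigma$ is defined on trigonometric polynomials by $(T_\sigma f)(x)=\sum_{k\in\mathbb{Z}}\sigma(x,k)\widehat f(k)e^{ixk}$; for $\sigma\in S^0_{1,0}(\mathbb{T}\times\mathbb{Z})$ it extends to a bounded operator on $L^p(\mathbb{T})$, $1<p<\infty$, again denoted $T_\sigma$. A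 bounded linear operator $T$ on a Banach space $E$ with unit ball $B_E$ is a Riesz operator if for every $\varepsilon>0$ there exist an exponent $s\in\{1,2,\dots\}$ and finitely many points $v_1,\dots,v_h\in E$ (depending on $\varepsilon$) such that $T^s(B_E)\subseteq\bigcup_{j=1}^h(v_j+\varepsilon^sB_E)$. *)

theory Defs
  imports "HOL-Analysis.Analysis"
begin

section \<open>The torus\<close>

text \<open>
  Functions on the torus are functions on the reals that are periodic with period \<open>2 * pi\<close>.
  Normalized Haar measure is Lebesgue measure on a fundamental domain, divided by \<open>2 * pi\<close>.
\<close>

abbreviation periodic :: "(real \<Rightarrow> complex) \<Rightarrow> bool" where
  "periodic f \<equiv> periodic_fun_simple f (2 * pi)"

definition torus_measure :: "real measure" where
  "torus_measure = uniform_measure lborel {0..<2 * pi}"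

definition fourier_coeff :: "(real \<Rightarrow> complex) \<Rightarrow> int \<Rightarrow> complex" where
  "fourier_coeff f k = (LINT x|torus_measure. f x * cis (- (x * of_int k)))"

definition trig_polys :: "(real \<Rightarrow> complex) set" where
  "trig_polys = {f. \<exists>K c. finite K \<and> f = (\<lambda>x. \<Sum>k\<in>K. c k * cis (x * of_int k))}"

text \<open>
  The space \<open>L^p\<close> of the torus is given by representatives: two functions represent the same
  element iff the seminorm of their difference is zero, that is, iff they agree almost everywhere.
\<close>

definition Lp :: "real \<Rightarrow> (real \<Rightarrow> complex) set" where
  "Lp p = {f \<in> borel_measurable torus_measure.
             periodic f \<and> integrable torus_measure (\<lambda>x. cmod (f x) powr p)}"

definition Lp_norm :: "real \<Rightarrow> (real \<Rightarrow> complex) \<Rightarrow> real" where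
  "Lp_norm p f = (LINT x|torus_measure. cmod (f x) powr p) powr (1 / p)"


section \<open>Riesz operators\<close>

text \<open>
  In this section a vector space \<open>E\<close> of functions with a seminorm \<open>N\<close> stands for the normed space
  obtained by identifying \<open>f\<close> and \<open>g\<close> when \<open>N (f - g) = 0\<close>. So linearity of an operator is
  required up to this identification; together with the bound it implies that the operator
  is well defined on the quotient.
\<close>

definition bounded_operator ::
    "('a \<Rightarrow> complex) set \<Rightarrow> (('a \<Rightarrow> complex) \<Rightarrow> real) \<Rightarrow>
      (('a \<Rightarrow> complex) \<Rightarrow> 'a \<Rightarrow> complex) \<Rightarrow> bool" where
  "bounded_operator E N T \<longleftrightarrow>
     (\<forall>f\<in>E. T f \<in> E) \<and>
     (\<forall>f\<in>E. \<forall>g\<in>E. N (\<lambda>x. T (\<lambda>y. f y + g y) x - (T f x + T g x)) = 0) \<and>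
     (\<forall>c. \<forall>f\<in>E. N (\<lambda>x. T (\<lambda>y. c * f y) x - c * T f x) = 0) \<and>
     (\<exists>C. \<forall>f\<in>E. N (T f) \<le> C * N f)"

definition unit_ball ::
    "('a \<Rightarrow> complex) set \<Rightarrow> (('a \<Rightarrow> complex) \<Rightarrow> real) \<Rightarrow> ('a \<Rightarrow> complex) set" where
  "unit_ball E N = {f \<in> E. N f \<le> 1}"

definition riesz_operator ::
    "('a \<Rightarrow> complex) set \<Rightarrow> (('a \<Rightarrow> complex) \<Rightarrow> real) \<Rightarrow>
      (('a \<Rightarrow> complex) \<Rightarrow> 'a \<Rightarrow> complex) \<Rightarrow> bool" where
  "riesz_operator E N T \<longleftrightarrow>
     bounded_operator E N T \<and>
     (\<forall>\<epsilon>>0. \<exists>s\<ge>1. \<exists>V. finite V \<and> V \<subseteq> E \<and>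
        (T ^^ s) ` unit_ball E N \<subseteq>
          (\<Union>v\<in>V. (\<lambda>b x. v x + of_real (\<epsilon> ^ s) * b x) ` unit_ball E N))"


section \<open>Symbols and pseudo-differential operators\<close>

definition japanese_bracket :: "int \<Rightarrow> real" where
  "japanese_bracket k = sqrt (1 + (of_int k)\<^sup>2)"

definition iter_deriv :: "nat \<Rightarrow> (real \<Rightarrow> complex) \<Rightarrow> real \<Rightarrow> complex" where
  "iter_deriv r = (\<lambda>f x. vector_derivative f (at x)) ^^ r"

definition smooth :: "(real \<Rightarrow> complex) \<Rightarrow> bool" where
  "smooth f \<longleftrightarrow> (\<forall>r x. iter_deriv r f differentiable (at x))"

definition D_op :: "nat \<Rightarrow> (real \<Rightarrow> complex) \<Rightarrow> real \<Rightarrow> complex" where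
  "D_op r f x = (- \<i>) ^ r * iter_deriv r f x"

definition fwd_diff :: "nat \<Rightarrow> (int \<Rightarrow> complex) \<Rightarrow> int \<Rightarrow> complex" where
  "fwd_diff t \<phi> k = (\<Sum>h\<le>t. (- 1) ^ (t - h) * of_nat (t choose h) * \<phi> (k + int h))"

text \<open>The class is of interest for parameters \<open>\<rho>\<close> and \<open>\<delta>\<close> in the interval from 0 to 1.\<close>

definition symbol_class :: "real \<Rightarrow> real \<Rightarrow> real \<Rightarrow> (real \<Rightarrow> int \<Rightarrow> complex) set" where
  "symbol_class m \<rho> \<delta> =
     {\<sigma>. (\<forall>k. periodic (\<lambda>x. \<sigma> x k) \<and> smooth (\<lambda>x. \<sigma> x k)) \<and>
          (\<forall>t r. \<exists>C>0. \<forall>x k.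
             cmod (fwd_diff t (\<lambda>j. D_op r (\<lambda>y. \<sigma> y j) x) k)
               \<le> C * japanese_bracket k powr (m - \<rho> * real t + \<delta> * real r))}"

text \<open>The sum is finite when \<open>f\<close> is a trigonometric polynomial.\<close>

definition pseudo_diff_trig ::
    "(real \<Rightarrow> int \<Rightarrow> complex) \<Rightarrow> (real \<Rightarrow> complex) \<Rightarrow> real \<Rightarrow> complex" where
  "pseudo_diff_trig \<sigma> f x =
     infsum (\<lambda>k. \<sigma> x k * fourier_coeff f k * cis (x * of_int k)) UNIV"

text \<open>
  The bounded extension to \<open>L^p\<close>. Trigonometric polynomials are dense, so the choice is unique up
  to equality almost everywhere; no extension exists unless the operator is \<open>L^p\<close>-bounded on
  trigonometric polynomials, which holds for the symbols in \<open>symbol_class 0 1 0\<close> and \<open>1 < p\<close>.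
\<close>

definition pseudo_diff_op ::
    "real \<Rightarrow> (real \<Rightarrow> int \<Rightarrow> complex) \<Rightarrow> (real \<Rightarrow> complex) \<Rightarrow> real \<Rightarrow> complex" where
  "pseudo_diff_op p \<sigma> =
     (SOME T. bounded_operator (Lp p) (Lp_norm p) T \<and>
        (\<forall>f\<in>trig_polys. Lp_norm p (\<lambda>x. T f x - pseudo_diff_trig \<sigma> f x) = 0))"

end

theory Submission
  imports
    Defs
    "HOL-Complex_Analysis.Great_Picard"
    "HOL-Real_Asymp.Real_Asymp"
begin

text \<open>
  The operator exists as a bounded operator on \<open>L^p\<close> because a half-line multiplier with Mikhlin
  coefficients \<open>a\<close> has the kernel \<open>\<Sum>k. a k * z ^ k\<close> at \<open>z = r * cis (x - y)\<close>, with \<open>r < 1\<close>: summation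
  by parts gives \<open>A / cmod (1 - z)\<^sup>2\<close> for its derivative, so Calderon--Zygmund theory applies uniformly
  in \<open>r\<close>. The height of the decomposition is chosen in terms of \<open>\<epsilon> = sup cmod (a k)\<close>; this makes the norm
  \<open>O(\<epsilon> powr \<theta> * A powr (1 - \<theta>))\<close> with \<open>\<theta> > 0\<close>, small with \<open>\<epsilon>\<close> although the Mikhlin constant \<open>A\<close> is
  not. Variable coefficients are frozen on a net of points and the increments are controlled by the
  derivative of the symbol.

  If the symbol vanishes at infinity, then the frequencies \<open>\<bar>k\<bar> \<ge> N\<close> contribute an operator of small
  norm and the remaining part has finite rank, so the operator is compact. Otherwise the symbol
  converges, along a sequence of frequencies \<open>\<kappa> n\<close>, uniformly to some \<open>\<omega> \<noteq> 0\<close>. Then \<open>T ^^ s\<close> acts on the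
  exponential of frequency \<open>\<kappa> n\<close> asymptotically as multiplication by \<open>\<omega> ^ s\<close>, and these images keep a
  distance of order \<open>\<bar>\<omega>\<bar> ^ s\<close> from each other, which excludes finite nets at scale \<open>\<epsilon> ^ s\<close> for small \<open>\<epsilon>\<close>.
\<close>

section \<open>The torus and its Lebesgue spaces\<close>

text \<open>The two endpoints of the interpolation differ in kind. On L^2 only the supremum
  \<epsilon> of the coefficients counts, whereas the weak type constant contains A. Taking the
  height as the tested level divided by \<epsilon> balances the good part against the exceptional
  set and keeps that constant linear in \<epsilon> + A; a positive share of the L^2 endpoint then
  leaves a power of \<epsilon>.

  As p > 1, n is fixed first to absorb the increments, and \<epsilon> is made small afterwards,
  depending on n.

  In the converse the radius of the net is \<epsilon> ^ s, and s is known only after \<epsilon>. One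
  \<epsilon> must therefore serve all s: the images are separated by (\<eta> / 2) ^ s times a
  constant c0 independent of s, where \<eta> is the modulus of the limit at a point, and a small
  multiple of c0 * \<eta> stays below this for every s.\<close>

lemma powr_add_le:
  fixes a b p :: real
  assumes "0 \<le> a" "0 \<le> b" "0 < p"
  shows "(a + b) powr p \<le> 2 powr p * (a powr p + b powr p)"
proof -
  have "(a + b) powr p \<le> (2 * max a b) powr p"
    using assms by (intro powr_mono2) auto
  also have "\<dots> = 2 powr p * max a b powr p"
    using assms by (simp add: powr_mult)
  also have "max a b powr p \<le> a powr p + b powr p"
    by (auto simp: max_def)
  finally show ?thesis by simp
qed

lemma powr_convex_nonneg:
  fixes x y \<theta> p :: real
  assumes "1 \<le> p" "0 \<le> x" "0 \<le> y" "0 \<le> \<theta>" "\<theta> \<le> 1"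
  shows "(\<theta> * x + (1 - \<theta>) * y) powr p \<le> \<theta> * x powr p + (1 - \<theta>) * y powr p"
proof -
  have scale: "(t * z) powr p \<le> t * z powr p" if "0 \<le> t" "t \<le> 1" "0 \<le> z" for t z :: real
  proof -
    have "t powr p \<le> t powr 1"
      using that assms powr_mono'[of 1 p t] by (cases "t = 0") auto
    then show ?thesis using that by (auto simp: powr_mult mult_right_mono)
  qed
  \<comment> \<open>\<open>powr_convex\<close> is applied at interior points only; on the boundary
    the claim reduces to \<open>t powr p \<le> t\<close> for \<open>t\<close> between 0 and
    1.\<close>
  consider "x = 0" | "y = 0" | "x > 0" "y > 0" using assms by linarith
  then show ?thesis
  proof cases
    case 3
    show ?thesis
      using convex_onD[OF powr_convex[OF \<open>1 \<le> p\<close>], of "1 - \<theta>" x y] 3 assms by simp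
  qed (use scale[of "1 - \<theta>" y] scale[of \<theta> x] assms in auto)
qed

lemma integrable_prod_powr:
  fixes f g :: "'a \<Rightarrow> real"
  assumes pq: "1 < p" "1 < q" "1 / p + 1 / q = 1"
    and [measurable]: "f \<in> borel_measurable M" "g \<in> borel_measurable M"
    and nonneg: "\<And>x. 0 \<le> f x" "\<And>x. 0 \<le> g x"
    and f: "integrable M (\<lambda>x. f x powr p)" and g: "integrable M (\<lambda>x. g x powr q)"
  shows "integrable M (\<lambda>x. f x * g x)"
proof (rule Bochner_Integration.integrable_bound[where f = "\<lambda>x. f x powr p / p + g x powr q / q"])
  show "AE x in M. norm (f x * g x) \<le> norm (f x powr p / p + g x powr q / q)"
  proof (rule AE_I2)
    fix x
    have "f x * g x \<le> f x powr p / p + g x powr q / q" "0 \<le> f x * g x"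
      using Youngs_inequality[OF pq, of "f x" "g x"] nonneg by auto
    then show "norm (f x * g x) \<le> norm (f x powr p / p + g x powr q / q)" by simp
  qed
qed (use f g in auto)

lemma powr_integral_eq_0:
  fixes f :: "'a \<Rightarrow> real"
  assumes "0 < p" "\<And>x. 0 \<le> f x" "integrable M (\<lambda>x. f x powr p)" "(LINT x|M. f x powr p) = 0"
  shows "AE x in M. f x = 0"
  using integral_nonneg_eq_0_iff_AE[OF assms(3)] assms by auto

text \<open>Young's inequality for \<open>f / s\<close> and \<open>g / t\<close>, with
  \<open>s\<close> and \<open>t\<close> the two norms, integrates to
  \<open>1 / p + 1 / q = 1\<close>. If a norm vanishes, normalization is impossible, but then the
  product is zero almost everywhere.\<close>

lemma Hoelder_inequality:
  fixes f g :: "'a \<Rightarrow> real"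
  assumes pq: "1 < p" "1 < q" "1 / p + 1 / q = 1"
    and [measurable]: "f \<in> borel_measurable M" "g \<in> borel_measurable M"
    and nonneg: "\<And>x. 0 \<le> f x" "\<And>x. 0 \<le> g x"
    and f: "integrable M (\<lambda>x. f x powr p)" and g: "integrable M (\<lambda>x. g x powr q)"
  shows "(LINT x|M. f x * g x) \<le>
    (LINT x|M. f x powr p) powr (1 / p) * (LINT x|M. g x powr q) powr (1 / q)"
proof -
  define a where "a = (LINT x|M. f x powr p)"
  define b where "b = (LINT x|M. g x powr q)"
  have fg: "integrable M (\<lambda>x. f x * g x)"
    by (rule integrable_prod_powr[OF pq]) (use assms in auto)
  have ab: "0 \<le> a" "0 \<le> b" by (auto simp: a_def b_def)
  show ?thesis
  proof (cases "a = 0 \<or> b = 0")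
    case True
    then have "AE x in M. f x * g x = 0"
    proof
      assume "a = 0"
      then have "AE x in M. f x = 0"
        using powr_integral_eq_0[of p f M] f nonneg pq by (auto simp: a_def)
      then show ?thesis by eventually_elim simp
    next
      assume "b = 0"
      then have "AE x in M. g x = 0"
        using powr_integral_eq_0[of q g M] g nonneg pq by (auto simp: b_def)
      then show ?thesis by eventually_elim simp
    qed
    then have "(LINT x|M. f x * g x) = 0"
      by (rule integral_eq_zero_AE)
    then show ?thesis using ab by simp
  next
    case False
    with ab have ab: "0 < a" "0 < b" by auto
    define s where "s = a powr (1 / p)"
    define t where "t = b powr (1 / q)"
    have st: "0 < s" "0 < t" "s powr p = a" "t powr q = b"
      using ab pq by (auto simp: s_def t_def powr_powr)
    have "(LINT x|M. f x * g x) / (s * t) = (LINT x|M. (f x / s) * (g x / t))"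
      by simp
    also have "\<dots> \<le> (LINT x|M. f x powr p / a / p + g x powr q / b / q)"
    proof (rule integral_mono)
      show "(f x / s) * (g x / t) \<le> f x powr p / a / p + g x powr q / b / q" for x
        using Youngs_inequality[OF pq, of "f x / s" "g x / t"] st nonneg[of x] 
        by (simp add: powr_divide)
      show "integrable M (\<lambda>x. f x / s * (g x / t))" using fg by simp
    qed (use f g in auto)
    also have "\<dots> = a / a / p + b / b / q"
      using f g by (subst Bochner_Integration.integral_add) (auto simp: a_def b_def)
    also have "\<dots> = 1" using ab pq by simp
    finally show ?thesis
      using st by (simp add: field_simps s_def t_def a_def b_def)
  qed
qed

lemma integrable_powr_add:
  fixes f g :: "'a \<Rightarrow> real"
  assumes "0 < p"
    and [measurable]: "f \<in> borel_measurable M" "g \<in> borel_measurable M"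
    and nonneg: "\<And>x. 0 \<le> f x" "\<And>x. 0 \<le> g x"
    and f: "integrable M (\<lambda>x. f x powr p)" and g: "integrable M (\<lambda>x. g x powr p)"
  shows "integrable M (\<lambda>x. (f x + g x) powr p)"
proof (rule Bochner_Integration.integrable_bound[where f = "\<lambda>x. 2 powr p * (f x powr p + g x powr p)"])
  show "AE x in M. norm ((f x + g x) powr p) \<le> norm (2 powr p * (f x powr p + g x powr p))"
    using powr_add_le[OF nonneg \<open>0 < p\<close>] by simp
qed (use f g in auto)

text \<open>With \<open>a\<close> and \<open>b\<close> the two norms,
  \<open>(f + g) / (a + b)\<close> is the convex combination of the normalized functions
  \<open>f / a\<close> and \<open>g / b\<close> with weights \<open>\<theta>\<close> and
  \<open>1 - \<theta>\<close>, so convexity of the power bounds its p-th moment by 1.\<close>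

lemma Minkowski_inequality:
  fixes f g :: "'a \<Rightarrow> real"
  assumes p: "1 \<le> p"
    and [measurable]: "f \<in> borel_measurable M" "g \<in> borel_measurable M"
    and nonneg: "\<And>x. 0 \<le> f x" "\<And>x. 0 \<le> g x"
    and f: "integrable M (\<lambda>x. f x powr p)" and g: "integrable M (\<lambda>x. g x powr p)"
  shows "(LINT x|M. (f x + g x) powr p) powr (1 / p) \<le>
    (LINT x|M. f x powr p) powr (1 / p) + (LINT x|M. g x powr p) powr (1 / p)"
proof -
  define a where "a = (LINT x|M. f x powr p) powr (1 / p)"
  define b where "b = (LINT x|M. g x powr p) powr (1 / p)"
  have fg: "integrable M (\<lambda>x. (f x + g x) powr p)"
    by (rule integrable_powr_add) (use assms in auto)
  have ap: "a powr p = (LINT x|M. f x powr p)" "b powr p = (LINT x|M. g x powr p)"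
    using p by (auto simp: a_def b_def powr_powr)
  have ab: "0 \<le> a" "0 \<le> b" by (auto simp: a_def b_def)
  show ?thesis
  proof (cases "a = 0 \<or> b = 0")
    case True
    then show ?thesis
    proof
      assume "a = 0"
      then have "AE x in M. f x = 0"
        using powr_integral_eq_0[of p f M] f nonneg p by (auto simp: a_def)
      then have "(LINT x|M. (f x + g x) powr p) = (LINT x|M. g x powr p)"
        by (intro integral_cong_AE) auto
      with \<open>a = 0\<close> show ?thesis by (simp add: a_def)
    next
      assume "b = 0"
      then have "AE x in M. g x = 0"
        using powr_integral_eq_0[of p g M] g nonneg p by (auto simp: b_def)
      then have "(LINT x|M. (f x + g x) powr p) = (LINT x|M. f x powr p)"
        by (intro integral_cong_AE) auto
      with \<open>b = 0\<close> show ?thesis by (simp add: b_def)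
    qed
  next
    case False
    with ab have ab: "0 < a" "0 < b" by auto
    define \<theta> where "\<theta> = a / (a + b)"
    have th: "0 \<le> \<theta>" "\<theta> \<le> 1" "1 - \<theta> = b / (a + b)" using ab by (auto simp: \<theta>_def field_simps)
    have "(LINT x|M. (f x + g x) powr p) / (a + b) powr p = (LINT x|M. ((f x + g x) / (a + b)) powr p)"
      using nonneg ab by (simp add: powr_divide)
    also have "\<dots> \<le> (LINT x|M. \<theta> * (f x powr p / a powr p) + (1 - \<theta>) * (g x powr p / b powr p))"
    proof (rule integral_mono)
      fix x
      have "(f x + g x) / (a + b) = \<theta> * (f x / a) + (1 - \<theta>) * (g x / b)"
        unfolding th using ab by (simp add: \<theta>_def add_divide_distrib)
      then show "((f x + g x) / (a + b)) powr p \<le>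
          \<theta> * (f x powr p / a powr p) + (1 - \<theta>) * (g x powr p / b powr p)"
        using powr_convex_nonneg[OF p _ _ th(1,2), of "f x / a" "g x / b"] nonneg[of x] ab
        by (simp add: powr_divide)
      show "integrable M (\<lambda>x. ((f x + g x) / (a + b)) powr p)"
        using fg nonneg ab by (simp add: powr_divide)
    qed (use f g in auto)
    also have "\<dots> = \<theta> * (a powr p / a powr p) + (1 - \<theta>) * (b powr p / b powr p)"
      using f g by (subst Bochner_Integration.integral_add) (auto simp: ap)
    also have "\<dots> = 1" using ab by simp
    finally have "(LINT x|M. (f x + g x) powr p) \<le> (a + b) powr p"
      using ab by (simp add: field_simps)
    then have "(LINT x|M. (f x + g x) powr p) powr (1 / p) \<le> ((a + b) powr p) powr (1 / p)"
      using p by (intro powr_mono2) auto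
    then show ?thesis using ab p by (simp add: powr_powr a_def b_def)
  qed
qed

section \<open>Normalized Lebesgue measure on a fundamental domain\<close>

abbreviation torus :: "real set" where "torus \<equiv> {0..<2 * pi}"

lemma sets_torus_measure [simp, measurable_cong]: "sets torus_measure = sets borel"
  by (simp add: torus_measure_def)

lemma space_torus_measure [simp]: "space torus_measure = UNIV"
  by (simp add: torus_measure_def)

lemma torus_measure_density:
  "torus_measure = density lborel (\<lambda>x. ennreal (indicator torus x / (2 * pi)))"
proof -
  have "indicator torus x / emeasure lborel torus = ennreal (indicator torus x / (2 * pi))" for x
    using divide_ennreal[of 1 "2 * pi"] by (simp add: indicator_def)
  then show ?thesis
    unfolding torus_measure_def uniform_measure_def by simp
qed

lemma nn_integral_torus:
  assumes "f \<in> borel_measurable borel"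
  shows "(\<integral>\<^sup>+x. f x \<partial>torus_measure) = (\<integral>\<^sup>+x. f x * indicator torus x \<partial>lborel) / ennreal (2 * pi)"
  unfolding torus_measure_def using assms by (subst nn_integral_uniform_measure) auto

lemma integral_torus:
  fixes f :: "real \<Rightarrow> 'b :: {banach, second_countable_topology}"
  assumes f: "f \<in> borel_measurable borel"
  shows "(LINT x|torus_measure. f x) = (LINT x:torus|lborel. f x) /\<^sub>R (2 * pi)"
proof -
  have "(LINT x|torus_measure. f x) = (LINT x|lborel. (indicator torus x / (2 * pi)) *\<^sub>R f x)"
    unfolding torus_measure_density
    by (subst integral_density) (simp_all add: f)
  also have "\<dots> = (LINT x|lborel. inverse (2 * pi) *\<^sub>R (indicator torus x *\<^sub>R f x))"
    by (simp only: divide_inverse mult.commute scaleR_scaleR)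
  finally show ?thesis by (simp only: set_lebesgue_integral_def integral_scaleR_right)
qed

lemma AE_torus_iff: "(AE x in torus_measure. P x) \<longleftrightarrow> (AE x in lborel. x \<in> torus \<longrightarrow> P x)"
  unfolding torus_measure_def by (rule AE_uniform_measure) auto

lemma AE_torus: "AE x in torus_measure. x \<in> torus"
  by (simp add: AE_torus_iff)

lemma measure_torus_UNIV [simp]: "measure torus_measure UNIV = 1"
  unfolding torus_measure_def by (subst measure_uniform_measure) auto

lemma emeasure_torus_UNIV [simp]: "emeasure torus_measure UNIV = 1"
  unfolding torus_measure_def by (subst emeasure_uniform_measure) (auto simp: divide_ennreal)

interpretation torus: finite_measure torus_measure
  by standard auto

lemma integrable_torus_bounded:
  fixes f :: "real \<Rightarrow> 'b :: {banach, second_countable_topology}"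
  assumes "f \<in> borel_measurable borel" "\<And>x. x \<in> torus \<Longrightarrow> norm (f x) \<le> B"
  shows "integrable torus_measure f"
  using assms eventually_mono[OF AE_torus, of "\<lambda>x. norm (f x) \<le> B"]
  by (intro torus.integrable_const_bound[of _ B]) auto

text \<open>Integrability is separated from periodicity so that norm estimates apply directly to
  auxiliary functions such as truncated or frozen ones; \<open>Lp_iff\<close> joins the two
  conditions again.\<close>

definition p_integrable :: "real \<Rightarrow> (real \<Rightarrow> complex) \<Rightarrow> bool" where
  "p_integrable p f \<longleftrightarrow> f \<in> borel_measurable borel \<and> integrable torus_measure (\<lambda>x. cmod (f x) powr p)"

lemma borel_measurable_torus [simp]: "borel_measurable torus_measure = borel_measurable borel"
  by (rule measurable_cong_sets) auto

lemma Lp_iff: "f \<in> Lp p \<longleftrightarrow> p_integrable p f \<and> periodic f"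
  by (auto simp: Lp_def p_integrable_def)

lemma p_integrable_bounded:
  assumes "f \<in> borel_measurable borel" "\<And>x. x \<in> torus \<Longrightarrow> cmod (f x) \<le> B" "0 < p"
  shows "p_integrable p f"
  unfolding p_integrable_def using assms
  by (auto intro!: integrable_torus_bounded[where B = "B powr p"] powr_mono2)

lemma p_integrable_continuous:
  assumes "continuous_on UNIV f" "0 < p"
  shows "p_integrable p f"
proof -
  have "compact (f ` {0..2 * pi})"
    using assms(1) by (intro compact_continuous_image) (auto intro: continuous_on_subset)
  then obtain B where "\<And>x. x \<in> {0..2 * pi} \<Longrightarrow> cmod (f x) \<le> B"
    by (meson compact_imp_bounded bounded_iff imageI)
  then show ?thesis
    using assms by (intro p_integrable_bounded[of f B] borel_measurable_continuous_onI) auto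
qed

lemma Lp_norm_nonneg [simp]: "0 \<le> Lp_norm p f"
  by (simp add: Lp_norm_def)

lemma Lp_norm_powr: "0 < p \<Longrightarrow> Lp_norm p f powr p = (LINT x|torus_measure. cmod (f x) powr p)"
  by (simp add: Lp_norm_def powr_powr)

lemma Lp_norm_le_iff:
  assumes "0 < p" "0 \<le> C"
  shows "Lp_norm p f \<le> C \<longleftrightarrow> (LINT x|torus_measure. cmod (f x) powr p) \<le> C powr p"
proof -
  have "Lp_norm p f \<le> C \<longleftrightarrow> Lp_norm p f powr p \<le> C powr p"
    using assms powr_mono2[of p "Lp_norm p f" C] powr_less_mono2[of p C "Lp_norm p f"]
    by (meson Lp_norm_nonneg less_imp_le not_le)
  then show ?thesis using assms by (simp add: Lp_norm_powr)
qed

lemma p_integrable_cmult: "p_integrable p f \<Longrightarrow> p_integrable p (\<lambda>x. c * f x)"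
  by (auto simp: p_integrable_def norm_mult powr_mult)

lemma Lp_norm_cmult: 
  assumes "0 < p" shows "Lp_norm p (\<lambda>x. c * f x) = cmod c * Lp_norm p f"
  using assms by (simp add: Lp_norm_def norm_mult powr_mult powr_powr)

lemma Lp_norm_mono:
  assumes "p_integrable p f" "0 < p"
    and le: "AE x in torus_measure. cmod (g x) \<le> cmod (f x)"
  shows "Lp_norm p g \<le> Lp_norm p f"
  unfolding Lp_norm_def
\<comment> \<open>\<open>integral_mono_AE'\<close> asks for integrability of the larger function; if
  the smaller one is not integrable, its integral has the default value 0.\<close>
proof (intro powr_mono2 integral_mono_AE')
  show "AE x in torus_measure. cmod (g x) powr p \<le> cmod (f x) powr p"
    using le by eventually_elim (simp add: powr_mono2 \<open>0 < p\<close> less_imp_le)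
qed (use assms(1,2) in \<open>auto simp: p_integrable_def\<close>)

lemma Lp_norm_bounded:
  assumes "AE x in torus_measure. cmod (f x) \<le> B" "0 < p" "0 \<le> B"
  shows "Lp_norm p f \<le> B"
proof -
  have "Lp_norm p f \<le> Lp_norm p (\<lambda>x. complex_of_real B)"
    using assms by (intro Lp_norm_mono p_integrable_continuous) auto
  also have "\<dots> = B"
    using assms by (simp add: Lp_norm_def powr_powr)
  finally show ?thesis .
qed

lemma
  assumes "1 \<le> p" "p_integrable p f" "p_integrable p g"
  shows p_integrable_add: "p_integrable p (\<lambda>x. f x + g x)"
    and Lp_norm_triangle: "Lp_norm p (\<lambda>x. f x + g x) \<le> Lp_norm p f + Lp_norm p g"
proof -
  have [measurable]: "f \<in> borel_measurable borel" "g \<in> borel_measurable borel"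
    using assms by (auto simp: p_integrable_def)
  have int: "integrable torus_measure (\<lambda>x. (cmod (f x) + cmod (g x)) powr p)"
    by (rule integrable_powr_add) (use assms in \<open>auto simp: p_integrable_def\<close>)
  have le: "norm (cmod (f x + g x) powr p) \<le> norm ((cmod (f x) + cmod (g x)) powr p)" for x
    using assms(1) powr_mono2[OF _ _ norm_triangle_ineq, of p "f x" "g x"] by simp
  have int': "integrable torus_measure (\<lambda>x. cmod (f x + g x) powr p)"
    by (rule Bochner_Integration.integrable_bound[OF int]) (use le in auto)
  then show "p_integrable p (\<lambda>x. f x + g x)"
    by (simp add: p_integrable_def)
  have "Lp_norm p (\<lambda>x. f x + g x) \<le> (LINT x|torus_measure. (cmod (f x) + cmod (g x)) powr p) powr (1 / p)"
    unfolding Lp_norm_def using assms(1) le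
    by (intro powr_mono2 integral_mono int int') (auto intro!: powr_mono2 norm_triangle_ineq)
  also have "\<dots> \<le> Lp_norm p f + Lp_norm p g"
    unfolding Lp_norm_def
    by (rule Minkowski_inequality) (use assms in \<open>auto simp: p_integrable_def\<close>)
  finally show "Lp_norm p (\<lambda>x. f x + g x) \<le> Lp_norm p f + Lp_norm p g" .
qed

lemma Lp_norm_diff_commute: "Lp_norm p (\<lambda>x. f x - g x) = Lp_norm p (\<lambda>x. g x - f x)"
  by (simp add: Lp_norm_def norm_minus_commute)

lemma p_integrable_minus: "p_integrable p f \<Longrightarrow> p_integrable p (\<lambda>x. - f x)"
  by (simp add: p_integrable_def)

lemma p_integrable_diff:
  assumes "1 \<le> p" "p_integrable p f" "p_integrable p g"
  shows "p_integrable p (\<lambda>x. f x - g x)"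
  using p_integrable_add[OF assms(1,2) p_integrable_minus[OF assms(3)]] by simp

lemma Lp_norm_diff_triangle:
  assumes "1 \<le> p" "p_integrable p f" "p_integrable p g" "p_integrable p h"
  shows "Lp_norm p (\<lambda>x. f x - h x) \<le> Lp_norm p (\<lambda>x. f x - g x) + Lp_norm p (\<lambda>x. g x - h x)"
  using Lp_norm_triangle[OF assms(1) p_integrable_diff[OF assms(1,2,3)] p_integrable_diff[OF assms(1,3,4)]]
  by simp

lemma Lp_norm_le_add_diff:
  assumes "1 \<le> p" "p_integrable p f" "p_integrable p g"
  shows "Lp_norm p f \<le> Lp_norm p g + Lp_norm p (\<lambda>x. f x - g x)"
  using Lp_norm_triangle[OF assms(1,3) p_integrable_diff[OF assms]] by simp

lemma Lp_norm_0 [simp]: "Lp_norm p (\<lambda>x. 0) = 0"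
  by (simp add: Lp_norm_def)

text \<open>Hoelder's inequality against the constant 1: the measure has total mass 1, so the second
  factor is 1.\<close>

lemma
  assumes "1 < p" "p_integrable p f"
  shows p_integrable_imp_integrable: "integrable torus_measure f"
    and integral_norm_le_Lp_norm: "(LINT x|torus_measure. cmod (f x)) \<le> Lp_norm p f"
proof -
  define q where "q = p / (p - 1)"
  have pq: "1 < q" "1 / p + 1 / q = 1" using assms(1) by (auto simp: q_def field_simps)
  have [measurable]: "f \<in> borel_measurable borel"
    using assms by (auto simp: p_integrable_def)
  have "integrable torus_measure (\<lambda>x. cmod (f x) * 1)"
    by (rule integrable_prod_powr[OF assms(1) pq]) (use assms in \<open>auto simp: p_integrable_def\<close>)
  then show "integrable torus_measure f"
    by (simp add: integrable_norm_iff)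
  have "(LINT x|torus_measure. cmod (f x) * 1) \<le> (LINT x|torus_measure. cmod (f x) powr p) powr (1 / p)
      * (LINT x|torus_measure. 1 powr q) powr (1 / q)"
    by (rule Hoelder_inequality[OF assms(1) pq]) (use assms in \<open>auto simp: p_integrable_def\<close>)
  then show "(LINT x|torus_measure. cmod (f x)) \<le> Lp_norm p f"
    by (simp add: Lp_norm_def)
qed

lemma fourier_coeff_le:
  assumes "1 < p" "p_integrable p f"
  shows "cmod (fourier_coeff f k) \<le> Lp_norm p f"
proof -
  have "cmod (fourier_coeff f k) \<le> (LINT x|torus_measure. cmod (f x * cis (- (x * of_int k))))"
    unfolding fourier_coeff_def by (rule integral_norm_bound)
  also have "\<dots> = (LINT x|torus_measure. cmod (f x))"
    by (simp add: norm_mult)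
  also note integral_norm_le_Lp_norm[OF assms]
  finally show ?thesis .
qed

section \<open>Power series with Mikhlin coefficients\<close>

definition nat_diff :: "(nat \<Rightarrow> complex) \<Rightarrow> nat \<Rightarrow> complex" where
  "nat_diff a k = a (Suc k) - a k"

text \<open>The condition stops at three differences because the kernel is differentiated once: the
  derived coefficients grow linearly, and three summations by parts turn them into terms of order
  \<open>1 / k ^ 2\<close>, which are summable. The weight \<open>Suc k\<close> avoids a division by
  zero at \<open>k = 0\<close>.\<close>

definition mikhlin :: "real \<Rightarrow> (nat \<Rightarrow> complex) \<Rightarrow> bool" where
  "mikhlin A a \<longleftrightarrow> (\<forall>t\<le>3. \<forall>k. cmod ((nat_diff ^^ t) a k) \<le> A / real (Suc k) ^ t)"

definition psum :: "(nat \<Rightarrow> complex) \<Rightarrow> complex \<Rightarrow> complex" where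
  "psum a z = (\<Sum>k. a k * z ^ k)"

text \<open>Linear growth is the growth of the coefficients of a derived series; the comparison
  series is the derivative of the geometric series.\<close>

lemma summable_psum:
  assumes "\<And>k. cmod (b k) \<le> B * real (Suc k)" "cmod z < 1"
  shows "summable (\<lambda>k. cmod (b k * z ^ k))"
proof (rule summable_comparison_test')
  have "summable (\<lambda>k. diffs (\<lambda>_. 1) k * (of_real (cmod z)::real) ^ k)"
    by (rule termdiff_converges[where K = 1]) (use assms(2) in \<open>auto intro: summable_geometric\<close>)
  then show "summable (\<lambda>k. B * (real (Suc k) * cmod z ^ k))"
    by (intro summable_mult) (simp add: diffs_def)
  show "norm (cmod (b k * z ^ k)) \<le> B * (real (Suc k) * cmod z ^ k)" for k
    using mult_right_mono[OF assms(1)[of k], of "cmod z ^ k"] by (simp add: norm_mult norm_power mult_ac)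
qed

text \<open>Summation by parts: each use trades a factor \<open>1 / cmod (1 - z)\<close> for a
  difference of the coefficients, at the price of the boundary term \<open>b 0\<close>.\<close>

lemma abel_summation:
  assumes "\<And>k. cmod (b k) \<le> B * real (Suc k)" "cmod z < 1"
  shows "(1 - z) * psum b z = b 0 + z * psum (nat_diff b) z"
proof -
  have s: "summable (\<lambda>k. b k * z ^ k)"
    using summable_psum[OF assms] by (rule summable_norm_cancel)
  then have s': "summable (\<lambda>k. b (Suc k) * z ^ Suc k)"
    by (subst summable_Suc_iff)
  have "z * psum (nat_diff b) z = (\<Sum>k. z * (nat_diff b k * z ^ k))"
  proof (unfold psum_def, rule suminf_mult[symmetric], rule summable_norm_cancel, rule summable_psum)
    have "0 \<le> B" using order_trans[OF norm_ge_zero assms(1)[of 0]] by simp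
    fix k
    have "cmod (nat_diff b k) \<le> B * real (Suc (Suc k)) + B * real (Suc k)"
      unfolding nat_diff_def using assms(1)[of k] assms(1)[of "Suc k"] norm_triangle_ineq4[of "b (Suc k)" "b k"] by linarith
    also have "\<dots> \<le> 3 * B * real (Suc k)" using \<open>0 \<le> B\<close> by (simp add: algebra_simps)
    finally show "cmod (nat_diff b k) \<le> 3 * B * real (Suc k)" .
  qed (rule assms)
  also have "\<dots> = (\<Sum>k. b (Suc k) * z ^ Suc k - z * (b k * z ^ k))"
    by (simp add: nat_diff_def algebra_simps)
  also have "\<dots> = (\<Sum>k. b (Suc k) * z ^ Suc k) - z * psum b z"
    unfolding psum_def using s s' by (subst suminf_diff[symmetric]) (auto simp: suminf_mult summable_mult)
  also have "(\<Sum>k. b (Suc k) * z ^ Suc k) = psum b z - b 0"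
    unfolding psum_def using suminf_split_head[OF s] by simp
  finally show ?thesis by (simp add: algebra_simps)
qed

lemma psum_shift:
  assumes "\<And>k. cmod (b k) \<le> B * real (Suc k)" "cmod z < 1"
  shows "psum b z = (\<Sum>k<N. b k * z ^ k) + z ^ N * psum (\<lambda>j. b (N + j)) z"
proof -
  have s: "summable (\<lambda>k. b k * z ^ k)"
    using summable_psum[OF assms] by (rule summable_norm_cancel)
  have "psum b z = (\<Sum>k. b (k + N) * z ^ (k + N)) + (\<Sum>k<N. b k * z ^ k)"
    unfolding psum_def by (rule suminf_split_initial_segment[OF s])
  also have "(\<Sum>k. b (k + N) * z ^ (k + N)) = (\<Sum>k. z ^ N * (b (N + k) * z ^ k))"
    by (simp add: power_add mult_ac add.commute)
  also have "\<dots> = z ^ N * psum (\<lambda>j. b (N + j)) z"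
    unfolding psum_def
  proof (rule suminf_mult)
    show "summable (\<lambda>j. b (N + j) * z ^ j)"
    proof (rule summable_norm_cancel, rule summable_psum)
      have "0 \<le> B" using order_trans[OF norm_ge_zero assms(1)[of 0]] by simp
      fix k
      have "cmod (b (N + k)) \<le> B * real (Suc (N + k))" by (rule assms)
      also have "\<dots> \<le> B * (real (Suc N) * real (Suc k))"
        using \<open>0 \<le> B\<close> by (intro mult_left_mono) (auto simp: algebra_simps)
      finally show "cmod (b (N + k)) \<le> B * real (Suc N) * real (Suc k)" by simp
    qed (rule assms)
  qed
  finally show ?thesis by simp
qed

text \<open>Each term is at most \<open>1 / ((N + j) * (N + j + 1))\<close>, which is a difference
  of reciprocals and telescopes.\<close>

lemma inverse_square_tail:
  assumes "1 \<le> N"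
  shows "summable (\<lambda>j. 1 / real (Suc (N + j)) ^ 2)" "(\<Sum>j. 1 / real (Suc (N + j)) ^ 2) \<le> 1 / real N"
proof -
  have "(\<lambda>j. 1 / real (N + Suc j)) \<longlonglongrightarrow> 0"
    by real_asymp
  then have "(\<lambda>j. 1 / real (N + j)) \<longlonglongrightarrow> 0"
    by (rule LIMSEQ_imp_Suc)
  from telescope_sums'[OF this]
  have t: "(\<lambda>j. 1 / real (N + j) - 1 / real (N + Suc j)) sums (1 / real N)" by simp
  have le: "1 / real (Suc (N + j)) ^ 2 \<le> 1 / real (N + j) - 1 / real (N + Suc j)" for j
  proof -
    have m: "0 < real (N + j)" using assms by simp
    have "1 / real (Suc (N + j)) ^ 2 \<le> 1 / (real (N + j) * real (Suc (N + j)))"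
      unfolding power2_eq_square using m by (intro divide_left_mono mult_right_mono) auto
    also have "\<dots> = 1 / real (N + j) - 1 / real (N + Suc j)"
      using m by (simp add: field_simps)
    finally show ?thesis .
  qed
  show s: "summable (\<lambda>j. 1 / real (Suc (N + j)) ^ 2)"
    by (rule summable_comparison_test'[OF sums_summable[OF t]]) (use le in auto)
  show "(\<Sum>j. 1 / real (Suc (N + j)) ^ 2) \<le> 1 / real N"
    using suminf_le[OF le s sums_summable[OF t]] sums_unique[OF t] by simp
qed

text \<open>The sum is split at \<open>N\<close>, the order of magnitude of \<open>1 / cmod (1 - z)\<close>, and the tail is summed by
  parts three times.\<close>

lemma psum_bound:
  assumes "0 \<le> A" and z: "cmod z < 1"
    and b0: "\<And>k. cmod (b k) \<le> A * real (Suc k)"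
    and b1: "\<And>k. cmod (nat_diff b k) \<le> 2 * A"
    and b2: "\<And>k. cmod (nat_diff (nat_diff b) k) \<le> 3 * A / real (Suc k)"
    and b3: "\<And>k. cmod (nat_diff (nat_diff (nat_diff b)) k) \<le> 4 * A / real (Suc k) ^ 2"
  shows "cmod (psum b z) \<le> 30 * A / cmod (1 - z) ^ 2"
proof -
  define w where "w = cmod (1 - z)"
  have w0: "0 < w" using z by (auto simp: w_def)
  have w2: "w < 2" using z norm_triangle_ineq4[of 1 z] by (simp add: w_def)
  define N where "N = nat \<lceil>1 / w\<rceil>"
  have N: "1 / w \<le> real N" "real N < 1 / w + 1"
    using w0 by (auto simp: N_def) linarith+
  have N1: "1 \<le> N" using N(1) w0 by (cases N) auto
  define B where "B j = b (N + j)" for j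
  have dB: "nat_diff B = (\<lambda>j. nat_diff b (N + j))"
    by (simp add: fun_eq_iff nat_diff_def B_def)
  have ddB: "nat_diff (nat_diff B) = (\<lambda>j. nat_diff (nat_diff b) (N + j))"
    by (simp add: fun_eq_iff nat_diff_def B_def)
  have dddB: "nat_diff (nat_diff (nat_diff B)) = (\<lambda>j. nat_diff (nat_diff (nat_diff b)) (N + j))"
    by (simp add: fun_eq_iff nat_diff_def B_def)
  have bd0: "cmod (B j) \<le> A * real (Suc N) * real (Suc j)" for j
  proof -
    have "cmod (B j) \<le> A * real (Suc (N + j))" unfolding B_def by (rule b0)
    also have "\<dots> \<le> A * (real (Suc N) * real (Suc j))"
      using \<open>0 \<le> A\<close> by (intro mult_left_mono) (auto simp: algebra_simps)
    finally show ?thesis by simp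
  qed
  have bd1: "cmod (nat_diff B j) \<le> 2 * A * real (Suc j)" for j
  proof -
    have "2 * A * 1 \<le> 2 * A * real (Suc j)" using \<open>0 \<le> A\<close> by (intro mult_left_mono) auto
    then show ?thesis using b1[of "N + j"] by (simp add: dB)
  qed
  have bd2: "cmod (nat_diff (nat_diff B) j) \<le> 3 * A * real (Suc j)" for j
  proof -
    have "3 * A / real (Suc (N + j)) \<le> 3 * A / 1" using \<open>0 \<le> A\<close> by (intro divide_left_mono) auto
    moreover have "3 * A * 1 \<le> 3 * A * real (Suc j)" using \<open>0 \<le> A\<close> by (intro mult_left_mono) auto
    ultimately show ?thesis using b2[of "N + j"] by (simp add: ddB)
  qed
  \<comment> \<open>The estimates run from the third difference back to \<open>B\<close> itself,
    dividing by \<open>w\<close> at each stage. The boundary terms are of order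
    \<open>1 / N\<close>, 1 and \<open>N\<close>; as \<open>N\<close> is comparable to
    \<open>1 / w\<close>, each of them matches the size inherited from the stage before.\<close>
  have G3: "cmod (psum (nat_diff (nat_diff (nat_diff B))) z) \<le> 4 * A * w"
  proof -
    have le: "cmod (nat_diff (nat_diff (nat_diff B)) j * z ^ j) \<le> 4 * A * (1 / real (Suc (N + j)) ^ 2)" for j
    proof -
      have "cmod (nat_diff (nat_diff (nat_diff B)) j) * cmod z ^ j \<le> 4 * A / real (Suc (N + j)) ^ 2 * 1"
        unfolding dddB using z \<open>0 \<le> A\<close> by (intro mult_mono b3 power_le_one) auto
      then show ?thesis by (simp add: norm_mult norm_power)
    qed
    have "cmod (psum (nat_diff (nat_diff (nat_diff B))) z) \<le> (\<Sum>j. 4 * A * (1 / real (Suc (N + j)) ^ 2))"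
      unfolding psum_def by (rule norm_suminf_le[OF le]) (intro summable_mult inverse_square_tail N1)
    also have "\<dots> = 4 * A * (\<Sum>j. 1 / real (Suc (N + j)) ^ 2)"
      by (rule suminf_mult[OF inverse_square_tail(1)[OF N1]])
    also have "\<dots> \<le> 4 * A * (1 / real N)"
      using \<open>0 \<le> A\<close> by (intro mult_left_mono inverse_square_tail N1) auto
    also have "\<dots> \<le> 4 * A * w"
      using \<open>0 \<le> A\<close> N w0 N1 by (intro mult_left_mono) (auto simp: field_simps)
    finally show ?thesis .
  qed
  have G2: "cmod (psum (nat_diff (nat_diff B)) z) \<le> 7 * A"
  proof -
    have "w * cmod (psum (nat_diff (nat_diff B)) z) = cmod (nat_diff (nat_diff B) 0 + z * psum (nat_diff (nat_diff (nat_diff B))) z)"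
      using abel_summation[OF bd2 z] by (simp add: w_def flip: norm_mult)
    also have "\<dots> \<le> 3 * A * w + 1 * (4 * A * w)"
    proof (rule order_trans[OF norm_triangle_ineq add_mono])
      have "3 * A / real (Suc N) \<le> 3 * A * w"
        using \<open>0 \<le> A\<close> N w0 N1 mult_left_mono[of "1/ real (Suc N)" w "3 * A"] by (auto simp: field_simps)
      then show "cmod (nat_diff (nat_diff B) 0) \<le> 3 * A * w" using b2[of N] by (simp add: ddB)
      show "cmod (z * psum (nat_diff (nat_diff (nat_diff B))) z) \<le> 1 * (4 * A * w)"
        unfolding norm_mult using z G3 by (intro mult_mono) auto
    qed
    finally have "w * cmod (psum (nat_diff (nat_diff B)) z) \<le> w * (7 * A)" by (simp add: algebra_simps)
    then show ?thesis using w0 by simp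
  qed
  have G1: "cmod (psum (nat_diff B) z) \<le> 9 * A / w"
  proof -
    have "w * cmod (psum (nat_diff B) z) = cmod (nat_diff B 0 + z * psum (nat_diff (nat_diff B)) z)"
      using abel_summation[OF bd1 z] by (simp add: w_def flip: norm_mult)
    also have "\<dots> \<le> 2 * A + 1 * (7 * A)"
    proof (rule order_trans[OF norm_triangle_ineq add_mono])
      show "cmod (nat_diff B 0) \<le> 2 * A" using b1[of N] by (simp add: dB)
      show "cmod (z * psum (nat_diff (nat_diff B)) z) \<le> 1 * (7 * A)"
        unfolding norm_mult using z G2 by (intro mult_mono) auto
    qed
    finally show ?thesis using w0 by (simp add: field_simps)
  qed
  \<comment> \<open>Here \<open>w < 2\<close> turns the additive constants from the rounding into
    multiples of \<open>1 / w\<close>.\<close>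
  have Nw: "real N \<le> 3 / w" "real (Suc N) \<le> 5 / w"
    using N w0 w2 by (auto simp: field_simps)
  have G0: "cmod (psum B z) \<le> 14 * A / w ^ 2"
  proof -
    have "w * cmod (psum B z) = cmod (B 0 + z * psum (nat_diff B) z)"
      using abel_summation[OF bd0 z] by (simp add: w_def flip: norm_mult)
    also have "\<dots> \<le> A * (5 / w) + 1 * (9 * A / w)"
    proof (rule order_trans[OF norm_triangle_ineq add_mono])
      have "A * real (Suc N) \<le> A * (5 / w)" using \<open>0 \<le> A\<close> Nw by (intro mult_left_mono)
      then show "cmod (B 0) \<le> A * (5 / w)" using b0[of N] unfolding B_def by simp
      show "cmod (z * psum (nat_diff B) z) \<le> 1 * (9 * A / w)"
        unfolding norm_mult using z G1 by (intro mult_mono) auto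
    qed
    finally show ?thesis using w0 by (simp add: field_simps power2_eq_square)
  qed
  \<comment> \<open>The head has \<open>N\<close> terms of size at most \<open>A * N\<close>, so it
    is again of order \<open>A / w ^ 2\<close>.\<close>
  have "cmod (\<Sum>k<N. b k * z ^ k) \<le> (\<Sum>k<N. A * real N)"
  proof (rule sum_norm_le)
    fix k assume k: "k \<in> {..<N}"
    have "cmod (b k) * cmod z ^ k \<le> (A * real (Suc k)) * 1"
      using z \<open>0 \<le> A\<close> by (intro mult_mono b0 power_le_one) auto
    also have "\<dots> \<le> A * real N" using k \<open>0 \<le> A\<close> by (auto intro!: mult_left_mono)
    finally show "cmod (b k * z ^ k) \<le> A * real N" by (simp add: norm_mult norm_power)
  qed
  also have "\<dots> = A * (real N) ^ 2" by (simp add: power2_eq_square)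
  also have "\<dots> \<le> A * (3 / w) ^ 2"
    using \<open>0 \<le> A\<close> Nw by (intro mult_left_mono power_mono) auto
  also have "\<dots> = 9 * A / w ^ 2" by (simp add: power_divide)
  finally have H: "cmod (\<Sum>k<N. b k * z ^ k) \<le> 9 * A / w ^ 2" .
  have "cmod (z ^ N * psum B z) \<le> 1 * (14 * A / w ^ 2)"
    unfolding norm_mult norm_power using z G0 by (intro mult_mono power_le_one) auto
  with H have "cmod (psum b z) \<le> 9 * A / w ^ 2 + 14 * A / w ^ 2"
    using psum_shift[OF b0 z, of N] norm_triangle_ineq[of "\<Sum>k<N. b k * z ^ k" "z ^ N * psum B z"]
    unfolding B_def by simp
  also have "\<dots> \<le> 30 * A / w ^ 2" using \<open>0 \<le> A\<close> w0 by (simp add: field_simps)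
  finally show ?thesis by (simp add: w_def)
qed

lemma mikhlin_nonneg: "mikhlin A a \<Longrightarrow> 0 \<le> A"
  unfolding mikhlin_def by (drule spec[of _ 0]) (auto intro: order_trans[OF norm_ge_zero])

lemma mikhlinD:
  assumes "mikhlin A a"
  shows "cmod (a k) \<le> A" "cmod (nat_diff a k) \<le> A / real (Suc k)"
    "cmod (nat_diff (nat_diff a) k) \<le> A / real (Suc k) ^ 2"
    "cmod (nat_diff (nat_diff (nat_diff a)) k) \<le> A / real (Suc k) ^ 3"
proof -
  have *: "cmod ((nat_diff ^^ t) a k) \<le> A / real (Suc k) ^ t" if "t \<le> 3" for t
    using assms that by (simp add: mikhlin_def)
  from *[of 0] *[of 1] *[of 2] *[of 3]
  show "cmod (a k) \<le> A" "cmod (nat_diff a k) \<le> A / real (Suc k)"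
    "cmod (nat_diff (nat_diff a) k) \<le> A / real (Suc k) ^ 2"
    "cmod (nat_diff (nat_diff (nat_diff a)) k) \<le> A / real (Suc k) ^ 3"
    by (simp_all add: eval_nat_numeral)
qed

text \<open>The coefficients of the derivative are \<open>(k + 1) * a (k + 1)\<close>. By the
  Leibniz rule their t-th difference is \<open>k + 1\<close> times the t-th difference of
  \<open>a\<close>, plus \<open>t\<close> times its difference of order \<open>t - 1\<close>, at
  shifted arguments; this gives the factors 2, 3 and 4 that \<open>psum_bound\<close>
  expects.\<close>

lemma psum_diffs_bound:
  assumes a: "mikhlin A a" and z: "cmod z < 1"
  shows "cmod (psum (diffs a) z) \<le> 30 * A / cmod (1 - z) ^ 2"
proof (rule psum_bound[OF mikhlin_nonneg[OF a] z])
  have A: "0 \<le> A" by (rule mikhlin_nonneg[OF a])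
  note D = mikhlinD[OF a]
  let ?b = "diffs a"
  have d1: "nat_diff ?b k = of_nat (Suc k) * nat_diff a (Suc k) + a (Suc (Suc k))" for k
    by (simp add: nat_diff_def diffs_def algebra_simps)
  have d2: "nat_diff (nat_diff ?b) k = of_nat (Suc k) * nat_diff (nat_diff a) (Suc k) + 2 * nat_diff a (Suc (Suc k))" for k
    by (simp add: nat_diff_def diffs_def algebra_simps)
  have d3: "nat_diff (nat_diff (nat_diff ?b)) k = of_nat (Suc k) * nat_diff (nat_diff (nat_diff a)) (Suc k) + 3 * nat_diff (nat_diff a) (Suc (Suc k))" for k
    by (simp add: nat_diff_def diffs_def algebra_simps)
  have mono: "A / real (Suc (j + k)) ^ t \<le> A / real (Suc k) ^ t" for j k t
    using A by (intro divide_left_mono power_mono) auto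
  fix k
  have E1: "cmod (nat_diff a (j + k)) \<le> A / real (Suc k)" for j
    using D(2)[of "j + k"] mono[of j k 1] by simp
  have E2: "cmod (nat_diff (nat_diff a) (j + k)) \<le> A / real (Suc k) ^ 2" for j
    using D(3)[of "j + k"] mono[of j k 2] by linarith
  have E3: "cmod (nat_diff (nat_diff (nat_diff a)) (j + k)) \<le> A / real (Suc k) ^ 3" for j
    using D(4)[of "j + k"] mono[of j k 3] by linarith
  have E: "cmod (of_nat n * v) \<le> real n * B" if "cmod v \<le> B" for n v B
    using that by (simp add: norm_mult norm_of_nat mult_left_mono)
  have E': "cmod (numeral n * v) \<le> numeral n * B" if "cmod v \<le> B" for n v B
    using that by (simp add: norm_mult mult_left_mono)
  show "cmod (diffs a k) \<le> A * real (Suc k)"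
    unfolding diffs_def norm_mult using mult_left_mono[OF D(1)[of "Suc k"], of "real (Suc k)"]
    by (simp add: mult.commute norm_of_nat del: of_nat_Suc)
  have "cmod (nat_diff ?b k) \<le> real (Suc k) * (A / real (Suc k)) + A"
    unfolding d1 using E1[of 1] D(1)[of "Suc (Suc k)"] 
    by (intro order_trans[OF norm_triangle_ineq] add_mono E E') simp_all
  then show "cmod (nat_diff ?b k) \<le> 2 * A" by simp
  have "cmod (nat_diff (nat_diff ?b) k) \<le> real (Suc k) * (A / real (Suc k) ^ 2) + 2 * (A / real (Suc k))"
    unfolding d2 using E2[of 1] E1[of 2] 
    by (intro order_trans[OF norm_triangle_ineq] add_mono E E') simp_all
  also have "\<dots> = 3 * A / real (Suc k)" by (simp add: power2_eq_square del: of_nat_Suc)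
  finally show "cmod (nat_diff (nat_diff ?b) k) \<le> 3 * A / real (Suc k)" .
  have "cmod (nat_diff (nat_diff (nat_diff ?b)) k) \<le> real (Suc k) * (A / real (Suc k) ^ 3) + 3 * (A / real (Suc k) ^ 2)"
    unfolding d3 using E3[of 1] E2[of 2] 
    by (intro order_trans[OF norm_triangle_ineq] add_mono E E') simp_all
  also have "\<dots> = 4 * A / real (Suc k) ^ 2" by (simp add: power2_eq_square power3_eq_cube del: of_nat_Suc)
  finally show "cmod (nat_diff (nat_diff (nat_diff ?b)) k) \<le> 4 * A / real (Suc k) ^ 2" .
qed

lemma psum_has_derivative:
  assumes "\<And>k. cmod (a k) \<le> A" "cmod z < 1"
  shows "(psum a has_field_derivative psum (diffs a) z) (at z)"
proof -
  have s: "summable (\<lambda>k. a k * w ^ k)" if "cmod w < 1" for w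
  proof (rule summable_norm_cancel, rule summable_psum[OF _ that])
    fix k
    have "0 \<le> A" using assms(1)[of 0] norm_ge_zero order_trans by blast
    then have "A * 1 \<le> A * real (Suc k)" by (intro mult_left_mono) auto
    then show "cmod (a k) \<le> A * real (Suc k)" using assms(1)[of k] by simp
  qed
  show ?thesis unfolding psum_def by (rule termdiffs_strong'[of 1]) (use s assms in auto)
qed

section \<open>Half-line Fourier multipliers\<close>

lemma integral_torus_FTC:
  fixes f :: "real \<Rightarrow> complex"
  assumes F: "\<And>x. (F has_vector_derivative f x) (at x)" and f: "continuous_on UNIV f"
  shows "(LINT x|torus_measure. f x) = (F (2 * pi) - F 0) /\<^sub>R (2 * pi)"
proof -
  have [measurable]: "f \<in> borel_measurable borel"
    using f by (rule borel_measurable_continuous_onI)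
  have ae: "AE x in lborel. x \<noteq> 2 * pi"
    by (rule AE_lborel_singleton)
  have "(LINT x:torus|lborel. f x) = (LINT x|lborel. indicator {0..2 * pi} x *\<^sub>R f x)"
    unfolding set_lebesgue_integral_def
  proof (rule integral_cong_AE)
    show "AE x in lborel. indicat_real torus x *\<^sub>R f x = indicat_real {0..2 * pi} x *\<^sub>R f x"
      using ae by eventually_elim (auto simp: indicator_def)
  qed auto
  also have "\<dots> = F (2 * pi) - F 0"
    by (rule integral_FTC_atLeastAtMost)
      (simp_all add: has_vector_derivative_at_within[OF F] continuous_on_subset[OF f])
  finally show ?thesis by (simp add: integral_torus)
qed

lemma continuous_on_cis_mult [continuous_intros]:
  "continuous_on S f \<Longrightarrow> continuous_on S (\<lambda>x. cis (f x))"
  by (auto simp: cis_conv_exp intro!: continuous_intros)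

lemma cis_has_vector_derivative:
  "((\<lambda>x. cis (x * c)) has_vector_derivative (\<i> * of_real c * cis (x * c))) (at x)"
proof -
  have "((\<lambda>z. exp (\<i> * (z * of_real c))) has_field_derivative (exp (\<i> * (of_real x * of_real c)) * (\<i> * of_real c))) (at (of_real x))"
    by (auto intro!: derivative_eq_intros)
  from has_vector_derivative_real_field[OF this]
  show ?thesis by (simp add: cis_conv_exp mult_ac)
qed

lemma integral_torus_cis:
  "(LINT x|torus_measure. cis (x * of_int k)) = (if k = 0 then 1 else 0)"
proof (cases "k = 0")
  case False
  have "(LINT x|torus_measure. cis (x * of_int k)) =
      (cis (2 * pi * of_int k) / (\<i> * of_int k) - cis (0 * of_int k) / (\<i> * of_int k)) /\<^sub>R (2 * pi)"
  proof (rule integral_torus_FTC)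
    fix x :: real
    have "((\<lambda>x. cis (x * of_int k)) has_vector_derivative (\<i> * of_real (of_int k) * cis (x * of_int k))) (at x)"
      by (rule cis_has_vector_derivative)
    from has_vector_derivative_mult_left[OF this, of "1 / (\<i> * of_int k)"]
    show "((\<lambda>x. cis (x * of_int k) / (\<i> * of_int k)) has_vector_derivative cis (x * of_int k)) (at x)"
      using False by (simp add: field_simps)
  qed (auto intro!: continuous_intros)
  also have "cis (2 * pi * of_int k) = 1"
    by (simp add: cis_multiple_2pi)
  finally show ?thesis using False by simp
qed simp

lemma integrable_torus_continuous:
  fixes f :: "real \<Rightarrow> complex"
  assumes "continuous_on UNIV f"
  shows "integrable torus_measure f"
  using p_integrable_imp_integrable[OF _ p_integrable_continuous[OF assms], of 2] by simp

lemma fourier_coeff_trig: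
  assumes "finite K"
  shows "fourier_coeff (\<lambda>x. \<Sum>k\<in>K. c k * cis (x * of_int k)) j = (if j \<in> K then c j else 0)"
proof -
  have "fourier_coeff (\<lambda>x. \<Sum>k\<in>K. c k * cis (x * of_int k)) j =
      (LINT x|torus_measure. (\<Sum>k\<in>K. c k * cis (x * of_int (k - j))))"
    unfolding fourier_coeff_def sum_distrib_right mult.assoc cis_mult
    by (simp add: algebra_simps)
  also have "\<dots> = (\<Sum>k\<in>K. c k * (LINT x|torus_measure. cis (x * of_int (k - j))))"
    by (subst Bochner_Integration.integral_sum)
       (auto intro!: integrable_torus_continuous continuous_intros)
  also have "\<dots> = (\<Sum>k\<in>K. if k = j then c j else 0)"
    by (simp only: integral_torus_cis) (auto intro: sum.cong)
  finally show ?thesis using assms by simp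
qed

lemma integral_trig_cnj:
  assumes "finite K" "integrable torus_measure f"
  shows "(LINT x|torus_measure. f x * cnj (\<Sum>k\<in>K. c k * cis (x * of_int k))) = (\<Sum>k\<in>K. cnj (c k) * fourier_coeff f k)"
proof -
  have int: "integrable torus_measure (\<lambda>x. f x * cis (- (x * of_int k)))" for k
    by (rule Bochner_Integration.integrable_bound[OF assms(2)])
      (use assms(2) in \<open>auto simp: norm_mult cis_conv_exp\<close>)
  have "(LINT x|torus_measure. f x * cnj (\<Sum>k\<in>K. c k * cis (x * of_int k))) =
      (LINT x|torus_measure. (\<Sum>k\<in>K. cnj (c k) * (f x * cis (- (x * of_int k)))))"
    by (simp add: sum_distrib_left cis_cnj mult_ac)
  also have "\<dots> = (\<Sum>k\<in>K. cnj (c k) * fourier_coeff f k)"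
    unfolding fourier_coeff_def using int by (subst Bochner_Integration.integral_sum) auto
  finally show ?thesis .
qed

lemma cnj_mult_self: "cnj z * z = complex_of_real ((cmod z)\<^sup>2)"
  by (simp only: complex_norm_square mult.commute)

lemma integral_trig_norm_square:
  assumes "finite K"
  shows "(LINT x|torus_measure. (cmod (\<Sum>k\<in>K. c k * cis (x * of_int k)))\<^sup>2) = (\<Sum>k\<in>K. (cmod (c k))\<^sup>2)"
proof -
  let ?f = "\<lambda>x. \<Sum>k\<in>K. c k * cis (x * of_int k)"
  have cont: "continuous_on UNIV ?f" by (auto intro!: continuous_intros)
  have "complex_of_real (LINT x|torus_measure. (cmod (?f x))\<^sup>2) = (LINT x|torus_measure. ?f x * cnj (?f x))"
    unfolding complex_norm_square[symmetric] integral_complex_of_real[symmetric] by simp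
  also have "\<dots> = (\<Sum>k\<in>K. cnj (c k) * fourier_coeff ?f k)"
    by (rule integral_trig_cnj[OF assms integrable_torus_continuous[OF cont]])
  also have "\<dots> = (\<Sum>k\<in>K. of_real ((cmod (c k))\<^sup>2))"
    unfolding fourier_coeff_trig[OF assms] by (intro sum.cong) (simp_all only: cnj_mult_self if_True)
  finally show ?thesis by (simp only: of_real_sum[symmetric] of_real_eq_iff)
qed

lemma cmod_diff_square: "(cmod (u - v))\<^sup>2 = (cmod u)\<^sup>2 + (cmod v)\<^sup>2 - 2 * Re (u * cnj v)"
  unfolding cmod_power2 by (simp add: power2_eq_square algebra_simps)

lemma integral_norm_diff_square:
  fixes f S :: "'a \<Rightarrow> complex"
  assumes f2: "integrable M (\<lambda>x. (cmod (f x))\<^sup>2)" and S2: "integrable M (\<lambda>x. (cmod (S x))\<^sup>2)"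
    and [measurable]: "f \<in> borel_measurable M" "S \<in> borel_measurable M" "(\<lambda>x. cnj (S x)) \<in> borel_measurable M"
  shows "(LINT x|M. (cmod (f x - S x))\<^sup>2) =
    (LINT x|M. (cmod (f x))\<^sup>2) + (LINT x|M. (cmod (S x))\<^sup>2) - 2 * Re (LINT x|M. f x * cnj (S x))"
proof -
  have "integrable M (\<lambda>x. cmod (f x) * cmod (S x))"
    by (rule integrable_prod_powr[of 2 2]) (use f2 S2 in auto)
  then have "integrable M (\<lambda>x. cmod (f x * cnj (S x)))"
    by (simp add: norm_mult)
  then have prod: "integrable M (\<lambda>x. f x * cnj (S x))"
    by (rule integrable_norm_cancel) simp
  have "(LINT x|M. (cmod (f x - S x))\<^sup>2) = (LINT x|M. (cmod (f x))\<^sup>2 + (cmod (S x))\<^sup>2 - 2 * Re (f x * cnj (S x)))"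
    by (simp only: cmod_diff_square)
  also have "\<dots> = (LINT x|M. (cmod (f x))\<^sup>2) + (LINT x|M. (cmod (S x))\<^sup>2) - 2 * (LINT x|M. Re (f x * cnj (S x)))"
    using f2 S2 integrable_Re[OF prod]
    by (simp only: Bochner_Integration.integral_diff Bochner_Integration.integral_add
        Bochner_Integration.integrable_add integrable_mult_right integral_mult_right_zero)
  finally show ?thesis by (simp only: integral_Re[OF prod])
qed

text \<open>In the square of the distance from \<open>f\<close> to its partial Fourier sum, the
  cross term and the norm of the sum both reduce to \<open>?b\<close>, so nonnegativity gives the
  claim.\<close>

lemma bessel_inequality:
  assumes "finite K" "p_integrable 2 f"
  shows "(\<Sum>k\<in>K. (cmod (fourier_coeff f k))\<^sup>2) \<le> (LINT x|torus_measure. (cmod (f x))\<^sup>2)"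
proof -
  let ?S = "\<lambda>x. \<Sum>k\<in>K. fourier_coeff f k * cis (x * of_int k)"
  let ?b = "\<Sum>k\<in>K. (cmod (fourier_coeff f k))\<^sup>2"
  have cont: "continuous_on UNIV ?S" by (auto intro!: continuous_intros)
  have f1: "integrable torus_measure f"
    by (rule p_integrable_imp_integrable[OF _ assms(2)]) simp
  have "(LINT x|torus_measure. f x * cnj (?S x)) = of_real ?b"
    unfolding integral_trig_cnj[OF assms(1) f1] of_real_sum
    by (simp only: cnj_mult_self)
  then have re: "Re (LINT x|torus_measure. f x * cnj (?S x)) = ?b"
    by (simp only: Re_complex_of_real)
  have "0 \<le> (LINT x|torus_measure. (cmod (f x - ?S x))\<^sup>2)"
    by simp
  also have "\<dots> = (LINT x|torus_measure. (cmod (f x))\<^sup>2) + (LINT x|torus_measure. (cmod (?S x))\<^sup>2)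
      - 2 * Re (LINT x|torus_measure. f x * cnj (?S x))"
  proof (rule integral_norm_diff_square)
    show "integrable torus_measure (\<lambda>x. (cmod (f x))\<^sup>2)" "f \<in> borel_measurable torus_measure"
      using assms(2) by (simp_all add: p_integrable_def)
    show "integrable torus_measure (\<lambda>x. (cmod (?S x))\<^sup>2)"
      using p_integrable_continuous[OF cont, of 2] by (simp add: p_integrable_def)
    show "?S \<in> borel_measurable torus_measure" "(\<lambda>x. cnj (?S x)) \<in> borel_measurable torus_measure"
      unfolding borel_measurable_torus by (intro borel_measurable_continuous_onI continuous_on_cnj cont)+
  qed
  finally show ?thesis
    unfolding re integral_trig_norm_square[OF assms(1)] by simp
qed

text \<open>The multiplier with coefficients \<open>a k * r ^ k\<close> at the frequencies
  \<open>s * k\<close>, so \<open>s = 1\<close> and \<open>s = -1\<close> select the two half lines.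
  The Abel factor with \<open>r < 1\<close> makes the kernel bounded and continuous; the norm
  estimates derived below have constants independent of \<open>r\<close>.\<close>

definition mult_op :: "(nat \<Rightarrow> complex) \<Rightarrow> int \<Rightarrow> real \<Rightarrow> (real \<Rightarrow> complex) \<Rightarrow> real \<Rightarrow> complex" where
  "mult_op a s r f x = (LINT y|torus_measure. psum a (of_real r * cis (of_int s * (x - y))) * f y)"

lemma psum_continuous:
  assumes "\<And>k. cmod (a k) \<le> A"
  shows "continuous_on {z. cmod z < 1} (psum a)"
  using DERIV_isCont[OF psum_has_derivative[of a, OF assms]]
  by (intro continuous_at_imp_continuous_on) auto

lemma psum_kernel_continuous:
  assumes "\<And>k. cmod (a k) \<le> A" "0 \<le> r" "r < 1"
  shows "continuous_on UNIV (\<lambda>t. psum a (of_real r * cis t))"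
  by (rule continuous_on_compose2[OF psum_continuous[OF assms(1)]])
    (use assms in \<open>auto intro!: continuous_intros simp: norm_mult\<close>)

lemma summable_bounded_psum:
  assumes "\<And>k. cmod (a k) \<le> A" "cmod z < 1"
  shows "summable (\<lambda>k. cmod (a k * z ^ k))"
proof (rule summable_psum)
  fix k
  have "0 \<le> A" using order_trans[OF norm_ge_zero assms(1)] .
  then have "A * 1 \<le> A * real (Suc k)" by (intro mult_left_mono) auto
  then show "cmod (a k) \<le> A * real (Suc k)" using assms(1)[of k] by simp
qed (rule assms)

lemma psum_le:
  assumes "\<And>k. cmod (a k) \<le> A" "cmod z \<le> r" "r < 1"
  shows "cmod (psum a z) \<le> A / (1 - r)"
proof -
  have r: "0 \<le> r" using assms(2) norm_ge_zero order_trans by blast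
  have "0 \<le> A" using order_trans[OF norm_ge_zero assms(1)] .
  have "cmod (psum a z) \<le> (\<Sum>k. A * r ^ k)"
    unfolding psum_def using assms r \<open>0 \<le> A\<close>
    by (intro norm_suminf_le summable_mult summable_geometric)
      (auto simp: norm_mult norm_power intro!: mult_mono power_mono)
  also have "\<dots> = A / (1 - r)"
    using assms r by (simp add: suminf_mult summable_geometric suminf_geometric)
  finally show ?thesis .
qed

text \<open>Integrating the kernel series term by term gives the Fourier side of the operator; the
  factor \<open>r ^ k\<close> makes the interchange absolutely convergent.\<close>

lemma mult_op_sums:
  assumes a: "\<And>k. cmod (a k) \<le> A" and r: "0 \<le> r" "r < 1" and f: "integrable torus_measure f"
  shows "(\<lambda>k. a k * of_real r ^ k * fourier_coeff f (s * int k) * cis (x * of_int (s * int k)))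
    sums mult_op a s r f x"
proof -
  let ?u = "\<lambda>k y. a k * (of_real r * cis (of_int s * (x - y))) ^ k * f y"
  have A: "0 \<le> A" using order_trans[OF norm_ge_zero a] .
  have [measurable]: "f \<in> borel_measurable borel" using f by auto
  have norm_u: "cmod (?u k y) = cmod (a k) * r ^ k * cmod (f y)" for k y
    using r by (simp add: norm_mult norm_power)
  have eq: "?u k y = (a k * of_real r ^ k * cis (x * of_int (s * int k))) * (f y * cis (- (y * of_int (s * int k))))" for k y
  proof -
    have "cis (real k * (of_int s * (x - y))) = cis (x * of_int (s * int k)) * cis (- (y * of_int (s * int k)))"
      unfolding cis_mult by (simp add: algebra_simps)
    then show ?thesis by (simp only: power_mult_distrib Complex.DeMoivre) (simp only: mult_ac)
  qed
  have int: "integrable torus_measure (?u k)" for k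
  proof (rule Bochner_Integration.integrable_bound)
    show "integrable torus_measure (\<lambda>y. of_real (cmod (a k) * r ^ k) * f y)" using f by simp
    show "AE y in torus_measure. norm (?u k y) \<le> norm (of_real (cmod (a k) * r ^ k) * f y)"
      using r by (intro AE_I2) (simp add: norm_mult norm_power)
  qed (simp add: cis_conv_exp)
  have sm: "summable (\<lambda>k. cmod (a k) * r ^ k)"
    using summable_bounded_psum[OF a, of "of_real r"] r by (simp add: norm_mult norm_power)
  have "(\<lambda>k. LINT y|torus_measure. ?u k y) sums (LINT y|torus_measure. (\<Sum>k. ?u k y))"
  proof (rule sums_integral[OF int])
    show "AE y in torus_measure. summable (\<lambda>k. norm (?u k y))"
      unfolding norm_u using sm by (intro AE_I2 summable_mult2)
    show "summable (\<lambda>k. LINT y|torus_measure. norm (?u k y))"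
      unfolding norm_u using sm by (simp add: summable_mult2)
  qed
  moreover have "(\<Sum>k. ?u k y) = psum a (of_real r * cis (of_int s * (x - y))) * f y" for y
    unfolding psum_def
    by (rule suminf_mult2[symmetric], rule summable_norm_cancel, rule summable_bounded_psum[OF a])
      (use r in \<open>auto simp: norm_mult\<close>)
  moreover have "(LINT y|torus_measure. ?u k y) = a k * of_real r ^ k * fourier_coeff f (s * int k) * cis (x * of_int (s * int k))" for k
    unfolding eq fourier_coeff_def by simp
  ultimately show ?thesis by (simp add: mult_op_def)
qed

lemma mult_op_measurable:
  assumes a: "\<And>k. cmod (a k) \<le> A" and r: "0 \<le> r" "r < 1" and f: "integrable torus_measure f"
  shows "mult_op a s r f \<in> borel_measurable borel"
proof (rule borel_measurable_LIMSEQ_metric)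
  show "(\<lambda>n. \<Sum>k<n. a k * of_real r ^ k * fourier_coeff f (s * int k) * cis (x * of_int (s * int k)))
     \<longlonglongrightarrow> mult_op a s r f x" for x
    using mult_op_sums[OF assms] by (simp add: sums_def)
qed (simp add: cis_conv_exp)

lemma mult_op_bound:
  assumes a: "\<And>k. cmod (a k) \<le> A" and r: "0 \<le> r" "r < 1" and f: "integrable torus_measure f"
  shows "cmod (mult_op a s r f x) \<le> A / (1 - r) * (LINT y|torus_measure. cmod (f y))"
proof -
  have [measurable]: "f \<in> borel_measurable borel" using f by auto
  have A: "0 \<le> A" using order_trans[OF norm_ge_zero a] .
  have k: "continuous_on UNIV (\<lambda>y. psum a (of_real r * cis (of_int s * (x - y))))"
    by (rule continuous_on_compose2[OF psum_kernel_continuous[OF a r]]) (auto intro!: continuous_intros)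
  have [measurable]: "(\<lambda>y. psum a (of_real r * cis (of_int s * (x - y)))) \<in> borel_measurable borel"
    by (rule borel_measurable_continuous_onI[OF k])
  have le: "cmod (psum a (of_real r * cis (of_int s * (x - y))) * f y) \<le> A / (1 - r) * cmod (f y)" for y
    unfolding norm_mult using r by (intro mult_right_mono psum_le[OF a]) (auto simp: norm_mult)
  have int: "integrable torus_measure (\<lambda>y. psum a (of_real r * cis (of_int s * (x - y))) * f y)"
  proof (rule Bochner_Integration.integrable_bound)
    show "integrable torus_measure (\<lambda>y. A / (1 - r) * cmod (f y))" using f by simp
    show "AE y in torus_measure. norm (psum a (of_real r * cis (of_int s * (x - y))) * f y) \<le> norm (A / (1 - r) * cmod (f y))"
      using le A r by (intro AE_I2) (auto intro: order_trans)
  qed simp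
  have "cmod (mult_op a s r f x) \<le> (LINT y|torus_measure. cmod (psum a (of_real r * cis (of_int s * (x - y))) * f y))"
    unfolding mult_op_def by (rule integral_norm_bound)
  also have "\<dots> \<le> (LINT y|torus_measure. A / (1 - r) * cmod (f y))"
    using f by (intro integral_mono integrable_norm int le) auto
  finally show ?thesis by simp
qed

lemma mult_op_p_integrable:
  assumes a: "\<And>k. cmod (a k) \<le> A" and r: "0 \<le> r" "r < 1" and f: "integrable torus_measure f" and "0 < p"
  shows "p_integrable p (mult_op a s r f)"
  using mult_op_bound[OF a r f] assms(5) by (intro p_integrable_bounded[OF mult_op_measurable[OF a r f]]) auto

text \<open>Bessel's inequality bounds every partial sum and Fatou's lemma passes to the limit. Only
  the supremum of the coefficients enters: this is the endpoint that later makes the norm small with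
  \<open>\<epsilon>\<close>.\<close>

lemma mult_op_L2:
  assumes a: "\<And>k. cmod (a k) \<le> \<epsilon>" and r: "0 \<le> r" "r < 1" and f: "p_integrable 2 f" and s: "s \<in> {1, -1}"
  shows "(LINT x|torus_measure. (cmod (mult_op a s r f x))\<^sup>2) \<le> \<epsilon>\<^sup>2 * (LINT x|torus_measure. (cmod (f x))\<^sup>2)"
proof -
  have f1: "integrable torus_measure f"
    by (rule p_integrable_imp_integrable[OF _ f]) simp
  define P where "P n x = (\<Sum>k<n. a k * of_real r ^ k * fourier_coeff f (s * int k) * cis (x * of_int (s * int k)))" for n x
  have lim: "(\<lambda>n. P n x) \<longlonglongrightarrow> mult_op a s r f x" for x
    using mult_op_sums[OF a r f1] by (simp add: sums_def P_def)
  have [measurable]: "P n \<in> borel_measurable borel" for n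
    unfolding P_def by (simp add: cis_conv_exp)
  have [measurable]: "mult_op a s r f \<in> borel_measurable borel"
    by (rule mult_op_measurable[OF a r f1])
  have bound: "(LINT x|torus_measure. (cmod (P n x))\<^sup>2) \<le> \<epsilon>\<^sup>2 * (LINT x|torus_measure. (cmod (f x))\<^sup>2)" for n
  proof -
    define K where "K = (\<lambda>k. s * int k) ` {..<n}"
    have inj: "inj_on (\<lambda>k. s * int k) {..<n}" using s by (auto simp: inj_on_def)
    \<comment> \<open>Since \<open>s\<close> is 1 or -1, the index \<open>k\<close> is recovered
      from the frequency \<open>s * k\<close> as its absolute value, so the partial sum becomes a
      sum over frequencies.\<close>
    define c where "c j = a (nat \<bar>j\<bar>) * of_real r ^ nat \<bar>j\<bar> * fourier_coeff f j" for j
    have c: "c (s * int k) = a k * of_real r ^ k * fourier_coeff f (s * int k)" for k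
      using s by (auto simp: c_def)
    have "P n x = (\<Sum>k\<in>K. c k * cis (x * of_int k))" for x
      unfolding K_def sum.reindex[OF inj] o_def c P_def ..
    then have "(LINT x|torus_measure. (cmod (P n x))\<^sup>2) = (\<Sum>k\<in>K. (cmod (c k))\<^sup>2)"
      using integral_trig_norm_square[of K c] by (simp add: K_def)
    also have "\<dots> \<le> (\<Sum>k\<in>K. (\<epsilon> * cmod (fourier_coeff f k))\<^sup>2)"
    proof (rule sum_mono, rule power_mono)
      fix j
      have "cmod (a (nat \<bar>j\<bar>)) * r ^ nat \<bar>j\<bar> \<le> \<epsilon> * 1"
        using r order_trans[OF norm_ge_zero a] by (intro mult_mono a power_le_one) auto
      then show "cmod (c j) \<le> \<epsilon> * cmod (fourier_coeff f j)"
        unfolding c_def norm_mult norm_power using r by (intro mult_right_mono) auto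
    qed simp
    also have "\<dots> = \<epsilon>\<^sup>2 * (\<Sum>k\<in>K. (cmod (fourier_coeff f k))\<^sup>2)"
      by (simp add: power_mult_distrib sum_distrib_left)
    also have "\<dots> \<le> \<epsilon>\<^sup>2 * (LINT x|torus_measure. (cmod (f x))\<^sup>2)"
      using bessel_inequality[OF _ f, of K] by (intro mult_left_mono) (auto simp: K_def)
    finally show ?thesis .
  qed
  have intP: "integrable torus_measure (\<lambda>x. (cmod (P n x))\<^sup>2)" for n
  proof -
    have "continuous_on UNIV (P n)" unfolding P_def by (intro continuous_intros)
    then show ?thesis using p_integrable_continuous[of "P n" 2] by (simp add: p_integrable_def)
  qed
  have intT: "integrable torus_measure (\<lambda>x. (cmod (mult_op a s r f x))\<^sup>2)"
    using mult_op_p_integrable[OF a r f1, of 2] by (simp add: p_integrable_def)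
  have "(\<integral>\<^sup>+x. ennreal ((cmod (mult_op a s r f x))\<^sup>2) \<partial>torus_measure) =
      (\<integral>\<^sup>+x. liminf (\<lambda>n. ennreal ((cmod (P n x))\<^sup>2)) \<partial>torus_measure)"
  proof (rule nn_integral_cong)
    fix x
    have "(\<lambda>n. ennreal ((cmod (P n x))\<^sup>2)) \<longlonglongrightarrow> ennreal ((cmod (mult_op a s r f x))\<^sup>2)"
      by (intro tendsto_intros lim)
    then show "ennreal ((cmod (mult_op a s r f x))\<^sup>2) = liminf (\<lambda>n. ennreal ((cmod (P n x))\<^sup>2))"
      by (rule lim_imp_Liminf[OF trivial_limit_sequentially, symmetric])
  qed
  also have "\<dots> \<le> liminf (\<lambda>n. \<integral>\<^sup>+x. ennreal ((cmod (P n x))\<^sup>2) \<partial>torus_measure)"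
    by (rule nn_integral_liminf) simp
  also have "\<dots> \<le> liminf (\<lambda>n::nat. ennreal (\<epsilon>\<^sup>2 * (LINT x|torus_measure. (cmod (f x))\<^sup>2)))"
    using bound by (intro Liminf_mono always_eventually allI)
      (subst nn_integral_eq_integral[OF intP], auto intro: ennreal_leI)
  also have "\<dots> = ennreal (\<epsilon>\<^sup>2 * (LINT x|torus_measure. (cmod (f x))\<^sup>2))"
    by (simp add: Liminf_const)
  finally show ?thesis
    by (subst (asm) nn_integral_eq_integral[OF intT]) auto
qed

section \<open>Calderon--Zygmund theory\<close>

text \<open>A crude form of Jordan's inequality: the mean value theorem up to \<open>pi / 3\<close>,
  where the cosine is at least 1/2, and monotonicity of the sine beyond.\<close>

lemma sin_ge_quarter:
  fixes t :: real
  assumes "0 \<le> t" "t \<le> pi / 2"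
  shows "t / 4 \<le> sin t"
proof (cases "t \<le> pi / 3")
  case True
  show ?thesis
  proof (cases "t = 0")
    case False
    with assms have "0 < t" by simp
    from MVT2[OF this, of sin cos] obtain z where z: "0 < z" "z < t" "sin t = t * cos z"
      by (auto intro: DERIV_sin)
    have "cos (pi / 3) \<le> cos z"
      using z True pi_gt_zero by (intro cos_monotone_0_pi_le) linarith+
    then have "1 / 2 \<le> cos z" by (simp add: cos_60)
    then have "t * (1 / 4) \<le> t * cos z" using \<open>0 < t\<close> by (intro mult_left_mono) auto
    then show ?thesis by (simp add: z(3))
  qed simp
next
  case False
  have "sin (pi / 6) \<le> sin t"
    using False assms pi_gt_zero by (intro sin_monotone_2pi_le) linarith+
  then have "1 / 2 \<le> sin t" by (simp add: sin_30)
  moreover have "t < 2" using assms pi_less_4 by linarith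
  ultimately show ?thesis by linarith
qed

text \<open>Two points of the fundamental domain differ by at most a full period, so the distance on
  the circle is realized by one of the lifts -1, 0, 1. This is the origin of the three-element index
  set in the kernel estimates.\<close>

lemma dist_le_sin_half:
  assumes "\<bar>t\<bar> \<le> 2 * pi"
  shows "\<exists>j\<in>{-1, 0, 1::int}. \<bar>t - 2 * pi * of_int j\<bar> \<le> 8 * \<bar>sin (t / 2)\<bar>"
proof -
  have pos: "\<exists>j\<in>{0, 1::int}. \<bar>t - 2 * pi * of_int j\<bar> \<le> 8 * \<bar>sin (t / 2)\<bar>" if "0 \<le> t" "t \<le> 2 * pi" for t
  proof (cases "t \<le> pi")
    case True
    then show ?thesis using sin_ge_quarter[of "t / 2"] that by auto
  next
    case False
    have "(pi - t / 2) / 4 \<le> sin (pi - t / 2)"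
      using False that by (intro sin_ge_quarter) auto
    then have "\<bar>t - 2 * pi * of_int 1\<bar> \<le> 8 * \<bar>sin (t / 2)\<bar>" using that by auto
    then show ?thesis by blast
  qed
  show ?thesis
  proof (cases "0 \<le> t")
    case True
    then show ?thesis using pos[of t] assms by auto
  next
    case False
    then obtain j where j: "j \<in> {0, 1::int}" "\<bar>- t - 2 * pi * of_int j\<bar> \<le> 8 * \<bar>sin (- t / 2)\<bar>"
      using pos[of "-t"] assms \<open>\<not> 0 \<le> t\<close> by (meson abs_le_D2 le_minus_iff neg_0_le_iff_le not_le_imp_less less_imp_le)
    have "\<bar>t - 2 * pi * of_int (- j)\<bar> = \<bar>- t - 2 * pi * of_int j\<bar>" by (simp add: abs_if)
    with j show ?thesis by (intro bexI[of _ "- j"]) auto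
  qed
qed

text \<open>On the unit circle the chord is \<open>2 * \<bar>sin (t / 2)\<bar>\<close>. Moving
  inward to radius \<open>r\<close> changes it by \<open>1 - r\<close>, which is itself at most the
  new distance; hence at least half of the chord survives.\<close>

lemma sin_half_le_one_minus_cis:
  assumes "0 \<le> r" "r \<le> 1"
  shows "\<bar>sin (t / 2)\<bar> \<le> cmod (1 - of_real r * cis t)"
proof -
  have "(cmod (1 - cis t))\<^sup>2 = 2 - 2 * cos t"
    unfolding cmod_power2 using sin_cos_squared_add[of t] by (simp add: power2_eq_square algebra_simps)
  also have "\<dots> = (2 * \<bar>sin (t / 2)\<bar>)\<^sup>2"
    using cos_double_sin[of "t / 2"] by (simp add: power_mult_distrib)
  finally have eq: "cmod (1 - cis t) = 2 * \<bar>sin (t / 2)\<bar>"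
    by (rule power2_eq_imp_eq) auto
  have "cmod (1 - cis t) \<le> cmod (1 - of_real r * cis t) + cmod (of_real r * cis t - cis t)"
    using norm_triangle_ineq[of "1 - of_real r * cis t" "of_real r * cis t - cis t"] by simp
  also have "of_real r * cis t - cis t = of_real (r - 1) * cis t" by (simp add: algebra_simps)
  also have "cmod (of_real (r - 1) * cis t) = 1 - r" using assms by (simp only: norm_mult norm_of_real) simp
  also have "1 - r \<le> cmod (1 - of_real r * cis t)"
    using norm_triangle_ineq2[of 1 "of_real r * cis t"] assms by (simp add: norm_mult)
  finally show ?thesis using eq by simp
qed

text \<open>Hoermander's regularity condition in pointwise form, from the mean value inequality and
  the bound \<open>A / cmod (1 - z) ^ 2\<close> for the derived series. The point \<open>x\<close>
  has to be far from the centre of the interval in every lift.\<close>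

lemma mult_op_kernel_lipschitz:
  assumes a: "mikhlin A a" and r: "0 \<le> r" "r < 1" and s: "s \<in> {1, -1}"
    and x: "0 \<le> x" "x \<le> 2 * pi" and uv: "0 \<le> u" "u < v" "v \<le> 2 * pi" and y: "u \<le> y" "y < v"
    and far: "\<And>j. j \<in> {-1, 0, 1} \<Longrightarrow> v - u \<le> \<bar>x - (u + v) / 2 - 2 * pi * of_int j\<bar>"
  shows "cmod (psum a (of_real r * cis (of_int s * (x - y))) - psum a (of_real r * cis (of_int s * (x - (u + v) / 2))))
    \<le> 3840 * A * (v - u) * (\<Sum>j\<in>{-1, 0, 1::int}. 1 / (x - (u + v) / 2 - 2 * pi * of_int j)\<^sup>2)"
proof -
  define c where "c = (u + v) / 2"
  define R where "R = (\<Sum>j\<in>{-1, 0, 1::int}. 1 / (x - c - 2 * pi * of_int j)\<^sup>2)"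
  have A: "0 \<le> A" using mikhlin_nonneg[OF a] .
  define z where "z t = of_real r * cis (of_int s * (x - t))" for t
  have zn: "cmod (z t) < 1" for t using r by (simp add: z_def norm_mult)
  have deriv: "((\<lambda>t. psum a (z t)) has_vector_derivative
      (- \<i> * of_int s * z t * psum (diffs a) (z t))) (at t within {u..v})" for t
  proof -
    have "((\<lambda>w. exp (\<i> * (of_int s * (of_real x - w)))) has_field_derivative
        (exp (\<i> * (of_int s * (of_real x - of_real t))) * (\<i> * (of_int s * (-1))))) (at (of_real t))"
      by (auto intro!: derivative_eq_intros)
    then have "((\<lambda>w. of_real r * exp (\<i> * (of_int s * (of_real x - w)))) has_field_derivative
        (of_real r * (exp (\<i> * (of_int s * (of_real x - of_real t))) * (\<i> * (of_int s * (-1)))))) (at (of_real t))"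
      by (rule DERIV_cmult)
    from has_vector_derivative_real_field[OF this]
    have "(z has_vector_derivative (- \<i> * of_int s * z t)) (at t)"
      by (simp add: z_def[abs_def] cis_conv_exp mult_ac)
    moreover have "(psum a has_field_derivative psum (diffs a) (z t)) (at (z t))"
      using mikhlinD(1)[OF a] zn by (intro psum_has_derivative)
    ultimately have "(psum a \<circ> z has_vector_derivative ((- \<i> * of_int s * z t) * psum (diffs a) (z t))) (at t)"
      by (rule field_vector_diff_chain_at)
    then show ?thesis by (auto simp: o_def intro: has_vector_derivative_at_within)
  qed
  have bound: "cmod (- \<i> * of_int s * z t * psum (diffs a) (z t)) \<le> 7680 * A * R" if t: "t \<in> {u..v}" for t
  proof -
    have "\<bar>of_int s * (x - t)\<bar> = \<bar>x - t\<bar>" using s by auto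
    have "\<bar>x - t\<bar> \<le> 2 * pi" using x t uv by auto
    then obtain j where j: "j \<in> {-1, 0, 1::int}" "\<bar>x - t - 2 * pi * of_int j\<bar> \<le> 8 * \<bar>sin ((x - t) / 2)\<bar>"
      using dist_le_sin_half by blast
    define \<rho> where "\<rho> = \<bar>x - c - 2 * pi * of_int j\<bar>"
    have \<rho>: "v - u \<le> \<rho>" "0 < \<rho>" using far[OF j(1)] uv by (auto simp: \<rho>_def c_def)
    have "\<bar>t - c\<bar> \<le> (v - u) / 2" using t by (auto simp: c_def field_simps abs_if)
    \<comment> \<open>The point \<open>t\<close> is within half the interval length of the centre,
      while \<open>\<rho>\<close> is at least the whole length, so at least half of
      \<open>\<rho>\<close> remains.\<close>
    then have "\<rho> / 2 \<le> \<bar>x - t - 2 * pi * of_int j\<bar>"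
      using \<rho> abs_triangle_ineq2[of "x - c - 2 * pi * of_int j" "t - c"] unfolding \<rho>_def
      by (simp add: algebra_simps)
    also have "\<dots> \<le> 8 * \<bar>sin ((x - t) / 2)\<bar>" by (rule j)
    also have "\<bar>sin ((x - t) / 2)\<bar> = \<bar>sin ((of_int s * (x - t)) / 2)\<bar>"
    proof -
      have "of_int s * (x - t) / 2 = (x - t) / 2 \<or> of_int s * (x - t) / 2 = - ((x - t) / 2)"
        using s by (auto simp: field_simps)
      then show ?thesis by (elim disjE) (simp_all only: sin_minus abs_minus_cancel)
    qed
    also have "\<dots> \<le> cmod (1 - z t)"
      unfolding z_def using r by (intro sin_half_le_one_minus_cis) auto
    finally have le: "\<rho> / 16 \<le> cmod (1 - z t)" by simp
    have "cmod (psum (diffs a) (z t)) \<le> 30 * A / cmod (1 - z t) ^ 2"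
      by (rule psum_diffs_bound[OF a zn])
    \<comment> \<open>The constant is \<open>30 * 16 ^ 2 = 7680\<close>; multiplication by half the
      interval length turns it into 3840 at the end.\<close>
    also have "\<dots> \<le> 30 * A / (\<rho> / 16) ^ 2"
      using le \<rho> A by (intro divide_left_mono power_mono mult_pos_pos) (auto simp: zero_less_power2)
    also have "\<dots> = 7680 * A * (1 / (x - c - 2 * pi * of_int j)\<^sup>2)"
      by (simp add: \<rho>_def power_divide)
    \<comment> \<open>The lift \<open>j\<close> varies with \<open>t\<close>; the sum over all three
      lifts removes this dependence.\<close>
    also have "\<dots> \<le> 7680 * A * R"
      unfolding R_def using A j(1) by (intro mult_left_mono member_le_sum) auto
    finally have p: "cmod (psum (diffs a) (z t)) \<le> 7680 * A * R" .
    have "cmod (- \<i> * of_int s * z t) \<le> 1" using s zn[of t] by (auto simp: norm_mult)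
    then have "cmod (- \<i> * of_int s * z t * psum (diffs a) (z t)) \<le> 1 * (7680 * A * R)"
      unfolding norm_mult[of "- \<i> * of_int s * z t"] using p by (intro mult_mono) auto
    then show ?thesis by simp
  qed
  have "cmod (psum a (z y) - psum a (z c)) \<le> 7680 * A * R * norm (y - c)"
  proof (rule differentiable_bound[of "{u..v}" _ "\<lambda>t h. h *\<^sub>R (- \<i> * of_int s * z t * psum (diffs a) (z t))"])
    show "onorm (\<lambda>h. h *\<^sub>R (- \<i> * of_int s * z t * psum (diffs a) (z t))) \<le> 7680 * A * R" if "t \<in> {u..v}" for t
    proof (rule onorm_le)
      show "norm (h *\<^sub>R (- \<i> * of_int s * z t * psum (diffs a) (z t))) \<le> 7680 * A * R * norm h" for h :: real
        unfolding norm_scaleR real_norm_def mult.commute[of "\<bar>h\<bar>"]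
        by (rule mult_right_mono[OF bound[OF that]]) simp
    qed
    show "((\<lambda>t. psum a (z t)) has_derivative (\<lambda>h. h *\<^sub>R (- \<i> * of_int s * z t * psum (diffs a) (z t)))) (at t within {u..v})" for t
      using deriv[of t] by (simp add: has_vector_derivative_def)
  qed (use y uv in \<open>auto simp: c_def\<close>)
  also have "\<dots> \<le> 7680 * A * R * ((v - u) / 2)"
  proof (rule mult_left_mono)
    show "norm (y - c) \<le> (v - u) / 2" using y by (auto simp: c_def field_simps abs_if)
    show "0 \<le> 7680 * A * R" using A by (auto simp: R_def intro!: mult_nonneg_nonneg sum_nonneg)
  qed
  also have "\<dots> = 3840 * A * (v - u) * R" by simp
  finally show ?thesis unfolding z_def c_def R_def .
qed

text \<open>Each of the two half lines \<open>x \<ge> c + l\<close> and \<open>x \<le> c - l\<close>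
  contributes \<open>1 / l\<close> to the integral over the real line, and normalization divides by
  \<open>2 * pi\<close>.\<close>

lemma integral_torus_inverse_square_tail:
  assumes "0 < l"
  shows "(LINT x|torus_measure. (if l \<le> \<bar>x - c\<bar> then 1 / (x - c)\<^sup>2 else 0)) \<le> 1 / (pi * l)"
proof -
  define H where "H x = ennreal (1 / x\<^sup>2) * indicator {l..} x" for x :: real
  let ?f = "\<lambda>x. if l \<le> \<bar>x - c\<bar> then 1 / (x - c)\<^sup>2 else 0"
  have [measurable]: "H \<in> borel_measurable borel" unfolding H_def by measurable
  have [measurable]: "?f \<in> borel_measurable borel" by measurable
  have "(\<integral>\<^sup>+x. H x \<partial>lborel) = ennreal (0 - (- (1 / l)))"
    unfolding H_def
  proof (rule nn_integral_FTC_atLeast)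
    show "((\<lambda>x::real. - (1 / x)) \<longlongrightarrow> 0) at_top"
      using tendsto_minus[OF tendsto_inverse_0_at_top[OF filterlim_ident]]
      by (simp add: inverse_eq_divide)
    show "DERIV (\<lambda>x. - (1 / x)) x :> 1 / x\<^sup>2" if "l \<le> x" for x
      using that assms by (auto intro!: derivative_eq_intros simp: power2_eq_square field_simps)
  qed auto
  then have H: "(\<integral>\<^sup>+x. H x \<partial>lborel) = ennreal (1 / l)" by simp
  have H1: "(\<integral>\<^sup>+x. H (x - c) \<partial>lborel) = ennreal (1 / l)"
  proof -
    have "(\<integral>\<^sup>+x. H x \<partial>lborel) = (\<integral>\<^sup>+x. H (x - c) \<partial>lborel)"
      using nn_integral_real_affine[of H 1 "- c"] by simp
    then show ?thesis unfolding H by simp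
  qed
  have H2: "(\<integral>\<^sup>+x. H (c - x) \<partial>lborel) = ennreal (1 / l)"
  proof -
    have "(\<integral>\<^sup>+x. H x \<partial>lborel) = (\<integral>\<^sup>+x. H (c - x) \<partial>lborel)"
      using nn_integral_real_affine[of H "-1" c] by simp
    then show ?thesis unfolding H by simp
  qed
  have "(\<integral>\<^sup>+x. ennreal (?f x) * indicator torus x \<partial>lborel) \<le> (\<integral>\<^sup>+x. H (x - c) + H (c - x) \<partial>lborel)"
    by (intro nn_integral_mono) (auto simp: H_def indicator_def abs_if power2_commute)
  also have "\<dots> = ennreal (1 / l) + ennreal (1 / l)"
    by (subst nn_integral_add) (auto simp: H1 H2)
  also have "\<dots> = ennreal (2 / l)" using assms by (simp flip: ennreal_plus)
  finally have "(\<integral>\<^sup>+x. ennreal (?f x) \<partial>torus_measure) \<le> ennreal (2 / l) / ennreal (2 * pi)"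
    by (subst nn_integral_torus) (auto intro: divide_right_mono_ennreal)
  also have "\<dots> = ennreal (1 / (pi * l))"
    using assms by (subst divide_ennreal) (auto simp: field_simps)
  finally have le: "(\<integral>\<^sup>+x. ennreal (?f x) \<partial>torus_measure) \<le> ennreal (1 / (pi * l))" .
  have int: "integrable torus_measure ?f"
    by (rule integrable_torus_bounded[where B = "1 / l\<^sup>2"])
      (use assms in \<open>auto intro!: divide_left_mono simp: abs_le_square_iff[symmetric]\<close>)
  from le have "ennreal (LINT x|torus_measure. ?f x) \<le> ennreal (1 / (pi * l))"
    by (subst (asm) nn_integral_eq_integral[OF int]) auto
  then show ?thesis using assms by (subst (asm) ennreal_le_iff) auto
qed

lemma measure_torus_interval:
  assumes "0 \<le> u" "u \<le> v" "v \<le> 2 * pi"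
  shows "measure torus_measure {u..<v} = (v - u) / (2 * pi)"
proof -
  have "torus \<inter> {u..<v} = {u..<v}" using assms by auto
  then show ?thesis
    unfolding torus_measure_def using assms by (subst measure_uniform_measure) auto
qed

lemma measure_torus_le:
  assumes "a \<le> b"
  shows "measure torus_measure {a..b} \<le> (b - a) / (2 * pi)"
proof -
  have "measure torus_measure {a..b} = measure lborel (torus \<inter> {a..b}) / (2 * pi)"
    unfolding torus_measure_def by (subst measure_uniform_measure) auto
  also have "measure lborel (torus \<inter> {a..b}) \<le> measure lborel {a..b}"
    by (intro measure_mono_fmeasurable) (auto simp: fmeasurable_def emeasure_lborel_Icc_eq)
  finally show ?thesis using assms by (auto simp: divide_right_mono)
qed

abbreviation int_on :: "(real \<Rightarrow> real) \<Rightarrow> real \<Rightarrow> real \<Rightarrow> real" where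
  "int_on w u v \<equiv> LINT x|torus_measure. indicator {u..<v} x * w x"

lemma int_on_integrable:
  fixes w :: "real \<Rightarrow> real"
  assumes "continuous_on UNIV w"
  shows "integrable torus_measure (\<lambda>x. indicator {u..<v} x * w x)"
proof -
  have [measurable]: "w \<in> borel_measurable borel"
    by (rule borel_measurable_continuous_onI[OF assms])
  have "integrable torus_measure (\<lambda>x. complex_of_real (w x))"
    by (intro integrable_torus_continuous continuous_intros assms)
  then have "integrable torus_measure w"
    by (simp add: complex_of_real_integrable_eq)
  then show ?thesis
    by (rule Bochner_Integration.integrable_bound) (simp_all add: indicator_def)
qed

lemma int_on_split:
  assumes "continuous_on UNIV w" "u \<le> m" "m \<le> v"
  shows "int_on w u v = int_on w u m + int_on w m v"
proof -
  have "indicator {u..<v} x * w x = indicator {u..<m} x * w x + indicator {m..<v} x * w x" for x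
    using assms by (auto simp: indicator_def)
  then show ?thesis
    using int_on_integrable[OF assms(1)] by simp
qed

lemma int_on_const: "0 \<le> u \<Longrightarrow> u \<le> v \<Longrightarrow> v \<le> 2 * pi \<Longrightarrow> int_on (\<lambda>_. c) u v = c * ((v - u) / (2 * pi))"
  using measure_torus_interval[of u v] by simp

lemma int_on_mono:
  assumes "continuous_on UNIV w" "continuous_on UNIV w'" "\<And>x. u \<le> x \<Longrightarrow> x < v \<Longrightarrow> w x \<le> w' x"
  shows "int_on w u v \<le> int_on w' u v"
  using assms(3) by (intro integral_mono int_on_integrable assms) (auto simp: indicator_def)

text \<open>A continuous function does not oscillate on short intervals, so that finitely many bisections
  suffice and no differentiation theorem is needed.\<close>

lemma calderon_zygmund_intervals:
  fixes w :: "real \<Rightarrow> real"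
  assumes w: "continuous_on UNIV w" "\<And>x. 0 \<le> w x" and h: "0 < h"
  shows "0 \<le> u \<Longrightarrow> u < v \<Longrightarrow> v \<le> 2 * pi \<Longrightarrow> int_on w u v \<le> h * ((v - u) / (2 * pi)) \<Longrightarrow>
    (\<And>x y. x \<in> {u..v} \<Longrightarrow> y \<in> {u..v} \<Longrightarrow> \<bar>x - y\<bar> \<le> (v - u) / 2 ^ d \<Longrightarrow> \<bar>w x - w y\<bar> < h) \<Longrightarrow>
    \<exists>S. finite S \<and> disjoint_family_on (\<lambda>(a, b). {a..<b}) S \<and>
      (\<forall>(a, b)\<in>S. u \<le> a \<and> a < b \<and> b \<le> v \<and> h * ((b - a) / (2 * pi)) \<le> int_on w a b \<and>
        int_on w a b \<le> 2 * h * ((b - a) / (2 * pi))) \<and>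
      (\<forall>x\<in>{u..<v} - (\<Union>(a, b)\<in>S. {a..<b}). w x \<le> 2 * h)"
proof (induction d arbitrary: u v)
  case 0
  \<comment> \<open>After \<open>d\<close> bisections \<open>w\<close> oscillates by less than
    \<open>h\<close>, so a value above \<open>2 * h\<close> would push the mean over the interval
    above \<open>h\<close>.\<close>
  have "w x \<le> 2 * h" if x: "x \<in> {u..<v}" for x
  proof (rule ccontr)
    assume "\<not> w x \<le> 2 * h"
    then have gt: "h < w x - h" by simp
    have "w x - h \<le> w y" if "u \<le> y" "y < v" for y
    proof -
      have "\<bar>x - y\<bar> \<le> (v - u) / 2 ^ 0" using x that by auto
      then have "\<bar>w x - w y\<bar> < h" using x that by (intro 0(5)) auto
      then show ?thesis by linarith
    qed
    then have "int_on (\<lambda>_. w x - h) u v \<le> int_on w u v"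
      by (intro int_on_mono w) auto
    then have "(w x - h) * ((v - u) / (2 * pi)) \<le> h * ((v - u) / (2 * pi))"
      using 0 int_on_const[of u v "w x - h"] by linarith
    moreover have "0 < (v - u) / (2 * pi)" using 0 by simp
    ultimately have "w x - h \<le> h" by (meson mult_le_cancel_right_pos)
    with gt show False by simp
  qed
  then show ?case by (intro exI[of _ "{}"]) (auto simp: disjoint_family_on_def)
next
  case (Suc d)
  let ?Q = "\<lambda>u v S. finite S \<and> disjoint_family_on (\<lambda>(a, b). {a..<b}) S \<and>
      (\<forall>(a, b)\<in>S. u \<le> a \<and> a < b \<and> b \<le> v \<and> h * ((b - a) / (2 * pi)) \<le> int_on w a b \<and>
        int_on w a b \<le> 2 * h * ((b - a) / (2 * pi))) \<and>
      (\<forall>x\<in>{u..<v} - (\<Union>(a, b)\<in>S. {a..<b}). w x \<le> 2 * h)"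
  define m where "m = (u + v) / 2"
  have m: "u < m" "m < v" "m - u = (v - u) / 2" "v - m = (v - u) / 2" using Suc.prems by (auto simp: m_def field_simps)
  have half: "\<exists>S. ?Q a b S" if ab: "u \<le> a" "a < b" "b \<le> v" "b - a = (v - u) / 2" and le: "int_on w a b \<le> int_on w u v" for a b
  proof (cases "int_on w a b \<le> h * ((b - a) / (2 * pi))")
    case True
    show ?thesis
    proof (rule Suc.IH)
      show "\<bar>w x - w y\<bar> < h" if "x \<in> {a..b}" "y \<in> {a..b}" "\<bar>x - y\<bar> \<le> (b - a) / 2 ^ d" for x y
        using that ab by (intro Suc.prems(5)) auto
    qed (use ab True Suc.prems in auto)
  next
    case False
    \<comment> \<open>A half whose mean exceeds \<open>h\<close> is selected and not divided
      further. Its mean is at most twice that of the parent, and the parent was divided because its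
      mean did not exceed \<open>h\<close>.\<close>
    have "int_on w a b \<le> 2 * h * ((b - a) / (2 * pi))"
    proof -
      have "2 * h * ((b - a) / (2 * pi)) = h * ((v - u) / (2 * pi))" unfolding ab(4) by simp
      then show ?thesis using le Suc.prems(4) by linarith
    qed
    then show ?thesis
      using False ab(1-3) by (intro exI[of _ "{(a, b)}"]) (simp add: disjoint_family_on_def)
  qed
  have nn: "0 \<le> int_on w a b" for a b
    using w by (intro Bochner_Integration.integral_nonneg) (auto simp: indicator_def)
  have sp: "int_on w u v = int_on w u m + int_on w m v"
    using m by (intro int_on_split w) auto
  obtain S1 where S1: "?Q u m S1" using half[of u m] m nn[of m v] sp by auto
  obtain S2 where S2: "?Q m v S2" using half[of m v] m nn[of u m] sp by auto
  have "?Q u v (S1 \<union> S2)"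
  proof (intro conjI)
    show "finite (S1 \<union> S2)" using S1 S2 by simp
    have disj: "{a..<b} \<inter> {a'..<b'} = {}" if "(a, b) \<in> S1" "(a', b') \<in> S2" for a b a' b'
      using S1 S2 that by fastforce
    show "disjoint_family_on (\<lambda>(a, b). {a..<b}) (S1 \<union> S2)"
      unfolding disjoint_family_on_def
    proof (intro ballI impI)
      fix p q assume pq: "p \<in> S1 \<union> S2" "q \<in> S1 \<union> S2" "p \<noteq> q"
      have d1: "(\<lambda>(a, b). {a..<b}) p \<inter> (\<lambda>(a, b). {a..<b}) q = {}" if "p \<in> S1" "q \<in> S1"
        using S1 that pq(3) unfolding disjoint_family_on_def by blast
      have d2: "(\<lambda>(a, b). {a..<b}) p \<inter> (\<lambda>(a, b). {a..<b}) q = {}" if "p \<in> S2" "q \<in> S2"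
        using S2 that pq(3) unfolding disjoint_family_on_def by blast
      have d3: "(\<lambda>(a, b). {a..<b}) p \<inter> (\<lambda>(a, b). {a..<b}) q = {}" if "p \<in> S1" "q \<in> S2"
        using disj[of "fst p" "snd p" "fst q" "snd q"] that by (simp add: case_prod_beta)
      have d4: "(\<lambda>(a, b). {a..<b}) p \<inter> (\<lambda>(a, b). {a..<b}) q = {}" if "p \<in> S2" "q \<in> S1"
        using disj[of "fst q" "snd q" "fst p" "snd p"] that by (simp add: case_prod_beta Int_commute)
      show "(\<lambda>(a, b). {a..<b}) p \<inter> (\<lambda>(a, b). {a..<b}) q = {}" using pq d1 d2 d3 d4 by blast
    qed
    show "\<forall>(a, b)\<in>S1 \<union> S2. u \<le> a \<and> a < b \<and> b \<le> v \<and> h * ((b - a) / (2 * pi)) \<le> int_on w a b \<and>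
        int_on w a b \<le> 2 * h * ((b - a) / (2 * pi))"
      using S1 S2 m by fastforce
    show "\<forall>x\<in>{u..<v} - (\<Union>(a, b)\<in>S1 \<union> S2. {a..<b}). w x \<le> 2 * h"
    proof
      fix x assume x: "x \<in> {u..<v} - (\<Union>(a, b)\<in>S1 \<union> S2. {a..<b})"
      show "w x \<le> 2 * h"
      proof (cases "x < m")
        case True
        with x have "x \<in> {u..<m} - (\<Union>(a, b)\<in>S1. {a..<b})" by auto
        then show ?thesis using S1 by blast
      next
        case False
        with x have "x \<in> {m..<v} - (\<Union>(a, b)\<in>S2. {a..<b})" by auto
        then show ?thesis using S2 by blast
      qed
    qed
  qed
  then show ?case by blast
qed

lemma mult_op_kernel_measurable:
  assumes a: "\<And>k. cmod (a k) \<le> A" and r: "0 \<le> r" "r < 1"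
  shows "(\<lambda>y. psum a (of_real r * cis (of_int s * (x - y)))) \<in> borel_measurable borel"
  by (rule borel_measurable_continuous_onI, rule continuous_on_compose2[OF psum_kernel_continuous[OF a r]])
    (auto intro!: continuous_intros)

lemma mult_op_kernel_integrable:
  assumes a: "\<And>k. cmod (a k) \<le> A" and r: "0 \<le> r" "r < 1" and f: "integrable torus_measure f"
  shows "integrable torus_measure (\<lambda>y. psum a (of_real r * cis (of_int s * (x - y))) * f y)"
proof (rule Bochner_Integration.integrable_bound)
  note [measurable] = mult_op_kernel_measurable[of a, OF a r]
  have [measurable]: "f \<in> borel_measurable borel" using f by auto
  have A: "0 \<le> A" using order_trans[OF norm_ge_zero a] .
  have le: "cmod (psum a (of_real r * cis (of_int s * (x - y))) * f y) \<le> A / (1 - r) * cmod (f y)" for y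
    unfolding norm_mult using r by (intro mult_right_mono psum_le[OF a]) (auto simp: norm_mult)
  show "integrable torus_measure (\<lambda>y. A / (1 - r) * cmod (f y))" using f by simp
  show "AE y in torus_measure. norm (psum a (of_real r * cis (of_int s * (x - y))) * f y) \<le> norm (A / (1 - r) * cmod (f y))"
    using le A r by (intro AE_I2) (auto intro: order_trans)
  show "(\<lambda>y. psum a (of_real r * cis (of_int s * (x - y))) * f y) \<in> borel_measurable torus_measure"
    by simp
qed

lemma mult_op_add:
  assumes a: "\<And>k. cmod (a k) \<le> A" and r: "0 \<le> r" "r < 1"
    and f: "integrable torus_measure f" and g: "integrable torus_measure g"
  shows "mult_op a s r (\<lambda>x. f x + g x) x = mult_op a s r f x + mult_op a s r g x"
  unfolding mult_op_def distrib_left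
  by (intro Bochner_Integration.integral_add mult_op_kernel_integrable[OF a r] f g)

lemma mult_op_sum:
  assumes a: "\<And>k. cmod (a k) \<le> A" and r: "0 \<le> r" "r < 1"
    and f: "\<And>i. i \<in> I \<Longrightarrow> integrable torus_measure (f i)"
  shows "mult_op a s r (\<lambda>x. \<Sum>i\<in>I. f i x) x = (\<Sum>i\<in>I. mult_op a s r (f i) x)"
  unfolding mult_op_def sum_distrib_left
  by (intro Bochner_Integration.integral_sum mult_op_kernel_integrable[OF a r] f)

text \<open>Off the enlarged interval, the mean value zero of the bad part lets the kernel be replaced by its
  increment.\<close>

lemma mult_op_bad_part:
  assumes a: "mikhlin A a" and r: "0 \<le> r" "r < 1" and s: "s \<in> {1, -1}"
    and x: "0 \<le> x" "x \<le> 2 * pi" and uv: "0 \<le> u" "u < v" "v \<le> 2 * pi"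
    and far: "\<And>j. j \<in> {-1, 0, 1} \<Longrightarrow> v - u \<le> \<bar>x - (u + v) / 2 - 2 * pi * of_int j\<bar>"
    and b: "integrable torus_measure b" "(LINT y|torus_measure. b y) = 0" "\<And>y. y \<notin> {u..<v} \<Longrightarrow> b y = 0"
  shows "cmod (mult_op a s r b x) \<le> 3840 * A * (v - u) *
      (\<Sum>j\<in>{-1, 0, 1::int}. 1 / (x - (u + v) / 2 - 2 * pi * of_int j)\<^sup>2) * (LINT y|torus_measure. cmod (b y))"
proof -
  define K where "K y = psum a (of_real r * cis (of_int s * (x - y)))" for y
  define M where "M = 3840 * A * (v - u) * (\<Sum>j\<in>{-1, 0, 1::int}. 1 / (x - (u + v) / 2 - 2 * pi * of_int j)\<^sup>2)"
  have int: "integrable torus_measure (\<lambda>y. K y * b y)"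
    unfolding K_def by (rule mult_op_kernel_integrable[OF mikhlinD(1)[OF a] r b(1)])
  have int2: "integrable torus_measure (\<lambda>y. (K y - K ((u + v) / 2)) * b y)"
    unfolding left_diff_distrib using int b(1) by simp
  have "mult_op a s r b x = (LINT y|torus_measure. K y * b y) - K ((u + v) / 2) * (LINT y|torus_measure. b y)"
    by (simp add: mult_op_def K_def b(2))
  also have "\<dots> = (LINT y|torus_measure. (K y - K ((u + v) / 2)) * b y)"
    unfolding left_diff_distrib using int b(1) by simp
  also have "cmod \<dots> \<le> (LINT y|torus_measure. cmod ((K y - K ((u + v) / 2)) * b y))"
    by (rule integral_norm_bound)
  also have "\<dots> \<le> (LINT y|torus_measure. M * cmod (b y))"
  proof (rule integral_mono)
    fix y
    show "cmod ((K y - K ((u + v) / 2)) * b y) \<le> M * cmod (b y)"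
    proof (cases "y \<in> {u..<v}")
      case True
      then have "cmod (K y - K ((u + v) / 2)) \<le> M"
        unfolding K_def M_def using True by (intro mult_op_kernel_lipschitz a r s x uv far) auto
      then show ?thesis by (simp add: norm_mult mult_right_mono)
    qed (use b(3) in simp)
  qed (use int2 b(1) in auto)
  finally show ?thesis by (simp add: M_def)
qed

text \<open>The length \<open>v - u\<close> from the kernel estimate cancels against the bound
  \<open>1 / (pi * (v - u))\<close> of each of the three tails, and \<open>3 / pi < 1\<close>. The
  result is independent of the interval, so it can be summed over a decomposition.\<close>

lemma mult_op_bad_part_integral:
  assumes a: "mikhlin A a" and r: "0 \<le> r" "r < 1" and s: "s \<in> {1, -1}"
    and uv: "0 \<le> u" "u < v" "v \<le> 2 * pi"
    and b: "integrable torus_measure b" "(LINT y|torus_measure. b y) = 0" "\<And>y. y \<notin> {u..<v} \<Longrightarrow> b y = 0"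
    and E: "E = (\<Union>j\<in>{-1, 0, 1::int}. {(u + v) / 2 + 2 * pi * of_int j - (v - u)..(u + v) / 2 + 2 * pi * of_int j + (v - u)})"
  shows "(LINT x|torus_measure. indicator (- E) x * cmod (mult_op a s r b x)) \<le> 3840 * A * (LINT y|torus_measure. cmod (b y))"
proof -
  define J where "J = (LINT y|torus_measure. cmod (b y))"
  \<comment> \<open>Cut off near the singularity, the inverse square is bounded and integrable on
    the whole torus; outside \<open>E\<close> it agrees with the term of the kernel
    estimate.\<close>
  define q where "q j x = (if v - u \<le> \<bar>x - ((u + v) / 2 + 2 * pi * of_int j)\<bar> then 1 / (x - ((u + v) / 2 + 2 * pi * of_int j))\<^sup>2 else 0)"
    for j :: int and x
  have A: "0 \<le> A" using mikhlin_nonneg[OF a] .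
  have [measurable]: "q j \<in> borel_measurable borel" for j unfolding q_def by measurable
  have J: "0 \<le> J" by (simp add: J_def)
  have qint: "integrable torus_measure (q j)" for j
    by (rule integrable_torus_bounded[where B = "1 / (v - u)\<^sup>2"])
      (use uv in \<open>auto simp: q_def abs_le_square_iff[symmetric] intro!: divide_left_mono\<close>)
  have ET [measurable]: "E \<in> sets borel" unfolding E by measurable
  have [measurable]: "mult_op a s r b \<in> borel_measurable borel"
    by (rule mult_op_measurable[OF mikhlinD(1)[OF a] r b(1)])
  have "(LINT x|torus_measure. indicator (- E) x * cmod (mult_op a s r b x)) \<le>
      (LINT x|torus_measure. 3840 * A * (v - u) * J * (\<Sum>j\<in>{-1, 0, 1::int}. q j x))"
  proof (rule integral_mono_AE)
    show "AE x in torus_measure. indicator (- E) x * cmod (mult_op a s r b x) \<le> 3840 * A * (v - u) * J * (\<Sum>j\<in>{-1, 0, 1::int}. q j x)"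
      using AE_torus
    proof eventually_elim
      case (elim x)
      show ?case
      proof (cases "x \<in> E")
        case True
        have "0 \<le> q j x" for j by (simp add: q_def)
        then show ?thesis using True A uv J by (auto intro!: mult_nonneg_nonneg sum_nonneg)
      next
        case False
        have far: "v - u \<le> \<bar>x - (u + v) / 2 - 2 * pi * of_int j\<bar>" if "j \<in> {-1, 0, 1}" for j
        proof (rule ccontr)
          assume "\<not> v - u \<le> \<bar>x - (u + v) / 2 - 2 * pi * of_int j\<bar>"
          then have "x \<in> {(u + v) / 2 + 2 * pi * of_int j - (v - u)..(u + v) / 2 + 2 * pi * of_int j + (v - u)}"
            by (auto simp: abs_if split: if_splits)
          with that False show False unfolding E by blast
        qed
        have "q j x = 1 / (x - (u + v) / 2 - 2 * pi * of_int j)\<^sup>2" if "j \<in> {-1, 0, 1}" for j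
          using far[OF that] by (simp add: q_def diff_diff_eq)
        then have "(\<Sum>j\<in>{-1, 0, 1}. q j x) = (\<Sum>j\<in>{-1, 0, 1::int}. 1 / (x - (u + v) / 2 - 2 * pi * of_int j)\<^sup>2)"
          by (intro sum.cong) auto
        then show ?thesis
          using mult_op_bad_part[OF a r s _ _ uv far b] elim False by (simp add: J_def mult_ac)
      qed
    qed
    show "integrable torus_measure (\<lambda>x. indicator (- E) x * cmod (mult_op a s r b x))"
      using mult_op_bound[where a = a and s = s, OF mikhlinD(1)[OF a] r b(1)] A r
      by (intro integrable_torus_bounded[where B = "A / (1 - r) * (LINT y|torus_measure. cmod (b y))"])
        (auto simp: indicator_def)
  qed (use qint in auto)
  also have "\<dots> = 3840 * A * (v - u) * J * (\<Sum>j\<in>{-1, 0, 1::int}. LINT x|torus_measure. q j x)"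
    using qint by (subst Bochner_Integration.integral_sum[symmetric]) auto
  also have "\<dots> \<le> 3840 * A * (v - u) * J * (\<Sum>j\<in>{-1, 0, 1::int}. 1 / (pi * (v - u)))"
    unfolding q_def using A uv J
    by (intro mult_left_mono sum_mono integral_torus_inverse_square_tail mult_nonneg_nonneg) auto
  also have "\<dots> = 3840 * A * J * (3 / pi)" using uv by simp
  also have "\<dots> \<le> 3840 * A * J * 1"
    using A J pi_gt3 by (intro mult_left_mono) (auto simp: divide_le_eq_1)
  finally show ?thesis by (simp add: J_def)
qed

lemma int_on_torus:
  assumes "continuous_on UNIV w"
  shows "int_on w 0 (2 * pi) = (LINT x|torus_measure. w x)"
proof (rule integral_cong_AE)
  show "AE x in torus_measure. indicator torus x * w x = w x"
    using AE_torus by eventually_elim simp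
qed (use borel_measurable_continuous_onI[OF assms] in auto)

lemma integrable_torus_continuous_real:
  fixes w :: "real \<Rightarrow> real"
  assumes "continuous_on UNIV w"
  shows "integrable torus_measure w"
proof -
  have "integrable torus_measure (\<lambda>x. complex_of_real (w x))"
    by (intro integrable_torus_continuous continuous_intros assms)
  then show ?thesis by (simp add: complex_of_real_integrable_eq)
qed

text \<open>Uniform continuity fixes in advance the number of bisections for
  \<open>calderon_zygmund_intervals\<close>; \<open>2 * pi - 0\<close> is written so as to match the
  length \<open>v - u\<close> there.\<close>

lemma exists_dyadic_modulus:
  fixes w :: "real \<Rightarrow> real"
  assumes "continuous_on UNIV w" "0 < h"
  shows "\<exists>d. \<forall>x\<in>{0..2 * pi}. \<forall>y\<in>{0..2 * pi}. \<bar>x - y\<bar> \<le> (2 * pi - 0) / 2 ^ d \<longrightarrow> \<bar>w x - w y\<bar> < h"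
proof -
  have "uniformly_continuous_on {0..2 * pi} w"
    by (intro compact_uniformly_continuous continuous_on_subset[OF assms(1)]) auto
  then obtain \<delta> where \<delta>: "0 < \<delta>" "\<And>x y. x \<in> {0..2 * pi} \<Longrightarrow> y \<in> {0..2 * pi} \<Longrightarrow> dist y x < \<delta> \<Longrightarrow> dist (w y) (w x) < h"
    using assms(2) unfolding uniformly_continuous_on_def by metis
  obtain d where d: "2 * pi / \<delta> < 2 ^ d"
    using real_arch_pow[of 2 "2 * pi / \<delta>"] by auto
  then have "2 * pi / 2 ^ d < \<delta>" using \<delta> by (simp add: field_simps)
  then show ?thesis
    using \<delta>(2) by (intro exI[of _ d]) (auto simp: dist_real_def)
qed

text \<open>The bound on the mean over the whole torus is what allows the bisection to start. On a
  selected interval the good part is the mean of \<open>f\<close>, elsewhere it is \<open>f\<close>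
  itself; both are at most \<open>2 * h\<close>, by the selection rule and by the estimate off the
  intervals.\<close>

lemma calderon_zygmund_decomposition:
  assumes f: "continuous_on UNIV f" and h: "0 < h" and le: "(LINT x|torus_measure. cmod (f x)) \<le> h"
  obtains S :: "(real \<times> real) set" and b :: "real \<times> real \<Rightarrow> real \<Rightarrow> complex" where
    "finite S"
    "\<And>u v. (u, v) \<in> S \<Longrightarrow> 0 \<le> u \<and> u < v \<and> v \<le> 2 * pi"
    "(\<Sum>(u, v)\<in>S. (v - u) / (2 * pi)) \<le> (LINT x|torus_measure. cmod (f x)) / h"
    "\<And>I. I \<in> S \<Longrightarrow> b I \<in> borel_measurable borel \<and> integrable torus_measure (b I)"
    "\<And>I. I \<in> S \<Longrightarrow> (LINT x|torus_measure. b I x) = 0"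
    "\<And>u v x. (u, v) \<in> S \<Longrightarrow> x \<notin> {u..<v} \<Longrightarrow> b (u, v) x = 0"
    "(\<Sum>I\<in>S. LINT x|torus_measure. cmod (b I x)) \<le> 2 * (LINT x|torus_measure. cmod (f x))"
    "\<And>x. x \<in> torus \<Longrightarrow> cmod (f x - (\<Sum>I\<in>S. b I x)) \<le> 2 * h"
proof -
  define w where "w x = cmod (f x)" for x
  have w: "continuous_on UNIV w" "\<And>x. 0 \<le> w x"
    unfolding w_def using f by (auto intro!: continuous_intros)
  have [measurable]: "f \<in> borel_measurable borel" using f by (rule borel_measurable_continuous_onI)
  have fint: "integrable torus_measure f" by (rule integrable_torus_continuous[OF f])
  obtain d where d: "\<forall>x\<in>{0..2 * pi}. \<forall>y\<in>{0..2 * pi}. \<bar>x - y\<bar> \<le> (2 * pi - 0) / 2 ^ d \<longrightarrow> \<bar>w x - w y\<bar> < h"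
    using exists_dyadic_modulus[OF w(1) h] by blast
  have "int_on w 0 (2 * pi) \<le> h * ((2 * pi - 0) / (2 * pi))"
    using le by (simp add: int_on_torus[OF w(1)]) (simp add: w_def)
  moreover have "\<bar>w x - w y\<bar> < h" if "x \<in> {0..2 * pi}" "y \<in> {0..2 * pi}" "\<bar>x - y\<bar> \<le> (2 * pi - 0) / 2 ^ d" for x y
    using d that by blast
  moreover have "0 < 2 * pi" by simp
  ultimately have "\<exists>S. finite S \<and> disjoint_family_on (\<lambda>(a, b). {a..<b}) S \<and>
      (\<forall>(u, v)\<in>S. 0 \<le> u \<and> u < v \<and> v \<le> 2 * pi \<and> h * ((v - u) / (2 * pi)) \<le> int_on w u v \<and>
        int_on w u v \<le> 2 * h * ((v - u) / (2 * pi))) \<and>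
      (\<forall>x\<in>torus - (\<Union>(a, b)\<in>S. {a..<b}). w x \<le> 2 * h)"
    by (intro calderon_zygmund_intervals[OF w h order_refl _ order_refl])
  then
  obtain S where S: "finite S" "disjoint_family_on (\<lambda>(a, b). {a..<b}) S"
    and S0: "\<forall>(u, v)\<in>S. 0 \<le> u \<and> u < v \<and> v \<le> 2 * pi \<and> h * ((v - u) / (2 * pi)) \<le> int_on w u v \<and>
        int_on w u v \<le> 2 * h * ((v - u) / (2 * pi))"
    and S1: "\<forall>x\<in>torus - (\<Union>(a, b)\<in>S. {a..<b}). w x \<le> 2 * h"
    by (elim exE conjE) (rule that)
  have S': "0 \<le> u \<and> u < v \<and> v \<le> 2 * pi \<and> h * ((v - u) / (2 * pi)) \<le> int_on w u v \<and>
        int_on w u v \<le> 2 * h * ((v - u) / (2 * pi))" if "(u, v) \<in> S" for u v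
    using S0 that by fast
  have off: "w x \<le> 2 * h" if "x \<in> torus" "x \<notin> (\<Union>(a, b)\<in>S. {a..<b})" for x
    using S1 that by blast
  define ind :: "real \<times> real \<Rightarrow> real \<Rightarrow> real" where "ind I x = indicator {fst I..<snd I} x" for I :: "real \<times> real" and x :: real
  \<comment> \<open>The mean of \<open>f\<close> over the interval; subtracting it gives
    \<open>b I\<close> mean zero.\<close>
  define c where "c I = (LINT x|torus_measure. complex_of_real (ind I x) * f x) / of_real ((snd I - fst I) / (2 * pi))" for I
  define b where "b I x = complex_of_real (ind I x) * (f x - c I)" for I x
  have [measurable]: "ind I \<in> borel_measurable borel" for I unfolding ind_def by measurable
  have [measurable]: "b I \<in> borel_measurable borel" for I unfolding b_def by measurable
  have find: "integrable torus_measure (\<lambda>x. complex_of_real (ind I x) * f x)" for I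
    by (rule Bochner_Integration.integrable_bound[OF fint]) (auto simp: ind_def indicator_def)
  have iind: "integrable torus_measure (ind I)" for I
    by (rule integrable_torus_bounded[where B = 1]) (auto simp: ind_def indicator_def)
  have wind: "integrable torus_measure (\<lambda>x. ind I x * w x)" for I
    unfolding ind_def by (rule int_on_integrable[OF w(1)])
  have indw: "(LINT x|torus_measure. ind (u, v) x * w x) = int_on w u v" for u v
    by (simp add: ind_def)
  have len: "(LINT x|torus_measure. ind (u, v) x) = (v - u) / (2 * pi)" if "(u, v) \<in> S" for u v
    using S'[OF that] measure_torus_interval[of u v] by (simp add: ind_def)
  have pos: "0 < (snd I - fst I) / (2 * pi)" if "I \<in> S" for I
    using S'[of "fst I" "snd I"] that by simp
  have aux1: "cmod (z / of_real L) * L = cmod z" if "0 < L" for z L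
    using that by (simp add: norm_divide)
  have aux2: "of_real L * (z / of_real L) = z" if "0 < L" for z :: complex and L
    using that by simp
  have c: "cmod (c I) * ((snd I - fst I) / (2 * pi)) \<le> (LINT x|torus_measure. ind I x * w x)" if I: "I \<in> S" for I
  proof -
    have "cmod (c I) * ((snd I - fst I) / (2 * pi)) = cmod (LINT x|torus_measure. complex_of_real (ind I x) * f x)"
      unfolding c_def by (rule aux1[OF pos[OF I]])
    also have "\<dots> \<le> (LINT x|torus_measure. cmod (complex_of_real (ind I x) * f x))"
      by (rule integral_norm_bound)
    also have "\<dots> = (LINT x|torus_measure. ind I x * w x)"
      by (simp add: norm_mult w_def ind_def)
    finally show ?thesis .
  qed
  \<comment> \<open>By disjointness at most one indicator is nonzero at each point, so the intervals
    together do not count any mass twice.\<close>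
  have sumJ: "(\<Sum>I\<in>S. LINT x|torus_measure. ind I x * w x) \<le> (LINT x|torus_measure. w x)"
  proof -
    have "(\<Sum>I\<in>S. LINT x|torus_measure. ind I x * w x) = (LINT x|torus_measure. (\<Sum>I\<in>S. ind I x * w x))"
      using wind by (subst Bochner_Integration.integral_sum) auto
    also have "\<dots> \<le> (LINT x|torus_measure. w x)"
    proof (rule integral_mono)
      fix x
      have "(\<Sum>I\<in>S. ind I x) \<le> 1"
      proof (cases "\<exists>I\<in>S. ind I x \<noteq> 0")
        case True
        then obtain I where I: "I \<in> S" "ind I x \<noteq> 0" by blast
        have "ind I' x = 0" if "I' \<in> S - {I}" for I'
        proof (rule ccontr)
          assume "ind I' x \<noteq> 0"
          then have "x \<in> {fst I..<snd I} \<inter> {fst I'..<snd I'}"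
            using I by (auto simp: ind_def indicator_def split: if_splits)
          moreover have "{fst I..<snd I} \<inter> {fst I'..<snd I'} = {}"
            using S(2) I(1) that by (auto simp: disjoint_family_on_def split_beta)
          ultimately show False by simp
        qed
        then have "(\<Sum>I\<in>S. ind I x) = ind I x + 0"
          using I S by (subst sum.remove[of _ I]) auto
        then show ?thesis by (simp add: ind_def indicator_def)
      qed simp
      then show "(\<Sum>I\<in>S. ind I x * w x) \<le> w x"
        using mult_right_mono[of "\<Sum>I\<in>S. ind I x" 1 "w x"] w(2) by (simp add: sum_distrib_right)
    qed (use wind integrable_torus_continuous_real[OF w(1)] in auto)
    finally show ?thesis .
  qed
  show ?thesis
  proof (rule that[of S b])
    show "finite S" by fact
    show "0 \<le> u \<and> u < v \<and> v \<le> 2 * pi" if "(u, v) \<in> S" for u v using S'[OF that] by simp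
    have "h * (\<Sum>(u, v)\<in>S. (v - u) / (2 * pi)) \<le> (\<Sum>I\<in>S. LINT x|torus_measure. ind I x * w x)"
      unfolding sum_distrib_left using S' by (intro sum_mono) (auto simp: ind_def split: prod.split)
    then have "h * (\<Sum>(u, v)\<in>S. (v - u) / (2 * pi)) \<le> (LINT x|torus_measure. w x)"
      using sumJ by linarith
    then show "(\<Sum>(u, v)\<in>S. (v - u) / (2 * pi)) \<le> (LINT x|torus_measure. cmod (f x)) / h"
      using h by (simp add: w_def field_simps)
    have bint: "integrable torus_measure (b I)" for I
      unfolding b_def right_diff_distrib using find iind[of I]
      by (intro Bochner_Integration.integrable_diff integrable_mult_left integrable_of_real) auto
    then show "b I \<in> borel_measurable borel \<and> integrable torus_measure (b I)" for I by simp
    show "(LINT x|torus_measure. b I x) = 0" if I: "I \<in> S" for I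
    proof -
      obtain u v where uv: "I = (u, v)" by (cases I)
      have "(LINT x|torus_measure. b I x) = (LINT x|torus_measure. complex_of_real (ind I x) * f x) -
          (LINT x|torus_measure. complex_of_real (ind I x) * c I)"
        unfolding b_def right_diff_distrib using find iind[of I]
        by (intro Bochner_Integration.integral_diff integrable_mult_left integrable_of_real) auto
      also have "(LINT x|torus_measure. complex_of_real (ind I x) * c I) = of_real ((v - u) / (2 * pi)) * c I"
        using len[of u v] I uv by simp
      also have "\<dots> = (LINT x|torus_measure. complex_of_real (ind I x) * f x)"
        using aux2[OF pos[OF I]] uv by (simp only: c_def fst_conv snd_conv)
      finally show ?thesis by simp
    qed
    show "b (u, v) x = 0" if "(u, v) \<in> S" "x \<notin> {u..<v}" for u v x
      using that by (simp add: b_def ind_def)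
    have "(\<Sum>I\<in>S. LINT x|torus_measure. cmod (b I x)) \<le> (\<Sum>I\<in>S. 2 * (LINT x|torus_measure. ind I x * w x))"
    proof (rule sum_mono)
      fix I assume I: "I \<in> S"
      obtain u v where uv: "I = (u, v)" by (cases I)
      have "(LINT x|torus_measure. cmod (b I x)) \<le> (LINT x|torus_measure. ind I x * w x + ind I x * cmod (c I))"
      proof (rule integral_mono)
        show "cmod (b I x) \<le> ind I x * w x + ind I x * cmod (c I)" for x
          using norm_triangle_ineq4[of "f x" "c I"] by (simp add: b_def ind_def indicator_def w_def)
      qed (use bint wind iind[of I] in auto)
      also have "\<dots> = (LINT x|torus_measure. ind I x * w x) + (v - u) / (2 * pi) * cmod (c I)"
        using wind iind[of I] len[of u v] I uv by simp
      also have "\<dots> \<le> 2 * (LINT x|torus_measure. ind I x * w x)"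
        using c[OF I] uv by (simp add: mult.commute)
      finally show "(LINT x|torus_measure. cmod (b I x)) \<le> 2 * (LINT x|torus_measure. ind I x * w x)" .
    qed
    also have "\<dots> \<le> 2 * (LINT x|torus_measure. cmod (f x))"
      using sumJ by (simp add: w_def flip: sum_distrib_left)
    finally show "(\<Sum>I\<in>S. LINT x|torus_measure. cmod (b I x)) \<le> 2 * (LINT x|torus_measure. cmod (f x))" .
    show "cmod (f x - (\<Sum>I\<in>S. b I x)) \<le> 2 * h" if x: "x \<in> torus" for x
    proof (cases "x \<in> (\<Union>(a, b)\<in>S. {a..<b})")
      case False
      then have "b I x = 0" if "I \<in> S" for I
        using that by (auto simp: b_def ind_def indicator_def)
      then show ?thesis using off[OF x False] by (simp add: w_def)
    next
      case True
      then obtain u v where uv: "(u, v) \<in> S" "x \<in> {u..<v}" by auto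
      have "b I x = 0" if "I \<in> S - {(u, v)}" for I
      proof -
        have "{fst I..<snd I} \<inter> {u..<v} = {}"
          using S(2) uv(1) that by (auto simp: disjoint_family_on_def split_beta)
        then show ?thesis using uv(2) by (auto simp: b_def ind_def indicator_def)
      qed
      then have "(\<Sum>I\<in>S. b I x) = b (u, v) x + 0"
        using uv S by (subst sum.remove[of _ "(u, v)"]) auto
      then have eq: "f x - (\<Sum>I\<in>S. b I x) = c (u, v)"
        using uv(2) by (simp add: b_def ind_def)
      have "cmod (c (u, v)) * ((v - u) / (2 * pi)) \<le> 2 * h * ((v - u) / (2 * pi))"
        using c[OF uv(1)] S'[OF uv(1)] indw[of u v] by simp
      moreover have "0 < (v - u) / (2 * pi)" using pos[OF uv(1)] by simp
      ultimately have "cmod (c (u, v)) \<le> 2 * h" by (meson mult_le_cancel_right_pos)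
      then show ?thesis unfolding eq .
    qed
  qed
qed

text \<open>At height \<open>h\<close> the good part contributes
  \<open>\<epsilon>\<^sup>2 * h * N / \<tau>\<^sup>2\<close>, up to a numerical factor, and the
  enlarged intervals have measure of order \<open>N / h\<close>, with \<open>N\<close> the L^1 norm.
  The choice \<open>h = \<tau> / \<epsilon>\<close> makes both equal to
  \<open>\<epsilon> * N / \<tau>\<close>, so the constant is linear in
  \<open>\<epsilon> + A\<close>; 8000 covers the \<open>12 * \<epsilon> + 7680 * A\<close> found
  below.\<close>

lemma mult_op_weak_type:
  assumes a: "mikhlin A a" and \<epsilon>: "\<And>k. cmod (a k) \<le> \<epsilon>" "0 < \<epsilon>" and r: "0 \<le> r" "r < 1" and s: "s \<in> {1, -1}"
    and f: "continuous_on UNIV f" and \<tau>: "0 < \<tau>"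
  shows "measure torus_measure {x. 2 * \<tau> < cmod (mult_op a s r f x)} \<le>
    8000 * (\<epsilon> + A) / \<tau> * (LINT x|torus_measure. cmod (f x))"
proof -
  define N where "N = (LINT x|torus_measure. cmod (f x))"
  define h where "h = \<tau> / \<epsilon>"
  define T where "T = mult_op a s r"
  have A: "0 \<le> A" using mikhlin_nonneg[OF a] .
  have N: "0 \<le> N" by (simp add: N_def)
  have h: "0 < h" using \<tau> \<epsilon> by (simp add: h_def)
  have fint: "integrable torus_measure f" by (rule integrable_torus_continuous[OF f])
  have [measurable]: "f \<in> borel_measurable borel" using f by (rule borel_measurable_continuous_onI)
  show ?thesis
  proof (cases "N \<le> h")
    case False
    \<comment> \<open>If the mean exceeds \<open>h\<close>, no decomposition at that height is
      possible, but then the claimed bound is at least 1, the total mass.\<close>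
    then have "1 \<le> \<epsilon> / \<tau> * N" using \<tau> \<epsilon> by (simp add: h_def field_simps)
    also have "\<dots> \<le> 8000 * (\<epsilon> + A) / \<tau> * N"
      using \<tau> \<epsilon> A N by (intro mult_right_mono divide_right_mono) auto
    finally have "1 \<le> 8000 * (\<epsilon> + A) / \<tau> * N" .
    moreover have "measure torus_measure {x. 2 * \<tau> < cmod (mult_op a s r f x)} \<le> 1"
      using torus.bounded_measure by simp
    ultimately show ?thesis by (simp add: N_def)
  next
    case True
    obtain S b where S: "finite S" and S': "\<And>u v. (u, v) \<in> S \<Longrightarrow> 0 \<le> u \<and> u < v \<and> v \<le> 2 * pi"
      and len: "(\<Sum>(u, v)\<in>S. (v - u) / (2 * pi)) \<le> N / h"
      and bint: "\<And>I. I \<in> S \<Longrightarrow> b I \<in> borel_measurable borel \<and> integrable torus_measure (b I)"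
      and b0: "\<And>I. I \<in> S \<Longrightarrow> (LINT x|torus_measure. b I x) = 0"
      and boff: "\<And>u v x. (u, v) \<in> S \<Longrightarrow> x \<notin> {u..<v} \<Longrightarrow> b (u, v) x = 0"
      and bsum: "(\<Sum>I\<in>S. LINT x|torus_measure. cmod (b I x)) \<le> 2 * N"
      and gh: "\<And>x. x \<in> torus \<Longrightarrow> cmod (f x - (\<Sum>I\<in>S. b I x)) \<le> 2 * h"
      by (rule calderon_zygmund_decomposition[OF f h True[unfolded N_def], folded N_def], rule that) assumption+
    have bm: "b I \<in> borel_measurable borel" if "I \<in> S" for I using bint[OF that] by blast
    have bi: "integrable torus_measure (b I)" if "I \<in> S" for I using bint[OF that] by blast
    define g where "g = (\<lambda>x. f x - (\<Sum>I\<in>S. b I x))"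
    have [measurable]: "g \<in> borel_measurable borel" unfolding g_def by (intro borel_measurable_diff borel_measurable_sum bm) simp_all
    have gint: "integrable torus_measure g"
      unfolding g_def by (intro Bochner_Integration.integrable_diff Bochner_Integration.integrable_sum fint bi)
    have ghg: "cmod (g x) \<le> 2 * h" if "x \<in> torus" for x
      using gh[OF that] by (simp add: g_def)
    have g2: "p_integrable 2 g"
      by (rule p_integrable_bounded[where B = "2 * h"]) (simp_all add: ghg)
    have g1: "(LINT x|torus_measure. cmod (g x)) \<le> 3 * N"
    proof -
      have "(LINT x|torus_measure. cmod (g x)) \<le> (LINT x|torus_measure. cmod (f x) + (\<Sum>I\<in>S. cmod (b I x)))"
      proof (rule integral_mono)
        show "cmod (g x) \<le> cmod (f x) + (\<Sum>I\<in>S. cmod (b I x))" for x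
          unfolding g_def using norm_triangle_ineq4[of "f x" "\<Sum>I\<in>S. b I x"] norm_sum[of "\<lambda>I. b I x" S] by linarith
      qed (intro integrable_norm gint Bochner_Integration.integrable_add fint Bochner_Integration.integrable_sum bi; assumption)+
      also have "\<dots> = N + (\<Sum>I\<in>S. LINT x|torus_measure. cmod (b I x))"
        using fint bi by (subst Bochner_Integration.integral_add) (auto simp: N_def Bochner_Integration.integral_sum)
      finally show ?thesis using bsum by linarith
    qed
    \<comment> \<open>The interval doubled about its centre, together with the two neighbouring
      translates by a period.\<close>
    define E where "E I = (\<Union>j\<in>{-1, 0, 1::int}. {(fst I + snd I) / 2 + 2 * pi * of_int j - (snd I - fst I)
        ..(fst I + snd I) / 2 + 2 * pi * of_int j + (snd I - fst I)})" for I :: "real \<times> real"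
    have [measurable]: "E I \<in> sets borel" for I unfolding E_def by measurable
    define U where "U x = (\<Sum>I\<in>S. indicator (- E I) x * cmod (T (b I) x))" for x
    have Tm [measurable]: "T k \<in> borel_measurable borel" if "integrable torus_measure k" for k
      unfolding T_def by (rule mult_op_measurable[OF \<epsilon>(1) r that])
    have [measurable]: "T f \<in> borel_measurable borel" "T g \<in> borel_measurable borel"
      using fint gint by (auto intro: Tm)
    have Tbm: "T (b I) \<in> borel_measurable borel" if "I \<in> S" for I by (rule Tm[OF bi[OF that]])
    have "(\<lambda>x. indicator (- E I) x * cmod (T (b I) x)) \<in> borel_measurable borel" if "I \<in> S" for I
      using Tbm[OF that] by measurable
    then have [measurable]: "U \<in> borel_measurable borel"
      unfolding U_def by (rule borel_measurable_sum)
    have Tf: "T f x = T g x + (\<Sum>I\<in>S. T (b I) x)" for x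
    proof -
      have "T (\<lambda>x. g x + (\<Sum>I\<in>S. b I x)) x = T g x + T (\<lambda>x. \<Sum>I\<in>S. b I x) x"
        unfolding T_def by (intro mult_op_add[OF \<epsilon>(1) r gint] Bochner_Integration.integrable_sum bi)
      also have "T (\<lambda>x. \<Sum>I\<in>S. b I x) x = (\<Sum>I\<in>S. T (b I) x)"
        unfolding T_def by (intro mult_op_sum[OF \<epsilon>(1) r] bi)
      finally show ?thesis by (simp add: g_def)
    qed
    let ?G = "{x. \<tau>\<^sup>2 \<le> (cmod (T g x))\<^sup>2}" and ?W = "{x. \<tau> \<le> U x}"
    have "{x \<in> space borel. \<tau>\<^sup>2 \<le> (cmod (T g x))\<^sup>2} \<in> sets borel" "{x \<in> space borel. \<tau> \<le> U x} \<in> sets borel"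
      by measurable
    then have sets [simp]: "?G \<in> sets borel" "?W \<in> sets borel" by simp_all
    have Es [simp]: "(\<Union>I\<in>S. E I) \<in> sets borel" using S by (intro sets.finite_UN) auto
    have sub: "{x. 2 * \<tau> < cmod (T f x)} \<subseteq> ?G \<union> (\<Union>I\<in>S. E I) \<union> ?W"
    proof
      fix x assume x: "x \<in> {x. 2 * \<tau> < cmod (T f x)}"
      show "x \<in> ?G \<union> (\<Union>I\<in>S. E I) \<union> ?W"
      proof (rule ccontr)
        assume "x \<notin> ?G \<union> (\<Union>I\<in>S. E I) \<union> ?W"
        then have n: "(cmod (T g x))\<^sup>2 < \<tau>\<^sup>2" "U x < \<tau>" "\<And>I. I \<in> S \<Longrightarrow> x \<notin> E I" by auto
        have "cmod (T g x) < \<tau>" using n(1) \<tau> by (simp add: power_less_imp_less_base)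
        moreover have "U x = (\<Sum>I\<in>S. cmod (T (b I) x))"
          unfolding U_def using n(3) by (intro sum.cong) auto
        ultimately have "cmod (T f x) < 2 * \<tau>"
          using Tf[of x] norm_triangle_ineq[of "T g x" "\<Sum>I\<in>S. T (b I) x"] norm_sum[of "\<lambda>I. T (b I) x" S] n(2)
          by simp
        with x show False by simp
      qed
    qed
    have "measure torus_measure {x. 2 * \<tau> < cmod (T f x)} \<le> measure torus_measure (?G \<union> (\<Union>I\<in>S. E I) \<union> ?W)"
      by (rule torus.finite_measure_mono[OF sub]) (simp only: sets_torus_measure sets.Un sets Es)
    also have "\<dots> \<le> measure torus_measure ?G + measure torus_measure (\<Union>I\<in>S. E I) + measure torus_measure ?W"
      by (intro order_trans[OF measure_Un_le] add_right_mono measure_Un_le)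
        (simp_all only: sets_torus_measure sets.Un sets Es)
    \<comment> \<open>Chebyshev on L^2: the good part is bounded by \<open>2 * h\<close> and has L^1
      norm at most \<open>3 * N\<close>, so the integral of its square is at most
      \<open>6 * h * N\<close>.\<close>
    also have "measure torus_measure ?G \<le> 6 * \<epsilon> / \<tau> * N"
    proof -
      have "measure torus_measure {x\<in>space torus_measure. \<tau>\<^sup>2 \<le> (cmod (T g x))\<^sup>2} \<le> (LINT x|torus_measure. (cmod (T g x))\<^sup>2) / \<tau>\<^sup>2"
      proof (rule integral_Markov_inequality_measure)
        show "integrable torus_measure (\<lambda>x. (cmod (T g x))\<^sup>2)"
          using mult_op_p_integrable[where a = a and s = s and p = 2, OF \<epsilon>(1) r gint] by (simp add: T_def p_integrable_def)
      qed (use \<tau> in auto)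
      also have "\<dots> \<le> \<epsilon>\<^sup>2 * (LINT x|torus_measure. (cmod (g x))\<^sup>2) / \<tau>\<^sup>2"
        unfolding T_def by (intro divide_right_mono mult_op_L2[OF \<epsilon>(1) r g2 s]) auto
      also have "(LINT x|torus_measure. (cmod (g x))\<^sup>2) \<le> (LINT x|torus_measure. 2 * h * cmod (g x))"
      proof (rule integral_mono_AE)
        show "integrable torus_measure (\<lambda>x. (cmod (g x))\<^sup>2)" using g2 by (simp add: p_integrable_def)
        show "AE x in torus_measure. (cmod (g x))\<^sup>2 \<le> 2 * h * cmod (g x)"
          using AE_torus by eventually_elim (auto simp: power2_eq_square intro!: mult_right_mono ghg)
      qed (use gint in auto)
      also have "\<dots> = 2 * h * (LINT x|torus_measure. cmod (g x))" by simp
      also have "\<dots> \<le> 2 * h * (3 * N)" using g1 h by (intro mult_left_mono) auto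
      finally have "measure torus_measure ?G \<le> \<epsilon>\<^sup>2 * (2 * h * (3 * N)) / \<tau>\<^sup>2"
        by (simp add: mult_left_mono divide_right_mono)
      also have "\<dots> = 6 * \<epsilon> / \<tau> * N" using \<epsilon> \<tau> by (simp add: h_def field_simps power2_eq_square)
      finally show ?thesis .
    qed
    also have "measure torus_measure (\<Union>I\<in>S. E I) \<le> 6 * \<epsilon> / \<tau> * N"
    proof -
      have "measure torus_measure (\<Union>I\<in>S. E I) \<le> (\<Sum>I\<in>S. measure torus_measure (E I))"
        by (rule torus.finite_measure_subadditive_finite[OF S]) auto
      also have "\<dots> \<le> (\<Sum>(u, v)\<in>S. 6 * ((v - u) / (2 * pi)))"
      proof (rule sum_mono, clarify)
        fix u v assume uv: "(u, v) \<in> S"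
        define B where "B j = {(u + v) / 2 + 2 * pi * of_int j - (v - u)..(u + v) / 2 + 2 * pi * of_int j + (v - u)}" for j :: int
        have "measure torus_measure (E (u, v)) \<le> (\<Sum>j\<in>{-1, 0, 1::int}. measure torus_measure (B j))"
          unfolding E_def fst_conv snd_conv B_def by (rule torus.finite_measure_subadditive_finite) auto
        also have "\<dots> \<le> (\<Sum>j\<in>{-1, 0, 1::int}. (2 * (v - u)) / (2 * pi))"
        proof (rule sum_mono)
          fix j
          show "measure torus_measure (B j) \<le> (2 * (v - u)) / (2 * pi)"
            unfolding B_def using S'[OF uv] by (intro order_trans[OF measure_torus_le]) (auto simp: field_simps)
        qed
        also have "\<dots> = 6 * ((v - u) / (2 * pi))" by simp
        finally show "measure torus_measure (E (u, v)) \<le> 6 * ((v - u) / (2 * pi))" .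
      qed
      also have "\<dots> = 6 * (\<Sum>(u, v)\<in>S. (v - u) / (2 * pi))" by (simp add: sum_distrib_left split_beta)
      also have "\<dots> \<le> 6 * (N / h)" using len by simp
      finally show ?thesis by (simp add: h_def mult_ac)
    qed
    \<comment> \<open>Chebyshev on L^1, applied to the bad parts off their enlarged
      intervals.\<close>
    also have "measure torus_measure ?W \<le> 7680 * A / \<tau> * N"
    proof -
      have I1: "(LINT x|torus_measure. indicator (- E I) x * cmod (T (b I) x)) \<le> 3840 * A * (LINT y|torus_measure. cmod (b I y))"
        if I: "I \<in> S" for I
      proof -
        obtain u v where uv: "I = (u, v)" by (cases I)
        show ?thesis unfolding T_def
          by (rule mult_op_bad_part_integral[OF a r s, of u v])
            (use S'[of u v] bint[OF I] b0[OF I] boff[of u v] I uv in \<open>auto simp: E_def\<close>)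
      qed
      have I2: "integrable torus_measure (\<lambda>x. indicator (- E I) x * cmod (T (b I) x))" if "I \<in> S" for I
        using mult_op_bound[where a = a and s = s and f = "b I", OF \<epsilon>(1) r] bint[OF that] Tbm[OF that] \<epsilon> r unfolding T_def
        by (intro integrable_torus_bounded[where B = "\<epsilon> / (1 - r) * (LINT y|torus_measure. cmod (b I y))"])
          (auto simp: indicator_def)
      have "measure torus_measure {x\<in>space torus_measure. \<tau> \<le> U x} \<le> (LINT x|torus_measure. U x) / \<tau>"
      proof (rule integral_Markov_inequality_measure)
        show "integrable torus_measure U" unfolding U_def using I2 by auto
      qed (use \<tau> in \<open>auto simp: U_def intro!: sum_nonneg AE_I2\<close>)
      also have "(LINT x|torus_measure. U x) = (\<Sum>I\<in>S. LINT x|torus_measure. indicator (- E I) x * cmod (T (b I) x))"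
        unfolding U_def using I2 by (rule Bochner_Integration.integral_sum)
      also have "\<dots> \<le> (\<Sum>I\<in>S. 3840 * A * (LINT y|torus_measure. cmod (b I y)))"
        by (intro sum_mono I1)
      also have "\<dots> \<le> 3840 * A * (2 * N)"
        unfolding sum_distrib_left[symmetric] using bsum A by (intro mult_left_mono) auto
      finally have "measure torus_measure ?W \<le> 3840 * A * (2 * N) / \<tau>"
        using \<tau> by (simp add: divide_right_mono)
      then show ?thesis by (simp add: mult_ac)
    qed
    finally have "measure torus_measure {x. 2 * \<tau> < cmod (T f x)} \<le> (12 * \<epsilon> + 7680 * A) / \<tau> * N"
      using \<tau> by (simp add: field_simps)
    also have "\<dots> \<le> 8000 * (\<epsilon> + A) / \<tau> * N"
      using \<tau> \<epsilon> A N by (intro mult_right_mono divide_right_mono) auto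
    finally show ?thesis by (simp add: T_def N_def)
  qed
qed

section \<open>Interpolation and duality\<close>

lemma nn_integral_powr_below:
  assumes "-1 < q" "0 \<le> t"
  shows "(\<integral>\<^sup>+\<tau>. ennreal (\<tau> powr q) * indicator {0..t} \<tau> \<partial>lborel) = ennreal (t powr (q + 1) / (q + 1))"
  by (rule nn_integral_has_integral_lebesgue'[OF _ has_integral_powr_from_0]) (use assms in auto)

lemma nn_integral_powr_above:
  assumes "q < -1" "0 < t"
  shows "(\<integral>\<^sup>+\<tau>. ennreal (\<tau> powr q) * indicator {t..} \<tau> \<partial>lborel) = ennreal (t powr (q + 1) / (- (q + 1)))"
proof -
  have "(\<integral>\<^sup>+\<tau>. ennreal (\<tau> powr q) * indicator {t..} \<tau> \<partial>lborel) = ennreal (0 - t powr (q + 1) / (q + 1))"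
  proof (rule nn_integral_FTC_atLeast)
    show "((\<lambda>x. x powr (q + 1) / (q + 1)) \<longlongrightarrow> 0) at_top"
      using tendsto_divide[OF tendsto_neg_powr[OF _ filterlim_ident, of "q + 1"] tendsto_const[of "q + 1"]] assms by simp
    show "DERIV (\<lambda>x. x powr (q + 1) / (q + 1)) x :> x powr q" if "t \<le> x" for x
      using that assms by (auto intro!: derivative_eq_intros)
  qed (use assms in auto)
  then show ?thesis by (simp only: diff_0 minus_divide_right)
qed

text \<open>With \<open>t = F x\<close> and Tonelli's theorem, this expresses a p-th moment through
  the measures of the sets where \<open>F\<close> exceeds \<open>\<tau>\<close>.\<close>

lemma nn_integral_layer_cake:
  assumes p: "0 < p" and t: "0 \<le> (t::real)"
  shows "(\<integral>\<^sup>+\<tau>. ennreal (p * \<tau> powr (p - 1)) * indicator {0<..<t} \<tau> \<partial>lborel) = ennreal (t powr p)"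
proof -
  have ae: "AE \<tau> in lborel. \<tau> \<noteq> 0 \<and> \<tau> \<noteq> t"
    using AE_lborel_singleton[of 0] AE_lborel_singleton[of t] by eventually_elim simp
  have "(\<integral>\<^sup>+\<tau>. ennreal (p * \<tau> powr (p - 1)) * indicator {0<..<t} \<tau> \<partial>lborel) =
      (\<integral>\<^sup>+\<tau>. ennreal p * (ennreal (\<tau> powr (p - 1)) * indicator {0..t} \<tau>) \<partial>lborel)"
  proof (rule nn_integral_cong_AE)
    show "AE \<tau> in lborel. ennreal (p * \<tau> powr (p - 1)) * indicator {0<..<t} \<tau> = ennreal p * (ennreal (\<tau> powr (p - 1)) * indicator {0..t} \<tau>)"
      using ae by eventually_elim (use p in \<open>auto simp: indicator_def ennreal_mult\<close>)
  qed
  also have "\<dots> = ennreal p * ennreal (t powr p / p)"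
    using p t by (subst nn_integral_cmult) (auto simp: nn_integral_powr_below)
  also have "\<dots> = ennreal (t powr p)"
    using p by (simp flip: ennreal_mult)
  finally show ?thesis .
qed

text \<open>The integrand lives on \<open>\<tau> \<le> t\<close>, where
  \<open>t - \<tau> \<le> t\<close>, and \<open>\<tau> powr (p - 2)\<close> is integrable at 0
  because \<open>p > 1\<close>.\<close>

lemma nn_integral_truncation_big:
  assumes p: "1 < p" and t: "0 \<le> (t::real)"
  shows "(\<integral>\<^sup>+\<tau>. ennreal (\<tau> powr (p - 2) * max 0 (t - \<tau>)) * indicator {0<..} \<tau> \<partial>lborel) \<le> ennreal (t powr p / (p - 1))"
proof -
  have "(\<integral>\<^sup>+\<tau>. ennreal (\<tau> powr (p - 2) * max 0 (t - \<tau>)) * indicator {0<..} \<tau> \<partial>lborel) \<le>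
      (\<integral>\<^sup>+\<tau>. ennreal t * (ennreal (\<tau> powr (p - 2)) * indicator {0..t} \<tau>) \<partial>lborel)"
    using t by (intro nn_integral_mono)
      (auto simp: indicator_def max_def mult.commute[of _ "t"] intro!: ennreal_leI mult_right_mono simp flip: ennreal_mult)
  also have "\<dots> = ennreal t * ennreal (t powr (p - 2 + 1) / (p - 2 + 1))"
    using p t by (subst nn_integral_cmult) (auto simp: nn_integral_powr_below)
  also have "\<dots> = ennreal (t powr p / (p - 1))"
    using p t powr_mult_base[of t "p - 1"] by (simp flip: ennreal_mult add: algebra_simps)
  finally show ?thesis .
qed

text \<open>Below \<open>t\<close> the integrand is \<open>\<tau> powr (p - 1)\<close>; above
  \<open>t\<close> it is \<open>t\<^sup>2 * \<tau> powr (p - 3)\<close>, integrable at infinity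
  because \<open>p < 2\<close>.\<close>

lemma nn_integral_truncation_small:
  assumes p: "1 < p" "p < 2" and t: "0 \<le> (t::real)"
  shows "(\<integral>\<^sup>+\<tau>. ennreal (\<tau> powr (p - 3) * (min t \<tau>)\<^sup>2) * indicator {0<..} \<tau> \<partial>lborel) \<le> ennreal (t powr p / p + t powr p / (2 - p))"
proof (cases "t = 0")
  case True
  have "(\<integral>\<^sup>+\<tau>. ennreal (\<tau> powr (p - 3) * (min t \<tau>)\<^sup>2) * indicator {0<..} \<tau> \<partial>lborel) = (\<integral>\<^sup>+\<tau>. 0 \<partial>(lborel :: real measure))"
    using True by (intro nn_integral_cong) (auto simp: indicator_def min_def)
  then show ?thesis by simp
next
  case False
  with t have t: "0 < t" by simp
  have sq: "\<tau> powr (p - 3) * \<tau>\<^sup>2 = \<tau> powr (p - 1)" if "0 < \<tau>" for \<tau> :: real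
  proof -
    have "\<tau> powr (p - 3) * \<tau>\<^sup>2 = \<tau> powr (p - 3) * \<tau> powr 2" using that by simp
    also have "\<dots> = \<tau> powr (p - 1)" by (subst powr_add[symmetric]) simp
    finally show ?thesis .
  qed
  have "(\<integral>\<^sup>+\<tau>. ennreal (\<tau> powr (p - 3) * (min t \<tau>)\<^sup>2) * indicator {0<..} \<tau> \<partial>lborel) \<le>
      (\<integral>\<^sup>+\<tau>. ennreal (\<tau> powr (p - 1)) * indicator {0..t} \<tau> + ennreal (t\<^sup>2) * (ennreal (\<tau> powr (p - 3)) * indicator {t..} \<tau>) \<partial>lborel)"
  proof (rule nn_integral_mono)
    fix \<tau> :: real
    show "ennreal (\<tau> powr (p - 3) * (min t \<tau>)\<^sup>2) * indicator {0<..} \<tau> \<le>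
        ennreal (\<tau> powr (p - 1)) * indicator {0..t} \<tau> + ennreal (t\<^sup>2) * (ennreal (\<tau> powr (p - 3)) * indicator {t..} \<tau>)"
    proof (cases "0 < \<tau>")
      case True
      then show ?thesis
        using t sq[OF True] by (cases "\<tau> \<le> t") (auto simp: indicator_def min_def mult.commute simp flip: ennreal_mult)
    qed (simp add: indicator_def)
  qed
  also have "\<dots> = ennreal (t powr p / p) + ennreal (t\<^sup>2) * ennreal (t powr (p - 3 + 1) / (- (p - 3 + 1)))"
    using p t by (subst nn_integral_add) (auto simp: nn_integral_cmult nn_integral_powr_below nn_integral_powr_above)
  also have "ennreal (t\<^sup>2) * ennreal (t powr (p - 3 + 1) / (- (p - 3 + 1))) = ennreal (t powr p / (2 - p))"
  proof -
    have "t\<^sup>2 * t powr (p - 3 + 1) = t powr 2 * t powr (p - 2)" using t by simp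
    also have "\<dots> = t powr p" by (subst powr_add[symmetric]) simp
    finally show ?thesis using p t by (simp flip: ennreal_mult)
  qed
  also have "ennreal (t powr p / p) + ennreal (t powr p / (2 - p)) = ennreal (t powr p / p + t powr p / (2 - p))"
    using p by (simp flip: ennreal_plus)
  finally show ?thesis .
qed

text \<open>The hypothesis \<open>weak\<close> is what truncation at level \<open>\<tau>\<close>
  yields: a weak type (1,1) bound for the part of \<open>w\<close> above \<open>\<tau>\<close> and
  an L^2 Chebyshev bound for the part below. Integration against
  \<open>p * \<tau> powr (p - 1)\<close> and Tonelli's theorem reduce the claim to the two
  truncation integrals. The form without an operator keeps linearity out of this argument.\<close>

lemma marcinkiewicz_interpolation:
  fixes F w :: "'a \<Rightarrow> real"
  assumes M: "sigma_finite_measure M" and p: "1 < p" "p < 2" and B: "0 \<le> B"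
    and [measurable]: "F \<in> borel_measurable M" "w \<in> borel_measurable M"
    and nonneg: "\<And>x. 0 \<le> F x" "\<And>x. 0 \<le> w x"
    and weak: "\<And>\<tau>. 0 < \<tau> \<Longrightarrow> emeasure M {x \<in> space M. \<tau> < F x} \<le>
      (\<integral>\<^sup>+x. ennreal (B / \<tau> * max 0 (w x - \<tau>) + (min (w x) \<tau>)\<^sup>2 / \<tau>\<^sup>2) \<partial>M)"
  shows "(\<integral>\<^sup>+x. ennreal (F x powr p) \<partial>M) \<le> ennreal (p * (B / (p - 1) + 1 / p + 1 / (2 - p))) * (\<integral>\<^sup>+x. ennreal (w x powr p) \<partial>M)"
proof -
  interpret sigma_finite_measure M by (rule M)
  interpret pair_sigma_finite lborel M ..
  let ?G = "\<lambda>\<tau> x. ennreal (B / \<tau> * max 0 (w x - \<tau>) + (min (w x) \<tau>)\<^sup>2 / \<tau>\<^sup>2)"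
  have "(\<integral>\<^sup>+x. ennreal (F x powr p) \<partial>M) = (\<integral>\<^sup>+x. (\<integral>\<^sup>+\<tau>. ennreal (p * \<tau> powr (p - 1)) * indicator {0<..<F x} \<tau> \<partial>lborel) \<partial>M)"
    using p nonneg by (simp add: nn_integral_layer_cake)
  also have "\<dots> = (\<integral>\<^sup>+\<tau>. (\<integral>\<^sup>+x. ennreal (p * \<tau> powr (p - 1)) * indicator {0<..<F x} \<tau> \<partial>M) \<partial>lborel)"
    unfolding indicator_def greaterThanLessThan_iff by (rule Fubini') measurable
  also have "\<dots> = (\<integral>\<^sup>+\<tau>. ennreal (p * \<tau> powr (p - 1)) * indicator {0<..} \<tau> * emeasure M {x \<in> space M. \<tau> < F x} \<partial>lborel)"
  proof (rule nn_integral_cong)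
    fix \<tau> :: real
    have "(\<integral>\<^sup>+x. ennreal (p * \<tau> powr (p - 1)) * indicator {0<..<F x} \<tau> \<partial>M) =
        (\<integral>\<^sup>+x. (ennreal (p * \<tau> powr (p - 1)) * indicator {0<..} \<tau>) * indicator {x \<in> space M. \<tau> < F x} x \<partial>M)"
      by (intro nn_integral_cong) (auto simp: indicator_def)
    also have "\<dots> = ennreal (p * \<tau> powr (p - 1)) * indicator {0<..} \<tau> * emeasure M {x \<in> space M. \<tau> < F x}"
      by (rule nn_integral_cmult_indicator) measurable
    finally show "(\<integral>\<^sup>+x. ennreal (p * \<tau> powr (p - 1)) * indicator {0<..<F x} \<tau> \<partial>M) =
      ennreal (p * \<tau> powr (p - 1)) * indicator {0<..} \<tau> * emeasure M {x \<in> space M. \<tau> < F x}" .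
  qed
  also have "\<dots> \<le> (\<integral>\<^sup>+\<tau>. ennreal (p * \<tau> powr (p - 1)) * indicator {0<..} \<tau> * (\<integral>\<^sup>+x. ?G \<tau> x \<partial>M) \<partial>lborel)"
    using weak by (intro nn_integral_mono) (auto simp: indicator_def intro!: mult_left_mono)
  also have "\<dots> = (\<integral>\<^sup>+\<tau>. (\<integral>\<^sup>+x. ennreal (p * \<tau> powr (p - 1)) * indicator {0<..} \<tau> * ?G \<tau> x \<partial>M) \<partial>lborel)"
    by (subst nn_integral_cmult) auto
  also have "\<dots> = (\<integral>\<^sup>+x. (\<integral>\<^sup>+\<tau>. ennreal (p * \<tau> powr (p - 1)) * indicator {0<..} \<tau> * ?G \<tau> x \<partial>lborel) \<partial>M)"
    by (rule Fubini'[symmetric]) measurable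
  also have "\<dots> \<le> (\<integral>\<^sup>+x. ennreal (p * (B / (p - 1) + 1 / p + 1 / (2 - p))) * ennreal (w x powr p) \<partial>M)"
  proof (rule nn_integral_mono)
    fix x
    define t where "t = w x"
    have t: "0 \<le> t" using nonneg by (simp add: t_def)
    have "(\<integral>\<^sup>+\<tau>. ennreal (p * \<tau> powr (p - 1)) * indicator {0<..} \<tau> * ?G \<tau> x \<partial>lborel) =
        (\<integral>\<^sup>+\<tau>. ennreal (p * B) * (ennreal (\<tau> powr (p - 2) * max 0 (t - \<tau>)) * indicator {0<..} \<tau>) +
            ennreal p * (ennreal (\<tau> powr (p - 3) * (min t \<tau>)\<^sup>2) * indicator {0<..} \<tau>) \<partial>lborel)"
    proof (rule nn_integral_cong)
      fix \<tau> :: real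
      show "ennreal (p * \<tau> powr (p - 1)) * indicator {0<..} \<tau> * ?G \<tau> x =
          ennreal (p * B) * (ennreal (\<tau> powr (p - 2) * max 0 (t - \<tau>)) * indicator {0<..} \<tau>) +
            ennreal p * (ennreal (\<tau> powr (p - 3) * (min t \<tau>)\<^sup>2) * indicator {0<..} \<tau>)"
      proof (cases "0 < \<tau>")
        case True
        have e1: "\<tau> powr (p - 2) = \<tau> powr (p - 1) / \<tau>"
          using True powr_diff[of \<tau> "p - 1" 1] by simp
        have e2: "\<tau> powr (p - 3) = \<tau> powr (p - 1) / \<tau>\<^sup>2"
          using True powr_diff[of \<tau> "p - 1" 2] by simp
        have "p * \<tau> powr (p - 1) * (B / \<tau> * max 0 (t - \<tau>) + (min t \<tau>)\<^sup>2 / \<tau>\<^sup>2) =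
            p * B * (\<tau> powr (p - 2) * max 0 (t - \<tau>)) + p * (\<tau> powr (p - 3) * (min t \<tau>)\<^sup>2)"
          unfolding e1 e2 by (simp add: algebra_simps)
        then have "ennreal (p * \<tau> powr (p - 1)) * ?G \<tau> x =
            ennreal (p * B * (\<tau> powr (p - 2) * max 0 (t - \<tau>)) + p * (\<tau> powr (p - 3) * (min t \<tau>)\<^sup>2))"
          using p B True by (subst ennreal_mult[symmetric]) (auto simp: t_def)
        also have "\<dots> = ennreal (p * B) * ennreal (\<tau> powr (p - 2) * max 0 (t - \<tau>)) + ennreal p * ennreal (\<tau> powr (p - 3) * (min t \<tau>)\<^sup>2)"
          using p B True by (simp add: ennreal_mult[symmetric] ennreal_plus[symmetric] del: ennreal_plus)
        finally show ?thesis using True by simp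
      qed simp
    qed
    also have "\<dots> = ennreal (p * B) * (\<integral>\<^sup>+\<tau>. ennreal (\<tau> powr (p - 2) * max 0 (t - \<tau>)) * indicator {0<..} \<tau> \<partial>lborel) +
        ennreal p * (\<integral>\<^sup>+\<tau>. ennreal (\<tau> powr (p - 3) * (min t \<tau>)\<^sup>2) * indicator {0<..} \<tau> \<partial>lborel)"
      by (subst nn_integral_add) (auto simp: nn_integral_cmult)
    also have "\<dots> \<le> ennreal (p * B) * ennreal (t powr p / (p - 1)) + ennreal p * ennreal (t powr p / p + t powr p / (2 - p))"
      using p t by (intro add_mono mult_left_mono nn_integral_truncation_big nn_integral_truncation_small) auto
    also have "\<dots> = ennreal (p * (B / (p - 1) + 1 / p + 1 / (2 - p)) * t powr p)"
      using p B by (subst (1 2) ennreal_mult[symmetric]) (auto simp: algebra_simps simp flip: ennreal_plus)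
    also have "\<dots> = ennreal (p * (B / (p - 1) + 1 / p + 1 / (2 - p))) * ennreal (w x powr p)"
      using p B by (subst ennreal_mult) (auto simp: t_def)
    finally show "(\<integral>\<^sup>+\<tau>. ennreal (p * \<tau> powr (p - 1)) * indicator {0<..} \<tau> * ?G \<tau> x \<partial>lborel) \<le>
      ennreal (p * (B / (p - 1) + 1 / p + 1 / (2 - p))) * ennreal (w x powr p)" .
  qed
  also have "\<dots> = ennreal (p * (B / (p - 1) + 1 / p + 1 / (2 - p))) * (\<integral>\<^sup>+x. ennreal (w x powr p) \<partial>M)"
    by (rule nn_integral_cmult) measurable
  finally show ?thesis .
qed

text \<open>The input is truncated at \<open>\<tau>\<close> but the output is tested at multiples of
  \<open>\<epsilon> * \<tau>\<close>. This amounts to dividing the operator by its L^2 bound: the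
  L^2 term gets constant 1 and all dependence on \<open>A\<close> moves to the L^1 term. The
  truncation is radial, hence preserves continuity.\<close>

lemma mult_op_weak_type_truncated:
  assumes a: "mikhlin A a" and \<epsilon>: "\<And>k. cmod (a k) \<le> \<epsilon>" "0 < \<epsilon>" and r: "0 \<le> r" "r < 1" and s: "s \<in> {1, -1}"
    and f: "continuous_on UNIV f" and \<tau>: "0 < \<tau>"
  shows "measure torus_measure {x. 3 * (\<epsilon> * \<tau>) < cmod (mult_op a s r f x)} \<le>
    (LINT x|torus_measure. (8000 * (\<epsilon> + A) / \<epsilon>) / \<tau> * max 0 (cmod (f x) - \<tau>) + (min (cmod (f x)) \<tau>)\<^sup>2 / \<tau>\<^sup>2)"
proof -
  define l where "l = \<epsilon> * \<tau>"
  have l: "0 < l" using \<epsilon> \<tau> by (simp add: l_def)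
  define f2 where "f2 x = f x * of_real (\<tau> / max \<tau> (cmod (f x)))" for x
  define f1 where "f1 x = f x - f2 x" for x
  have c2: "continuous_on UNIV f2" unfolding f2_def using f \<tau> by (intro continuous_intros) auto
  have c1: "continuous_on UNIV f1" unfolding f1_def by (intro continuous_intros f c2)
  have n2: "cmod (f2 x) = min (cmod (f x)) \<tau>" for x
    using \<tau> by (simp add: f2_def norm_mult norm_divide max_def min_def)
  have n1: "cmod (f1 x) = max 0 (cmod (f x) - \<tau>)" for x
  proof -
    have "f1 x = f x * of_real (1 - \<tau> / max \<tau> (cmod (f x)))" by (simp add: f1_def f2_def algebra_simps)
    then have "cmod (f1 x) = cmod (f x) * \<bar>1 - \<tau> / max \<tau> (cmod (f x))\<bar>" by (simp only: norm_mult norm_of_real)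
    then show ?thesis using \<tau> by (auto simp: max_def field_simps abs_if)
  qed
  have i: "integrable torus_measure f1" "integrable torus_measure f2"
    using integrable_torus_continuous c1 c2 by auto
  have p2: "p_integrable 2 f2" by (rule p_integrable_continuous[OF c2]) simp
  note Tm = mult_op_measurable[where a = a and s = s, OF \<epsilon>(1) r]
  have [measurable]: "mult_op a s r f1 \<in> borel_measurable borel" "mult_op a s r f2 \<in> borel_measurable borel"
    using Tm i by auto
  have Tf: "mult_op a s r f x = mult_op a s r f1 x + mult_op a s r f2 x" for x
    using mult_op_add[where a = a and s = s and x = x, OF \<epsilon>(1) r i] by (simp add: f1_def)
  let ?V = "{x. 2 * l < cmod (mult_op a s r f1 x)}" and ?G = "{x. l\<^sup>2 \<le> (cmod (mult_op a s r f2 x))\<^sup>2}"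
  have "{x \<in> space borel. 2 * l < cmod (mult_op a s r f1 x)} \<in> sets borel"
     "{x \<in> space borel. l\<^sup>2 \<le> (cmod (mult_op a s r f2 x))\<^sup>2} \<in> sets borel"
    by measurable
  then have sets: "?V \<in> sets borel" "?G \<in> sets borel" by simp_all
  have sub: "{x. 3 * l < cmod (mult_op a s r f x)} \<subseteq> ?V \<union> ?G"
  proof
    fix x assume x: "x \<in> {x. 3 * l < cmod (mult_op a s r f x)}"
    show "x \<in> ?V \<union> ?G"
    proof (rule ccontr)
      assume "x \<notin> ?V \<union> ?G"
      then have n: "cmod (mult_op a s r f1 x) \<le> 2 * l" "(cmod (mult_op a s r f2 x))\<^sup>2 < l\<^sup>2" by auto
      have "cmod (mult_op a s r f2 x) < l" using n(2) l by (simp add: power_less_imp_less_base)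
      with n(1) x Tf[of x] norm_triangle_ineq[of "mult_op a s r f1 x" "mult_op a s r f2 x"]
      show False by simp
    qed
  qed
  have "measure torus_measure {x. 3 * l < cmod (mult_op a s r f x)} \<le> measure torus_measure (?V \<union> ?G)"
    by (rule torus.finite_measure_mono[OF sub]) (simp only: sets_torus_measure sets.Un sets)
  also have "\<dots> \<le> measure torus_measure ?V + measure torus_measure ?G"
    by (rule measure_Un_le) (simp_all only: sets_torus_measure sets)
  also have "measure torus_measure ?V \<le> 8000 * (\<epsilon> + A) / l * (LINT x|torus_measure. cmod (f1 x))"
    by (rule mult_op_weak_type[OF a \<epsilon> r s c1 l])
  also have "measure torus_measure ?G \<le> (LINT x|torus_measure. (cmod (f2 x))\<^sup>2) / \<tau>\<^sup>2"
  proof -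
    have "measure torus_measure {x\<in>space torus_measure. l\<^sup>2 \<le> (cmod (mult_op a s r f2 x))\<^sup>2} \<le>
        (LINT x|torus_measure. (cmod (mult_op a s r f2 x))\<^sup>2) / l\<^sup>2"
    proof (rule integral_Markov_inequality_measure)
      show "integrable torus_measure (\<lambda>x. (cmod (mult_op a s r f2 x))\<^sup>2)"
        using mult_op_p_integrable[where a = a and s = s and p = 2, OF \<epsilon>(1) r i(2)] by (simp add: p_integrable_def)
    qed (use l in auto)
    also have "\<dots> \<le> \<epsilon>\<^sup>2 * (LINT x|torus_measure. (cmod (f2 x))\<^sup>2) / l\<^sup>2"
      by (intro divide_right_mono mult_op_L2[OF \<epsilon>(1) r p2 s]) auto
    also have "\<dots> = (LINT x|torus_measure. (cmod (f2 x))\<^sup>2) / \<tau>\<^sup>2"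
      using \<epsilon> by (simp add: l_def power_mult_distrib)
    finally show ?thesis by simp
  qed
  also have "8000 * (\<epsilon> + A) / l * (LINT x|torus_measure. cmod (f1 x)) + (LINT x|torus_measure. (cmod (f2 x))\<^sup>2) / \<tau>\<^sup>2 =
      (LINT x|torus_measure. (8000 * (\<epsilon> + A) / \<epsilon>) / \<tau> * cmod (f1 x) + (cmod (f2 x))\<^sup>2 / \<tau>\<^sup>2)"
  proof -
    have "integrable torus_measure (\<lambda>x. cmod (f1 x))" "integrable torus_measure (\<lambda>x. (cmod (f2 x))\<^sup>2)"
      using i p2 by (simp_all add: p_integrable_def)
    then show ?thesis by (subst Bochner_Integration.integral_add) (simp_all add: l_def)
  qed
  finally show ?thesis by (simp add: l_def n1 n2)
qed

text \<open>For the operator divided by \<open>3 * \<epsilon>\<close>, interpolation bounds the p-th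
  power of the norm by a multiple of \<open>A / \<epsilon>\<close>. Undoing the division gives
  \<open>\<epsilon> powr (p - 1) * A\<close>, whose p-th root has the stated exponents.\<close>

lemma mult_op_strong_type_less_2:
  assumes p: "1 < p" "p < 2"
  shows "\<exists>C>0. \<forall>A \<epsilon> a r s f. mikhlin A a \<longrightarrow> (\<forall>k. cmod (a k) \<le> \<epsilon>) \<longrightarrow> 0 < \<epsilon> \<longrightarrow> \<epsilon> \<le> A \<longrightarrow> 0 \<le> r \<longrightarrow> r < 1 \<longrightarrow>
    s \<in> {1, -1} \<longrightarrow> continuous_on UNIV f \<longrightarrow>
    Lp_norm p (mult_op a s r f) \<le> C * (\<epsilon> powr (1 - 1 / p) * A powr (1 / p)) * Lp_norm p f"
proof -
  define K where "K = 3 powr p * (p * (16000 / (p - 1) + 1 / p + 1 / (2 - p)))"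
  have "0 < 16000 / (p - 1) + 1 / p + 1 / (2 - p)" using p by (intro add_pos_pos) auto
  then have K: "0 < K" using p by (simp add: K_def)
  show ?thesis
  proof (intro exI[of _ "K powr (1 / p)"] conjI allI impI)
    show "0 < K powr (1 / p)" using K by simp
    fix A \<epsilon> r :: real and a :: "nat \<Rightarrow> complex" and s :: int and f :: "real \<Rightarrow> complex"
    assume a: "mikhlin A a" and \<epsilon>': "\<forall>k. cmod (a k) \<le> \<epsilon>" and \<epsilon>: "0 < \<epsilon>" "\<epsilon> \<le> A" and r: "0 \<le> r" "r < 1"
      and s: "s \<in> {1, - 1}" and f: "continuous_on UNIV f"
    have \<epsilon>'': "cmod (a k) \<le> \<epsilon>" for k using \<epsilon>' by blast
    define B where "B = 8000 * (\<epsilon> + A) / \<epsilon>"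
    define F where "F x = cmod (mult_op a s r f x) / (3 * \<epsilon>)" for x
    have B: "0 \<le> B" using \<epsilon> by (simp add: B_def)
    have fi: "integrable torus_measure f" by (rule integrable_torus_continuous[OF f])
    have pf: "p_integrable p f" using p by (intro p_integrable_continuous[OF f]) auto
    have pT: "p_integrable p (mult_op a s r f)"
      using p by (intro mult_op_p_integrable[OF \<epsilon>'' r fi]) auto
    have [measurable]: "f \<in> borel_measurable borel" "mult_op a s r f \<in> borel_measurable borel"
      using pf pT by (auto simp: p_integrable_def)
    have [measurable]: "F \<in> borel_measurable borel" unfolding F_def by simp
    have "(\<integral>\<^sup>+x. ennreal (F x powr p) \<partial>torus_measure) \<le> ennreal (p * (B / (p - 1) + 1 / p + 1 / (2 - p))) * (\<integral>\<^sup>+x. ennreal (cmod (f x) powr p) \<partial>torus_measure)"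
    proof (rule marcinkiewicz_interpolation[OF _ p B])
      show "sigma_finite_measure torus_measure" by (rule torus.sigma_finite_measure_axioms)
      show "0 \<le> F x" for x using \<epsilon> by (simp add: F_def)
      fix \<tau> :: real assume \<tau>: "0 < \<tau>"
      let ?R = "\<lambda>x. B / \<tau> * max 0 (cmod (f x) - \<tau>) + (min (cmod (f x)) \<tau>)\<^sup>2 / \<tau>\<^sup>2"
      have "continuous_on UNIV ?R" using f \<tau> by (intro continuous_intros) auto
      then have Ri: "integrable torus_measure ?R" by (rule integrable_torus_continuous_real)
      have "{x \<in> space torus_measure. \<tau> < F x} = {x. 3 * (\<epsilon> * \<tau>) < cmod (mult_op a s r f x)}"
        using \<epsilon> by (auto simp: F_def field_simps)
      then have "emeasure torus_measure {x \<in> space torus_measure. \<tau> < F x} \<le> ennreal (LINT x|torus_measure. ?R x)"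
        using mult_op_weak_type_truncated[OF a \<epsilon>'' \<epsilon>(1) r s f \<tau>]
        unfolding torus.emeasure_eq_measure B_def by (intro ennreal_leI) simp
      also have "\<dots> = (\<integral>\<^sup>+x. ennreal (?R x) \<partial>torus_measure)"
        using B \<tau> by (intro nn_integral_eq_integral[symmetric] Ri AE_I2) auto
      finally show "emeasure torus_measure {x \<in> space torus_measure. \<tau> < F x} \<le> (\<integral>\<^sup>+x. ennreal (?R x) \<partial>torus_measure)" .
    qed auto
    also have "(\<integral>\<^sup>+x. ennreal (cmod (f x) powr p) \<partial>torus_measure) = ennreal (LINT x|torus_measure. cmod (f x) powr p)"
      using pf by (intro nn_integral_eq_integral) (auto simp: p_integrable_def)
    also have "(\<integral>\<^sup>+x. ennreal (F x powr p) \<partial>torus_measure) = ennreal (LINT x|torus_measure. F x powr p)"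
      using pT \<epsilon> by (intro nn_integral_eq_integral) (auto simp: p_integrable_def F_def powr_divide)
    also have "ennreal (p * (B / (p - 1) + 1 / p + 1 / (2 - p))) * ennreal (LINT x|torus_measure. cmod (f x) powr p) =
        ennreal (p * (B / (p - 1) + 1 / p + 1 / (2 - p)) * (LINT x|torus_measure. cmod (f x) powr p))"
      using p B by (intro ennreal_mult[symmetric]) auto
    finally have "(LINT x|torus_measure. F x powr p) \<le> p * (B / (p - 1) + 1 / p + 1 / (2 - p)) * (LINT x|torus_measure. cmod (f x) powr p)"
      using p B by (subst (asm) ennreal_le_iff) (auto intro!: mult_nonneg_nonneg)
    \<comment> \<open>As \<open>\<epsilon> \<le> A\<close>, every summand is at most its counterpart
      times \<open>A / \<epsilon>\<close>, which isolates the dependence on the two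
      parameters.\<close>
    also have "p * (B / (p - 1) + 1 / p + 1 / (2 - p)) \<le> p * (16000 / (p - 1) + 1 / p + 1 / (2 - p)) * (A / \<epsilon>)"
    proof -
      have A1: "1 \<le> A / \<epsilon>" using \<epsilon> by simp
      have "8000 * (\<epsilon> + A) \<le> 16000 * A" using \<epsilon> by simp
      then have "B \<le> 16000 * (A / \<epsilon>)" using \<epsilon> by (simp add: B_def divide_right_mono)
      then have "B / (p - 1) \<le> 16000 * (A / \<epsilon>) / (p - 1)" using p by (intro divide_right_mono) auto
      then have "B / (p - 1) \<le> 16000 / (p - 1) * (A / \<epsilon>)" by (simp add: mult.commute)
      moreover have "1 / p \<le> 1 / p * (A / \<epsilon>)" "1 / (2 - p) \<le> 1 / (2 - p) * (A / \<epsilon>)"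
        using A1 p mult_left_mono[OF A1, of "1 / p"] mult_left_mono[OF A1, of "1 / (2 - p)"] by auto
      ultimately have "B / (p - 1) + 1 / p + 1 / (2 - p) \<le> (16000 / (p - 1) + 1 / p + 1 / (2 - p)) * (A / \<epsilon>)"
        by (simp only: distrib_right)
      then show ?thesis unfolding mult.assoc using p by (intro mult_left_mono) auto
    qed
    finally have "(LINT x|torus_measure. F x powr p) \<le> p * (16000 / (p - 1) + 1 / p + 1 / (2 - p)) * (A / \<epsilon>) * (LINT x|torus_measure. cmod (f x) powr p)"
      by (simp add: mult_right_mono)
    moreover have "(LINT x|torus_measure. F x powr p) = (LINT x|torus_measure. cmod (mult_op a s r f x) powr p) / (3 * \<epsilon>) powr p"
      using \<epsilon> by (simp add: F_def powr_divide)
    ultimately have "(LINT x|torus_measure. cmod (mult_op a s r f x) powr p) \<le>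
        (3 * \<epsilon>) powr p * (p * (16000 / (p - 1) + 1 / p + 1 / (2 - p)) * (A / \<epsilon>) * (LINT x|torus_measure. cmod (f x) powr p))"
      using \<epsilon> by (simp add: pos_divide_le_eq mult.commute)
    also have "\<dots> = K * (\<epsilon> powr (p - 1) * A) * (Lp_norm p f powr p)"
      using \<epsilon> p by (simp add: K_def powr_mult powr_diff Lp_norm_powr)
    also have "\<dots> = (K powr (1 / p) * (\<epsilon> powr (1 - 1 / p) * A powr (1 / p)) * Lp_norm p f) powr p"
      using K \<epsilon> p by (simp add: powr_mult powr_powr left_diff_distrib)
    finally show "Lp_norm p (mult_op a s r f) \<le> K powr (1 / p) * (\<epsilon> powr (1 - 1 / p) * A powr (1 / p)) * Lp_norm p f"
      using K p by (subst Lp_norm_le_iff) auto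
  qed
qed

lemma Lp_norm_2: "Lp_norm 2 f = sqrt (LINT x|torus_measure. (cmod (f x))\<^sup>2)"
  by (simp add: Lp_norm_def powr_half_sqrt)

text \<open>The Fourier series of the output converges uniformly because of \<open>r ^ k\<close>.
  Continuity of the output makes the dual function built from it an admissible input for the bound
  with exponent below 2.\<close>

lemma mult_op_continuous:
  assumes a: "\<And>k. cmod (a k) \<le> A" and r: "0 \<le> r" "r < 1" and f: "integrable torus_measure f"
  shows "continuous_on UNIV (mult_op a s r f)"
proof -
  let ?N = "LINT y|torus_measure. cmod (f y)"
  let ?u = "\<lambda>k x. a k * of_real r ^ k * fourier_coeff f (s * int k) * cis (x * of_int (s * int k))"
  have A: "0 \<le> A" using order_trans[OF norm_ge_zero a] .
  have fc: "cmod (fourier_coeff f k) \<le> ?N" for k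
  proof -
    have "cmod (fourier_coeff f k) \<le> (LINT x|torus_measure. cmod (f x * cis (- (x * of_int k))))"
      unfolding fourier_coeff_def by (rule integral_norm_bound)
    then show ?thesis by (simp add: norm_mult)
  qed
  have "uniform_limit UNIV (\<lambda>n x. \<Sum>k<n. ?u k x) (\<lambda>x. suminf (\<lambda>k. ?u k x)) sequentially"
  proof (rule Weierstrass_m_test)
    fix k x
    have "cmod (a k) * r ^ k * cmod (fourier_coeff f (s * int k)) \<le> A * r ^ k * ?N"
      using r A by (intro mult_mono a fc) auto
    then show "norm (?u k x) \<le> A * r ^ k * ?N" using r by (simp add: norm_mult norm_power)
  next
    show "summable (\<lambda>k. A * r ^ k * ?N)"
      using r by (intro summable_mult summable_mult2 summable_geometric) auto
  qed
  moreover have "suminf (\<lambda>k. ?u k x) = mult_op a s r f x" for x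
    using mult_op_sums[where a = a and s = s and x = x, OF a r f] by (rule sums_unique[symmetric])
  ultimately have "uniform_limit UNIV (\<lambda>n x. \<Sum>k<n. ?u k x) (mult_op a s r f) sequentially"
    by simp
  then show ?thesis
    by (rule uniform_limit_theorem[rotated]) (auto intro!: always_eventually continuous_intros)
qed

text \<open>The kernel depends on \<open>s * (x - y)\<close>, so exchanging \<open>x\<close> and
  \<open>y\<close> replaces \<open>s\<close> by \<open>- s\<close>: the transpose acts on the
  opposite half line. The pairing is bilinear, without conjugation, so the coefficients stay the
  same.\<close>

lemma mult_op_transpose:
  assumes a: "\<And>k. cmod (a k) \<le> A" and r: "0 \<le> r" "r < 1"
    and f: "continuous_on UNIV f" "\<And>x. cmod (f x) \<le> B" and g: "continuous_on UNIV g" "\<And>x. cmod (g x) \<le> B'"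
  shows "(LINT x|torus_measure. mult_op a s r f x * g x) = (LINT x|torus_measure. f x * mult_op a (-s) r g x)"
proof -
  interpret pair: pair_sigma_finite torus_measure torus_measure
    by (intro pair_sigma_finite.intro torus.sigma_finite_measure_axioms)
  interpret P: finite_measure "torus_measure \<Otimes>\<^sub>M torus_measure"
    by (intro finite_measure_pair_measure torus.finite_measure_axioms)
  let ?K = "\<lambda>x y. psum a (of_real r * cis (of_int s * (x - y)))"
  have A: "0 \<le> A" using order_trans[OF norm_ge_zero a] .
  have B: "0 \<le> B" "0 \<le> B'" using order_trans[OF norm_ge_zero f(2)] order_trans[OF norm_ge_zero g(2)] .
  have cont: "continuous_on UNIV (\<lambda>(x, y). ?K x y * f y * g x)"
    unfolding split_beta
    by (intro continuous_intros continuous_on_compose2[OF psum_kernel_continuous[OF a r]]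
        continuous_on_compose2[OF f(1)] continuous_on_compose2[OF g(1)]) auto
  have "(\<lambda>(x, y). ?K x y * f y * g x) \<in> borel_measurable (borel \<Otimes>\<^sub>M borel)"
    unfolding borel_prod by (rule borel_measurable_continuous_onI[OF cont])
  then have meas: "(\<lambda>(x, y). ?K x y * f y * g x) \<in> borel_measurable (torus_measure \<Otimes>\<^sub>M torus_measure)"
    by (simp add: measurable_cong_sets[OF sets_pair_measure_cong[OF sets_torus_measure sets_torus_measure] refl])
  have "norm (?K x y * f y * g x) \<le> A / (1 - r) * B * B'" for x y
    unfolding norm_mult using A B r
    by (intro mult_mono psum_le[OF a] f(2) g(2)) (auto simp: norm_mult)
  then have int: "integrable (torus_measure \<Otimes>\<^sub>M torus_measure) (\<lambda>(x, y). ?K x y * f y * g x)"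
    by (intro P.integrable_const_bound[of _ "A / (1 - r) * B * B'"] meas) auto
  have K: "?K x y = psum a (of_real r * cis (of_int (-s) * (y - x)))" for x y
    by (simp add: algebra_simps)
  have "(LINT x|torus_measure. mult_op a s r f x * g x) = (LINT x|torus_measure. (LINT y|torus_measure. ?K x y * f y * g x))"
    by (simp add: mult_op_def)
  also have "\<dots> = (LINT y|torus_measure. (LINT x|torus_measure. ?K x y * f y * g x))"
    using pair.Fubini_integral[OF int] by simp
  also have "\<dots> = (LINT y|torus_measure. f y * mult_op a (-s) r g y)"
    unfolding mult_op_def K[symmetric]
    by (simp add: mult_ac flip: Bochner_Integration.integral_mult_right_zero)
  finally show ?thesis .
qed

text \<open>Duality with the conjugate exponent \<open>q < 2\<close>: there the exponents
  \<open>1 - 1 / q\<close> and \<open>1 / q\<close> become \<open>1 / p\<close> and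
  \<open>1 - 1 / p\<close>. Boundedness of the input makes the double integral in
  \<open>mult_op_transpose\<close> absolutely convergent.\<close>

lemma mult_op_strong_type_greater_2:
  assumes p: "2 < p"
  shows "\<exists>C>0. \<forall>A \<epsilon> a r s f. mikhlin A a \<longrightarrow> (\<forall>k. cmod (a k) \<le> \<epsilon>) \<longrightarrow> 0 < \<epsilon> \<longrightarrow> \<epsilon> \<le> A \<longrightarrow> 0 \<le> r \<longrightarrow> r < 1 \<longrightarrow>
    s \<in> {1, -1} \<longrightarrow> continuous_on UNIV f \<longrightarrow> bounded (range f) \<longrightarrow>
    Lp_norm p (mult_op a s r f) \<le> C * (\<epsilon> powr (1 / p) * A powr (1 - 1 / p)) * Lp_norm p f"
proof -
  define q where "q = p / (p - 1)"
  have q: "1 < q" "q < 2" "1 / p + 1 / q = 1" using p by (auto simp: q_def field_simps)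
  have q': "1 - 1 / q = 1 / p" "1 / q = 1 - 1 / p" using q by auto
  obtain C where C: "0 < C" and bound: "\<And>A \<epsilon> a r s f. mikhlin A a \<Longrightarrow> (\<forall>k. cmod (a k) \<le> \<epsilon>) \<Longrightarrow> 0 < \<epsilon> \<Longrightarrow> \<epsilon> \<le> A \<Longrightarrow>
      0 \<le> r \<Longrightarrow> r < 1 \<Longrightarrow> s \<in> {1, -1} \<Longrightarrow> continuous_on UNIV f \<Longrightarrow>
    Lp_norm q (mult_op a s r f) \<le> C * (\<epsilon> powr (1 - 1 / q) * A powr (1 / q)) * Lp_norm q f"
    using mult_op_strong_type_less_2[OF q(1,2)] by blast
  show ?thesis
  proof (intro exI[of _ C] conjI allI impI C)
    fix A \<epsilon> r :: real and a :: "nat \<Rightarrow> complex" and s :: int and f :: "real \<Rightarrow> complex"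
    assume a: "mikhlin A a" and \<epsilon>': "\<forall>k. cmod (a k) \<le> \<epsilon>" and \<epsilon>: "0 < \<epsilon>" "\<epsilon> \<le> A" and r: "0 \<le> r" "r < 1"
      and s: "s \<in> {1, - 1::int}" and f: "continuous_on UNIV f" and bf: "bounded (range f)"
    have \<epsilon>'': "cmod (a k) \<le> \<epsilon>" for k using \<epsilon>' by blast
    have fi: "integrable torus_measure f" by (rule integrable_torus_continuous[OF f])
    obtain Bf where Bf: "\<And>x. cmod (f x) \<le> Bf" using bf by (auto simp: bounded_iff)
    define h where "h = mult_op a s r f"
    define H where "H = Lp_norm p h"
    define D where "D = C * (\<epsilon> powr (1 / p) * A powr (1 - 1 / p))"
    have D: "0 \<le> D" using C by (simp add: D_def)
    have h: "continuous_on UNIV h" unfolding h_def by (rule mult_op_continuous[OF \<epsilon>'' r fi])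
    obtain Bh where Bh: "\<And>x. cmod (h x) \<le> Bh"
      unfolding h_def using mult_op_bound[where a = a and s = s, OF \<epsilon>'' r fi] by blast
    \<comment> \<open>The extremal function of Hoelder's inequality: \<open>h * g\<close> is the
      p-th power of \<open>cmod h\<close>, and so is the q-th power of
      \<open>cmod g\<close>.\<close>
    define g where "g x = cnj (h x) * of_real (cmod (h x) powr (p - 2))" for x
    have g: "continuous_on UNIV g"
      unfolding g_def using h p by (intro continuous_intros continuous_on_cnj continuous_on_powr') auto
    have hp: "cmod (h x) * (cmod (h x) * cmod (h x) powr (p - 2)) = cmod (h x) powr p" for x
      using p powr_add[of "cmod (h x)" 2 "p - 2"] by (cases "h x = 0") (auto simp: power2_eq_square mult_ac)
    have hg: "h x * g x = of_real (cmod (h x) powr p)" for x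
      unfolding g_def mult.assoc[symmetric] complex_norm_square[symmetric] of_real_mult[symmetric]
      using hp[of x] by (simp only: power2_eq_square mult_ac)
    have ng: "cmod (g x) = cmod (h x) powr (p - 1)" for x
      using p powr_add[of "cmod (h x)" 1 "p - 2"] by (cases "h x = 0") (auto simp: g_def norm_mult)
    have gB: "cmod (g x) \<le> Bh powr (p - 1)" for x
      unfolding ng using p Bh by (intro powr_mono2) auto
    have pq: "(p - 1) * q = p" using p by (simp add: q_def)
    have gq: "cmod (g x) powr q = cmod (h x) powr p" for x
      by (simp add: ng powr_powr pq)
    have ph: "p_integrable p h" using p by (intro p_integrable_continuous[OF h]) auto
    have pf: "p_integrable p f" using p by (intro p_integrable_continuous[OF f]) auto
    have gi: "integrable torus_measure g" by (rule integrable_torus_continuous[OF g])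
    have Tg: "p_integrable q (mult_op a (-s) r g)"
      using q by (intro mult_op_p_integrable[OF \<epsilon>'' r gi]) auto
    have Lg: "Lp_norm q g = H powr (p - 1)"
      unfolding Lp_norm_def gq H_def
    proof -
      have "(p - 1) / p = 1 / q" using p by (simp add: q_def)
      then show "(LINT x|torus_measure. cmod (h x) powr p) powr (1 / q) = ((LINT x|torus_measure. cmod (h x) powr p) powr (1 / p)) powr (p - 1)"
        by (simp add: powr_powr)
    qed
    have "H powr p = cmod (LINT x|torus_measure. h x * g x)"
      using p by (simp add: hg H_def Lp_norm_powr)
    also have "\<dots> = cmod (LINT x|torus_measure. f x * mult_op a (-s) r g x)"
      unfolding h_def by (subst mult_op_transpose[OF \<epsilon>'' r f Bf g gB]) simp
    also have "\<dots> \<le> (LINT x|torus_measure. cmod (f x * mult_op a (-s) r g x))"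
      by (rule integral_norm_bound)
    also have "\<dots> \<le> Lp_norm p f * Lp_norm q (mult_op a (-s) r g)"
      unfolding norm_mult Lp_norm_def using p q pf Tg
      by (intro Hoelder_inequality) (auto simp: p_integrable_def)
    also have "Lp_norm q (mult_op a (-s) r g) \<le> D * Lp_norm q g"
    proof -
      have "D = C * (\<epsilon> powr (1 - 1 / q) * A powr (1 / q))"
        unfolding D_def by (simp only: q'(1)) (simp only: q'(2))
      moreover have "- s \<in> {1, -1}" using s by auto
      ultimately show ?thesis using bound[OF a \<epsilon>' \<epsilon> r _ g] by simp
    qed
    finally have le: "H powr p \<le> Lp_norm p f * (D * H powr (p - 1))"
      by (simp add: Lg mult_left_mono)
    show "Lp_norm p (mult_op a s r f) \<le> C * (\<epsilon> powr (1 / p) * A powr (1 - 1 / p)) * Lp_norm p f"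
    proof (cases "H = 0")
      case True
      then show ?thesis using D by (simp add: H_def h_def D_def[symmetric])
    next
      case False
      then have H: "0 < H" by (simp add: H_def order_less_le)
      \<comment> \<open>As \<open>H\<close> is positive, one power \<open>p - 1\<close> cancels from
        both sides of \<open>le\<close>.\<close>
      have "H powr p = H powr (p - 1) * H" using H powr_add[of H "p - 1" 1] by simp
      with le have "H powr (p - 1) * H \<le> H powr (p - 1) * (D * Lp_norm p f)" by (simp add: mult_ac)
      then have "H \<le> D * Lp_norm p f" using H by (simp add: mult_le_cancel_left_pos)
      then show ?thesis by (simp add: H_def h_def D_def)
    qed
  qed
qed

theorem mult_op_strong_type:
  assumes p: "1 < p"
  shows "\<exists>C>0. \<exists>\<theta>>0. \<theta> < 1 \<and> (\<forall>A \<epsilon> a r s f. mikhlin A a \<longrightarrow> (\<forall>k. cmod (a k) \<le> \<epsilon>) \<longrightarrow> 0 < \<epsilon> \<longrightarrow> \<epsilon> \<le> A \<longrightarrow> 0 \<le> r \<longrightarrow> r < 1 \<longrightarrow>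
    s \<in> {1, -1} \<longrightarrow> continuous_on UNIV f \<longrightarrow> bounded (range f) \<longrightarrow>
    Lp_norm p (mult_op a s r f) \<le> C * (\<epsilon> powr \<theta> * A powr (1 - \<theta>)) * Lp_norm p f)"
proof -
  consider "p < 2" | "p = 2" | "2 < p" by linarith
  then show ?thesis
  proof cases
    case 1
    obtain C where "0 < C" "\<forall>A \<epsilon> a r s f. mikhlin A a \<longrightarrow> (\<forall>k. cmod (a k) \<le> \<epsilon>) \<longrightarrow> 0 < \<epsilon> \<longrightarrow> \<epsilon> \<le> A \<longrightarrow> 0 \<le> r \<longrightarrow> r < 1 \<longrightarrow>
      s \<in> {1, -1} \<longrightarrow> continuous_on UNIV f \<longrightarrow>
      Lp_norm p (mult_op a s r f) \<le> C * (\<epsilon> powr (1 - 1 / p) * A powr (1 / p)) * Lp_norm p f"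
      using mult_op_strong_type_less_2[OF p 1] by blast
    then show ?thesis using p by (intro exI[of _ C] conjI exI[of _ "1 - 1 / p"]) auto
  next
    case 3
    obtain C where "0 < C" "\<forall>A \<epsilon> a r s f. mikhlin A a \<longrightarrow> (\<forall>k. cmod (a k) \<le> \<epsilon>) \<longrightarrow> 0 < \<epsilon> \<longrightarrow> \<epsilon> \<le> A \<longrightarrow> 0 \<le> r \<longrightarrow> r < 1 \<longrightarrow>
      s \<in> {1, -1} \<longrightarrow> continuous_on UNIV f \<longrightarrow> bounded (range f) \<longrightarrow>
      Lp_norm p (mult_op a s r f) \<le> C * (\<epsilon> powr (1 / p) * A powr (1 - 1 / p)) * Lp_norm p f"
      using mult_op_strong_type_greater_2[OF 3] by blast
    then show ?thesis using p by (intro exI[of _ C] conjI exI[of _ "1 / p"]) auto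
  next
    case 2
    \<comment> \<open>For exponent 2 the factor is \<open>\<epsilon>\<close> itself; since
      \<open>\<epsilon> \<le> A\<close>, it is weakened to fit the common form with
      \<open>\<theta> = 1 / 2\<close>.\<close>
    have "Lp_norm p (mult_op a s r f) \<le> 1 * (\<epsilon> powr (1 / 2) * A powr (1 - 1 / 2)) * Lp_norm p f"
      if a: "mikhlin A a" "\<forall>k. cmod (a k) \<le> \<epsilon>" "0 < \<epsilon>" "\<epsilon> \<le> A" and r: "0 \<le> r" "r < 1" and s: "s \<in> {1, -1}"
        and f: "continuous_on UNIV f" for A \<epsilon> a r s f
    proof -
      have f2: "p_integrable 2 f" by (rule p_integrable_continuous[OF f]) simp
      have "Lp_norm p (mult_op a s r f) \<le> sqrt (\<epsilon>\<^sup>2 * (LINT x|torus_measure. (cmod (f x))\<^sup>2))"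
        unfolding 2 Lp_norm_2 using a(2) by (intro real_sqrt_le_mono mult_op_L2 r f2 s) auto
      also have "\<dots> = \<epsilon> * Lp_norm p f"
        unfolding 2 Lp_norm_2 using a(3) by (simp add: real_sqrt_mult)
      also have "\<epsilon> = \<epsilon> powr (1 / 2) * \<epsilon> powr (1 - 1 / 2)"
        using a(3) by (subst powr_add[symmetric]) simp
      also have "\<dots> \<le> \<epsilon> powr (1 / 2) * A powr (1 - 1 / 2)"
        using a by (intro mult_left_mono powr_mono2) auto
      finally show ?thesis by (simp add: mult_right_mono)
    qed
    then show ?thesis by (intro exI[of _ 1] exI[of _ "1 / 2"] conjI) auto
  qed
qed

section \<open>Multipliers on trigonometric polynomials\<close>

definition trig :: "int set \<Rightarrow> (int \<Rightarrow> complex) \<Rightarrow> real \<Rightarrow> complex" where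
  "trig K c x = (\<Sum>k\<in>K. c k * cis (x * of_int k))"

lemma trig_continuous: "continuous_on UNIV (trig K c)"
  unfolding trig_def[abs_def] by (intro continuous_intros)

lemma trig_norm_le: "cmod (trig K c x) \<le> (\<Sum>k\<in>K. cmod (c k))"
  unfolding trig_def by (rule sum_norm_le) (simp add: norm_mult)

lemma trig_bounded: "bounded (range (trig K c))"
  using trig_norm_le[of K c] by (auto simp: bounded_iff)

lemma trig_periodic: "periodic (trig K c)"
proof
  have "cis ((x + 2 * pi) * of_int k) = cis (x * of_int k)" for x k
  proof -
    have "(x + 2 * pi) * of_int k = x * of_int k + 2 * pi * of_int k" by (simp add: algebra_simps)
    then show ?thesis by (simp only: cis_mult[symmetric] cis_multiple_2pi[OF Ints_of_int]) simp
  qed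
  then show "trig K c (x + 2 * pi) = trig K c x" for x by (simp add: trig_def)
qed

lemma trig_p_integrable: "0 < p \<Longrightarrow> p_integrable p (trig K c)"
  by (rule p_integrable_continuous[OF trig_continuous])

lemma trig_in_Lp: "0 < p \<Longrightarrow> trig K c \<in> Lp p"
  by (simp add: Lp_iff trig_p_integrable trig_periodic)

lemma trig_polys_iff: "f \<in> trig_polys \<longleftrightarrow> (\<exists>K c. finite K \<and> f = trig K c)"
  by (auto simp: trig_polys_def trig_def[abs_def])

lemma fourier_coeff_trig': "finite K \<Longrightarrow> fourier_coeff (trig K c) j = (if j \<in> K then c j else 0)"
  using fourier_coeff_trig[of K c j] by (simp add: trig_def[abs_def])

lemma mult_op_trig:
  assumes a: "\<And>k. cmod (a k) \<le> A" and r: "0 \<le> r" "r < 1" and s: "s \<in> {1, -1}" and K: "finite K"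
  shows "mult_op a s r (trig K c) x = trig {k\<in>K. 0 \<le> s * k} (\<lambda>k. a (nat (s * k)) * of_real r ^ nat (s * k) * c k) x"
proof -
  let ?K = "{k\<in>K. 0 \<le> s * k}"
  let ?u = "\<lambda>k. a k * of_real r ^ k * fourier_coeff (trig K c) (s * int k) * cis (x * of_int (s * int k))"
  have ss: "s * s = 1" using s by auto
  have inj: "inj_on (\<lambda>k. nat (s * k)) ?K"
    using s by (auto simp: inj_on_def)
  have "?u sums (\<Sum>k\<in>(\<lambda>k. nat (s * k)) ` ?K. ?u k)"
  proof (rule sums_finite)
    show "finite ((\<lambda>k. nat (s * k)) ` ?K)" using K by simp
    fix n assume n: "n \<notin> (\<lambda>k. nat (s * k)) ` ?K"
    have "s * int n \<notin> K"
    proof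
      assume "s * int n \<in> K"
      moreover have e: "s * (s * int n) = int n" using ss by (simp add: mult.assoc[symmetric])
      ultimately have "s * int n \<in> ?K" by (simp add: e)
      then have "nat (s * (s * int n)) \<in> (\<lambda>k. nat (s * k)) ` ?K" by (rule imageI)
      then have "n \<in> (\<lambda>k. nat (s * k)) ` ?K" by (simp only: e nat_int)
      with n show False by simp
    qed
    then show "?u n = 0" by (simp add: fourier_coeff_trig'[OF K])
  qed
  then have "mult_op a s r (trig K c) x = (\<Sum>k\<in>(\<lambda>k. nat (s * k)) ` ?K. ?u k)"
    using mult_op_sums[where a = a and s = s and x = x, OF a r integrable_torus_continuous[OF trig_continuous]]
    by (rule sums_unique2[rotated])
  also have "\<dots> = (\<Sum>k\<in>?K. ?u (nat (s * k)))" using inj by (simp add: sum.reindex)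
  also have "\<dots> = (\<Sum>k\<in>?K. a (nat (s * k)) * of_real r ^ nat (s * k) * c k * cis (x * of_int k))"
  proof (rule sum.cong)
    fix k assume k: "k \<in> ?K"
    then have "s * int (nat (s * k)) = k" using ss by (simp add: mult.assoc[symmetric])
    then show "?u (nat (s * k)) = a (nat (s * k)) * of_real r ^ nat (s * k) * c k * cis (x * of_int k)"
      using k by (simp only: fourier_coeff_trig'[OF K]) simp
  qed simp
  finally show ?thesis by (simp add: trig_def)
qed

text \<open>The Abel factor is removed by letting \<open>r\<close> tend to 1. Only finitely many
  frequencies occur, so the regularized polynomials converge uniformly, with error at most
  \<open>\<delta> n\<close>, and the bound was uniform in \<open>r\<close>.\<close>

theorem trig_multiplier_half:
  assumes p: "1 < p"
  shows "\<exists>C>0. \<exists>\<theta>>0. \<theta> < 1 \<and> (\<forall>A \<epsilon> a s K c. mikhlin A a \<longrightarrow> (\<forall>k. cmod (a k) \<le> \<epsilon>) \<longrightarrow> 0 < \<epsilon> \<longrightarrow> \<epsilon> \<le> A \<longrightarrow>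
    s \<in> {1, -1} \<longrightarrow> finite K \<longrightarrow>
    Lp_norm p (trig {k\<in>K. 0 \<le> s * k} (\<lambda>k. a (nat (s * k)) * c k)) \<le> C * (\<epsilon> powr \<theta> * A powr (1 - \<theta>)) * Lp_norm p (trig K c))"
proof -
  obtain C \<theta> where C: "0 < C" "0 < \<theta>" "\<theta> < 1" and bound0: "\<forall>A \<epsilon> a r s f. mikhlin A a \<longrightarrow> (\<forall>k. cmod (a k) \<le> \<epsilon>) \<longrightarrow> 0 < \<epsilon> \<longrightarrow> \<epsilon> \<le> A \<longrightarrow> 0 \<le> r \<longrightarrow> r < 1 \<longrightarrow>
    s \<in> {1, -1} \<longrightarrow> continuous_on UNIV f \<longrightarrow> bounded (range f) \<longrightarrow>
    Lp_norm p (mult_op a s r f) \<le> C * (\<epsilon> powr \<theta> * A powr (1 - \<theta>)) * Lp_norm p f"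
    using mult_op_strong_type[OF p] by - (elim exE conjE, rule that)
  note bound = bound0[rule_format]
  show ?thesis
  proof (rule exI[of _ C], intro conjI C(1), rule exI[of _ \<theta>], intro conjI allI impI C(2,3))
    fix A \<epsilon> :: real and a :: "nat \<Rightarrow> complex" and s :: int and K :: "int set" and c :: "int \<Rightarrow> complex"
    assume a: "mikhlin A a" "\<forall>k. cmod (a k) \<le> \<epsilon>" "0 < \<epsilon>" "\<epsilon> \<le> A" and s: "s \<in> {1, - 1}" and K: "finite K"
    let ?K = "{k\<in>K. 0 \<le> s * k}"
    let ?B = "C * (\<epsilon> powr \<theta> * A powr (1 - \<theta>)) * Lp_norm p (trig K c)"
    define r where "r n = 1 - 1 / real (Suc n)" for n
    have r: "0 \<le> r n" "r n < 1" for n by (auto simp: r_def field_simps)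
    define \<delta> where "\<delta> n = (\<Sum>k\<in>?K. cmod (a (nat (s * k)) * c k * (1 - of_real (r n) ^ nat (s * k))))" for n
    have "r \<longlonglongrightarrow> 1" unfolding r_def by real_asymp
    then have "\<delta> \<longlonglongrightarrow> (\<Sum>k\<in>?K. cmod (a (nat (s * k)) * c k * (1 - of_real 1 ^ nat (s * k))))"
      unfolding \<delta>_def by (intro tendsto_intros)
    then have \<delta>: "\<delta> \<longlonglongrightarrow> 0" by simp
    let ?g = "trig ?K (\<lambda>k. a (nat (s * k)) * c k)"
    have "Lp_norm p ?g \<le> ?B + \<delta> n" for n
    proof -
      let ?h = "trig ?K (\<lambda>k. a (nat (s * k)) * of_real (r n) ^ nat (s * k) * c k)"
      have eq: "?h = mult_op a s (r n) (trig K c)"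
        using a(2) by (intro ext mult_op_trig[symmetric] r s K) auto
      have "Lp_norm p ?h \<le> ?B"
        unfolding eq using a(2) by (intro bound a r s trig_continuous trig_bounded) auto
      moreover have "Lp_norm p (\<lambda>x. ?g x - ?h x) \<le> \<delta> n"
      proof (rule Lp_norm_bounded)
        have "?g x - ?h x = trig ?K (\<lambda>k. a (nat (s * k)) * c k * (1 - of_real (r n) ^ nat (s * k))) x" for x
          by (simp add: trig_def sum_subtractf[symmetric] algebra_simps)
        then show "AE x in torus_measure. cmod (?g x - ?h x) \<le> \<delta> n"
          unfolding \<delta>_def using trig_norm_le by (intro AE_I2) auto
        show "0 \<le> \<delta> n" unfolding \<delta>_def by (intro sum_nonneg) auto
      qed (use p in auto)
      moreover have "Lp_norm p ?g \<le> Lp_norm p ?h + Lp_norm p (\<lambda>x. ?g x - ?h x)"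
        using p by (intro Lp_norm_le_add_diff trig_p_integrable) auto
      ultimately show ?thesis by linarith
    qed
    moreover have "(\<lambda>n. ?B + \<delta> n) \<longlonglongrightarrow> ?B + 0" by (intro tendsto_intros \<delta>)
    ultimately have "Lp_norm p ?g \<le> ?B + 0"
      by (intro LIMSEQ_le_const[of "\<lambda>n. ?B + \<delta> n" "?B + 0"]) blast+
    then show "Lp_norm p ?g \<le> ?B" by simp
  qed
qed

section \<open>From symbol estimates to multipliers on two half lines\<close>

lemma Lp_norm_trig_shift: "finite K \<Longrightarrow> Lp_norm p (trig ((\<lambda>k. k + m) ` K) (\<lambda>k. c (k - m))) = Lp_norm p (trig K c)"
proof -
  assume K: "finite K"
  have "trig ((\<lambda>k. k + m) ` K) (\<lambda>k. c (k - m)) x = cis (x * of_int m) * trig K c x" for x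
    by (simp add: trig_def sum.reindex sum_distrib_left cis_mult[symmetric] algebra_simps)
  then have "cmod (trig ((\<lambda>k. k + m) ` K) (\<lambda>k. c (k - m)) x) = cmod (trig K c x)" for x
    by (simp add: norm_mult)
  then show ?thesis by (simp add: Lp_norm_def)
qed

text \<open>The estimates of a symbol of order zero at a fixed point \<open>x\<close>, for as many
  differences as the Mikhlin condition asks.\<close>

definition symbol_bound :: "real \<Rightarrow> (int \<Rightarrow> complex) \<Rightarrow> bool" where
  "symbol_bound A \<phi> \<longleftrightarrow> (\<forall>t\<le>3. \<forall>k. cmod (fwd_diff t \<phi> k) \<le> A * japanese_bracket k powr (- real t))"

lemma japanese_bracket_ge: "(1 + \<bar>of_int k\<bar>) / 2 \<le> japanese_bracket k"
proof -
  have "1 \<le> japanese_bracket k" "\<bar>of_int k\<bar> \<le> japanese_bracket k"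
    unfolding japanese_bracket_def by (auto intro: real_le_rsqrt)
  then have "1 + \<bar>of_int k\<bar> \<le> japanese_bracket k + japanese_bracket k" by (rule add_mono)
  then show ?thesis by simp
qed

lemma fwd_diff_cases:
  "fwd_diff 0 \<phi> k = \<phi> k"
  "fwd_diff 1 \<phi> k = \<phi> (k + 1) - \<phi> k"
  "fwd_diff 2 \<phi> k = \<phi> (k + 2) - 2 * \<phi> (k + 1) + \<phi> k"
  "fwd_diff 3 \<phi> k = \<phi> (k + 3) - 3 * \<phi> (k + 2) + 3 * \<phi> (k + 1) - \<phi> k"
  by (simp_all add: fwd_diff_def numeral_2_eq_2 numeral_3_eq_3 algebra_simps)

lemma nat_diff_cases:
  "(nat_diff ^^ 0) a k = a k"
  "(nat_diff ^^ 1) a k = a (k + 1) - a k"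
  "(nat_diff ^^ 2) a k = a (k + 2) - 2 * a (k + 1) + a k"
  "(nat_diff ^^ 3) a k = a (k + 3) - 3 * a (k + 2) + 3 * a (k + 1) - a k"
  by (simp_all add: nat_diff_def numeral_2_eq_2 numeral_3_eq_3 algebra_simps)

lemma le_3_cases: "t \<le> (3::nat) \<Longrightarrow> t = 0 \<or> t = 1 \<or> t = 2 \<or> t = 3"
  by auto

text \<open>Moving the origin out to \<open>N\<close> or \<open>- N\<close> only moves the
  frequencies away from 0, so the decay in \<open>j\<close> persists. The factor 8 is
  \<open>2 ^ 3\<close>, from the 2 in \<open>japanese_bracket_ge\<close> and at most three
  differences.\<close>

lemma symbol_bound_mikhlin:
  assumes \<phi>: "symbol_bound A \<phi>" and N: "0 \<le> N"
  shows "mikhlin (8 * A) (\<lambda>j. \<phi> (N + int j))" "mikhlin (8 * A) (\<lambda>j. \<phi> (- N - int j))"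
proof -
  have *: "cmod (fwd_diff t \<phi> k) \<le> 8 * A / real (Suc j) ^ t" if "t \<le> 3" "int j \<le> \<bar>k\<bar>" for t j k
  proof -
    have "cmod (fwd_diff t \<phi> k) \<le> A * japanese_bracket k powr (- real t)"
      using \<phi> that by (simp add: symbol_bound_def)
    moreover have A: "0 \<le> A"
    proof -
      have "0 \<le> A * japanese_bracket 0 powr (- real 0)"
        using \<phi> order_trans[OF norm_ge_zero] unfolding symbol_bound_def by blast
      then show ?thesis by (simp add: japanese_bracket_def)
    qed
    moreover have "japanese_bracket k powr (- real t) \<le> 8 / real (Suc j) ^ t"
    proof -
      have "real_of_int (int j) \<le> of_int \<bar>k\<bar>" using that(2) by (simp only: of_int_le_iff)
      then have ge: "real (Suc j) / 2 \<le> japanese_bracket k" using japanese_bracket_ge[of k] by simp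
      then have pos: "0 < japanese_bracket k" by (intro less_le_trans[OF _ ge]) simp
      have "japanese_bracket k powr (- real t) = 1 / japanese_bracket k ^ t"
        using pos by (simp add: powr_minus powr_realpow field_simps)
      also have "\<dots> \<le> 1 / (real (Suc j) / 2) ^ t"
        using ge pos by (intro divide_left_mono power_mono) auto
      also have "\<dots> = 2 ^ t / real (Suc j) ^ t" by (simp add: power_divide)
      also have "\<dots> \<le> 2 ^ 3 / real (Suc j) ^ t" using that(1) by (intro divide_right_mono power_increasing) auto
      finally show ?thesis by simp
    qed
    ultimately have "cmod (fwd_diff t \<phi> k) \<le> A * (8 / real (Suc j) ^ t)"
      using mult_left_mono[of "japanese_bracket k powr (- real t)" "8 / real (Suc j) ^ t" A] by linarith
    then show ?thesis by (simp only: times_divide_eq_right mult.commute)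
  qed
  show "mikhlin (8 * A) (\<lambda>j. \<phi> (N + int j))"
    unfolding mikhlin_def
  proof (intro allI impI)
    fix t j :: nat assume t: "t \<le> 3"
    have "(nat_diff ^^ t) (\<lambda>j. \<phi> (N + int j)) j = fwd_diff t \<phi> (N + int j)"
      using le_3_cases[OF t] by (elim disjE) (simp_all only: nat_diff_cases fwd_diff_cases, simp_all add: algebra_simps)
    then show "cmod ((nat_diff ^^ t) (\<lambda>j. \<phi> (N + int j)) j) \<le> 8 * A / real (Suc j) ^ t"
      using *[OF t, of j "N + int j"] N by simp
  qed
  show "mikhlin (8 * A) (\<lambda>j. \<phi> (- N - int j))"
    unfolding mikhlin_def
  proof (intro allI impI)
    fix t j :: nat assume t: "t \<le> 3"
    \<comment> \<open>Reversing the direction turns a difference in \<open>j\<close> into a forward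
      difference at the far end \<open>- N - j - t\<close>, up to sign; that point still has
      absolute value at least \<open>j\<close>.\<close>
    have "(nat_diff ^^ t) (\<lambda>j. \<phi> (- N - int j)) j = (-1) ^ t * fwd_diff t \<phi> (- N - int j - int t)"
      using le_3_cases[OF t]
      by (elim disjE) (simp_all only: nat_diff_cases fwd_diff_cases, simp_all add: algebra_simps,
        (rule arg_cong[where f = \<phi>], simp)+)
    then show "cmod ((nat_diff ^^ t) (\<lambda>j. \<phi> (- N - int j)) j) \<le> 8 * A / real (Suc j) ^ t"
      using *[OF t, of j "- N - int j - int t"] N by (simp add: norm_mult norm_power)
  qed
qed

text \<open>Sharp cut-offs are harmless: after a modulation the two tails are again multipliers on the half
  lines \<open>k \<ge> 0\<close> and \<open>k \<le> 0\<close>.\<close>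

theorem trig_multiplier:
  assumes p: "1 < p"
  shows "\<exists>C>0. \<exists>\<theta>>0. \<theta> < 1 \<and> (\<forall>A \<epsilon> \<phi> N M K c. symbol_bound A \<phi> \<longrightarrow> 0 \<le> N \<longrightarrow> 0 \<le> M \<longrightarrow> - M < N \<longrightarrow>
    (\<forall>k. N \<le> k \<or> k \<le> - M \<longrightarrow> cmod (\<phi> k) \<le> \<epsilon>) \<longrightarrow> 0 < \<epsilon> \<longrightarrow> \<epsilon> \<le> 8 * A \<longrightarrow> finite K \<longrightarrow>
    Lp_norm p (trig {k\<in>K. N \<le> k \<or> k \<le> - M} (\<lambda>k. \<phi> k * c k)) \<le> C * (\<epsilon> powr \<theta> * A powr (1 - \<theta>)) * Lp_norm p (trig K c))"
proof -
  obtain C \<theta> where C: "0 < C" "0 < \<theta>" "\<theta> < 1" and bound0: "\<forall>A \<epsilon> a s K c. mikhlin A a \<longrightarrow> (\<forall>k. cmod (a k) \<le> \<epsilon>) \<longrightarrow> 0 < \<epsilon> \<longrightarrow> \<epsilon> \<le> A \<longrightarrow>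
    s \<in> {1, -1} \<longrightarrow> finite K \<longrightarrow>
    Lp_norm p (trig {k\<in>K. 0 \<le> s * k} (\<lambda>k. a (nat (s * k)) * c k)) \<le> C * (\<epsilon> powr \<theta> * A powr (1 - \<theta>)) * Lp_norm p (trig K c)"
    using trig_multiplier_half[OF p] by - (elim exE conjE, rule that)
  note bound = bound0[rule_format]
  show ?thesis
  \<comment> \<open>The 2 counts the half lines, and the power of 8 comes from the constant
    \<open>8 * A\<close> in \<open>symbol_bound_mikhlin\<close>.\<close>
  proof (rule exI[of _ "2 * C * 8 powr (1 - \<theta>)"], intro conjI, goal_cases)
    case 1
    show ?case using C by simp
  next
    case 2
    show ?case
    proof (rule exI[of _ \<theta>], intro conjI allI impI C(2,3))
    fix A \<epsilon> :: real and \<phi> :: "int \<Rightarrow> complex" and N M :: int and K :: "int set" and c :: "int \<Rightarrow> complex"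
    assume \<phi>: "symbol_bound A \<phi>" and NM: "0 \<le> N" "0 \<le> M" "- M < N" and small: "\<forall>k. N \<le> k \<or> k \<le> - M \<longrightarrow> cmod (\<phi> k) \<le> \<epsilon>"
      and \<epsilon>: "0 < \<epsilon>" "\<epsilon> \<le> 8 * A" and K: "finite K"
    let ?B = "C * (\<epsilon> powr \<theta> * (8 * A) powr (1 - \<theta>)) * Lp_norm p (trig K c)"
    have up: "Lp_norm p (trig {k\<in>K. N \<le> k} (\<lambda>k. \<phi> k * c k)) \<le> ?B"
    proof -
      let ?K = "(\<lambda>k. k + (- N)) ` K" and ?c = "\<lambda>k. c (k - (- N))"
      have "Lp_norm p (trig {k\<in>?K. 0 \<le> 1 * k} (\<lambda>k. \<phi> (N + int (nat (1 * k))) * ?c k)) \<le>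
          C * (\<epsilon> powr \<theta> * (8 * A) powr (1 - \<theta>)) * Lp_norm p (trig ?K ?c)"
        using small K by (intro bound[of "8 * A" "\<lambda>j. \<phi> (N + int j)"] symbol_bound_mikhlin \<phi> NM \<epsilon>) auto
      also have "Lp_norm p (trig ?K ?c) = Lp_norm p (trig K c)"
        by (rule Lp_norm_trig_shift[OF K])
      also have "trig {k\<in>?K. 0 \<le> 1 * k} (\<lambda>k. \<phi> (N + int (nat (1 * k))) * ?c k) =
          trig ((\<lambda>k. k + (- N)) ` {k\<in>K. N \<le> k}) (\<lambda>k. \<phi> (k - (- N)) * c (k - (- N)))"
        unfolding trig_def[abs_def] by (intro ext sum.cong) (auto simp: add.commute)
      also have "Lp_norm p \<dots> = Lp_norm p (trig {k\<in>K. N \<le> k} (\<lambda>k. \<phi> k * c k))"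
        using Lp_norm_trig_shift[of "{k\<in>K. N \<le> k}" p "- N" "\<lambda>k. \<phi> k * c k"] K by simp
      finally show ?thesis .
    qed
    have down: "Lp_norm p (trig {k\<in>K. k \<le> - M} (\<lambda>k. \<phi> k * c k)) \<le> ?B"
    proof -
      let ?K = "(\<lambda>k. k + M) ` K" and ?c = "\<lambda>k. c (k - M)"
      have "Lp_norm p (trig {k\<in>?K. 0 \<le> -1 * k} (\<lambda>k. \<phi> (- M - int (nat (-1 * k))) * ?c k)) \<le>
          C * (\<epsilon> powr \<theta> * (8 * A) powr (1 - \<theta>)) * Lp_norm p (trig ?K ?c)"
        using small K by (intro bound[of "8 * A" "\<lambda>j. \<phi> (- M - int j)"] symbol_bound_mikhlin \<phi> NM \<epsilon>) auto
      also have "Lp_norm p (trig ?K ?c) = Lp_norm p (trig K c)"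
        by (rule Lp_norm_trig_shift[OF K])
      also have "trig {k\<in>?K. 0 \<le> -1 * k} (\<lambda>k. \<phi> (- M - int (nat (-1 * k))) * ?c k) =
          trig ((\<lambda>k. k + M) ` {k\<in>K. k \<le> - M}) (\<lambda>k. \<phi> (k - M) * c (k - M))"
        unfolding trig_def[abs_def] by (intro ext sum.cong) auto
      also have "Lp_norm p \<dots> = Lp_norm p (trig {k\<in>K. k \<le> - M} (\<lambda>k. \<phi> k * c k))"
        using Lp_norm_trig_shift[of "{k\<in>K. k \<le> - M}" p M "\<lambda>k. \<phi> k * c k"] K by simp
      finally show ?thesis .
    qed
    have "{k\<in>K. N \<le> k \<or> k \<le> - M} = {k\<in>K. N \<le> k} \<union> {k\<in>K. k \<le> - M}" by auto
    moreover have "{k\<in>K. N \<le> k} \<inter> {k\<in>K. k \<le> - M} = {}" using NM by auto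
    ultimately have "trig {k\<in>K. N \<le> k \<or> k \<le> - M} (\<lambda>k. \<phi> k * c k) =
        (\<lambda>x. trig {k\<in>K. N \<le> k} (\<lambda>k. \<phi> k * c k) x + trig {k\<in>K. k \<le> - M} (\<lambda>k. \<phi> k * c k) x)"
      unfolding trig_def[abs_def] using K by (auto simp: sum.union_disjoint)
    then have "Lp_norm p (trig {k\<in>K. N \<le> k \<or> k \<le> - M} (\<lambda>k. \<phi> k * c k)) \<le>
        Lp_norm p (trig {k\<in>K. N \<le> k} (\<lambda>k. \<phi> k * c k)) + Lp_norm p (trig {k\<in>K. k \<le> - M} (\<lambda>k. \<phi> k * c k))"
      using p by (simp add: Lp_norm_triangle trig_p_integrable)
    also have "\<dots> \<le> ?B + ?B" by (intro add_mono up down)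
    also have "\<dots> = 2 * C * 8 powr (1 - \<theta>) * (\<epsilon> powr \<theta> * A powr (1 - \<theta>)) * Lp_norm p (trig K c)"
      using \<epsilon> by (simp add: powr_mult)
    finally show "Lp_norm p (trig {k\<in>K. N \<le> k \<or> k \<le> - M} (\<lambda>k. \<phi> k * c k)) \<le>
        2 * C * 8 powr (1 - \<theta>) * (\<epsilon> powr \<theta> * A powr (1 - \<theta>)) * Lp_norm p (trig K c)" .
    qed
  qed
qed

section \<open>Symbols with variable coefficients\<close>

lemma increment_le_integral:
  assumes G: "\<And>y. (G has_vector_derivative G' y) (at y)" and G': "continuous_on UNIV G'"
    and ab: "0 \<le> a" "a \<le> b" "b < 2 * pi"
  shows "cmod (G b - G a) \<le> 2 * pi * (LINT y|torus_measure. indicator {a..b} y * cmod (G' y))"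
proof -
  have [measurable]: "G' \<in> borel_measurable borel" by (rule borel_measurable_continuous_onI[OF G'])
  have "G b - G a = (LINT y|lborel. indicator {a..b} y *\<^sub>R G' y)"
    by (rule integral_FTC_atLeastAtMost[symmetric])
      (use ab in \<open>simp_all add: has_vector_derivative_at_within[OF G] continuous_on_subset[OF G']\<close>)
  also have "cmod \<dots> \<le> (LINT y|lborel. norm (indicator {a..b} y *\<^sub>R G' y))"
    by (rule integral_norm_bound)
  also have "\<dots> = (LINT y|lborel. indicator torus y *\<^sub>R (indicator {a..b} y * cmod (G' y)))"
    using ab by (intro Bochner_Integration.integral_cong) (auto simp: indicator_def)
  also have "\<dots> = 2 * pi * (LINT y|torus_measure. indicator {a..b} y * cmod (G' y))"
    by (subst integral_torus) (auto simp: set_lebesgue_integral_def)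
  finally show ?thesis .
qed

text \<open>The fundamental theorem of calculus and Hoelder's inequality on an interval of
  normalized measure at most \<open>1 / n\<close>; the indicator contributes
  \<open>(1 / n) powr (1 / q)\<close>, which is the gain \<open>n powr (1 - p)\<close> after taking
  p-th powers.\<close>

lemma increment_le_Lp:
  assumes p: "1 < p" and G: "\<And>y. (G has_vector_derivative G' y) (at y)" and G': "continuous_on UNIV G'"
    and ab: "0 \<le> a" "a \<le> b" "b < 2 * pi" "b - a \<le> 2 * pi / n" and n: "0 < n"
  shows "cmod (G b - G a) powr p \<le> (2 * pi) powr p * n powr (1 - p) * (LINT y|torus_measure. cmod (G' y) powr p)"
proof -
  define q where "q = p / (p - 1)"
  have q: "1 < q" "1 / p + 1 / q = 1" using p by (auto simp: q_def field_simps)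
  have [measurable]: "G' \<in> borel_measurable borel" by (rule borel_measurable_continuous_onI[OF G'])
  have pG: "p_integrable p G'" using p by (intro p_integrable_continuous[OF G']) auto
  define I where "I = (LINT y|torus_measure. cmod (G' y) powr p)"
  have I: "0 \<le> I" by (simp add: I_def)
  have ind: "indicator {a..b} y powr q = (indicator {a..b} y :: real)" for y :: real
    by (simp add: indicator_def)
  have m: "measure torus_measure {a..b} \<le> 1 / n"
  proof -
    have "(b - a) / (2 * pi) \<le> (2 * pi / n) / (2 * pi)" using ab by (intro divide_right_mono) auto
    then show ?thesis using measure_torus_le[OF ab(2)] by simp
  qed
  have "cmod (G b - G a) \<le> 2 * pi * (LINT y|torus_measure. indicator {a..b} y * cmod (G' y))"
    by (rule increment_le_integral[OF G G' ab(1,2,3)])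
  also have "(LINT y|torus_measure. indicator {a..b} y * cmod (G' y)) = (LINT y|torus_measure. cmod (G' y) * indicator {a..b} y)"
    by (simp add: mult.commute)
  also have "\<dots> \<le> (LINT y|torus_measure. cmod (G' y) powr p) powr (1 / p) * (LINT y|torus_measure. indicator {a..b} y powr q) powr (1 / q)"
  proof (rule Hoelder_inequality[OF p q])
    show "integrable torus_measure (\<lambda>y. indicator {a..b} y powr q)"
      unfolding ind by (rule integrable_torus_bounded[where B = 1]) (auto simp: indicator_def)
  qed (use pG in \<open>auto simp: p_integrable_def\<close>)
  also have "(LINT y|torus_measure. indicator {a..b} y powr q) = measure torus_measure {a..b}"
    unfolding ind by simp
  also have "measure torus_measure {a..b} powr (1 / q) \<le> (1 / n) powr (1 / q)"
    using m q by (intro powr_mono2) auto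
  finally have "cmod (G b - G a) \<le> 2 * pi * (I powr (1 / p) * (1 / n) powr (1 / q))"
    by (simp add: I_def mult_left_mono)
  then have "cmod (G b - G a) powr p \<le> (2 * pi * (I powr (1 / p) * (1 / n) powr (1 / q))) powr p"
    using p by (intro powr_mono2) auto
  also have "\<dots> = (2 * pi) powr p * (I * (1 / n) powr (p / q))"
    using p I n by (simp add: powr_mult powr_powr)
  also have "p / q = p - 1" using p by (simp add: q_def)
  also have "(1 / n) powr (p - 1) = n powr (1 - p)"
    using n by (simp add: powr_divide powr_minus_divide[symmetric])
  finally show ?thesis by (simp add: I_def mult_ac)
qed

text \<open>Here \<open>x\<close> plays two roles: \<open>G y x\<close> is a function of \<open>x\<close> with the coefficients frozen at \<open>y\<close>.\<close>

lemma Lp_norm_diagonal: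
  fixes G G' :: "real \<Rightarrow> real \<Rightarrow> complex"
  assumes p: "1 < p" and n: "0 < n"
    and G: "\<And>x y. ((\<lambda>y. G y x) has_vector_derivative G' y x) (at y)"
    and cG: "continuous_on UNIV (\<lambda>(y, x). G y x)" and cG': "continuous_on UNIV (\<lambda>(y, x). G' y x)"
    and B0: "\<And>y. Lp_norm p (G y) \<le> B0" and B1: "\<And>y. Lp_norm p (G' y) \<le> B1"
  shows "Lp_norm p (\<lambda>x. G x x) powr p \<le> 2 powr p * (real n * B0 powr p + (2 * pi) powr p * real n powr (1 - p) * B1 powr p)"
proof -
  interpret pair: pair_sigma_finite torus_measure torus_measure
    by (intro pair_sigma_finite.intro torus.sigma_finite_measure_axioms)
  have p0: "0 < p" using p by simp
  have cont: "continuous_on UNIV (G y)" "continuous_on UNIV (G' y)" "continuous_on UNIV (\<lambda>y. G' y x)" for x y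
  proof -
    have "continuous_on UNIV (\<lambda>x. (\<lambda>(y, x). G y x) (y, x))" "continuous_on UNIV (\<lambda>x. (\<lambda>(y, x). G' y x) (y, x))"
      "continuous_on UNIV (\<lambda>y. (\<lambda>(y, x). G' y x) (y, x))"
      by (rule continuous_on_compose2[OF cG] continuous_on_compose2[OF cG'];
          intro continuous_on_Pair continuous_on_const continuous_on_id subset_UNIV)+
    then show "continuous_on UNIV (G y)" "continuous_on UNIV (G' y)" "continuous_on UNIV (\<lambda>y. G' y x)" by simp_all
  qed
  have contd: "continuous_on UNIV (\<lambda>x. G x x)"
  proof -
    have "continuous_on UNIV (\<lambda>x. (\<lambda>(y, x). G y x) (x, x))"
      by (rule continuous_on_compose2[OF cG]; intro continuous_on_Pair continuous_on_const continuous_on_id subset_UNIV)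
    then show ?thesis by simp
  qed
  have B: "0 \<le> B0" "0 \<le> B1" using order_trans[OF Lp_norm_nonneg B0] order_trans[OF Lp_norm_nonneg B1] .
  define d where "d = 2 * pi / real n"
  define D where "D x = (LINT y|torus_measure. cmod (G' y x) powr p)" for x
  define c where "c = (2 * pi) powr p * real n powr (1 - p)"
  have D0: "0 \<le> D x" for x by (simp add: D_def)
  have c0: "0 \<le> c" by (simp add: c_def)
  have d0: "0 < d" using n by (simp add: d_def)
  \<comment> \<open>The base point is the left end of the cell of length \<open>d\<close> containing
    \<open>x\<close>. As it varies with \<open>x\<close>, its term is replaced by the sum over all
    base points; this is what costs the factor \<open>n\<close>.\<close>
  have point: "cmod (G x x) powr p \<le> 2 powr p * ((\<Sum>i<n. cmod (G (d * real i) x) powr p) + c * D x)" if x: "x \<in> torus" for x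
  proof -
    define i where "i = nat \<lfloor>x / d\<rfloor>"
    have xd: "0 \<le> x / d" using x d0 by simp
    then have "real i = of_int \<lfloor>x / d\<rfloor>" by (simp add: i_def)
    then have i: "real i \<le> x / d" "x / d < real i + 1" by linarith+
    have "x < d * real n" using x n by (simp add: d_def)
    then have "x / d < real n" using d0 by (simp add: field_simps)
    then have "i < n" using i(1) by linarith
    have a: "0 \<le> d * real i" "d * real i \<le> x" "x - d * real i \<le> 2 * pi / real n"
    proof -
      show "0 \<le> d * real i" using d0 by simp
      show "d * real i \<le> x" using i(1) d0 by (simp add: field_simps)
      have "x \<le> d * real i + d" using i(2) d0 by (simp add: field_simps)
      then show "x - d * real i \<le> 2 * pi / real n" by (simp add: d_def)
    qed
    have "cmod (G x x) \<le> cmod (G (d * real i) x) + cmod (G x x - G (d * real i) x)"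
      using norm_triangle_ineq[of "G (d * real i) x" "G x x - G (d * real i) x"] by simp
    then have "cmod (G x x) powr p \<le> (cmod (G (d * real i) x) + cmod (G x x - G (d * real i) x)) powr p"
      using p0 by (intro powr_mono2) auto
    also have "\<dots> \<le> 2 powr p * (cmod (G (d * real i) x) powr p + cmod (G x x - G (d * real i) x) powr p)"
      by (rule powr_add_le) (use p0 in auto)
    also have "cmod (G x x - G (d * real i) x) powr p \<le> c * D x"
      unfolding c_def D_def using n x a
      by (intro increment_le_Lp[OF p G cont(3)]) auto
    also have "cmod (G (d * real i) x) powr p \<le> (\<Sum>i<n. cmod (G (d * real i) x) powr p)"
      using \<open>i < n\<close> by (intro member_le_sum) auto
    finally show ?thesis by simp
  qed
  have mG': "(\<lambda>(y, x). ennreal (cmod (G' y x) powr p)) \<in> borel_measurable (torus_measure \<Otimes>\<^sub>M torus_measure)"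
  proof -
    have "(\<lambda>(y, x). G' y x) \<in> borel_measurable (borel \<Otimes>\<^sub>M borel)"
      unfolding borel_prod by (rule borel_measurable_continuous_onI[OF cG'])
    then have [measurable]: "(\<lambda>(y, x). G' y x) \<in> borel_measurable (torus_measure \<Otimes>\<^sub>M torus_measure)"
      by (simp add: measurable_cong_sets[OF sets_pair_measure_cong[OF sets_torus_measure sets_torus_measure] refl])
    have "(\<lambda>z. ennreal (cmod ((\<lambda>(y, x). G' y x) z) powr p)) \<in> borel_measurable (torus_measure \<Otimes>\<^sub>M torus_measure)"
      by measurable
    then show ?thesis by (simp add: split_beta)
  qed
  have pG: "p_integrable p (G y)" "p_integrable p (G' y)" "p_integrable p (\<lambda>y. G' y x)" for x y
    using cont p0 by (auto intro: p_integrable_continuous)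
  have nnB0: "(\<integral>\<^sup>+x. ennreal (cmod (G y x) powr p) \<partial>torus_measure) \<le> ennreal (B0 powr p)" for y
    using pG(1)[of y] B0[of y] B p0
    by (subst nn_integral_eq_integral) (auto simp: p_integrable_def Lp_norm_le_iff[OF p0 B(1)] intro!: ennreal_leI)
  have nnB1: "(\<integral>\<^sup>+x. ennreal (cmod (G' y x) powr p) \<partial>torus_measure) \<le> ennreal (B1 powr p)" for y
    using pG(2)[of y] B1[of y] B p0
    by (subst nn_integral_eq_integral) (auto simp: p_integrable_def Lp_norm_le_iff[OF p0 B(2)] intro!: ennreal_leI)
  have D_nn: "ennreal (D x) = (\<integral>\<^sup>+y. ennreal (cmod (G' y x) powr p) \<partial>torus_measure)" for x
    unfolding D_def using pG(3)[of x] by (intro nn_integral_eq_integral[symmetric]) (auto simp: p_integrable_def)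
  have mD: "(\<lambda>x. ennreal (D x)) \<in> borel_measurable torus_measure"
  proof -
    have "(\<lambda>(x, y). ennreal (cmod (G' y x) powr p)) \<in> borel_measurable (torus_measure \<Otimes>\<^sub>M torus_measure)"
      using measurable_pair_swap[OF mG'] by (simp add: split_beta)
    then show ?thesis unfolding D_nn by (rule torus.borel_measurable_nn_integral)
  qed
  have Dint: "(\<integral>\<^sup>+x. ennreal (D x) \<partial>torus_measure) \<le> ennreal (B1 powr p)"
  proof -
    have "(\<integral>\<^sup>+x. ennreal (D x) \<partial>torus_measure) = (\<integral>\<^sup>+y. (\<integral>\<^sup>+x. ennreal (cmod (G' y x) powr p) \<partial>torus_measure) \<partial>torus_measure)"
      unfolding D_nn by (rule pair.Fubini'[OF mG'])
    also have "\<dots> \<le> (\<integral>\<^sup>+y. ennreal (B1 powr p) \<partial>torus_measure)"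
      by (intro nn_integral_mono nnB1)
    finally show ?thesis by simp
  qed
  have mG: "(\<lambda>x. ennreal (cmod (G y x) powr p)) \<in> borel_measurable torus_measure" for y
    using pG(1)[of y] by (auto simp: p_integrable_def)
  have "ennreal (Lp_norm p (\<lambda>x. G x x) powr p) = (\<integral>\<^sup>+x. ennreal (cmod (G x x) powr p) \<partial>torus_measure)"
    unfolding Lp_norm_powr[OF p0] using p_integrable_continuous[OF contd p0]
    by (intro nn_integral_eq_integral[symmetric]) (auto simp: p_integrable_def)
  also have "\<dots> \<le> (\<integral>\<^sup>+x. ennreal (2 powr p) * ((\<Sum>i<n. ennreal (cmod (G (d * real i) x) powr p)) + ennreal c * ennreal (D x)) \<partial>torus_measure)"
  proof (rule nn_integral_mono_AE)
    show "AE x in torus_measure. ennreal (cmod (G x x) powr p) \<le>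
        ennreal (2 powr p) * ((\<Sum>i<n. ennreal (cmod (G (d * real i) x) powr p)) + ennreal c * ennreal (D x))"
      using AE_torus
    proof eventually_elim
      case (elim x)
      have "ennreal (2 powr p) * ((\<Sum>i<n. ennreal (cmod (G (d * real i) x) powr p)) + ennreal c * ennreal (D x)) =
          ennreal (2 powr p * ((\<Sum>i<n. cmod (G (d * real i) x) powr p) + c * D x))"
        using c0 D0[of x] by (simp add: ennreal_mult ennreal_plus sum_ennreal sum_nonneg)
      then show ?case using point[OF elim] by (simp add: ennreal_leI)
    qed
  qed
  also have "\<dots> = ennreal (2 powr p) * ((\<Sum>i<n. \<integral>\<^sup>+x. ennreal (cmod (G (d * real i) x) powr p) \<partial>torus_measure) + ennreal c * (\<integral>\<^sup>+x. ennreal (D x) \<partial>torus_measure))"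
    using mD mG by (simp add: nn_integral_cmult nn_integral_add nn_integral_sum del: sum_ennreal)
  also have "\<dots> \<le> ennreal (2 powr p) * ((\<Sum>i<n. ennreal (B0 powr p)) + ennreal c * ennreal (B1 powr p))"
    by (intro mult_left_mono add_mono sum_mono nnB0 Dint) auto
  also have "\<dots> = ennreal (2 powr p * (real n * B0 powr p + c * B1 powr p))"
    using c0 by (simp add: ennreal_mult ennreal_plus ennreal_of_nat_eq_real_of_nat)
  finally show ?thesis
    by (subst (asm) ennreal_le_iff) (auto simp: c_def)
qed

lemma symbol_bound_le:
  assumes "symbol_bound A \<phi>"
  shows "cmod (\<phi> k) \<le> A"
proof -
  have "cmod (fwd_diff 0 \<phi> k) \<le> A * japanese_bracket k powr (- real 0)"
    using assms unfolding symbol_bound_def by blast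
  moreover have "japanese_bracket k \<noteq> 0"
    using japanese_bracket_ge[of k] by auto
  ultimately show ?thesis by (simp add: fwd_diff_cases(1))
qed

definition symbol_trig :: "(real \<Rightarrow> int \<Rightarrow> complex) \<Rightarrow> int set \<Rightarrow> (int \<Rightarrow> complex) \<Rightarrow> real \<Rightarrow> complex" where
  "symbol_trig \<sigma> K c x = trig K (\<lambda>k. \<sigma> x k * c k) x"

locale zero_order_symbol =
  fixes \<sigma> :: "real \<Rightarrow> int \<Rightarrow> complex"
  assumes symbol: "\<sigma> \<in> symbol_class 0 1 0"
begin

lemma periodic_symbol: "periodic (\<lambda>x. \<sigma> x k)"
  using symbol by (simp add: symbol_class_def)

definition d\<sigma> :: "real \<Rightarrow> int \<Rightarrow> complex" where
  "d\<sigma> x k = iter_deriv 1 (\<lambda>y. \<sigma> y k) x"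

lemma symbol_has_derivative: "((\<lambda>x. \<sigma> x k) has_vector_derivative d\<sigma> x k) (at x)"
proof -
  have "iter_deriv 0 (\<lambda>x. \<sigma> x k) differentiable (at x)"
    using symbol by (auto simp: symbol_class_def smooth_def)
  then show ?thesis
    by (simp add: d\<sigma>_def iter_deriv_def vector_derivative_works)
qed

lemma continuous_symbol: "continuous_on UNIV (\<lambda>x. \<sigma> x k)"
  using symbol_has_derivative by (intro continuous_at_imp_continuous_on ballI has_vector_derivative_continuous)

lemma continuous_d_symbol: "continuous_on UNIV (\<lambda>x. d\<sigma> x k)"
proof -
  have "iter_deriv 1 (\<lambda>x. \<sigma> x k) differentiable (at x)" for x
    using symbol by (auto simp: symbol_class_def smooth_def)
  then show ?thesis
    unfolding d\<sigma>_def by (intro continuous_at_imp_continuous_on ballI differentiable_imp_continuous_within)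
qed

lemma symbol_bounds: "\<exists>A>0. \<forall>x. symbol_bound A (\<sigma> x) \<and> symbol_bound A (d\<sigma> x)"
proof -
  have "\<exists>C>0. \<forall>x k. cmod (fwd_diff t (\<lambda>j. D_op r (\<lambda>y. \<sigma> y j) x) k) \<le> C * japanese_bracket k powr (0 - 1 * real t + 0 * real r)" for t r
    using symbol unfolding symbol_class_def by blast
  then obtain C where C: "\<And>t r. 0 < C t r" and bound: "\<And>t r x k. cmod (fwd_diff t (\<lambda>j. D_op r (\<lambda>y. \<sigma> y j) x) k) \<le> C t r * japanese_bracket k powr (- real t)"
    by (auto; metis)
  define A where "A = (\<Sum>t\<le>3. C t 0 + C t 1)"
  have A: "C t 0 \<le> A" "C t 1 \<le> A" if "t \<le> 3" for t
  proof -
    have "C t 0 + C t 1 \<le> A"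
      unfolding A_def using that C by (intro member_le_sum) (auto intro: add_nonneg_nonneg less_imp_le)
    then show "C t 0 \<le> A" "C t 1 \<le> A" using C[of t 0] C[of t 1] by auto
  qed
  have "0 < A" using A(1)[of 0] C[of 0 0] by simp
  moreover have "symbol_bound A (\<sigma> x)" for x
    unfolding symbol_bound_def
  proof (intro allI impI)
    fix t :: nat and k :: int assume t: "t \<le> 3"
    have "cmod (fwd_diff t (\<sigma> x) k) = cmod (fwd_diff t (\<lambda>j. D_op 0 (\<lambda>y. \<sigma> y j) x) k)"
      by (simp add: D_op_def iter_deriv_def)
    also have "\<dots> \<le> C t 0 * japanese_bracket k powr (- real t)" by (rule bound)
    also have "\<dots> \<le> A * japanese_bracket k powr (- real t)" using A[OF t] by (intro mult_right_mono) auto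
    finally show "cmod (fwd_diff t (\<sigma> x) k) \<le> A * japanese_bracket k powr (- real t)" .
  qed
  moreover have "symbol_bound A (d\<sigma> x)" for x
    unfolding symbol_bound_def
  proof (intro allI impI)
    fix t :: nat and k :: int assume t: "t \<le> 3"
    have "fwd_diff t (\<lambda>j. D_op 1 (\<lambda>y. \<sigma> y j) x) k = - \<i> * fwd_diff t (d\<sigma> x) k"
      by (simp add: D_op_def fwd_diff_def d\<sigma>_def sum_distrib_left mult_ac)
    then have "cmod (fwd_diff t (d\<sigma> x) k) = cmod (fwd_diff t (\<lambda>j. D_op 1 (\<lambda>y. \<sigma> y j) x) k)"
      by (simp add: norm_mult)
    also have "\<dots> \<le> C t 1 * japanese_bracket k powr (- real t)" by (rule bound)
    also have "\<dots> \<le> A * japanese_bracket k powr (- real t)" using A[OF t] by (intro mult_right_mono) auto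
    finally show "cmod (fwd_diff t (d\<sigma> x) k) \<le> A * japanese_bracket k powr (- real t)" .
  qed
  ultimately show ?thesis by blast
qed

lemma symbol_bounded: "\<exists>A>0. \<forall>x k. cmod (\<sigma> x k) \<le> A"
  using symbol_bounds symbol_bound_le by blast

text \<open>The diagonal estimate for the tail frozen at \<open>y\<close>: the first summand comes
  from the \<open>n\<close> base points, where the supremum \<open>\<epsilon>\<close> counts, the
  second from the increments. The number \<open>n\<close> stays free. The returned \<open>A\<close>
  bounds the symbol, so \<open>\<epsilon> = A\<close> is admissible.\<close>

theorem symbol_trig_tail:
  assumes p: "1 < p"
  shows "\<exists>C A \<theta>. 0 < C \<and> 0 < A \<and> 0 < \<theta> \<and> (\<forall>x k. cmod (\<sigma> x k) \<le> A) \<and> (\<forall>\<epsilon> N M K c n. 0 \<le> N \<longrightarrow> 0 \<le> M \<longrightarrow> - M < N \<longrightarrow>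
    (\<forall>x k. N \<le> k \<or> k \<le> - M \<longrightarrow> cmod (\<sigma> x k) \<le> \<epsilon>) \<longrightarrow> 0 < \<epsilon> \<longrightarrow> \<epsilon> \<le> A \<longrightarrow> finite K \<longrightarrow> 0 < n \<longrightarrow>
    Lp_norm p (symbol_trig \<sigma> {k\<in>K. N \<le> k \<or> k \<le> - M} c) \<le>
      C * (real n * (\<epsilon> powr \<theta>) powr p + real n powr (1 - p)) powr (1 / p) * Lp_norm p (trig K c))"
proof -
  obtain C \<theta> where C: "0 < C" "0 < \<theta>" "\<theta> < 1" and bound0: "\<forall>A \<epsilon> \<phi> N M K c. symbol_bound A \<phi> \<longrightarrow> 0 \<le> N \<longrightarrow> 0 \<le> M \<longrightarrow> - M < N \<longrightarrow>
    (\<forall>k. N \<le> k \<or> k \<le> - M \<longrightarrow> cmod (\<phi> k) \<le> \<epsilon>) \<longrightarrow> 0 < \<epsilon> \<longrightarrow> \<epsilon> \<le> 8 * A \<longrightarrow> finite K \<longrightarrow>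
    Lp_norm p (trig {k\<in>K. N \<le> k \<or> k \<le> - M} (\<lambda>k. \<phi> k * c k)) \<le> C * (\<epsilon> powr \<theta> * A powr (1 - \<theta>)) * Lp_norm p (trig K c)"
    using trig_multiplier[OF p] by - (elim exE conjE, rule that)
  note bound = bound0[rule_format]
  obtain A where A: "0 < A" and A1: "\<And>x. symbol_bound A (\<sigma> x)" "\<And>x. symbol_bound A (d\<sigma> x)"
    using symbol_bounds by blast
  have dA: "cmod (d\<sigma> x k) \<le> 8 * A" for x k
    using symbol_bound_le[OF A1(2), of x k] A by linarith
  \<comment> \<open>\<open>C1 / 2\<close> dominates both coefficients of the diagonal estimate, and
    the 2 is the p-th root of its factor \<open>2 powr p\<close>.\<close>
  define C1 where "C1 = 2 * (C * A powr (1 - \<theta>) + 2 * pi * (C * ((8 * A) powr \<theta> * A powr (1 - \<theta>))))"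
  have c1: "0 < C * A powr (1 - \<theta>)" "0 < 2 * pi * (C * ((8 * A) powr \<theta> * A powr (1 - \<theta>)))" using C A by auto
  have C1: "0 < C1" using add_pos_pos[OF c1] by (simp add: C1_def)
  show ?thesis
  proof (rule exI[of _ C1], rule exI[of _ A], rule exI[of _ \<theta>], intro conjI allI impI C1 A C symbol_bound_le[OF A1(1)])
    fix \<epsilon> :: real and N M :: int and K :: "int set" and c :: "int \<Rightarrow> complex" and n :: nat
    assume NM: "0 \<le> N" "0 \<le> M" "- M < N" and small: "\<forall>x k. N \<le> k \<or> k \<le> - M \<longrightarrow> cmod (\<sigma> x k) \<le> \<epsilon>"
      and \<epsilon>: "0 < \<epsilon>" "\<epsilon> \<le> A" and K: "finite K" and n: "0 < n"
    define F where "F = Lp_norm p (trig K c)"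
    define J where "J = {k\<in>K. N \<le> k \<or> k \<le> - M}"
    have J: "finite J" using K by (simp add: J_def)
    define G where "G y x = trig J (\<lambda>k. \<sigma> y k * c k) x" for y x
    define G' where "G' y x = trig J (\<lambda>k. d\<sigma> y k * c k) x" for y x
    have F: "0 \<le> F" by (simp add: F_def)
    have "Lp_norm p (\<lambda>x. G x x) powr p \<le> 2 powr p * (real n * (C * (\<epsilon> powr \<theta> * A powr (1 - \<theta>)) * F) powr p +
        (2 * pi) powr p * real n powr (1 - p) * (C * ((8 * A) powr \<theta> * A powr (1 - \<theta>)) * F) powr p)"
    proof (rule Lp_norm_diagonal[where G = G and G' = G', OF p n])
      show "((\<lambda>y. G y x) has_vector_derivative G' y x) (at y)" for x y
        unfolding G_def G'_def trig_def
        by (intro has_vector_derivative_sum has_vector_derivative_mult_left symbol_has_derivative)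
      show "continuous_on UNIV (\<lambda>(y, x). G y x)"
        unfolding G_def trig_def split_beta
        by (intro continuous_intros continuous_on_compose2[OF continuous_symbol]) auto
      show "continuous_on UNIV (\<lambda>(y, x). G' y x)"
        unfolding G'_def trig_def split_beta
        by (intro continuous_intros continuous_on_compose2[OF continuous_d_symbol]) auto
      have Geq: "G y = trig J (\<lambda>k. \<sigma> y k * c k)" "G' y = trig J (\<lambda>k. d\<sigma> y k * c k)" for y
        by (auto simp: G_def G'_def)
      show "Lp_norm p (G y) \<le> C * (\<epsilon> powr \<theta> * A powr (1 - \<theta>)) * F" for y
        unfolding Geq J_def F_def using small \<epsilon> A by (intro bound A1 NM K) auto
      \<comment> \<open>The smallness hypothesis says nothing about the derivative of the symbol, so
        the multiplier bound is used with \<open>8 * A\<close> in place of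
        \<open>\<epsilon>\<close>.\<close>
      show "Lp_norm p (G' y) \<le> C * ((8 * A) powr \<theta> * A powr (1 - \<theta>)) * F" for y
        unfolding Geq J_def F_def using dA A by (intro bound A1 NM K) auto
    qed
    also have "\<dots> \<le> 2 powr p * (real n * ((C1 / 2) * \<epsilon> powr \<theta> * F) powr p + real n powr (1 - p) * ((C1 / 2) * F) powr p)"
    proof (intro mult_left_mono add_mono)
      have "C * (\<epsilon> powr \<theta> * A powr (1 - \<theta>)) * F = (C * A powr (1 - \<theta>)) * \<epsilon> powr \<theta> * F" by simp
      also have "\<dots> \<le> (C1 / 2) * \<epsilon> powr \<theta> * F"
        unfolding C1_def using c1 F by (intro mult_right_mono) auto
      finally show "(C * (\<epsilon> powr \<theta> * A powr (1 - \<theta>)) * F) powr p \<le> ((C1 / 2) * \<epsilon> powr \<theta> * F) powr p"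
        using p C F by (intro powr_mono2) auto
      have "(2 * pi) powr p * real n powr (1 - p) * (C * ((8 * A) powr \<theta> * A powr (1 - \<theta>)) * F) powr p =
          real n powr (1 - p) * ((2 * pi * (C * ((8 * A) powr \<theta> * A powr (1 - \<theta>)))) * F) powr p"
        using C F by (simp add: powr_mult)
      also have "\<dots> \<le> real n powr (1 - p) * ((C1 / 2) * F) powr p"
        using c1 p F by (intro mult_left_mono powr_mono2 mult_right_mono) (auto simp: C1_def)
      finally show "(2 * pi) powr p * real n powr (1 - p) * (C * ((8 * A) powr \<theta> * A powr (1 - \<theta>)) * F) powr p \<le>
        real n powr (1 - p) * ((C1 / 2) * F) powr p" .
    qed auto
    also have "\<dots> = (C1 * (real n * (\<epsilon> powr \<theta>) powr p + real n powr (1 - p)) powr (1 / p) * F) powr p"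
      using C1 F p by (simp add: powr_mult powr_powr powr_divide algebra_simps)
    finally have "Lp_norm p (\<lambda>x. G x x) \<le> C1 * (real n * (\<epsilon> powr \<theta>) powr p + real n powr (1 - p)) powr (1 / p) * F"
      using C1 F p by (subst Lp_norm_le_iff) (auto simp: Lp_norm_powr[symmetric])
    then show "Lp_norm p (symbol_trig \<sigma> {k\<in>K. N \<le> k \<or> k \<le> - M} c) \<le>
      C1 * (real n * (\<epsilon> powr \<theta>) powr p + real n powr (1 - p)) powr (1 / p) * Lp_norm p (trig K c)"
      by (simp add: symbol_trig_def[abs_def] G_def J_def F_def)
  qed
qed

end

section \<open>Density and completeness\<close>

lemma trig_polys_const: "(\<lambda>x. c) \<in> trig_polys"
  unfolding trig_polys_iff by (intro exI[of _ "{0}"] exI[of _ "\<lambda>_. c"]) (simp add: trig_def[abs_def])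

lemma trig_polys_monomial: "(\<lambda>x. c * cis (x * of_int k)) \<in> trig_polys"
  unfolding trig_polys_iff by (intro exI[of _ "{k}"] exI[of _ "\<lambda>_. c"]) (simp add: trig_def[abs_def])

lemma trig_polys_add:
  assumes "f \<in> trig_polys" "g \<in> trig_polys"
  shows "(\<lambda>x. f x + g x) \<in> trig_polys"
proof -
  obtain K c K' c' where K: "finite K" "f = trig K c" "finite K'" "g = trig K' c'"
    using assms unfolding trig_polys_iff by blast
  have ext: "trig K c x = trig (K \<union> K') (\<lambda>k. if k \<in> K then c k else 0) x" if "finite K" "finite K'" for K K' c x
    unfolding trig_def using that by (intro sum.mono_neutral_cong_left) auto
  have "f x + g x = trig (K \<union> K') (\<lambda>k. (if k \<in> K then c k else 0) + (if k \<in> K' then c' k else 0)) x" for x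
    using ext[OF K(1,3), of c x] ext[OF K(3,1), of c' x] K(2,4)
    by (simp add: trig_def Un_commute sum.distrib[symmetric] distrib_right)
  then show ?thesis
    unfolding trig_polys_iff using K(1,3)
    by (intro exI[of _ "K \<union> K'"] exI[of _ "\<lambda>k. (if k \<in> K then c k else 0) + (if k \<in> K' then c' k else 0)"]) auto
qed

lemma trig_polys_sum: "(\<And>i. i \<in> I \<Longrightarrow> f i \<in> trig_polys) \<Longrightarrow> (\<lambda>x. \<Sum>i\<in>I. f i x) \<in> trig_polys"
  by (induction I rule: infinite_finite_induct) (auto intro: trig_polys_add trig_polys_const)

lemma trig_polys_mult:
  assumes "f \<in> trig_polys" "g \<in> trig_polys"
  shows "(\<lambda>x. f x * g x) \<in> trig_polys"
proof -
  obtain K c K' c' where K: "f = trig K c" "g = trig K' c'"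
    using assms unfolding trig_polys_iff by blast
  have "(\<lambda>x. f x * g x) = (\<lambda>x. \<Sum>k\<in>K. \<Sum>l\<in>K'. (c k * c' l) * cis (x * of_int (k + l)))"
    unfolding K trig_def sum_product by (auto simp: cis_mult[symmetric] distrib_left mult_ac)
  also have "\<dots> \<in> trig_polys"
    by (intro trig_polys_sum trig_polys_monomial)
  finally show ?thesis .
qed

lemma trig_polys_cmult: "f \<in> trig_polys \<Longrightarrow> (\<lambda>x. c * f x) \<in> trig_polys"
  by (rule trig_polys_mult[OF trig_polys_const])

lemma trig_polys_diff: "f \<in> trig_polys \<Longrightarrow> g \<in> trig_polys \<Longrightarrow> (\<lambda>x. f x - g x) \<in> trig_polys"
  using trig_polys_add[of f "\<lambda>x. (-1) * g x"] trig_polys_cmult[of g "-1"] by simp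

text \<open>The link to the Stone--Weierstrass theorem: a real linear function of a point of the
  circle combines cosine and sine, which are trigonometric polynomials by Euler's formula, and these
  form an algebra.\<close>

lemma real_polynomial_function_cis:
  assumes "real_polynomial_function P"
  shows "(\<lambda>x. complex_of_real (P (cis x))) \<in> trig_polys"
  using assms
proof (induction rule: real_polynomial_function.induct)
  case (linear f)
  interpret bounded_linear f by fact
  have "f (cis x) = cos x * f 1 + sin x * f \<i>" for x
  proof -
    have "cis x = cos x *\<^sub>R 1 + sin x *\<^sub>R \<i>" by (simp add: complex_eq_iff)
    then show ?thesis by (simp only: add scaleR) simp
  qed
  moreover have "complex_of_real (cos x) = (1 / 2) * cis (x * of_int 1) + (1 / 2) * cis (x * of_int (-1))"
    "complex_of_real (sin x) = (- \<i> / 2) * cis (x * of_int 1) + (\<i> / 2) * cis (x * of_int (-1))" for x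
    by (simp_all add: complex_eq_iff)
  ultimately have "complex_of_real (f (cis x)) =
      ((1 / 2) * cis (x * of_int 1) + (1 / 2) * cis (x * of_int (-1))) * of_real (f 1) +
      ((- \<i> / 2) * cis (x * of_int 1) + (\<i> / 2) * cis (x * of_int (-1))) * of_real (f \<i>)" for x
    by (simp only: of_real_add of_real_mult)
  then show ?case
    by (simp only:) (intro trig_polys_add trig_polys_mult trig_polys_monomial trig_polys_const)
next
  case (const c)
  show ?case by (rule trig_polys_const)
qed (simp_all add: trig_polys_add trig_polys_mult)

text \<open>Because of the equal end values the function descends to the unit circle, where the
  Stone--Weierstrass theorem gives a polynomial approximation.\<close>

lemma trig_polys_dense_continuous:
  fixes \<phi> :: "real \<Rightarrow> complex"
  assumes \<phi>: "continuous_on {0..2 * pi} \<phi>" "\<phi> 0 = \<phi> (2 * pi)" and e: "0 < e"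
  shows "\<exists>g\<in>trig_polys. \<forall>x\<in>torus. cmod (\<phi> x - g x) < e"
proof -
  define F where "F z = \<phi> (Arg2pi z)" for z
  let ?S = "sphere 0 1 :: complex set"
  have S: "cis ` {0..2 * pi} = ?S"
  proof
    show "?S \<subseteq> cis ` {0..2 * pi}"
    proof
      fix z :: complex assume "z \<in> ?S"
      then have "z = cis (Arg2pi z)" using Arg2pi_eq[of z] by (simp add: cis_conv_exp)
      then show "z \<in> cis ` {0..2 * pi}" using Arg2pi[of z] by (intro image_eqI[of _ _ "Arg2pi z"]) auto
    qed
  qed auto
  have arg: "Arg2pi (cis x) = x" if "x \<in> torus" for x
    using Arg2pi_unique[of 1 x "cis x"] that by (simp add: cis_conv_exp)
  have Fcis: "F (cis x) = \<phi> x" if "x \<in> {0..2 * pi}" for x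
  proof (cases "x = 2 * pi")
    case True
    then show ?thesis using \<phi>(2) arg[of 0] by (simp add: F_def)
  next
    case False
    then show ?thesis using arg[of x] that by (simp add: F_def)
  qed
  \<comment> \<open>\<open>cis\<close> maps a compact interval continuously onto the circle and is
    therefore a quotient map, so continuity of \<open>F\<close> can be tested after composition with
    \<open>cis\<close>, where \<open>F\<close> becomes \<open>\<phi>\<close>. This avoids the jump
    of \<open>Arg2pi\<close>.\<close>
  have "continuous_on ?S F"
    unfolding continuous_openin_preimage_eq
  proof (intro allI impI)
    fix T :: "complex set" assume T: "open T"
    have "{0..2 * pi} \<inter> cis -` (?S \<inter> F -` T) = {0..2 * pi} \<inter> \<phi> -` T"
      using S Fcis by auto
    moreover have "openin (top_of_set {0..2 * pi}) ({0..2 * pi} \<inter> \<phi> -` T)"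
      using \<phi>(1) T by (simp add: continuous_openin_preimage_eq)
    ultimately have "openin (top_of_set {0..2 * pi}) ({0..2 * pi} \<inter> cis -` (?S \<inter> F -` T))"
      by simp
    then show "openin (top_of_set ?S) (?S \<inter> F -` T)"
      by (subst (asm) Abstract_Topology_2.continuous_imp_quotient_map[OF _ S]) (auto intro!: continuous_intros)
  qed
  then obtain P where P: "polynomial_function P" "\<And>z. z \<in> ?S \<Longrightarrow> norm (F z - P z) < e"
    using Stone_Weierstrass_polynomial_function[of ?S F e] e by auto
  have re: "real_polynomial_function (Re \<circ> P)" "real_polynomial_function (Im \<circ> P)"
    using P(1) bounded_linear_Re bounded_linear_Im unfolding polynomial_function_def by blast+
  have "(\<lambda>x. complex_of_real ((Re \<circ> P) (cis x)) + \<i> * complex_of_real ((Im \<circ> P) (cis x))) \<in> trig_polys"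
    by (intro trig_polys_add trig_polys_cmult real_polynomial_function_cis re)
  also have "(\<lambda>x. complex_of_real ((Re \<circ> P) (cis x)) + \<i> * complex_of_real ((Im \<circ> P) (cis x))) = (\<lambda>x. P (cis x))"
    by (simp add: complex_eq[symmetric])
  finally have "(\<lambda>x. P (cis x)) \<in> trig_polys" .
  moreover have "cmod (\<phi> x - P (cis x)) < e" if "x \<in> torus" for x
    using P(2)[of "cis x"] Fcis[of x] that by simp
  ultimately show ?thesis by (intro bexI[of _ "\<lambda>x. P (cis x)"] ballI)
qed

lemma Lp_norm_tendsto_0:
  assumes p: "1 \<le> p" and [measurable]: "\<And>n. u n \<in> borel_measurable borel" "w \<in> borel_measurable borel"
    and lim: "AE x in torus_measure. (\<lambda>n. u n x) \<longlonglongrightarrow> 0"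
    and bd: "\<And>n. AE x in torus_measure. cmod (u n x) \<le> cmod (w x)" and w: "p_integrable p w"
  shows "(\<lambda>n. Lp_norm p (u n)) \<longlonglongrightarrow> 0"
proof -
  have "(\<lambda>n. LINT x|torus_measure. cmod (u n x) powr p) \<longlonglongrightarrow> (LINT x|torus_measure. 0)"
  proof (rule integral_dominated_convergence)
    show "integrable torus_measure (\<lambda>x. cmod (w x) powr p)" using w by (simp add: p_integrable_def)
    show "AE x in torus_measure. (\<lambda>n. cmod (u n x) powr p) \<longlonglongrightarrow> 0"
      using lim
    proof eventually_elim
      case (elim x)
      then have "(\<lambda>n. cmod (u n x)) \<longlonglongrightarrow> 0" by (rule tendsto_norm_zero)
      from tendsto_powr'[OF this tendsto_const[of p]] show ?case using p by simp
    qed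
    show "AE x in torus_measure. norm (cmod (u n x) powr p) \<le> cmod (w x) powr p" for n
      using bd[of n] by eventually_elim (use p in \<open>auto intro: powr_mono2\<close>)
  qed simp_all
  then have "(\<lambda>n. LINT x|torus_measure. cmod (u n x) powr p) \<longlonglongrightarrow> 0" by simp
  from tendsto_powr'[OF this tendsto_const[of "1 / p"]] show ?thesis
    using p by (simp add: Lp_norm_def)
qed

text \<open>The radial retraction onto the closed disc of radius \<open>M\<close>; the maximum keeps
  the denominator positive at the origin and makes continuity evident.\<close>

definition clamp_norm :: "real \<Rightarrow> complex \<Rightarrow> complex" where
  "clamp_norm M z = z * of_real (M / max M (cmod z))"

lemma clamp_norm_continuous: "0 < M \<Longrightarrow> continuous_on UNIV (clamp_norm M)"
  unfolding clamp_norm_def[abs_def] by (intro continuous_intros) auto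

lemma clamp_norm_le: "0 < M \<Longrightarrow> cmod (clamp_norm M z) \<le> M"
  by (simp add: clamp_norm_def norm_mult norm_divide max_def field_simps)

lemma clamp_norm_diff_le: "0 < M \<Longrightarrow> cmod (z - clamp_norm M z) \<le> cmod z"
proof -
  assume M: "0 < M"
  have "z - clamp_norm M z = z * of_real (1 - M / max M (cmod z))"
    by (simp add: clamp_norm_def algebra_simps)
  then have "cmod (z - clamp_norm M z) = cmod z * \<bar>1 - M / max M (cmod z)\<bar>"
    by (simp only: norm_mult norm_of_real)
  also have "\<dots> \<le> cmod z * 1"
  proof (rule mult_left_mono)
    have "0 \<le> M / max M (cmod z)" "M / max M (cmod z) \<le> 1" using M by auto
    then show "\<bar>1 - M / max M (cmod z)\<bar> \<le> 1" by linarith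
  qed simp
  finally show ?thesis by simp
qed

lemma clamp_norm_eq: "cmod z \<le> M \<Longrightarrow> 0 < M \<Longrightarrow> clamp_norm M z = z"
  by (simp add: clamp_norm_def max_def)

text \<open>Three approximations with error about \<open>e / 3\<close> each: truncation to a bounded
  function, replacement by a continuous function with equal end values, and approximation by a
  trigonometric polynomial. The first two follow by dominated convergence.\<close>

theorem trig_polys_dense_Lp:
  assumes p: "1 \<le> p" and f: "p_integrable p f" and e: "0 < e"
  shows "\<exists>g\<in>trig_polys. Lp_norm p (\<lambda>x. f x - g x) < e"
proof -
  have p0: "0 < p" using p by simp
  have fm [measurable]: "f \<in> borel_measurable borel" using f by (simp add: p_integrable_def)
  have cm [measurable]: "clamp_norm (real (Suc n)) \<in> borel_measurable borel" for n
    by (intro borel_measurable_continuous_onI clamp_norm_continuous) simp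
  have "(\<lambda>n. Lp_norm p (\<lambda>x. f x - clamp_norm (real (Suc n)) (f x))) \<longlonglongrightarrow> 0"
  proof (rule Lp_norm_tendsto_0[OF p _ fm])
    show "AE x in torus_measure. (\<lambda>n. f x - clamp_norm (real (Suc n)) (f x)) \<longlonglongrightarrow> 0"
    proof (rule AE_I2)
      fix x
      obtain n0 where n0: "cmod (f x) \<le> real n0" using real_arch_simple by blast
      have "eventually (\<lambda>n. f x - clamp_norm (real (Suc n)) (f x) = 0) sequentially"
        using eventually_ge_at_top[of n0]
        by eventually_elim (use n0 in \<open>auto simp: clamp_norm_eq\<close>)
      then show "(\<lambda>n. f x - clamp_norm (real (Suc n)) (f x)) \<longlonglongrightarrow> 0"
        by (rule tendsto_eventually)
    qed
    show "(\<lambda>x. f x - clamp_norm (real (Suc n)) (f x)) \<in> borel_measurable borel" for n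
      by measurable
    show "AE x in torus_measure. cmod (f x - clamp_norm (real (Suc n)) (f x)) \<le> cmod (f x)" for n
      by (intro AE_I2 clamp_norm_diff_le) simp
  qed (rule f)
  then have "eventually (\<lambda>n. Lp_norm p (\<lambda>x. f x - clamp_norm (real (Suc n)) (f x)) < e / 3) sequentially"
    using e by (intro order_tendstoD) auto
  then obtain n where n: "Lp_norm p (\<lambda>x. f x - clamp_norm (real (Suc n)) (f x)) < e / 3"
    by (auto simp: eventually_sequentially)
  define M where "M = real (Suc n)"
  have M: "0 < M" by (simp add: M_def)
  define h where "h x = clamp_norm M (f x)" for x
  have [measurable]: "clamp_norm M \<in> borel_measurable borel" unfolding M_def by (rule cm)
  have hm [measurable]: "h \<in> borel_measurable borel" unfolding h_def by measurable
  have hM: "cmod (h x) \<le> M" for x unfolding h_def by (rule clamp_norm_le[OF M])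
  have hp: "p_integrable p h" using hM p0 by (intro p_integrable_bounded) auto
  \<comment> \<open>A Lebesgue measurable function is an almost everywhere limit of continuous
    functions, by \<open>measurable_on\<close>. Clamping these gives convergence to \<open>h\<close>
    and a constant as dominating function.\<close>
  have "f \<in> borel_measurable lebesgue" by (intro measurable_completion) simp
  from lebesgue_measurable_imp_measurable_on[OF this, of UNIV]
  obtain N g where N: "negligible N" and g: "\<And>m. continuous_on UNIV (g m)" and lim: "\<And>x. x \<notin> N \<Longrightarrow> (\<lambda>m. g m x) \<longlonglongrightarrow> f x"
    by (auto simp: measurable_on_def)
  have ae: "AE x in torus_measure. x \<notin> N \<and> x \<noteq> 0 \<and> x \<in> torus"
  proof -
    have "N \<in> null_sets lebesgue" using N by (simp add: negligible_iff_null_sets)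
    then have "AE x in lebesgue. x \<notin> N" by (rule AE_not_in)
    then have "AE x in lborel. x \<notin> N" by (simp add: AE_completion_iff)
    then show ?thesis
      using AE_lborel_singleton[of 0] unfolding AE_torus_iff by eventually_elim auto
  qed
  \<comment> \<open>A cut-off that vanishes at both ends of the period, so that the end values
    agree, and equals 1 eventually at every interior point.\<close>
  define \<eta> where "\<eta> m x = min 1 (real m * \<bar>sin (x / 2)\<bar>)" for m :: nat and x :: real
  define \<phi> where "\<phi> m x = clamp_norm M (g m x) * of_real (\<eta> m x)" for m x
  have \<eta>c: "continuous_on UNIV (\<eta> m)" for m unfolding \<eta>_def by (intro continuous_intros) auto
  have \<eta>1: "0 \<le> \<eta> m x" "\<eta> m x \<le> 1" for m x by (auto simp: \<eta>_def)
  have \<phi>c: "continuous_on UNIV (\<phi> m)" for m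
    unfolding \<phi>_def by (intro continuous_intros \<eta>c continuous_on_compose2[OF clamp_norm_continuous[OF M] g]) auto
  have \<phi>m [measurable]: "\<phi> m \<in> borel_measurable borel" for m by (rule borel_measurable_continuous_onI[OF \<phi>c])
  have \<phi>M: "cmod (\<phi> m x) \<le> M" for m x
  proof -
    have "cmod (\<phi> m x) \<le> M * 1"
      unfolding \<phi>_def norm_mult using \<eta>1[of m x] M by (intro mult_mono clamp_norm_le) auto
    then show ?thesis by simp
  qed
  have "(\<lambda>m. Lp_norm p (\<lambda>x. h x - \<phi> m x)) \<longlonglongrightarrow> 0"
  proof (rule Lp_norm_tendsto_0[OF p, where w = "\<lambda>_. of_real (2 * M)"])
    show "AE x in torus_measure. (\<lambda>m. h x - \<phi> m x) \<longlonglongrightarrow> 0"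
      using ae
    proof eventually_elim
      case (elim x)
      have "isCont (clamp_norm M) (f x)"
        using clamp_norm_continuous[OF M] by (simp add: continuous_on_eq_continuous_at)
      then have l1: "(\<lambda>m. clamp_norm M (g m x)) \<longlonglongrightarrow> h x"
        unfolding h_def by (rule isCont_tendsto_compose[OF _ lim]) (use elim in simp)
      have "0 < sin (x / 2)" using elim by (intro sin_gt_zero) auto
      then obtain m0 where m0: "1 / sin (x / 2) \<le> real m0" using real_arch_simple by blast
      have "eventually (\<lambda>m. \<eta> m x = 1) sequentially"
        using eventually_ge_at_top[of m0]
      proof eventually_elim
        case (elim m)
        then have "1 / sin (x / 2) \<le> real m" using m0 by linarith
        then have "1 \<le> real m * sin (x / 2)" using \<open>0 < sin (x / 2)\<close> by (simp add: field_simps)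
        then show ?case using \<open>0 < sin (x / 2)\<close> by (simp add: \<eta>_def)
      qed
      then have "(\<lambda>m. \<eta> m x) \<longlonglongrightarrow> 1" by (rule tendsto_eventually)
      then have "(\<lambda>m. h x - \<phi> m x) \<longlonglongrightarrow> h x - h x * of_real 1"
        unfolding \<phi>_def by (intro tendsto_intros l1)
      then show ?case by simp
    qed
    show "AE x in torus_measure. cmod (h x - \<phi> m x) \<le> cmod (of_real (2 * M))" for m
    proof (rule AE_I2)
      fix x
      show "cmod (h x - \<phi> m x) \<le> cmod (of_real (2 * M))"
        using norm_triangle_ineq4[of "h x" "\<phi> m x"] hM[of x] \<phi>M[of m x] M by simp
    qed
    show "p_integrable p (\<lambda>_. of_real (2 * M))" by (intro p_integrable_continuous p0) simp
  qed simp_all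
  then have "eventually (\<lambda>m. Lp_norm p (\<lambda>x. h x - \<phi> m x) < e / 3) sequentially"
    using e by (intro order_tendstoD) auto
  then obtain m where m: "Lp_norm p (\<lambda>x. h x - \<phi> m x) < e / 3"
    by (auto simp: eventually_sequentially)
  have "\<phi> m 0 = \<phi> m (2 * pi)" by (simp add: \<phi>_def \<eta>_def)
  from trig_polys_dense_continuous[OF continuous_on_subset[OF \<phi>c] this, of "e / 3"] e
  obtain t where t: "t \<in> trig_polys" "\<And>x. x \<in> torus \<Longrightarrow> cmod (\<phi> m x - t x) < e / 3" by auto
  have tp: "p_integrable p t" using t(1) p0 by (auto simp: trig_polys_iff trig_p_integrable)
  have \<phi>p: "p_integrable p (\<phi> m)" by (rule p_integrable_continuous[OF \<phi>c p0])
  have "Lp_norm p (\<lambda>x. \<phi> m x - t x) \<le> e / 3"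
    using e p0 by (intro Lp_norm_bounded eventually_mono[OF AE_torus] less_imp_le[OF t(2)]) auto
  moreover have "Lp_norm p (\<lambda>x. f x - h x) < e / 3" using n by (simp add: h_def M_def)
  moreover have "Lp_norm p (\<lambda>x. f x - t x) \<le> Lp_norm p (\<lambda>x. f x - h x) + Lp_norm p (\<lambda>x. h x - t x)"
    by (rule Lp_norm_diff_triangle[OF p f hp tp])
  moreover have "Lp_norm p (\<lambda>x. h x - t x) \<le> Lp_norm p (\<lambda>x. h x - \<phi> m x) + Lp_norm p (\<lambda>x. \<phi> m x - t x)"
    by (rule Lp_norm_diff_triangle[OF p hp \<phi>p tp])
  ultimately have "Lp_norm p (\<lambda>x. f x - t x) < e" using m by linarith
  then show ?thesis using t(1) by blast
qed

text \<open>Fatou's lemma, which yields integrability of the limit together with the bound.\<close>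

lemma Lp_norm_le_liminf:
  assumes p: "0 < p" and u: "\<And>n. p_integrable p (u n)" and v: "v \<in> borel_measurable borel"
    and lim: "AE x in torus_measure. (\<lambda>n. u n x) \<longlonglongrightarrow> v x" and B: "0 \<le> B" "eventually (\<lambda>n. Lp_norm p (u n) \<le> B) sequentially"
  shows "p_integrable p v" "Lp_norm p v \<le> B"
proof -
  have [measurable]: "v \<in> borel_measurable borel" "u n \<in> borel_measurable borel" for n
    using u v by (auto simp: p_integrable_def)
  have "(\<integral>\<^sup>+x. ennreal (cmod (v x) powr p) \<partial>torus_measure) = (\<integral>\<^sup>+x. liminf (\<lambda>n. ennreal (cmod (u n x) powr p)) \<partial>torus_measure)"
  proof (rule nn_integral_cong_AE)
    show "AE x in torus_measure. ennreal (cmod (v x) powr p) = liminf (\<lambda>n. ennreal (cmod (u n x) powr p))"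
      using lim
    proof eventually_elim
      case (elim x)
      have "(\<lambda>n. ennreal (cmod (u n x) powr p)) \<longlonglongrightarrow> ennreal (cmod (v x) powr p)"
        using p by (intro tendsto_ennrealI tendsto_powr' tendsto_norm elim tendsto_const) auto
      then show ?case by (rule lim_imp_Liminf[OF trivial_limit_sequentially, symmetric])
    qed
  qed
  also have "\<dots> \<le> liminf (\<lambda>n. \<integral>\<^sup>+x. ennreal (cmod (u n x) powr p) \<partial>torus_measure)"
    by (rule nn_integral_liminf) simp
  also have "\<dots> \<le> liminf (\<lambda>n::nat. ennreal (B powr p))"
  proof (rule Liminf_mono)
    show "eventually (\<lambda>n. (\<integral>\<^sup>+x. ennreal (cmod (u n x) powr p) \<partial>torus_measure) \<le> ennreal (B powr p)) sequentially"
      using B(2)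
    proof eventually_elim
      case (elim n)
      have "(\<integral>\<^sup>+x. ennreal (cmod (u n x) powr p) \<partial>torus_measure) = ennreal (LINT x|torus_measure. cmod (u n x) powr p)"
        using u[of n] by (intro nn_integral_eq_integral) (auto simp: p_integrable_def)
      then show ?case using elim Lp_norm_le_iff[OF p B(1), of "u n"] by (simp add: ennreal_leI)
    qed
  qed
  also have "\<dots> = ennreal (B powr p)" by (simp add: Liminf_const)
  finally have le: "(\<integral>\<^sup>+x. ennreal (cmod (v x) powr p) \<partial>torus_measure) \<le> ennreal (B powr p)" .
  have "integrable torus_measure (\<lambda>x. cmod (v x) powr p)"
    using le by (intro integrableI_nonneg) (auto simp: le_less_trans)
  then show vp: "p_integrable p v" by (simp add: p_integrable_def)
  have "ennreal (LINT x|torus_measure. cmod (v x) powr p) \<le> ennreal (B powr p)"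
    using le vp by (subst (asm) nn_integral_eq_integral) (auto simp: p_integrable_def)
  then show "Lp_norm p v \<le> B" using Lp_norm_le_iff[OF p B(1), of v] by simp
qed

text \<open>The ratio 1/4 leaves room for the weights \<open>2 ^ n\<close>: the weighted differences
  still have summable p-th moments, so almost everywhere they are bounded and the differences
  themselves decay like \<open>(1 / 2) ^ n\<close>. The limit is thus taken pointwise, and Fatou's
  lemma transfers the rate.\<close>

lemma Lp_fast_Cauchy:
  assumes p: "1 \<le> p" and u: "\<And>n. p_integrable p (u n)" and D: "0 \<le> D"
    and cauchy: "\<And>n. Lp_norm p (\<lambda>x. u (Suc n) x - u n x) \<le> D * (1 / 4) ^ n"
  shows "p_integrable p (\<lambda>x. lim (\<lambda>n. u n x))"
    "Lp_norm p (\<lambda>x. lim (\<lambda>n. u n x) - u n x) \<le> 2 * D * (1 / 4) ^ n"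
proof -
  have p0: "0 < p" using p by simp
  have um [measurable]: "u n \<in> borel_measurable borel" for n
    using u by (auto simp: p_integrable_def)
  have du: "p_integrable p (\<lambda>x. u m x - u n x)" for m n by (rule p_integrable_diff[OF p u u])
  let ?w = "\<lambda>n x. ennreal ((2 ^ n * cmod (u (Suc n) x - u n x)) powr p)"
  have weight: "(\<integral>\<^sup>+x. ?w n x \<partial>torus_measure) \<le> ennreal (D powr p * ((1 / 2) powr p) ^ n)" for n
  proof -
    have "(\<integral>\<^sup>+x. ?w n x \<partial>torus_measure) = ennreal (LINT x|torus_measure. (2 ^ n) powr p * cmod (u (Suc n) x - u n x) powr p)"
      using du[of "Suc n" n] by (subst nn_integral_eq_integral[symmetric]) (auto simp: p_integrable_def powr_mult)
    also have "(LINT x|torus_measure. (2 ^ n) powr p * cmod (u (Suc n) x - u n x) powr p) =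
        (2 ^ n * Lp_norm p (\<lambda>x. u (Suc n) x - u n x)) powr p"
      by (simp add: powr_mult Lp_norm_powr[OF p0])
    also have "\<dots> \<le> (2 ^ n * (D * (1 / 4) ^ n)) powr p"
      using p0 cauchy by (intro powr_mono2 mult_left_mono) auto
    also have "2 ^ n * (D * (1 / 4) ^ n) = D * (1 / 2) ^ n"
      by (simp add: power_divide field_simps) (simp flip: power_mult_distrib)
    also have "(D * (1 / 2) ^ n) powr p = D powr p * ((1 / 2) powr p) ^ n"
      using D by (simp add: powr_mult powr_powr powr_realpow[symmetric] mult.commute del: powr_one_gt_zero_iff)
    finally show ?thesis by (simp add: ennreal_leI)
  qed
  have half: "(1 / 2) powr p < (1::real)" using powr_less_mono2[of p "1 / 2" 1] p0 by simp
  have "(\<integral>\<^sup>+x. (\<Sum>n. ?w n x) \<partial>torus_measure) = (\<Sum>n. \<integral>\<^sup>+x. ?w n x \<partial>torus_measure)"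
    by (rule nn_integral_suminf) simp
  also have "\<dots> \<le> (\<Sum>n. ennreal (D powr p * ((1 / 2) powr p) ^ n))"
    by (rule suminf_le[OF weight]) auto
  also have "\<dots> < \<infinity>"
    using half by (subst suminf_ennreal2) (auto intro!: summable_mult summable_geometric)
  finally have "(\<integral>\<^sup>+x. (\<Sum>n. ?w n x) \<partial>torus_measure) \<noteq> \<infinity>" by simp
  then have "AE x in torus_measure. (\<Sum>n. ?w n x) \<noteq> \<infinity>"
    by (intro nn_integral_PInf_AE) auto
  then have conv: "AE x in torus_measure. (\<lambda>n. u n x) \<longlonglongrightarrow> lim (\<lambda>n. u n x)"
  proof eventually_elim
    case (elim x)
    define s where "s = enn2real (\<Sum>n. ?w n x)"
    have s: "(\<Sum>n. ?w n x) = ennreal s" "0 \<le> s" using elim by (auto simp: s_def less_top)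
    have "(2 ^ n * cmod (u (Suc n) x - u n x)) powr p \<le> s" for n
    proof -
      have "(\<Sum>i\<in>{n}. ?w i x) \<le> (\<Sum>n. ?w n x)"
        by (rule sum_le_suminf) auto
      then have "?w n x \<le> ennreal s" unfolding s(1) by simp
      then show ?thesis using s(2) by (simp only: ennreal_le_iff)
    qed
    then have "((2 ^ n * cmod (u (Suc n) x - u n x)) powr p) powr (1 / p) \<le> s powr (1 / p)" for n
      using p0 by (intro powr_mono2) auto
    then have "2 ^ n * cmod (u (Suc n) x - u n x) \<le> s powr (1 / p)" for n
      using p0 by (simp add: powr_powr)
    then have le: "cmod (u (Suc n) x - u n x) \<le> s powr (1 / p) * (1 / 2) ^ n" for n
      by (simp add: power_divide field_simps)
    have "summable (\<lambda>n. u (Suc n) x - u n x)"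
      by (rule summable_comparison_test'[OF _ le]) (auto intro!: summable_mult summable_geometric)
    then have "(\<lambda>n. \<Sum>i<n. u (Suc i) x - u i x) \<longlonglongrightarrow> (\<Sum>i. u (Suc i) x - u i x)"
      by (rule summable_LIMSEQ)
    then have "(\<lambda>n. u n x - u 0 x) \<longlonglongrightarrow> (\<Sum>i. u (Suc i) x - u i x)"
      by (simp only: sum_lessThan_telescope[of "\<lambda>i. u i x"])
    then have "(\<lambda>n. (u n x - u 0 x) + u 0 x) \<longlonglongrightarrow> (\<Sum>i. u (Suc i) x - u i x) + u 0 x"
      by (intro tendsto_intros)
    then have "convergent (\<lambda>n. u n x)" by (auto simp: convergent_def)
    then show ?case by (simp add: convergent_LIMSEQ_iff)
  qed
  have lm: "(\<lambda>x. lim (\<lambda>n. u n x)) \<in> borel_measurable borel" by measurable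
  \<comment> \<open>The subtracted term strengthens the claim so that the induction closes: it pays
    for the next increment.\<close>
  have tail: "Lp_norm p (\<lambda>x. u (n + m) x - u n x) \<le> 2 * D * (1 / 4) ^ n - 2 * D * (1 / 4) ^ (n + m)" for n m
  proof (induction m)
    case (Suc m)
    have "Lp_norm p (\<lambda>x. u (n + Suc m) x - u n x) \<le> Lp_norm p (\<lambda>x. u (Suc (n + m)) x - u (n + m) x) + Lp_norm p (\<lambda>x. u (n + m) x - u n x)"
      using Lp_norm_diff_triangle[OF p u u u, of "Suc (n + m)" n "n + m"] by simp
    also have "\<dots> \<le> D * (1 / 4) ^ (n + m) + (2 * D * (1 / 4) ^ n - 2 * D * (1 / 4) ^ (n + m))"
      by (intro add_mono cauchy Suc.IH)
    also have "\<dots> \<le> 2 * D * (1 / 4) ^ n - 2 * D * (1 / 4) ^ (n + Suc m)"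
      using D by simp
    finally show ?case .
  qed simp
  have tail': "Lp_norm p (\<lambda>x. u m x - u n x) \<le> 2 * D * (1 / 4) ^ n" if "n \<le> m" for n m
  proof -
    have "0 \<le> 2 * D * (1 / 4) ^ m" using D by simp
    then show ?thesis using tail[of n "m - n"] that by simp
  qed
  have L: "p_integrable p (\<lambda>x. lim (\<lambda>n. u n x) - u n x)" "Lp_norm p (\<lambda>x. lim (\<lambda>n. u n x) - u n x) \<le> 2 * D * (1 / 4) ^ n" for n
  proof -
    have ae: "AE x in torus_measure. (\<lambda>m. u m x - u n x) \<longlonglongrightarrow> lim (\<lambda>n. u n x) - u n x"
      using conv by eventually_elim (intro tendsto_intros)
    have meas: "(\<lambda>x. lim (\<lambda>n. u n x) - u n x) \<in> borel_measurable borel" by measurable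
    have ev: "eventually (\<lambda>m. Lp_norm p (\<lambda>x. u m x - u n x) \<le> 2 * D * (1 / 4) ^ n) sequentially"
      using eventually_ge_at_top[of n] by eventually_elim (rule tail')
    have nn: "0 \<le> 2 * D * (1 / 4) ^ n" using D by simp
    show "p_integrable p (\<lambda>x. lim (\<lambda>n. u n x) - u n x)" "Lp_norm p (\<lambda>x. lim (\<lambda>n. u n x) - u n x) \<le> 2 * D * (1 / 4) ^ n"
      using Lp_norm_le_liminf[where u = "\<lambda>m x. u m x - u n x", OF p0 du meas ae nn ev] by auto
  qed
  show "Lp_norm p (\<lambda>x. lim (\<lambda>n. u n x) - u n x) \<le> 2 * D * (1 / 4) ^ n" by (rule L)
  show "p_integrable p (\<lambda>x. lim (\<lambda>n. u n x))"
    using p_integrable_add[OF p L(1)[of 0] u[of 0]] by simp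
qed

section \<open>The bounded extension\<close>

lemma Lp_add: "1 \<le> p \<Longrightarrow> f \<in> Lp p \<Longrightarrow> g \<in> Lp p \<Longrightarrow> (\<lambda>x. f x + g x) \<in> Lp p"
  by (auto simp: Lp_iff periodic_fun_simple_def intro: p_integrable_add)

lemma Lp_cmult: "f \<in> Lp p \<Longrightarrow> (\<lambda>x. c * f x) \<in> Lp p"
  by (auto simp: Lp_iff periodic_fun_simple_def intro: p_integrable_cmult)

lemma Lp_diff: "1 \<le> p \<Longrightarrow> f \<in> Lp p \<Longrightarrow> g \<in> Lp p \<Longrightarrow> (\<lambda>x. f x - g x) \<in> Lp p"
  by (auto simp: Lp_iff periodic_fun_simple_def intro: p_integrable_diff)

lemma Lp_continuous: "0 < p \<Longrightarrow> continuous_on UNIV f \<Longrightarrow> periodic f \<Longrightarrow> f \<in> Lp p"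
  by (simp add: Lp_iff p_integrable_continuous)

lemma trig_polys_Lp: "0 < p \<Longrightarrow> f \<in> trig_polys \<Longrightarrow> f \<in> Lp p"
  by (auto simp: trig_polys_iff trig_in_Lp)

text \<open>Additivity holds only up to functions of seminorm zero; it is applied to
  \<open>f = (f - g) + g\<close>.\<close>

lemma bounded_operator_diff:
  assumes p: "1 \<le> p" and T: "bounded_operator (Lp p) (Lp_norm p) T" and C: "\<And>f. f \<in> Lp p \<Longrightarrow> Lp_norm p (T f) \<le> C * Lp_norm p f"
    and f: "f \<in> Lp p" and g: "g \<in> Lp p"
  shows "Lp_norm p (\<lambda>x. T f x - T g x) \<le> C * Lp_norm p (\<lambda>x. f x - g x)"
proof -
  define d where "d = (\<lambda>x. f x - g x)"
  have d: "d \<in> Lp p" unfolding d_def by (rule Lp_diff[OF p f g])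
  have TL: "T h \<in> Lp p" if "h \<in> Lp p" for h using T that by (auto simp: bounded_operator_def)
  have i: "p_integrable p (T f)" "p_integrable p (T g)" "p_integrable p (T d)"
    using TL f g d by (auto simp: Lp_iff)
  have "Lp_norm p (\<lambda>x. T (\<lambda>y. d y + g y) x - (T d x + T g x)) = 0"
    using T d g unfolding bounded_operator_def by blast
  then have 0: "Lp_norm p (\<lambda>x. T f x - (T d x + T g x)) = 0" by (simp add: d_def)
  have "Lp_norm p (\<lambda>x. (T f x - T g x)) \<le> Lp_norm p (T d) + Lp_norm p (\<lambda>x. (T f x - T g x) - T d x)"
    by (intro Lp_norm_le_add_diff p_integrable_diff p i)
  also have "(\<lambda>x. (T f x - T g x) - T d x) = (\<lambda>x. T f x - (T d x + T g x))" by (simp add: algebra_simps)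
  finally show ?thesis using 0 C[OF d] by (simp add: d_def)
qed

text \<open>Coefficients are padded with zeros to the union of the supports, so that algebraic
  identities can be checked frequency by frequency.\<close>

lemma trig_polys_common_support:
  assumes "f \<in> trig_polys" "g \<in> trig_polys"
  obtains K c c' where "finite K" "f = trig K c" "g = trig K c'"
proof -
  obtain K c K' c' where K: "finite K" "f = trig K c" "finite K'" "g = trig K' c'"
    using assms unfolding trig_polys_iff by blast
  have ext: "trig K c = trig (K \<union> K') (\<lambda>k. if k \<in> K then c k else 0)" if "finite K" "finite K'" for K K' c
    unfolding trig_def[abs_def] using that by (intro ext sum.mono_neutral_cong_left) auto
  show ?thesis
    using that[of "K \<union> K'" "\<lambda>k. if k \<in> K then c k else 0" "\<lambda>k. if k \<in> K' then c' k else 0"]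
      ext[OF K(1,3), of c] ext[OF K(3,1), of c'] K by (simp add: Un_commute)
qed

context zero_order_symbol
begin

lemma pseudo_diff_trig_eq:
  assumes "finite K"
  shows "pseudo_diff_trig \<sigma> (trig K c) = symbol_trig \<sigma> K c"
proof
  fix x
  have "pseudo_diff_trig \<sigma> (trig K c) x = infsum (\<lambda>k. \<sigma> x k * c k * cis (x * of_int k)) K"
    unfolding pseudo_diff_trig_def by (rule infsum_cong_neutral) (auto simp: fourier_coeff_trig'[OF assms])
  also have "\<dots> = symbol_trig \<sigma> K c x"
    using assms by (simp add: symbol_trig_def trig_def)
  finally show "pseudo_diff_trig \<sigma> (trig K c) x = symbol_trig \<sigma> K c x" .
qed

lemma symbol_trig_continuous: "continuous_on UNIV (symbol_trig \<sigma> K c)"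
  unfolding symbol_trig_def[abs_def] trig_def by (intro continuous_intros continuous_symbol)

lemma symbol_trig_periodic: "periodic (symbol_trig \<sigma> K c)"
proof
  fix x
  have s: "\<sigma> (x + 2 * pi) k = \<sigma> x k" for k
    by (rule periodic_fun_simple.plus_period[OF periodic_symbol])
  show "symbol_trig \<sigma> K c (x + 2 * pi) = symbol_trig \<sigma> K c x"
    unfolding symbol_trig_def s by (rule periodic_fun_simple.plus_period[OF trig_periodic])
qed

lemma symbol_trig_Lp: "0 < p \<Longrightarrow> symbol_trig \<sigma> K c \<in> Lp p"
  by (intro Lp_continuous symbol_trig_continuous symbol_trig_periodic)

lemma pseudo_diff_trig_Lp: "0 < p \<Longrightarrow> f \<in> trig_polys \<Longrightarrow> pseudo_diff_trig \<sigma> f \<in> Lp p"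
  by (auto simp: trig_polys_iff pseudo_diff_trig_eq symbol_trig_Lp)

lemma pseudo_diff_trig_add:
  assumes "f \<in> trig_polys" "g \<in> trig_polys"
  shows "pseudo_diff_trig \<sigma> (\<lambda>x. f x + g x) = (\<lambda>x. pseudo_diff_trig \<sigma> f x + pseudo_diff_trig \<sigma> g x)"
proof -
  obtain K c c' where K: "finite K" "f = trig K c" "g = trig K c'"
    using assms by (rule trig_polys_common_support)
  have "(\<lambda>x. f x + g x) = trig K (\<lambda>k. c k + c' k)"
    unfolding K trig_def[abs_def] by (simp add: sum.distrib[symmetric] distrib_right)
  then show ?thesis
    using K(1) by (simp add: K(2,3) pseudo_diff_trig_eq)
      (simp add: symbol_trig_def[abs_def] trig_def sum.distrib[symmetric] distrib_left distrib_right)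
qed

lemma pseudo_diff_trig_cmult:
  assumes "f \<in> trig_polys"
  shows "pseudo_diff_trig \<sigma> (\<lambda>x. a * f x) = (\<lambda>x. a * pseudo_diff_trig \<sigma> f x)"
proof -
  obtain K c where K: "finite K" "f = trig K c" using assms by (auto simp: trig_polys_iff)
  have "(\<lambda>x. a * f x) = trig K (\<lambda>k. a * c k)"
    unfolding K trig_def[abs_def] by (simp add: sum_distrib_left mult_ac)
  then show ?thesis
    using K(1) by (simp add: K(2) pseudo_diff_trig_eq)
      (simp add: symbol_trig_def[abs_def] trig_def sum_distrib_left mult_ac)
qed

lemma pseudo_diff_trig_diff:
  assumes "f \<in> trig_polys" "g \<in> trig_polys"
  shows "pseudo_diff_trig \<sigma> (\<lambda>x. f x - g x) = (\<lambda>x. pseudo_diff_trig \<sigma> f x - pseudo_diff_trig \<sigma> g x)"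
  using pseudo_diff_trig_add[OF assms(1) trig_polys_cmult[OF assms(2), of "-1"]]
    pseudo_diff_trig_cmult[OF assms(2), of "-1"] by simp

theorem pseudo_diff_trig_bounded:
  assumes p: "1 < p"
  shows "\<exists>B>0. \<forall>f\<in>trig_polys. Lp_norm p (pseudo_diff_trig \<sigma> f) \<le> B * Lp_norm p f"
proof -
  obtain C A \<theta> where C: "0 < C" "0 < A" "0 < \<theta>" and \<sigma>A: "\<forall>x k. cmod (\<sigma> x k) \<le> A"
    and bound0: "\<forall>\<epsilon> N M K c n. 0 \<le> N \<longrightarrow> 0 \<le> M \<longrightarrow> - M < N \<longrightarrow>
    (\<forall>x k. N \<le> k \<or> k \<le> - M \<longrightarrow> cmod (\<sigma> x k) \<le> \<epsilon>) \<longrightarrow> 0 < \<epsilon> \<longrightarrow> \<epsilon> \<le> A \<longrightarrow> finite K \<longrightarrow> 0 < n \<longrightarrow>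
    Lp_norm p (symbol_trig \<sigma> {k\<in>K. N \<le> k \<or> k \<le> - M} c) \<le>
      C * (real n * (\<epsilon> powr \<theta>) powr p + real n powr (1 - p)) powr (1 / p) * Lp_norm p (trig K c)"
    using symbol_trig_tail[OF p] by - (elim exE conjE, rule that)
  \<comment> \<open>With \<open>N = 0\<close> and \<open>M = 1\<close> the tail comprises every
    integer frequency; \<open>\<epsilon> = A\<close> and a single net point suffice as no smallness
    is wanted.\<close>
  note bound = bound0[rule_format, of 0 1 A _ 1]
  let ?B = "C * (real 1 * (A powr \<theta>) powr p + real 1 powr (1 - p)) powr (1 / p)"
  have "Lp_norm p (pseudo_diff_trig \<sigma> f) \<le> ?B * Lp_norm p f" if "f \<in> trig_polys" for f
  proof -
    obtain K c where K: "finite K" "f = trig K c" using \<open>f \<in> trig_polys\<close> by (auto simp: trig_polys_iff)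
    have eq: "{k\<in>K. 0 \<le> k \<or> k \<le> - 1} = K" by auto
    show ?thesis using bound[of K c] C \<sigma>A K unfolding eq by (simp add: pseudo_diff_trig_eq)
  qed
  moreover have "0 < ?B"
  proof -
    have "0 < real 1 * (A powr \<theta>) powr p + real 1 powr (1 - p)" by (intro add_nonneg_pos) auto
    then show ?thesis using C(1) by simp
  qed
  ultimately show ?thesis by blast
qed

text \<open>Values on trigonometric approximants chosen at rate \<open>(1 / 4) ^ n\<close> converge
  fast. Everything else follows from \<open>key\<close>, which compares the limit at
  \<open>f\<close> with the operator at an arbitrary trigonometric polynomial.\<close>

theorem extension_exists:
  assumes p: "1 < p"
  shows "\<exists>T. bounded_operator (Lp p) (Lp_norm p) T \<and>
        (\<forall>f\<in>trig_polys. Lp_norm p (\<lambda>x. T f x - pseudo_diff_trig \<sigma> f x) = 0)"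
proof -
  define P where "P = pseudo_diff_trig \<sigma>"
  have p1: "1 \<le> p" "0 < p" using p by auto
  obtain B where B: "0 < B" and PB: "\<And>f. f \<in> trig_polys \<Longrightarrow> Lp_norm p (P f) \<le> B * Lp_norm p f"
    using pseudo_diff_trig_bounded[OF p] unfolding P_def by blast
  note Padd = pseudo_diff_trig_add[folded P_def] and Pdiff = pseudo_diff_trig_diff[folded P_def]
    and Pcmult = pseudo_diff_trig_cmult[folded P_def]
  have PL: "P f \<in> Lp p" if "f \<in> trig_polys" for f
    unfolding P_def using pseudo_diff_trig_Lp[OF p1(2) that] .
  have Pi: "p_integrable p (P f)" if "f \<in> trig_polys" for f using PL[OF that] by (simp add: Lp_iff)
  have ti: "p_integrable p f" if "f \<in> trig_polys" for f using trig_polys_Lp[OF p1(2) that] by (simp add: Lp_iff)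
  have "\<exists>a. \<forall>n. a n \<in> trig_polys \<and> Lp_norm p (\<lambda>x. f x - a n x) < (1 / 4) ^ n" if "f \<in> Lp p" for f
  proof -
    have "\<exists>g. g \<in> trig_polys \<and> Lp_norm p (\<lambda>x. f x - g x) < (1 / 4) ^ n" for n
      using trig_polys_dense_Lp[OF p1(1), of f "(1 / 4) ^ n"] that by (auto simp: Lp_iff)
    then show ?thesis by metis
  qed
  then obtain a where a: "\<And>f n. f \<in> Lp p \<Longrightarrow> a f n \<in> trig_polys"
    and af: "\<And>f n. f \<in> Lp p \<Longrightarrow> Lp_norm p (\<lambda>x. f x - a f n x) < (1 / 4) ^ n"
    by metis
  \<comment> \<open>As a pointwise limit, \<open>T f\<close> inherits periodicity from the
    approximants at every point. It depends on the chosen approximants, so linearity is to be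
    expected only up to null functions.\<close>
  define T where "T f x = lim (\<lambda>n. P (a f n) x)" for f x
  have fast: "p_integrable p (T f)" "Lp_norm p (\<lambda>x. T f x - P (a f n) x) \<le> 2 * (2 * B) * (1 / 4) ^ n" if f: "f \<in> Lp p" for f n
  proof -
    have fi: "p_integrable p f" using f by (simp add: Lp_iff)
    have cauchy: "Lp_norm p (\<lambda>x. P (a f (Suc n)) x - P (a f n) x) \<le> 2 * B * (1 / 4) ^ n" for n
    proof -
      have "Lp_norm p (\<lambda>x. P (a f (Suc n)) x - P (a f n) x) = Lp_norm p (P (\<lambda>x. a f (Suc n) x - a f n x))"
        by (simp only: Pdiff[OF a[OF f] a[OF f]])
      also have "\<dots> \<le> B * Lp_norm p (\<lambda>x. a f (Suc n) x - a f n x)"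
        by (intro PB trig_polys_diff a f)
      also have "Lp_norm p (\<lambda>x. a f (Suc n) x - a f n x) \<le> Lp_norm p (\<lambda>x. a f (Suc n) x - f x) + Lp_norm p (\<lambda>x. f x - a f n x)"
        by (intro Lp_norm_diff_triangle p1 ti a f fi)
      also have "\<dots> \<le> (1 / 4) ^ Suc n + (1 / 4) ^ n"
        using af[OF f, of "Suc n"] af[OF f, of n] by (simp only: Lp_norm_diff_commute[of p "a f (Suc n)" f])
      also have "\<dots> \<le> 2 * (1 / 4) ^ n" by simp
      finally show ?thesis using B by (simp add: mult_left_mono)
    qed
    have D: "0 \<le> 2 * B" using B by simp
    note F = Lp_fast_Cauchy[where u = "\<lambda>n. P (a f n)", OF p1(1) Pi[OF a[OF f]] D cauchy]
    show "p_integrable p (T f)" using F(1) by (simp add: T_def[abs_def])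
    show "Lp_norm p (\<lambda>x. T f x - P (a f n) x) \<le> 2 * (2 * B) * (1 / 4) ^ n" using F(2) by (simp add: T_def)
  qed
  have TL: "T f \<in> Lp p" if f: "f \<in> Lp p" for f
  proof -
    have "periodic (T f)"
    proof
      fix x
      have "P (a f n) (x + 2 * pi) = P (a f n) x" for n
        using PL[OF a[OF f], of n] by (auto simp: Lp_iff periodic_fun_simple_def)
      then show "T f (x + 2 * pi) = T f x" by (simp add: T_def)
    qed
    then show ?thesis using fast(1)[OF f] by (simp add: Lp_iff)
  qed
  have key: "Lp_norm p (\<lambda>x. T f x - P g x) \<le> B * Lp_norm p (\<lambda>x. f x - g x)" if f: "f \<in> Lp p" and g: "g \<in> trig_polys" for f g
  proof -
    have fi: "p_integrable p f" using f by (simp add: Lp_iff)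
    let ?R = "\<lambda>n. 5 * B * (1 / 4) ^ n + B * Lp_norm p (\<lambda>x. f x - g x)"
    have "Lp_norm p (\<lambda>x. T f x - P g x) \<le> ?R n" for n
    proof -
      have "Lp_norm p (\<lambda>x. T f x - P g x) \<le> Lp_norm p (\<lambda>x. T f x - P (a f n) x) + Lp_norm p (\<lambda>x. P (a f n) x - P g x)"
        by (intro Lp_norm_diff_triangle p1 fast f Pi a g)
      also have "Lp_norm p (\<lambda>x. P (a f n) x - P g x) = Lp_norm p (P (\<lambda>x. a f n x - g x))"
        by (simp only: Pdiff[OF a[OF f] g])
      also have "\<dots> \<le> B * Lp_norm p (\<lambda>x. a f n x - g x)"
        by (intro PB trig_polys_diff a f g)
      also have "Lp_norm p (\<lambda>x. a f n x - g x) \<le> Lp_norm p (\<lambda>x. a f n x - f x) + Lp_norm p (\<lambda>x. f x - g x)"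
        by (intro Lp_norm_diff_triangle p1 ti a f fi g)
      also have "Lp_norm p (\<lambda>x. a f n x - f x) \<le> (1 / 4) ^ n"
        using af[OF f, of n] by (simp only: Lp_norm_diff_commute[of p "a f n" f])
      finally have "Lp_norm p (\<lambda>x. T f x - P g x) \<le> Lp_norm p (\<lambda>x. T f x - P (a f n) x) + B * ((1 / 4) ^ n + Lp_norm p (\<lambda>x. f x - g x))"
        using B by (simp add: mult_left_mono)
      also have "\<dots> \<le> 2 * (2 * B) * (1 / 4) ^ n + B * ((1 / 4) ^ n + Lp_norm p (\<lambda>x. f x - g x))"
        by (intro add_right_mono fast f)
      also have "\<dots> = ?R n" by (simp add: algebra_simps)
      finally show ?thesis .
    qed
    moreover have "?R \<longlonglongrightarrow> 5 * B * 0 + B * Lp_norm p (\<lambda>x. f x - g x)"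
      by (intro tendsto_intros LIMSEQ_power_zero) simp
    ultimately have "Lp_norm p (\<lambda>x. T f x - P g x) \<le> 5 * B * 0 + B * Lp_norm p (\<lambda>x. f x - g x)"
      by (intro LIMSEQ_le_const) blast+
    then show ?thesis by simp
  qed
  have Ti: "p_integrable p (T f)" if "f \<in> Lp p" for f using fast(1)[OF that] .
  have zeroI: "t = 0" if "0 \<le> t" "\<And>e. 0 < e \<Longrightarrow> t \<le> K * e" "0 < K" for t K :: real
  proof (rule ccontr)
    assume "t \<noteq> 0"
    then have "0 < t" using that(1) by simp
    then show False using that(2)[of "t / (2 * K)"] that(3) by simp
  qed
  have dense: "\<exists>g\<in>trig_polys. Lp_norm p (\<lambda>x. f x - g x) < e" if "f \<in> Lp p" "0 < e" for f e
    using trig_polys_dense_Lp[OF p1(1), of f e] that by (simp add: Lp_iff)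
  have key': "Lp_norm p (\<lambda>x. T f x - P u x) \<le> B * e" if f: "f \<in> Lp p" and u: "u \<in> trig_polys" and e: "Lp_norm p (\<lambda>x. f x - u x) < e" for f u e
    by (rule order_trans[OF key[OF f u]]) (use e B in simp)
  have bo: "bounded_operator (Lp p) (Lp_norm p) T"
    unfolding bounded_operator_def
  proof (intro conjI ballI allI)
    show "T f \<in> Lp p" if "f \<in> Lp p" for f by (rule TL[OF that])
    show "\<exists>C. \<forall>f\<in>Lp p. Lp_norm p (T f) \<le> C * Lp_norm p f"
    proof (intro exI[of _ B] ballI)
      fix f assume f: "f \<in> Lp p"
      \<comment> \<open>Homogeneity with factor 0 gives the image of the zero function, and
        \<open>key\<close> against it is the norm bound.\<close>
      have "P (\<lambda>x. 0 * 0) = (\<lambda>x. 0 * P (\<lambda>x. 0) x)" by (rule Pcmult[OF trig_polys_const])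
      then show "Lp_norm p (T f) \<le> B * Lp_norm p f" using key[OF f trig_polys_const[of 0]] by simp
    qed
    fix f assume f: "f \<in> Lp p"
    show "Lp_norm p (\<lambda>x. T (\<lambda>y. f y + g y) x - (T f x + T g x)) = 0" if g: "g \<in> Lp p" for g
    proof (rule zeroI[of _ "4 * B"])
      fix e :: real assume e: "0 < e"
      obtain u where u: "u \<in> trig_polys" "Lp_norm p (\<lambda>x. f x - u x) < e" using dense[OF f e] by blast
      obtain v where v: "v \<in> trig_polys" "Lp_norm p (\<lambda>x. g x - v x) < e" using dense[OF g e] by blast
      have fg: "(\<lambda>y. f y + g y) \<in> Lp p" by (rule Lp_add[OF p1(1) f g])
      have uv: "(\<lambda>y. u y + v y) \<in> trig_polys" by (rule trig_polys_add[OF u(1) v(1)])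
      have i: "p_integrable p (\<lambda>x. f x - u x)" "p_integrable p (\<lambda>x. g x - v x)"
        using f g p_integrable_diff[OF p1(1) _ ti[OF u(1)], of f] p_integrable_diff[OF p1(1) _ ti[OF v(1)], of g]
        by (auto simp: Lp_iff)
      have "Lp_norm p (\<lambda>x. T (\<lambda>y. f y + g y) x - (T f x + T g x)) \<le>
          Lp_norm p (\<lambda>x. T (\<lambda>y. f y + g y) x - P (\<lambda>y. u y + v y) x) + Lp_norm p (\<lambda>x. P (\<lambda>y. u y + v y) x - (T f x + T g x))"
        by (intro Lp_norm_diff_triangle p1 Ti fg Pi uv p_integrable_add f g)
      also have "(\<lambda>x. P (\<lambda>y. u y + v y) x - (T f x + T g x)) = (\<lambda>x. (P u x - T f x) + (P v x - T g x))"
        by (simp add: Padd[OF u(1) v(1)] algebra_simps)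
      also have "Lp_norm p (\<lambda>x. (P u x - T f x) + (P v x - T g x)) \<le> Lp_norm p (\<lambda>x. P u x - T f x) + Lp_norm p (\<lambda>x. P v x - T g x)"
        by (intro Lp_norm_triangle p1 p_integrable_diff Pi Ti u v f g)
      also have "Lp_norm p (\<lambda>x. P u x - T f x) \<le> B * e"
        unfolding Lp_norm_diff_commute[of p "P u"] by (rule key'[OF f u])
      also have "Lp_norm p (\<lambda>x. P v x - T g x) \<le> B * e"
        unfolding Lp_norm_diff_commute[of p "P v"] by (rule key'[OF g v])
      also have "Lp_norm p (\<lambda>x. T (\<lambda>y. f y + g y) x - P (\<lambda>y. u y + v y) x) \<le> B * (2 * e)"
      proof -
        have "Lp_norm p (\<lambda>x. (f x + g x) - (u x + v x)) = Lp_norm p (\<lambda>x. (f x - u x) + (g x - v x))"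
          by (simp add: algebra_simps)
        also have "\<dots> \<le> Lp_norm p (\<lambda>x. f x - u x) + Lp_norm p (\<lambda>x. g x - v x)"
          by (intro Lp_norm_triangle p1 i)
        also have "\<dots> \<le> 2 * e" using u(2) v(2) by simp
        finally have "B * Lp_norm p (\<lambda>x. (f x + g x) - (u x + v x)) \<le> B * (2 * e)" using B by simp
        with key[OF fg uv] show ?thesis by simp
      qed
      finally show "Lp_norm p (\<lambda>x. T (\<lambda>y. f y + g y) x - (T f x + T g x)) \<le> 4 * B * e" by (simp add: algebra_simps)
    qed (use B in auto)
    show "Lp_norm p (\<lambda>x. T (\<lambda>y. c * f y) x - c * T f x) = 0" for c
    proof (rule zeroI[of _ "2 * B * (cmod c + 1)"])
      fix e :: real assume e: "0 < e"
      obtain u where u: "u \<in> trig_polys" "Lp_norm p (\<lambda>x. f x - u x) < e" using dense[OF f e] by blast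
      have cf: "(\<lambda>y. c * f y) \<in> Lp p" by (rule Lp_cmult[OF f])
      have cu: "(\<lambda>y. c * u y) \<in> trig_polys" by (rule trig_polys_cmult[OF u(1)])
      have le: "Lp_norm p (\<lambda>x. T f x - P u x) \<le> B * e"
        by (rule key'[OF f u])
      have "Lp_norm p (\<lambda>x. T (\<lambda>y. c * f y) x - c * T f x) \<le>
          Lp_norm p (\<lambda>x. T (\<lambda>y. c * f y) x - P (\<lambda>y. c * u y) x) + Lp_norm p (\<lambda>x. P (\<lambda>y. c * u y) x - c * T f x)"
        by (intro Lp_norm_diff_triangle p1 Ti cf Pi cu p_integrable_cmult f)
      also have "(\<lambda>x. P (\<lambda>y. c * u y) x - c * T f x) = (\<lambda>x. (- c) * (T f x - P u x))"
        by (simp add: Pcmult[OF u(1)] algebra_simps)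
      also have "Lp_norm p (\<lambda>x. (- c) * (T f x - P u x)) \<le> cmod c * (B * e)"
        unfolding Lp_norm_cmult[OF p1(2)] using le by (simp add: mult_left_mono)
      also have "Lp_norm p (\<lambda>x. T (\<lambda>y. c * f y) x - P (\<lambda>y. c * u y) x) \<le> B * (cmod c * e)"
      proof -
        have "Lp_norm p (\<lambda>x. c * f x - c * u x) = cmod c * Lp_norm p (\<lambda>x. f x - u x)"
          unfolding right_diff_distrib[symmetric] by (rule Lp_norm_cmult[OF p1(2)])
        also have "\<dots> \<le> cmod c * e" using u(2) by (intro mult_left_mono) auto
        finally have "B * Lp_norm p (\<lambda>x. c * f x - c * u x) \<le> B * (cmod c * e)" using B by simp
        with key[OF cf cu] show ?thesis by simp
      qed
      finally have "Lp_norm p (\<lambda>x. T (\<lambda>y. c * f y) x - c * T f x) \<le> 2 * B * cmod c * e" by (simp add: algebra_simps)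
      also have "\<dots> \<le> 2 * B * (cmod c + 1) * e" using B e by (intro mult_right_mono mult_left_mono) auto
      finally show "Lp_norm p (\<lambda>x. T (\<lambda>y. c * f y) x - c * T f x) \<le> 2 * B * (cmod c + 1) * e" .
    qed (use B in \<open>auto intro!: mult_pos_pos add_nonneg_pos\<close>)
  qed
  have "Lp_norm p (\<lambda>x. T f x - P f x) = 0" if f: "f \<in> trig_polys" for f
  proof -
    have "Lp_norm p (\<lambda>x. T f x - P f x) \<le> 0" using key[OF trig_polys_Lp[OF p1(2) f] f] by simp
    then show ?thesis by (simp add: order_antisym)
  qed
  with bo show ?thesis unfolding P_def by blast
qed

text \<open>The operator is a choice among possible extensions; both directions of the theorem use
  it only through these two facts.\<close>

lemma
  assumes "1 < p"
  shows pseudo_diff_op_bounded: "bounded_operator (Lp p) (Lp_norm p) (pseudo_diff_op p \<sigma>)"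
    and pseudo_diff_op_trig: "f \<in> trig_polys \<Longrightarrow> Lp_norm p (\<lambda>x. pseudo_diff_op p \<sigma> f x - pseudo_diff_trig \<sigma> f x) = 0"
  using someI_ex[OF extension_exists[OF assms]] unfolding pseudo_diff_op_def by blast+

end

section \<open>Symbols vanishing at infinity\<close>

context zero_order_symbol
begin

text \<open>The order of choices matters: first \<open>n\<close>, to make the increment term small;
  then \<open>\<epsilon>\<close> depending on \<open>n\<close>; last \<open>N\<close>, from the
  limit hypothesis for this \<open>\<epsilon>\<close>.\<close>

lemma symbol_trig_tail_small:
  assumes p: "1 < p" and lim: "((\<lambda>k. SUP x. cmod (\<sigma> x k)) \<longlongrightarrow> 0) (filtercomap abs at_top)" and \<delta>: "0 < \<delta>"
  shows "\<exists>N>0. \<forall>K c. finite K \<longrightarrow> Lp_norm p (symbol_trig \<sigma> {k\<in>K. N \<le> k \<or> k \<le> - N} c) \<le> \<delta> * Lp_norm p (trig K c)"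
proof -
  obtain C A \<theta> where C: "0 < C" "0 < A" "0 < \<theta>" and \<sigma>A: "\<forall>x k. cmod (\<sigma> x k) \<le> A"
    and bound0: "\<forall>\<epsilon> N M K c n. 0 \<le> N \<longrightarrow> 0 \<le> M \<longrightarrow> - M < N \<longrightarrow>
    (\<forall>x k. N \<le> k \<or> k \<le> - M \<longrightarrow> cmod (\<sigma> x k) \<le> \<epsilon>) \<longrightarrow> 0 < \<epsilon> \<longrightarrow> \<epsilon> \<le> A \<longrightarrow> finite K \<longrightarrow> 0 < n \<longrightarrow>
    Lp_norm p (symbol_trig \<sigma> {k\<in>K. N \<le> k \<or> k \<le> - M} c) \<le>
      C * (real n * (\<epsilon> powr \<theta>) powr p + real n powr (1 - p)) powr (1 / p) * Lp_norm p (trig K c)"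
    using symbol_trig_tail[OF p] by - (elim exE conjE, rule that)
  note bound = bound0[rule_format]
  \<comment> \<open>The size that the sum of the two terms may have so that \<open>C\<close> times
    its p-th root is at most \<open>\<delta>\<close>.\<close>
  define \<kappa> where "\<kappa> = (\<delta> / C) powr p"
  have \<kappa>: "0 < \<kappa>" using \<delta> C by (simp add: \<kappa>_def)
  have "((\<lambda>n. real n powr (1 - p)) \<longlongrightarrow> 0) sequentially"
    by (rule tendsto_neg_powr[OF _ filterlim_real_sequentially]) (use p in simp)
  then have "eventually (\<lambda>n. real n powr (1 - p) < \<kappa> / 2) sequentially"
    using \<kappa> by (intro order_tendstoD) auto
  then have "eventually (\<lambda>n. real n powr (1 - p) < \<kappa> / 2 \<and> 0 < n) sequentially"
    using eventually_gt_at_top[of 0] by eventually_elim simp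
  then obtain n where n: "real n powr (1 - p) < \<kappa> / 2" "0 < n"
    by (auto simp: eventually_sequentially)
  \<comment> \<open>The second entry of the minimum solves
    \<open>real n * (\<epsilon> powr \<theta>) powr p = \<kappa> / 2\<close>; the first keeps
    \<open>\<epsilon>\<close> admissible.\<close>
  define \<epsilon> where "\<epsilon> = min A ((\<kappa> / (2 * real n)) powr (1 / (\<theta> * p)))"
  have \<epsilon>: "0 < \<epsilon>" "\<epsilon> \<le> A" using C \<kappa> n by (auto simp: \<epsilon>_def)
  have "(\<epsilon> powr \<theta>) powr p \<le> (((\<kappa> / (2 * real n)) powr (1 / (\<theta> * p))) powr \<theta>) powr p"
    using \<epsilon> C p by (intro powr_mono2) (auto simp: \<epsilon>_def)
  also have "\<dots> = \<kappa> / (2 * real n)"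
    using C p \<kappa> n by (simp add: powr_powr)
  finally have "real n * (\<epsilon> powr \<theta>) powr p \<le> real n * (\<kappa> / (2 * real n))"
    by (intro mult_left_mono) auto
  then have "real n * (\<epsilon> powr \<theta>) powr p \<le> \<kappa> / 2" using n by simp
  then have sum: "real n * (\<epsilon> powr \<theta>) powr p + real n powr (1 - p) \<le> \<kappa>" using n by linarith
  have "(real n * (\<epsilon> powr \<theta>) powr p + real n powr (1 - p)) powr (1 / p) \<le> \<kappa> powr (1 / p)"
    using p by (intro powr_mono2 sum) auto
  also have "\<dots> = \<delta> / C" using \<delta> C p by (simp add: \<kappa>_def powr_powr)
  finally have small: "C * (real n * (\<epsilon> powr \<theta>) powr p + real n powr (1 - p)) powr (1 / p) \<le> \<delta>"
    using C by (simp add: field_simps)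
  have bdd: "bdd_above (range (\<lambda>x. cmod (\<sigma> x k)))" for k
    using \<sigma>A by (intro bdd_aboveI[of _ A]) auto
  have "eventually (\<lambda>k. (SUP x. cmod (\<sigma> x k)) < \<epsilon>) (filtercomap abs at_top)"
    using lim \<epsilon> by (intro order_tendstoD) auto
  then obtain Q where Q: "eventually Q at_top" "\<And>k. Q \<bar>k\<bar> \<Longrightarrow> (SUP x. cmod (\<sigma> x k)) < \<epsilon>"
    unfolding eventually_filtercomap by blast
  obtain N0 where N0: "\<And>k. N0 \<le> k \<Longrightarrow> Q k" using Q(1) unfolding eventually_at_top_linorder by blast
  define N where "N = max 1 N0"
  have "cmod (\<sigma> x k) \<le> \<epsilon>" if "N \<le> k \<or> k \<le> - N" for x k
  proof -
    have "N0 \<le> \<bar>k\<bar>" using that by (auto simp: N_def)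
    then have "(SUP x. cmod (\<sigma> x k)) < \<epsilon>" using Q(2) N0 by blast
    moreover have "cmod (\<sigma> x k) \<le> (SUP x. cmod (\<sigma> x k))" by (rule cSUP_upper[OF UNIV_I bdd])
    ultimately show ?thesis by linarith
  qed
  then have "Lp_norm p (symbol_trig \<sigma> {k\<in>K. N \<le> k \<or> k \<le> - N} c) \<le> \<delta> * Lp_norm p (trig K c)" if "finite K" for K c
    using bound[of N N \<epsilon> K n c] that \<epsilon> n small mult_right_mono[OF small, of "Lp_norm p (trig K c)"]
    by (fastforce simp: N_def)
  then show ?thesis by (intro exI[of _ N]) (simp add: N_def)
qed

text \<open>The exponent \<open>s = 1\<close> always works, since the image of the unit ball is
  totally bounded. Three errors of at most \<open>\<epsilon> / 4\<close> arise: from the polynomial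
  approximation, from the tail, and from rounding the remaining coefficients.\<close>

theorem symbol_vanishing_imp_riesz:
  assumes p: "1 < p" and lim: "((\<lambda>k. SUP x. cmod (\<sigma> x k)) \<longlongrightarrow> 0) (filtercomap abs at_top)"
  shows "riesz_operator (Lp p) (Lp_norm p) (pseudo_diff_op p \<sigma>)"
  unfolding riesz_operator_def
proof (intro conjI allI impI)
  define T where "T = pseudo_diff_op p \<sigma>"
  have bo: "bounded_operator (Lp p) (Lp_norm p) T" unfolding T_def by (rule pseudo_diff_op_bounded[OF p])
  then show "bounded_operator (Lp p) (Lp_norm p) (pseudo_diff_op p \<sigma>)" by (simp add: T_def)
  fix \<epsilon> :: real assume \<epsilon>: "0 < \<epsilon>"
  have p1: "1 \<le> p" "0 < p" using p by auto
  have TL: "T f \<in> Lp p" if "f \<in> Lp p" for f using bo that by (auto simp: bounded_operator_def)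
  obtain C0 where C0: "\<And>f. f \<in> Lp p \<Longrightarrow> Lp_norm p (T f) \<le> C0 * Lp_norm p f"
    using bo unfolding bounded_operator_def by blast
  define C where "C = \<bar>C0\<bar> + 1"
  have C: "0 < C" by (simp add: C_def)
  have TC: "Lp_norm p (T f) \<le> C * Lp_norm p f" if "f \<in> Lp p" for f
  proof -
    have "C0 * Lp_norm p f \<le> C * Lp_norm p f" by (intro mult_right_mono) (auto simp: C_def)
    then show ?thesis using C0[OF that] by linarith
  qed
  obtain A where A: "0 < A" "\<And>x k. cmod (\<sigma> x k) \<le> A" using symbol_bounded by blast
  obtain N where N: "0 < N" and tail: "\<And>K c. finite K \<Longrightarrow> Lp_norm p (symbol_trig \<sigma> {k\<in>K. N \<le> k \<or> k \<le> - N} c) \<le> (\<epsilon> / 8) * Lp_norm p (trig K c)"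
    using symbol_trig_tail_small[OF p lim, of "\<epsilon> / 8"] \<epsilon> by auto
  define J where "J = {- N<..<N}"
  have J: "finite J" "0 < card J" using N by (auto simp: J_def card_gt_0_iff)
  \<comment> \<open>Rounding \<open>card J\<close> coefficients by \<open>\<delta>\<close> changes
    the image by at most \<open>card J * A * \<delta> = \<epsilon> / 4\<close>.\<close>
  define \<delta> where "\<delta> = \<epsilon> / (4 * real (card J) * A)"
  have \<delta>: "0 < \<delta>" using \<epsilon> J A by (simp add: \<delta>_def)
  \<comment> \<open>The approximants below have norm at most 2, and so have their Fourier
    coefficients.\<close>
  have "compact (cball (0::complex) 2)" by simp
  then obtain G where G: "finite G" "cball (0::complex) 2 \<subseteq> (\<Union>z\<in>G. ball z \<delta>)"
    using \<delta> unfolding compact_eq_totally_bounded by blast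
  define V where "V = symbol_trig \<sigma> J ` PiE J (\<lambda>_. G)"
  have V: "finite V" "V \<subseteq> Lp p"
    using J G by (auto simp: V_def intro: finite_PiE symbol_trig_Lp[OF p1(2)])
  have cover: "\<exists>v\<in>V. Lp_norm p (\<lambda>x. T f x - v x) \<le> \<epsilon>" if f: "f \<in> Lp p" "Lp_norm p f \<le> 1" for f
  proof -
    have fi: "p_integrable p f" using f by (simp add: Lp_iff)
    \<comment> \<open>The bound 1 keeps the norm of the approximant at most 2; the other makes the
      error at most \<open>\<epsilon> / 4\<close> after applying \<open>T\<close>.\<close>
    define e where "e = min 1 (\<epsilon> / (4 * C))"
    have e: "0 < e" using \<epsilon> C by (simp add: e_def)
    obtain g where g: "g \<in> trig_polys" "Lp_norm p (\<lambda>x. f x - g x) < e"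
      using trig_polys_dense_Lp[OF p1(1) fi e] by blast
    obtain K c where K: "finite K" "g = trig K c" using g(1) by (auto simp: trig_polys_iff)
    have gL: "g \<in> Lp p" by (rule trig_polys_Lp[OF p1(2) g(1)])
    have gi: "p_integrable p g" using gL by (simp add: Lp_iff)
    have "Lp_norm p g \<le> Lp_norm p f + Lp_norm p (\<lambda>x. g x - f x)"
      by (rule Lp_norm_le_add_diff[OF p1(1) gi fi])
    then have g2: "Lp_norm p g \<le> 2"
      using g(2) f(2) by (simp add: Lp_norm_diff_commute[of p g] e_def)
    define c' where "c' k = fourier_coeff g k" for k
    have c'K: "c' k = (if k \<in> K then c k else 0)" for k
      using K by (simp add: c'_def fourier_coeff_trig')
    have "\<exists>z\<in>G. cmod (c' k - z) < \<delta>" for k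
    proof -
      have "c' k \<in> cball 0 2" using fourier_coeff_le[OF p gi, of k] g2 by (simp add: c'_def)
      then obtain z where "z \<in> G" "c' k \<in> ball z \<delta>" using G(2) by blast
      then show ?thesis by (intro bexI[of _ z]) (auto simp: dist_norm norm_minus_commute)
    qed
    then obtain z0 where z0: "\<And>k. z0 k \<in> G" "\<And>k. cmod (c' k - z0 k) < \<delta>" by metis
    define z where "z = restrict z0 J"
    have z: "z \<in> PiE J (\<lambda>_. G)" "\<And>k. k \<in> J \<Longrightarrow> z k = z0 k" using z0(1) by (auto simp: z_def)
    define v where "v = symbol_trig \<sigma> J z"
    have "v \<in> V" using z by (auto simp: V_def v_def)
    define P where "P = pseudo_diff_trig \<sigma> g"
    define u where "u = symbol_trig \<sigma> J c'"
    let ?t = "symbol_trig \<sigma> {k\<in>K. N \<le> k \<or> k \<le> - N} c"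
    have i: "p_integrable p (T f)" "p_integrable p (T g)" "p_integrable p P" "p_integrable p u" "p_integrable p v" "p_integrable p ?t"
      using TL[OF f(1)] TL[OF gL] pseudo_diff_trig_Lp[OF p1(2) g(1)] symbol_trig_Lp[OF p1(2)]
      by (auto simp: Lp_iff P_def u_def v_def)
    have n1: "Lp_norm p (\<lambda>x. T f x - T g x) \<le> \<epsilon> / 4"
    proof -
      have "Lp_norm p (\<lambda>x. T f x - T g x) \<le> C * Lp_norm p (\<lambda>x. f x - g x)"
        by (rule bounded_operator_diff[OF p1(1) bo TC f(1) gL])
      also have "\<dots> \<le> C * (\<epsilon> / (4 * C))"
        using g(2) C by (intro mult_left_mono) (auto simp: e_def)
      finally show ?thesis using C by simp
    qed
    have n2: "Lp_norm p (\<lambda>x. T g x - P x) = 0"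
      unfolding T_def P_def by (rule pseudo_diff_op_trig[OF p g(1)])
    have n3: "Lp_norm p (\<lambda>x. P x - u x) \<le> \<epsilon> / 4"
    proof -
      have "P x - u x = ?t x" for x
      proof -
        have "u x = (\<Sum>k\<in>{k\<in>K. k \<in> J}. \<sigma> x k * c k * cis (x * of_int k))"
          unfolding u_def symbol_trig_def trig_def using J
          by (intro sum.mono_neutral_cong_right) (auto simp: c'K)
        moreover have "P x = (\<Sum>k\<in>K. \<sigma> x k * c k * cis (x * of_int k))"
          using K by (simp add: P_def pseudo_diff_trig_eq symbol_trig_def trig_def)
        moreover have "K = {k\<in>K. N \<le> k \<or> k \<le> - N} \<union> {k\<in>K. k \<in> J}" by (auto simp: J_def)
        then have "(\<Sum>k\<in>K. \<sigma> x k * c k * cis (x * of_int k)) =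
            (\<Sum>k\<in>{k\<in>K. N \<le> k \<or> k \<le> - N}. \<sigma> x k * c k * cis (x * of_int k)) + (\<Sum>k\<in>{k\<in>K. k \<in> J}. \<sigma> x k * c k * cis (x * of_int k))"
          using K(1) by (subst sum.union_disjoint[symmetric]) (auto simp: J_def)
        ultimately show ?thesis by (simp add: symbol_trig_def trig_def)
      qed
      then have "Lp_norm p (\<lambda>x. P x - u x) \<le> (\<epsilon> / 8) * Lp_norm p g" using tail[OF K(1), of c] K(2) by simp
      also have "\<dots> \<le> (\<epsilon> / 8) * 2" using g2 \<epsilon> by (intro mult_left_mono) auto
      finally show ?thesis by simp
    qed
    have n4: "Lp_norm p (\<lambda>x. u x - v x) \<le> \<epsilon> / 4"
    proof (rule Lp_norm_bounded)
      have "cmod (u x - v x) \<le> \<epsilon> / 4" for x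
      proof -
        have "u x - v x = (\<Sum>k\<in>J. \<sigma> x k * (c' k - z0 k) * cis (x * of_int k))"
          unfolding u_def v_def symbol_trig_def trig_def sum_subtractf[symmetric]
          by (intro sum.cong) (auto simp: z algebra_simps)
        also have "cmod \<dots> \<le> (\<Sum>k\<in>J. A * \<delta>)"
        proof (rule sum_norm_le)
          show "cmod (\<sigma> x k * (c' k - z0 k) * cis (x * of_int k)) \<le> A * \<delta>" for k
            using mult_mono[OF A(2)[of x k] less_imp_le[OF z0(2)[of k]]] A(1) by (simp add: norm_mult)
        qed
        also have "\<dots> = \<epsilon> / 4"
        proof -
          have "m * (A * (\<epsilon> / (4 * m * A))) = \<epsilon> / 4" if "0 < m" for m using that A(1) by simp
          from this[of "real (card J)"] show ?thesis using J(2) by (simp only: \<delta>_def sum_constant of_nat_0_less_iff)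
        qed
        finally show ?thesis .
      qed
      then show "AE x in torus_measure. cmod (u x - v x) \<le> \<epsilon> / 4" by (intro AE_I2)
    qed (use p1 \<epsilon> in auto)
    have "Lp_norm p (\<lambda>x. T f x - v x) \<le> Lp_norm p (\<lambda>x. T f x - T g x) + Lp_norm p (\<lambda>x. T g x - v x)"
      by (intro Lp_norm_diff_triangle p1 i)
    also have "Lp_norm p (\<lambda>x. T g x - v x) \<le> Lp_norm p (\<lambda>x. T g x - P x) + Lp_norm p (\<lambda>x. P x - v x)"
      by (intro Lp_norm_diff_triangle p1 i)
    also have "Lp_norm p (\<lambda>x. P x - v x) \<le> Lp_norm p (\<lambda>x. P x - u x) + Lp_norm p (\<lambda>x. u x - v x)"
      by (intro Lp_norm_diff_triangle p1 i)
    finally have "Lp_norm p (\<lambda>x. T f x - v x) \<le> \<epsilon>" using n1 n2 n3 n4 \<epsilon> by linarith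
    with \<open>v \<in> V\<close> show ?thesis by blast
  qed
  have "(T ^^ 1) ` unit_ball (Lp p) (Lp_norm p) \<subseteq>
      (\<Union>v\<in>V. (\<lambda>b x. v x + of_real (\<epsilon> ^ 1) * b x) ` unit_ball (Lp p) (Lp_norm p))"
  proof
    fix h assume "h \<in> (T ^^ 1) ` unit_ball (Lp p) (Lp_norm p)"
    then obtain f where f: "f \<in> Lp p" "Lp_norm p f \<le> 1" "h = T f" by (auto simp: unit_ball_def)
    obtain v where v: "v \<in> V" "Lp_norm p (\<lambda>x. T f x - v x) \<le> \<epsilon>" using cover[OF f(1,2)] by blast
    define b where "b x = of_real (1 / \<epsilon>) * (T f x - v x)" for x
    have "b \<in> Lp p" unfolding b_def using v V by (intro Lp_cmult Lp_diff p1 TL f) auto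
    moreover have "Lp_norm p b \<le> 1"
      unfolding b_def Lp_norm_cmult[OF p1(2)] norm_of_real using v(2) \<epsilon> by (simp add: divide_le_eq)
    ultimately have "b \<in> unit_ball (Lp p) (Lp_norm p)" by (simp add: unit_ball_def)
    moreover have "h = (\<lambda>x. v x + of_real (\<epsilon> ^ 1) * b x)"
      using \<epsilon> f(3) by (simp add: b_def)
    ultimately show "h \<in> (\<Union>v\<in>V. (\<lambda>b x. v x + of_real (\<epsilon> ^ 1) * b x) ` unit_ball (Lp p) (Lp_norm p))"
      using v(1) by blast
  qed
  then show "\<exists>s\<ge>1. \<exists>V. finite V \<and> V \<subseteq> Lp p \<and> (pseudo_diff_op p \<sigma> ^^ s) ` unit_ball (Lp p) (Lp_norm p) \<subseteq>
      (\<Union>v\<in>V. (\<lambda>b x. v x + of_real (\<epsilon> ^ s) * b x) ` unit_ball (Lp p) (Lp_norm p))"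
    using V unfolding T_def by (intro exI[of _ 1] conjI exI[of _ V]) auto
qed

end

section \<open>Symbols not vanishing at infinity\<close>

lemma torus_representative:
  obtains n :: int where "x - of_int n * (2 * pi) \<in> torus"
proof -
  define n where "n = \<lfloor>x / (2 * pi)\<rfloor>"
  have "of_int n \<le> x / (2 * pi)" "x / (2 * pi) < of_int n + 1" unfolding n_def by linarith+
  then have "of_int n * (2 * pi) \<le> x" "x < (of_int n + 1) * (2 * pi)" by (simp_all add: field_simps)
  then have "x - of_int n * (2 * pi) \<in> torus" by (simp add: algebra_simps)
  then show ?thesis by (rule that)
qed

text \<open>As the chord is at most 2 and its square is \<open>2 - 2 * cos t\<close>, it is at least
  \<open>1 - cos t\<close>, which has an explicit primitive. The oscillating part of the integral is
  at most \<open>2 / \<bar>m\<bar>\<close>, hence at most half of the interval length.\<close>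

lemma integral_interval_cis_diff:
  assumes ab: "0 \<le> a" "a < b" "b < 2 * pi" and m: "4 / (b - a) \<le> \<bar>real_of_int m\<bar>"
  shows "(b - a) / (4 * pi) \<le> (LINT x|torus_measure. indicator {a..b} x * cmod (cis (x * of_int m) - 1))"
proof -
  have m0: "m \<noteq> 0" using m ab by auto
  have sq: "(cmod (cis t - 1))\<^sup>2 = 2 - 2 * cos t" for t
    unfolding cmod_power2 using sin_cos_squared_add[of t] by (simp add: power2_eq_square algebra_simps)
  have le2: "cmod (cis t - 1) \<le> 2" for t using norm_triangle_ineq4[of "cis t" 1] by simp
  have half: "1 - cos t \<le> cmod (cis t - 1)" for t
  proof -
    have "2 - 2 * cos t \<le> 2 * cmod (cis t - 1)"
      unfolding sq[symmetric] power2_eq_square using le2[of t] by (intro mult_right_mono) auto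
    then show ?thesis by simp
  qed
  define F where "F x = x - sin (x * of_int m) / of_int m" for x :: real
  have "(LINT x|lborel. indicator {a..b} x *\<^sub>R (1 - cos (x * of_int m))) = F b - F a"
  proof (rule integral_FTC_atLeastAtMost)
    show "(F has_vector_derivative 1 - cos (x * of_int m)) (at x within {a..b})" for x
      unfolding F_def has_real_derivative_iff_has_vector_derivative[symmetric]
      using m0 by (auto intro!: derivative_eq_intros)
  qed (use ab in \<open>auto intro!: continuous_intros\<close>)
  moreover have "(b - a) / 2 \<le> F b - F a"
  proof -
    have "\<bar>sin (b * of_int m) - sin (a * of_int m)\<bar> \<le> 2"
      using abs_sin_le_one[of "b * of_int m"] abs_sin_le_one[of "a * of_int m"] by linarith
    then have "\<bar>(sin (b * of_int m) - sin (a * of_int m)) / of_int m\<bar> \<le> 2 / \<bar>real_of_int m\<bar>"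
      unfolding abs_divide by (intro divide_right_mono) auto
    also have "\<dots> \<le> (b - a) / 2" using m ab m0 by (simp add: field_simps)
    finally have "\<bar>sin (b * of_int m) / of_int m - sin (a * of_int m) / of_int m\<bar> \<le> (b - a) / 2"
      by (simp add: diff_divide_distrib)
    moreover have "(b - a) / 2 \<le> b - s - (a - t)" if "\<bar>s - t\<bar> \<le> (b - a) / 2" for s t :: real
      using that unfolding abs_le_iff by (simp add: field_simps)
    ultimately show ?thesis unfolding F_def by blast
  qed
  moreover have "(LINT x|torus_measure. indicator {a..b} x * (1 - cos (x * of_int m))) =
      (LINT x|lborel. indicator {a..b} x *\<^sub>R (1 - cos (x * of_int m))) / (2 * pi)"
  proof -
    have "(LINT x|lborel. indicator torus x *\<^sub>R (indicator {a..b} x * (1 - cos (x * of_int m)))) =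
        (LINT x|lborel. indicator {a..b} x *\<^sub>R (1 - cos (x * of_int m)))"
      using ab by (intro Bochner_Integration.integral_cong) (auto simp: indicator_def)
    moreover have "(LINT x|torus_measure. indicator {a..b} x * (1 - cos (x * of_int m))) =
        (LINT x|lborel. indicator torus x *\<^sub>R (indicator {a..b} x * (1 - cos (x * of_int m)))) /\<^sub>R (2 * pi)"
      by (subst integral_torus) (simp_all add: set_lebesgue_integral_def)
    ultimately show ?thesis by (simp only: real_scaleR_def divide_inverse mult.commute)
  qed
  ultimately have "(b - a) / 2 / (2 * pi) \<le> (LINT x|torus_measure. indicator {a..b} x * (1 - cos (x * of_int m)))"
    by (simp only:) (intro divide_right_mono, auto)
  also have "\<dots> \<le> (LINT x|torus_measure. indicator {a..b} x * cmod (cis (x * of_int m) - 1))"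
  proof (rule integral_mono)
    show "integrable torus_measure (\<lambda>x. indicator {a..b} x * (1 - cos (x * of_int m)))"
    proof (rule integrable_torus_bounded[where B = 2])
      show "norm (indicator {a..b} x * (1 - cos (x * of_int m))) \<le> 2" for x
        using abs_cos_le_one[of "x * of_int m"] unfolding indicator_def real_norm_def by (cases "x \<in> {a..b}") auto
    qed measurable
    show "integrable torus_measure (\<lambda>x. indicator {a..b} x * cmod (cis (x * of_int m) - 1))"
    proof (rule integrable_torus_bounded[where B = 2])
      show "norm (indicator {a..b} x * cmod (cis (x * of_int m) - 1)) \<le> 2" for x
        using le2[of "x * of_int m"] by (simp add: indicator_def)
    qed (simp add: cis_conv_exp)
    show "indicator {a..b} x * (1 - cos (x * of_int m)) \<le> indicator {a..b} x * cmod (cis (x * of_int m) - 1)" for x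
      by (intro mult_left_mono half) auto
  qed
  finally show ?thesis by simp
qed

lemma eventually_abs_int: "eventually P (filtercomap abs (at_top :: int filter)) \<longleftrightarrow> (\<exists>N. \<forall>k. N \<le> \<bar>k\<bar> \<longrightarrow> P k)"
proof
  assume "eventually P (filtercomap abs (at_top :: int filter))"
  then obtain Q where "eventually Q at_top" "\<And>k. Q \<bar>k\<bar> \<Longrightarrow> P k" unfolding eventually_filtercomap by blast
  then show "\<exists>N. \<forall>k. N \<le> \<bar>k\<bar> \<longrightarrow> P k" unfolding eventually_at_top_linorder by blast
next
  assume "\<exists>N. \<forall>k. N \<le> \<bar>k\<bar> \<longrightarrow> P k"
  then obtain N where "\<And>k. N \<le> \<bar>k\<bar> \<Longrightarrow> P k" by blast
  then show "eventually P (filtercomap abs at_top)"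
    unfolding eventually_filtercomap using eventually_ge_at_top[of N] by blast
qed

context zero_order_symbol
begin

text \<open>The first difference is of order \<open>1 / japanese_bracket k\<close>, uniformly in
  \<open>x\<close>, and a fixed shift is a sum of \<open>\<bar>j\<bar>\<close> unit shifts. Thus a
  fixed modulation does not see the dependence of the symbol on the frequency in the limit.\<close>

lemma symbol_slowly_varying:
  fixes j :: int
  assumes "0 < e"
  shows "\<exists>N. \<forall>k x. N \<le> \<bar>k\<bar> \<longrightarrow> cmod (\<sigma> x (k + j) - \<sigma> x k) < e"
  using assms
proof (induction j arbitrary: e rule: int_induct[where k = 0])
  case base
  then show ?case by simp
next
  obtain A where A: "0 < A" "\<And>x. symbol_bound A (\<sigma> x)" using symbol_bounds by blast
  have unit: "\<exists>N. \<forall>k x. N \<le> \<bar>k\<bar> \<longrightarrow> cmod (\<sigma> x (k + 1) - \<sigma> x k) < e" if e: "0 < e" for e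
  proof -
    obtain N where N: "2 * A / e < of_int N" using ex_less_of_int by blast
    have "cmod (\<sigma> x (k + 1) - \<sigma> x k) < e" if k: "N \<le> \<bar>k\<bar>" for k x
    proof -
      have "cmod (fwd_diff 1 (\<sigma> x) k) \<le> A * japanese_bracket k powr (- real 1)"
        using A(2)[of x] unfolding symbol_bound_def by (metis one_le_numeral)
      then have le: "cmod (\<sigma> x (k + 1) - \<sigma> x k) \<le> A / japanese_bracket k"
        using japanese_bracket_ge[of k] by (simp add: fwd_diff_cases(2)[simplified] powr_minus_divide)
      have "real_of_int N \<le> \<bar>of_int k\<bar>" using k by linarith
      then have g: "A / e < japanese_bracket k" using japanese_bracket_ge[of k] N by simp
      moreover have "0 < A / e" using A e by simp
      ultimately have "A < e * japanese_bracket k" "0 < japanese_bracket k" using e by (simp add: field_simps, linarith)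
      then have "A / japanese_bracket k < e" by (simp add: divide_less_eq)
      with le show ?thesis by linarith
    qed
    then show ?thesis by blast
  qed
  {
    case (step1 i)
    obtain N1 where N1: "\<And>k x. N1 \<le> \<bar>k\<bar> \<Longrightarrow> cmod (\<sigma> x (k + i) - \<sigma> x k) < e / 2"
      using step1.IH[of "e / 2"] step1.prems by auto
    obtain N2 where N2: "\<And>k x. N2 \<le> \<bar>k\<bar> \<Longrightarrow> cmod (\<sigma> x (k + 1) - \<sigma> x k) < e / 2"
      using unit[of "e / 2"] step1.prems by auto
    have "cmod (\<sigma> x (k + (i + 1)) - \<sigma> x k) < e" if "max N1 (N2 + \<bar>i\<bar>) \<le> \<bar>k\<bar>" for k x
    proof -
      have "cmod (\<sigma> x (k + i + 1) - \<sigma> x (k + i)) < e / 2" using that by (intro N2) auto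
      moreover have "cmod (\<sigma> x (k + i) - \<sigma> x k) < e / 2" using that by (intro N1) auto
      moreover have "\<sigma> x (k + (i + 1)) - \<sigma> x k = (\<sigma> x (k + i + 1) - \<sigma> x (k + i)) + (\<sigma> x (k + i) - \<sigma> x k)"
        by (simp add: add.assoc)
      ultimately show ?thesis
        using norm_triangle_ineq[of "\<sigma> x (k + i + 1) - \<sigma> x (k + i)" "\<sigma> x (k + i) - \<sigma> x k"] by simp
    qed
    then show ?case by blast
  next
    case (step2 i)
    obtain N1 where N1: "\<And>k x. N1 \<le> \<bar>k\<bar> \<Longrightarrow> cmod (\<sigma> x (k + i) - \<sigma> x k) < e / 2"
      using step2.IH[of "e / 2"] step2.prems by auto
    obtain N2 where N2: "\<And>k x. N2 \<le> \<bar>k\<bar> \<Longrightarrow> cmod (\<sigma> x (k + 1) - \<sigma> x k) < e / 2"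
      using unit[of "e / 2"] step2.prems by auto
    have "cmod (\<sigma> x (k + (i - 1)) - \<sigma> x k) < e" if "max N1 (N2 + \<bar>i - 1\<bar>) \<le> \<bar>k\<bar>" for k x
    proof -
      have "cmod (\<sigma> x (k + (i - 1) + 1) - \<sigma> x (k + (i - 1))) < e / 2" using that by (intro N2) auto
      moreover have "cmod (\<sigma> x (k + i) - \<sigma> x k) < e / 2" using that by (intro N1) auto
      moreover have "\<sigma> x (k + (i - 1)) - \<sigma> x k = (\<sigma> x (k + i) - \<sigma> x k) - (\<sigma> x (k + (i - 1) + 1) - \<sigma> x (k + (i - 1)))"
        by simp
      ultimately show ?thesis
        using norm_triangle_ineq4[of "\<sigma> x (k + i) - \<sigma> x k" "\<sigma> x (k + (i - 1) + 1) - \<sigma> x (k + (i - 1))"] by simp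
    qed
    then show ?case by blast
  }
qed

text \<open>The derivative is bounded uniformly in \<open>k\<close>, so the functions
  \<open>\<sigma> x k\<close> of \<open>x\<close> are equicontinuous, as the Arzela--Ascoli theorem
  demands.\<close>

lemma symbol_lipschitz: "\<exists>L>0. \<forall>k x y. cmod (\<sigma> x k - \<sigma> y k) \<le> L * \<bar>x - y\<bar>"
proof -
  obtain A where A: "0 < A" "\<And>x. symbol_bound A (d\<sigma> x)" using symbol_bounds by blast
  have "cmod (\<sigma> x k - \<sigma> y k) \<le> A * norm (x - y)" for k x y
  proof (rule differentiable_bound[of UNIV _ "\<lambda>t h. h *\<^sub>R d\<sigma> t k"])
    show "((\<lambda>x. \<sigma> x k) has_derivative (\<lambda>h. h *\<^sub>R d\<sigma> t k)) (at t within UNIV)" for t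
      using symbol_has_derivative[of k t] by (simp add: has_vector_derivative_def)
    show "onorm (\<lambda>h. h *\<^sub>R d\<sigma> t k) \<le> A" for t
    proof (rule onorm_le)
      show "norm (h *\<^sub>R d\<sigma> t k) \<le> A * norm h" for h
        unfolding norm_scaleR real_norm_def mult.commute[of "\<bar>h\<bar>"]
        by (rule mult_right_mono[OF symbol_bound_le[OF A(2)]]) simp
    qed
  qed auto
  then show ?thesis using A(1) by (intro exI[of _ A]) auto
qed

lemma symbol_representative: "\<exists>x'\<in>torus. \<forall>k. \<sigma> x k = \<sigma> x' k"
proof -
  obtain n :: int where n: "x - of_int n * (2 * pi) \<in> torus" by (rule torus_representative)
  have "\<sigma> (x - of_int n * (2 * pi)) k = \<sigma> x k" for k
  proof -
    interpret periodic_fun_simple "\<lambda>x. \<sigma> x k" "2 * pi" by (rule periodic_symbol)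
    show ?thesis by (rule minus_of_int)
  qed
  then show ?thesis using n by (intro bexI[of _ "x - of_int n * (2 * pi)"]) auto
qed

text \<open>Failure of the limit gives frequencies beyond every bound at which the supremum exceeds
  \<open>e / 2\<close>; Arzela--Ascoli extracts a uniformly convergent subsequence.\<close>

lemma symbol_nonvanishing_limit:
  assumes "\<not> ((\<lambda>k. SUP x. cmod (\<sigma> x k)) \<longlongrightarrow> 0) (filtercomap abs at_top)"
  obtains \<kappa> :: "nat \<Rightarrow> int" and \<omega> :: "real \<Rightarrow> complex" and x0 where
    "filterlim (\<lambda>n. \<bar>\<kappa> n\<bar>) at_top sequentially"
    "uniform_limit UNIV (\<lambda>n x. \<sigma> x (\<kappa> n)) \<omega> sequentially"
    "x0 \<in> torus" "\<omega> x0 \<noteq> 0"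
proof -
  note main = that
  obtain A where A: "0 < A" "\<And>x k. cmod (\<sigma> x k) \<le> A" using symbol_bounded by blast
  obtain L where L: "0 < L" "\<And>k x y. cmod (\<sigma> x k - \<sigma> y k) \<le> L * \<bar>x - y\<bar>" using symbol_lipschitz by blast
  have bdd: "bdd_above (range (\<lambda>x. cmod (\<sigma> x k)))" for k
    using A by (intro bdd_aboveI[of _ A]) auto
  have sup0: "0 \<le> (SUP x. cmod (\<sigma> x k))" for k
    by (rule order_trans[OF norm_ge_zero cSUP_upper[OF UNIV_I bdd]])
  obtain e where e: "0 < e" "\<not> eventually (\<lambda>k. dist (SUP x. cmod (\<sigma> x k)) 0 < e) (filtercomap abs at_top)"
    using assms unfolding tendsto_iff by blast
  have "\<exists>k x. int n \<le> \<bar>k\<bar> \<and> e / 2 < cmod (\<sigma> x k)" for n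
  proof -
    obtain k where k: "int n \<le> \<bar>k\<bar>" "e \<le> (SUP x. cmod (\<sigma> x k))"
      using e(2) sup0 unfolding eventually_abs_int by (auto simp: not_less)
    have "e / 2 < (SUP x. cmod (\<sigma> x k))" using k(2) e(1) by linarith
    then obtain x where "e / 2 < cmod (\<sigma> x k)" using less_cSUP_iff[OF UNIV_not_empty bdd] by blast
    with k show ?thesis by blast
  qed
  then obtain k where k: "\<And>n. int n \<le> \<bar>k n\<bar>" and kx: "\<And>n. \<exists>x. e / 2 < cmod (\<sigma> x (k n))"
    by metis
  obtain g r where g: "continuous_on {0..2 * pi} g" and r: "strict_mono (r :: nat \<Rightarrow> nat)"
    and conv: "\<And>e. 0 < e \<Longrightarrow> \<exists>N. \<forall>n x. n \<ge> N \<and> x \<in> {0..2 * pi} \<longrightarrow> norm (\<sigma> x (k (r n)) - g x) < e"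
  proof (rule Arzela_Ascoli[of "{0..2 * pi}" "\<lambda>n x. \<sigma> x (k n)" A])
    show "\<exists>d>0. \<forall>n y. y \<in> {0..2 * pi} \<and> norm (x - y) < d \<longrightarrow> norm (\<sigma> x (k n) - \<sigma> y (k n)) < e"
      if "x \<in> {0..2 * pi}" "0 < e" for x e
    proof (intro exI[of _ "e / L"] conjI allI impI)
      show "0 < e / L" using that L by simp
      fix n y assume y: "y \<in> {0..2 * pi} \<and> norm (x - y) < e / L"
      have "cmod (\<sigma> x (k n) - \<sigma> y (k n)) \<le> L * \<bar>x - y\<bar>" by (rule L(2))
      also have "\<dots> < e" using y L(1) by (simp add: field_simps)
      finally show "norm (\<sigma> x (k n) - \<sigma> y (k n)) < e" .
    qed
  qed (use A that in auto)
  define \<kappa> where "\<kappa> n = k (r n)" for n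
  \<comment> \<open>Taken pointwise on the whole line, the limit agrees with \<open>g\<close> on one
    period, and equality of the symbols at congruent points carries the uniform convergence to all
    \<open>x\<close>.\<close>
  define \<omega> where "\<omega> x = lim (\<lambda>n. \<sigma> x (\<kappa> n))" for x
  have "(\<lambda>n. \<sigma> x (\<kappa> n)) \<longlonglongrightarrow> g x" if "x \<in> {0..2 * pi}" for x
    unfolding \<kappa>_def LIMSEQ_iff using conv that by blast
  then have \<omega>g: "\<omega> x = g x" if "x \<in> {0..2 * pi}" for x
    unfolding \<omega>_def using that by (intro limI) auto
  have unif: "\<exists>N. \<forall>n\<ge>N. \<forall>x. cmod (\<sigma> x (\<kappa> n) - \<omega> x) < e" if "0 < e" for e
  proof -
    obtain N where N: "\<And>n x. n \<ge> N \<Longrightarrow> x \<in> {0..2 * pi} \<Longrightarrow> norm (\<sigma> x (k (r n)) - g x) < e"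
      using conv[OF \<open>0 < e\<close>] by blast
    have "cmod (\<sigma> x (\<kappa> n) - \<omega> x) < e" if "n \<ge> N" for n x
    proof -
      obtain x' where x': "x' \<in> torus" "\<And>k. \<sigma> x k = \<sigma> x' k" using symbol_representative by blast
      then have "\<omega> x = \<omega> x'" by (simp add: \<omega>_def)
      then show ?thesis using N[OF that, of x'] x' \<omega>g[of x'] by (simp add: \<kappa>_def)
    qed
    then show ?thesis by blast
  qed
  show ?thesis
  proof (rule ccontr)
    \<comment> \<open>If every point of the torus failed, the limit would vanish there, so the
      symbol at \<open>\<kappa> N\<close> would be below \<open>e / 2\<close> everywhere, against
      the choice of the frequencies.\<close>
    assume no: "\<not> thesis"
    have "filterlim (\<lambda>n. \<bar>\<kappa> n\<bar>) at_top sequentially"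
    proof (rule filterlim_at_top_mono)
      show "filterlim int at_top sequentially" by (rule filterlim_int_sequentially)
      show "eventually (\<lambda>n. int n \<le> \<bar>\<kappa> n\<bar>) sequentially"
      proof (rule always_eventually, rule allI)
        fix n show "int n \<le> \<bar>\<kappa> n\<bar>"
          using k[of "r n"] seq_suble[OF r, of n] by (simp add: \<kappa>_def)
      qed
    qed
    moreover have "uniform_limit UNIV (\<lambda>n x. \<sigma> x (\<kappa> n)) \<omega> sequentially"
      unfolding uniform_limit_iff eventually_sequentially dist_norm using unif by blast
    ultimately have z: "\<omega> x = 0" if "x \<in> torus" for x using that no main[of \<kappa> \<omega> x] by blast
    obtain N where N: "\<And>n x. n \<ge> N \<Longrightarrow> cmod (\<sigma> x (\<kappa> n) - \<omega> x) < e / 2" using unif[of "e / 2"] e by auto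
    obtain x where x: "e / 2 < cmod (\<sigma> x (\<kappa> N))" using kx by (auto simp: \<kappa>_def)
    obtain x' where x': "x' \<in> torus" "\<And>k. \<sigma> x k = \<sigma> x' k" using symbol_representative by blast
    show False using N[of N x'] z[OF x'(1)] x x'(2) by simp
  qed
qed

end

context zero_order_symbol
begin

text \<open>Approximate eigenfunctions in the sense that \<open>T\<close> multiplies high
  exponentials by a function \<open>\<omega>\<close>, not by a number. After one application the
  exponential carries the amplitude \<open>\<omega>\<close>, so the asymptotics is needed for
  general amplitudes before it can be iterated.\<close>

theorem riesz_imp_symbol_vanishing:
  assumes p: "1 < p" and riesz: "riesz_operator (Lp p) (Lp_norm p) (pseudo_diff_op p \<sigma>)"
  shows "((\<lambda>k. SUP x. cmod (\<sigma> x k)) \<longlongrightarrow> 0) (filtercomap abs at_top)"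
proof (rule ccontr)
  assume "\<not> ((\<lambda>k. SUP x. cmod (\<sigma> x k)) \<longlongrightarrow> 0) (filtercomap abs at_top)"
  then obtain \<kappa> \<omega> x0 where \<kappa>: "filterlim (\<lambda>n. \<bar>\<kappa> n\<bar>) at_top sequentially"
    and \<omega>: "uniform_limit UNIV (\<lambda>n x. \<sigma> x (\<kappa> n)) \<omega> sequentially" and x0: "x0 \<in> torus" "\<omega> x0 \<noteq> 0"
    by (rule symbol_nonvanishing_limit)
  have p1: "1 \<le> p" "0 < p" using p by auto
  define T where "T = pseudo_diff_op p \<sigma>"
  have bo: "bounded_operator (Lp p) (Lp_norm p) T" unfolding T_def by (rule pseudo_diff_op_bounded[OF p])
  have TL: "T f \<in> Lp p" if "f \<in> Lp p" for f using bo that by (auto simp: bounded_operator_def)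
  obtain C0 where C0: "\<And>f. f \<in> Lp p \<Longrightarrow> Lp_norm p (T f) \<le> C0 * Lp_norm p f"
    using bo unfolding bounded_operator_def by blast
  define C where "C = \<bar>C0\<bar> + 1"
  have C: "0 < C" by (simp add: C_def)
  have TC: "Lp_norm p (T f) \<le> C * Lp_norm p f" if "f \<in> Lp p" for f
  proof -
    have "C0 * Lp_norm p f \<le> C * Lp_norm p f" by (intro mult_right_mono) (auto simp: C_def)
    then show ?thesis using C0[OF that] by linarith
  qed
  have Tdiff: "Lp_norm p (\<lambda>x. T f x - T g x) \<le> C * Lp_norm p (\<lambda>x. f x - g x)" if "f \<in> Lp p" "g \<in> Lp p" for f g
    by (rule bounded_operator_diff[OF p1(1) bo TC that])
  obtain A where A: "0 < A" "\<And>x k. cmod (\<sigma> x k) \<le> A" using symbol_bounded by blast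
  have lim: "(\<lambda>n. \<sigma> x (\<kappa> n)) \<longlonglongrightarrow> \<omega> x" for x
    using \<omega> by (rule tendsto_uniform_limitI) simp
  have \<omega>A: "cmod (\<omega> x) \<le> A" for x
    using A(2) by (intro Lim_norm_ubound[OF _ lim]) auto
  have \<omega>c: "continuous_on UNIV \<omega>"
    by (rule uniform_limit_theorem[OF _ \<omega>]) (auto intro!: always_eventually continuous_symbol)
  have \<omega>p: "\<omega> (x + 2 * pi) = \<omega> x" for x
  proof -
    have "(\<lambda>n. \<sigma> (x + 2 * pi) (\<kappa> n)) = (\<lambda>n. \<sigma> x (\<kappa> n))"
      using periodic_fun_simple.plus_period[OF periodic_symbol] by blast
    then show ?thesis using LIMSEQ_unique[OF lim[of "x + 2 * pi"]] lim[of x] by simp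
  qed

  \<comment> \<open>Asymptotics of the operator on modulated functions\<close>
  define E where "E n x = cis (x * of_int (\<kappa> n))" for n and x :: real
  have E1: "cmod (E n x) = 1" for n x by (simp add: E_def)
  have Ec: "continuous_on UNIV (E n)" for n unfolding E_def by (intro continuous_intros)
  have Ep: "E n (x + 2 * pi) = E n x" for n x
    using periodic_fun_simple.plus_period[OF trig_periodic[of "{\<kappa> n}" "\<lambda>_. 1"]] by (simp add: trig_def E_def)
  have modL: "(\<lambda>x. \<phi> x * E n x) \<in> Lp p" if "continuous_on UNIV \<phi>" "\<And>x. \<phi> (x + 2 * pi) = \<phi> x" for \<phi> n
    using that by (intro Lp_continuous p1 continuous_intros Ec) (simp_all add: periodic_fun_simple_def Ep)
  \<comment> \<open>The defect of multiplication by \<open>\<omega>\<close> on the amplitude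
    \<open>\<phi>\<close> modulated to frequency \<open>\<kappa> n\<close>. It tends to 0 for
    trigonometric amplitudes by computation, then for continuous periodic ones by
    approximation.\<close>
  define D where "D \<phi> n = Lp_norm p (\<lambda>x. T (\<lambda>x. \<phi> x * E n x) x - \<omega> x * (\<phi> x * E n x))" for \<phi> n
  have wmodL: "(\<lambda>x. \<omega> x * (\<phi> x * E n x)) \<in> Lp p" if "continuous_on UNIV \<phi>" "\<And>x. \<phi> (x + 2 * pi) = \<phi> x" for \<phi> n
    using that by (intro Lp_continuous p1 continuous_intros Ec \<omega>c) (simp_all add: periodic_fun_simple_def Ep \<omega>p)
  have Dtrig: "eventually (\<lambda>n. D \<psi> n < d) sequentially" if \<psi>: "\<psi> \<in> trig_polys" and d: "0 < d" for \<psi> d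
  proof -
    obtain L c where L: "finite L" "\<psi> = trig L c" using \<psi> by (auto simp: trig_polys_iff)
    \<comment> \<open>The frequency shift and the passage to \<open>\<omega>\<close> cost
      \<open>\<delta>\<close> each, so the total is at most \<open>2 * \<delta>\<close> times the
      sum of the moduli, which is below \<open>d / 2\<close>. The added 1 excludes division by
      zero.\<close>
    define \<delta> where "\<delta> = d / (4 * ((\<Sum>j\<in>L. cmod (c j)) + 1))"
    have S: "0 \<le> (\<Sum>j\<in>L. cmod (c j))" by (intro sum_nonneg) auto
    have \<delta>: "0 < \<delta>" using d S by (simp add: \<delta>_def)
    have "eventually (\<lambda>n. \<forall>x. cmod (\<sigma> x (\<kappa> n + j) - \<sigma> x (\<kappa> n)) < \<delta>) sequentially" for j
    proof -
      obtain N where N: "\<And>k x. N \<le> \<bar>k\<bar> \<Longrightarrow> cmod (\<sigma> x (k + j) - \<sigma> x k) < \<delta>"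
        using symbol_slowly_varying[OF \<delta>] by blast
      have "eventually (\<lambda>n. N \<le> \<bar>\<kappa> n\<bar>) sequentially" using \<kappa> by (simp add: filterlim_at_top)
      then show ?thesis by eventually_elim (use N in blast)
    qed
    then have "eventually (\<lambda>n. \<forall>j\<in>L. \<forall>x. cmod (\<sigma> x (\<kappa> n + j) - \<sigma> x (\<kappa> n)) < \<delta>) sequentially"
      using L(1) by (simp add: eventually_ball_finite_distrib)
    moreover have "eventually (\<lambda>n. \<forall>x\<in>UNIV. dist (\<sigma> x (\<kappa> n)) (\<omega> x) < \<delta>) sequentially"
      using \<omega> \<delta> unfolding uniform_limit_iff by blast
    ultimately show ?thesis
    proof eventually_elim
      case (elim n)
      define Q where "Q = pseudo_diff_trig \<sigma> (\<lambda>x. \<psi> x * E n x)"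
      have eq: "(\<lambda>x. \<psi> x * E n x) = trig ((\<lambda>j. j + \<kappa> n) ` L) (\<lambda>k. c (k - \<kappa> n))"
        by (simp add: L(2) trig_def[abs_def] E_def sum.reindex sum_distrib_right cis_mult[symmetric] distrib_left mult.assoc)
      have tp: "(\<lambda>x. \<psi> x * E n x) \<in> trig_polys"
        unfolding eq trig_polys_iff using L(1) by blast
      have Qx: "Q x = (\<Sum>j\<in>L. \<sigma> x (\<kappa> n + j) * c j * cis (x * of_int (j + \<kappa> n)))" for x
        unfolding Q_def eq using L(1)
        by (simp add: pseudo_diff_trig_eq symbol_trig_def trig_def sum.reindex add.commute)
      have wx: "\<omega> x * (\<psi> x * E n x) = (\<Sum>j\<in>L. \<omega> x * c j * cis (x * of_int (j + \<kappa> n)))" for x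
        unfolding fun_cong[OF eq] by (simp add: trig_def sum.reindex sum_distrib_left mult.assoc)
      have "cmod (Q x - \<omega> x * (\<psi> x * E n x)) \<le> d / 2" for x
      proof -
        have "Q x - \<omega> x * (\<psi> x * E n x) = (\<Sum>j\<in>L. (\<sigma> x (\<kappa> n + j) - \<omega> x) * c j * cis (x * of_int (j + \<kappa> n)))"
          unfolding Qx wx sum_subtractf[symmetric] by (simp add: algebra_simps)
        also have "cmod \<dots> \<le> (\<Sum>j\<in>L. 2 * \<delta> * cmod (c j))"
        proof (rule sum_norm_le)
          fix j assume j: "j \<in> L"
          have "cmod (\<sigma> x (\<kappa> n + j) - \<sigma> x (\<kappa> n)) < \<delta>" using elim(1) j by blast
          moreover have "cmod (\<sigma> x (\<kappa> n) - \<omega> x) < \<delta>" using elim(2) by (simp add: dist_norm)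
          ultimately have "cmod (\<sigma> x (\<kappa> n + j) - \<omega> x) \<le> 2 * \<delta>"
            using norm_triangle_ineq[of "\<sigma> x (\<kappa> n + j) - \<sigma> x (\<kappa> n)" "\<sigma> x (\<kappa> n) - \<omega> x"] by simp
          then show "cmod ((\<sigma> x (\<kappa> n + j) - \<omega> x) * c j * cis (x * of_int (j + \<kappa> n))) \<le> 2 * \<delta> * cmod (c j)"
            by (simp add: norm_mult mult_right_mono)
        qed
        also have "\<dots> = 2 * \<delta> * (\<Sum>j\<in>L. cmod (c j))" by (simp add: sum_distrib_left)
        also have "\<dots> \<le> 2 * \<delta> * ((\<Sum>j\<in>L. cmod (c j)) + 1)" using \<delta> by (intro mult_left_mono) auto
        also have "\<dots> = d / 2"
        proof -
          have "2 * (d / (4 * t)) * t = d / 2" if "0 < t" for t :: real using that by simp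
          from this[of "(\<Sum>j\<in>L. cmod (c j)) + 1"] show ?thesis using S unfolding \<delta>_def by linarith
        qed
        finally show ?thesis .
      qed
      then have le: "Lp_norm p (\<lambda>x. Q x - \<omega> x * (\<psi> x * E n x)) \<le> d / 2"
        using d p1 by (intro Lp_norm_bounded AE_I2) auto
      have \<psi>L: "continuous_on UNIV \<psi>" "\<psi> (x + 2 * pi) = \<psi> x" for x
        unfolding L(2) by (rule trig_continuous, rule periodic_fun_simple.plus_period[OF trig_periodic])
      have i: "p_integrable p (T (\<lambda>x. \<psi> x * E n x))" "p_integrable p Q" "p_integrable p (\<lambda>x. \<omega> x * (\<psi> x * E n x))"
        using TL[OF trig_polys_Lp[OF p1(2) tp]] pseudo_diff_trig_Lp[OF p1(2) tp] wmodL[OF \<psi>L]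
        by (auto simp: Lp_iff Q_def)
      have "Lp_norm p (\<lambda>x. T (\<lambda>x. \<psi> x * E n x) x - Q x) = 0"
        unfolding Q_def T_def by (rule pseudo_diff_op_trig[OF p tp])
      then have "D \<psi> n \<le> d / 2"
        using Lp_norm_diff_triangle[OF p1(1) i] le unfolding D_def by linarith
      then show "D \<psi> n < d" using d by linarith
    qed
  qed
  have Dlim: "eventually (\<lambda>n. D \<phi> n < d) sequentially"
    if \<phi>: "continuous_on UNIV \<phi>" "\<And>x. \<phi> (x + 2 * pi) = \<phi> x" and d: "0 < d" for \<phi> d
  proof -
    \<comment> \<open>Replacing the amplitude costs \<open>C * \<delta>\<close> under
      \<open>T\<close> and \<open>A * \<delta>\<close> under multiplication by
      \<open>\<omega>\<close>, together \<open>d / 2\<close>.\<close>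
    define \<delta> where "\<delta> = d / (2 * (C + A))"
    have \<delta>: "0 < \<delta>" using d C A by (simp add: \<delta>_def)
    obtain \<psi> where \<psi>: "\<psi> \<in> trig_polys" "\<And>x. x \<in> torus \<Longrightarrow> cmod (\<phi> x - \<psi> x) < \<delta>"
      using trig_polys_dense_continuous[OF continuous_on_subset[OF \<phi>(1)] _ \<delta>] \<phi>(2)[of 0] by auto
    have \<psi>L: "continuous_on UNIV \<psi>" "\<psi> (x + 2 * pi) = \<psi> x" for x
      using \<psi>(1) trig_continuous periodic_fun_simple.plus_period[OF trig_periodic] by (auto simp: trig_polys_iff)
    have "eventually (\<lambda>n. D \<psi> n < d / 2) sequentially" using d by (intro Dtrig \<psi>(1)) simp
    then show ?thesis
    proof eventually_elim
      case (elim n)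
      let ?f = "\<lambda>x. \<phi> x * E n x" and ?g = "\<lambda>x. \<psi> x * E n x"
      have fL: "?f \<in> Lp p" by (rule modL[OF \<phi>])
      have gL: "?g \<in> Lp p" by (rule modL[OF \<psi>L])
      have fg: "Lp_norm p (\<lambda>x. ?f x - ?g x) \<le> \<delta>"
      proof (rule Lp_norm_bounded)
        show "AE x in torus_measure. cmod (?f x - ?g x) \<le> \<delta>"
          using AE_torus
        proof eventually_elim
          case (elim x)
          have "?f x - ?g x = (\<phi> x - \<psi> x) * E n x" by (simp add: algebra_simps)
          then show ?case using \<psi>(2)[OF elim] by (simp add: norm_mult E1)
        qed
      qed (use p1 \<delta> in auto)
      have wfg: "Lp_norm p (\<lambda>x. \<omega> x * ?g x - \<omega> x * ?f x) \<le> A * \<delta>"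
      proof (rule Lp_norm_bounded)
        show "AE x in torus_measure. cmod (\<omega> x * ?g x - \<omega> x * ?f x) \<le> A * \<delta>"
          using AE_torus
        proof eventually_elim
          case (elim x)
          have "\<omega> x * ?g x - \<omega> x * ?f x = \<omega> x * ((\<psi> x - \<phi> x) * E n x)" by (simp add: algebra_simps)
          then have "cmod (\<omega> x * ?g x - \<omega> x * ?f x) = cmod (\<omega> x) * cmod (\<phi> x - \<psi> x)"
            by (simp add: norm_mult E1 norm_minus_commute)
          also have "\<dots> \<le> A * \<delta>" using \<psi>(2)[OF elim] A by (intro mult_mono \<omega>A) auto
          finally show ?case .
        qed
      qed (use p1 A \<delta> in auto)
      have i: "p_integrable p (T ?f)" "p_integrable p (T ?g)" "p_integrable p (\<lambda>x. \<omega> x * ?g x)" "p_integrable p (\<lambda>x. \<omega> x * ?f x)"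
        using TL[OF fL] TL[OF gL] wmodL[OF \<phi>] wmodL[OF \<psi>L] by (auto simp: Lp_iff)
      have "D \<phi> n \<le> Lp_norm p (\<lambda>x. T ?f x - T ?g x) + Lp_norm p (\<lambda>x. T ?g x - \<omega> x * ?f x)"
        unfolding D_def by (intro Lp_norm_diff_triangle p1 i)
      moreover have "Lp_norm p (\<lambda>x. T ?g x - \<omega> x * ?f x) \<le> D \<psi> n + Lp_norm p (\<lambda>x. \<omega> x * ?g x - \<omega> x * ?f x)"
        unfolding D_def by (intro Lp_norm_diff_triangle p1 i)
      moreover have "Lp_norm p (\<lambda>x. T ?f x - T ?g x) \<le> C * \<delta>"
        using order_trans[OF Tdiff[OF fL gL] mult_left_mono[OF fg, of C]] C by simp
      moreover have "C * \<delta> + A * \<delta> = d / 2"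
      proof -
        have "t * (d / (2 * t)) = d / 2" if "0 < t" for t :: real using that by simp
        from this[of "C + A"] show ?thesis using C A unfolding \<delta>_def by (simp only: distrib_right[symmetric])
      qed
      ultimately show "D \<phi> n < d" using elim wfg by linarith
    qed
  qed
  have EL: "E n \<in> Lp p" for n by (intro Lp_continuous p1 Ec) (simp add: periodic_fun_simple_def Ep)
  have HL: "(T ^^ s) (E n) \<in> Lp p" for s n by (induction s) (auto intro: TL EL)
  have \<omega>s: "continuous_on UNIV (\<lambda>x. \<omega> x ^ s)" "\<omega> (x + 2 * pi) ^ s = \<omega> x ^ s" for s x
    by (auto intro!: continuous_intros \<omega>c simp: \<omega>p)
  \<comment> \<open>In the induction step \<open>T\<close> enlarges the previous error by at most
    \<open>C\<close>, and what remains is the defect for the amplitude \<open>\<omega> ^ s\<close>.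
    That amplitude is continuous and periodic but need not be a trigonometric polynomial, which is
    why \<open>Dlim\<close> covers all continuous periodic amplitudes.\<close>
  have power: "eventually (\<lambda>n. Lp_norm p (\<lambda>x. (T ^^ s) (E n) x - \<omega> x ^ s * E n x) < d) sequentially" if "0 < d" for s d
    using that
  proof (induction s arbitrary: d)
    case (Suc s)
    have "eventually (\<lambda>n. Lp_norm p (\<lambda>x. (T ^^ s) (E n) x - \<omega> x ^ s * E n x) < d / (2 * C)) sequentially"
      using Suc.prems C by (intro Suc.IH) simp
    moreover have "eventually (\<lambda>n. D (\<lambda>x. \<omega> x ^ s) n < d / 2) sequentially"
      using Suc.prems by (intro Dlim \<omega>s) simp
    ultimately show ?case
    proof eventually_elim
      case (elim n)
      let ?h = "(T ^^ s) (E n)" and ?g = "\<lambda>x. \<omega> x ^ s * E n x"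
      have gL: "?g \<in> Lp p" by (rule modL[OF \<omega>s])
      have i: "p_integrable p (T ?h)" "p_integrable p (T ?g)" "p_integrable p (\<lambda>x. \<omega> x * ?g x)"
        using TL[OF HL] TL[OF gL] wmodL[OF \<omega>s] by (auto simp: Lp_iff)
      have "Lp_norm p (\<lambda>x. T ?h x - \<omega> x * ?g x) \<le> Lp_norm p (\<lambda>x. T ?h x - T ?g x) + D (\<lambda>x. \<omega> x ^ s) n"
        unfolding D_def by (rule Lp_norm_diff_triangle[OF p1(1) i])
      moreover have "Lp_norm p (\<lambda>x. T ?h x - T ?g x) \<le> C * (d / (2 * C))"
        by (rule order_trans[OF Tdiff[OF HL gL] mult_left_mono]) (use elim(1) C in auto)
      moreover have "C * (d / (2 * C)) = d / 2" using C by simp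
      ultimately have "Lp_norm p (\<lambda>x. T ?h x - \<omega> x * ?g x) < d" using elim(2) by linarith
      then show ?case by (simp add: mult.assoc)
    qed
  qed simp

  \<comment> \<open>Separation of the images\<close>
  define \<eta> where "\<eta> = cmod (\<omega> x0)"
  have \<eta>: "0 < \<eta>" using x0 by (simp add: \<eta>_def)
  obtain a b where ab: "0 \<le> a" "a < b" "b < 2 * pi" and big: "\<And>x. x \<in> {a..b} \<Longrightarrow> \<eta> / 2 \<le> cmod (\<omega> x)"
  proof -
    have "isCont \<omega> x0" using \<omega>c by (simp add: continuous_on_eq_continuous_at)
    then obtain t where t: "0 < t" "\<And>x. dist x x0 < t \<Longrightarrow> dist (\<omega> x) (\<omega> x0) < \<eta> / 2"
      using \<eta> unfolding continuous_at_eps_delta dist_norm by (metis half_gt_zero)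
    define b where "b = x0 + min (t / 2) ((2 * pi - x0) / 2)"
    show ?thesis
    proof (rule that[of x0 b])
      show "0 \<le> x0" "x0 < b" using x0(1) t(1) by (auto simp: b_def)
      have "b \<le> x0 + (2 * pi - x0) / 2" unfolding b_def by (intro add_left_mono min.cobounded2)
      also have "\<dots> = pi + x0 / 2" by (simp add: field_simps)
      also have "\<dots> < 2 * pi" using x0(1) by simp
      finally show "b < 2 * pi" .
      fix x assume x: "x \<in> {x0..b}"
      have "b \<le> x0 + t / 2" unfolding b_def by (intro add_left_mono min.cobounded1)
      then have "dist x x0 < t" using x t(1) by (auto simp: dist_real_def)
      then have "cmod (\<omega> x - \<omega> x0) < \<eta> / 2" using t(2) by (simp add: dist_norm)
      then show "\<eta> / 2 \<le> cmod (\<omega> x)"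
        using norm_triangle_ineq2[of "\<omega> x0" "\<omega> x"] by (simp add: \<eta>_def norm_minus_commute)
    qed
  qed
  \<comment> \<open>The constant of \<open>integral_interval_cis_diff\<close>. It depends on the
    interval but not on \<open>s\<close>, which enters \<open>lower\<close> only through
    \<open>(\<eta> / 2) ^ s\<close>.\<close>
  define c0 where "c0 = (b - a) / (4 * pi)"
  have c0: "0 < c0" "c0 \<le> 1" using ab by (auto simp: c0_def)
  have lower: "(\<eta> / 2) ^ s * c0 \<le> Lp_norm p (\<lambda>x. \<omega> x ^ s * E n x - \<omega> x ^ s * E m x)"
    if m: "4 / (b - a) \<le> \<bar>real_of_int (\<kappa> n - \<kappa> m)\<bar>" for s n m
  proof -
    have cont: "continuous_on UNIV (\<lambda>x. \<omega> x ^ s * E n x - \<omega> x ^ s * E m x)"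
      by (intro continuous_intros \<omega>c Ec)
    have pi: "p_integrable p (\<lambda>x. \<omega> x ^ s * E n x - \<omega> x ^ s * E m x)"
      by (rule p_integrable_continuous[OF cont p1(2)])
    have "(\<eta> / 2) ^ s * c0 \<le> (\<eta> / 2) ^ s * (LINT x|torus_measure. indicator {a..b} x * cmod (cis (x * of_int (\<kappa> n - \<kappa> m)) - 1))"
      unfolding c0_def using \<eta> by (intro mult_left_mono integral_interval_cis_diff ab m) auto
    also have "\<dots> = (LINT x|torus_measure. (\<eta> / 2) ^ s * (indicator {a..b} x * cmod (cis (x * of_int (\<kappa> n - \<kappa> m)) - 1)))"
      by simp
    also have "\<dots> \<le> (LINT x|torus_measure. cmod (\<omega> x ^ s * E n x - \<omega> x ^ s * E m x))"
    proof (rule integral_mono_AE')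
      show "integrable torus_measure (\<lambda>x. cmod (\<omega> x ^ s * E n x - \<omega> x ^ s * E m x))"
        using integrable_torus_continuous[OF cont] by simp
      show "AE x in torus_measure. (\<eta> / 2) ^ s * (indicator {a..b} x * cmod (cis (x * of_int (\<kappa> n - \<kappa> m)) - 1)) \<le>
          cmod (\<omega> x ^ s * E n x - \<omega> x ^ s * E m x)"
      proof (rule AE_I2)
        fix x
        have "cis (x * of_int (\<kappa> n - \<kappa> m)) * E m x = E n x"
          unfolding E_def cis_mult by (simp add: algebra_simps)
        then have "\<omega> x ^ s * E n x - \<omega> x ^ s * E m x = \<omega> x ^ s * ((cis (x * of_int (\<kappa> n - \<kappa> m)) - 1) * E m x)"
          by (simp add: algebra_simps)
        then have eq: "cmod (\<omega> x ^ s * E n x - \<omega> x ^ s * E m x) = cmod (\<omega> x) ^ s * cmod (cis (x * of_int (\<kappa> n - \<kappa> m)) - 1)"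
          by (simp only: norm_mult norm_power E1 mult_1_right)
        show "(\<eta> / 2) ^ s * (indicator {a..b} x * cmod (cis (x * of_int (\<kappa> n - \<kappa> m)) - 1)) \<le>
          cmod (\<omega> x ^ s * E n x - \<omega> x ^ s * E m x)"
        proof (cases "x \<in> {a..b}")
          case True
          have "(\<eta> / 2) ^ s \<le> cmod (\<omega> x) ^ s" using big[OF True] \<eta> by (intro power_mono) auto
          then show ?thesis unfolding eq using True by (simp add: mult_right_mono)
        qed simp
      qed
    qed (use \<eta> in auto)
    also have "\<dots> \<le> Lp_norm p (\<lambda>x. \<omega> x ^ s * E n x - \<omega> x ^ s * E m x)"
      by (rule integral_norm_le_Lp_norm[OF p pi])
    finally show ?thesis .
  qed
  \<comment> \<open>Fixed before \<open>s\<close> is known: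
    \<open>\<epsilon> = (\<eta> / 2) * (c0 / 6)\<close>, so \<open>4 * \<epsilon> ^ s\<close> stays
    below the separation for every \<open>s \<ge> 1\<close>. The 4 counts the errors of size
    \<open>\<epsilon> ^ s\<close> on the way from one model function to the other through a common
    net point.\<close>
  define \<epsilon> where "\<epsilon> = c0 * \<eta> / 12"
  have \<epsilon>: "0 < \<epsilon>" using c0 \<eta> by (simp add: \<epsilon>_def)
  obtain s V where s: "1 \<le> s" and V: "finite V" "V \<subseteq> Lp p"
    and cover: "(T ^^ s) ` unit_ball (Lp p) (Lp_norm p) \<subseteq> (\<Union>v\<in>V. (\<lambda>b x. v x + of_real (\<epsilon> ^ s) * b x) ` unit_ball (Lp p) (Lp_norm p))"
    using riesz \<epsilon> unfolding riesz_operator_def T_def by blast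
  have es: "0 < \<epsilon> ^ s" using \<epsilon> by simp
  let ?H = "\<lambda>n. (T ^^ s) (E n)" and ?G = "\<lambda>n x. \<omega> x ^ s * E n x"
  have near: "\<exists>v\<in>V. Lp_norm p (\<lambda>x. ?H n x - v x) \<le> \<epsilon> ^ s" for n
  proof -
    have "Lp_norm p (E n) \<le> 1" using p1 by (intro Lp_norm_bounded AE_I2) (auto simp: E1)
    then have "E n \<in> unit_ball (Lp p) (Lp_norm p)" using EL by (simp add: unit_ball_def)
    then have "?H n \<in> (\<Union>v\<in>V. (\<lambda>b x. v x + of_real (\<epsilon> ^ s) * b x) ` unit_ball (Lp p) (Lp_norm p))"
      using cover by blast
    then obtain v b where vb: "v \<in> V" "b \<in> unit_ball (Lp p) (Lp_norm p)" "?H n = (\<lambda>x. v x + of_real (\<epsilon> ^ s) * b x)"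
      by blast
    have "Lp_norm p (\<lambda>x. ?H n x - v x) = Lp_norm p (\<lambda>x. of_real (\<epsilon> ^ s) * b x)"
      unfolding vb(3) by simp
    also have "\<dots> = cmod (of_real (\<epsilon> ^ s)) * Lp_norm p b" by (rule Lp_norm_cmult[OF p1(2)])
    also have "\<dots> \<le> \<epsilon> ^ s * 1"
      unfolding norm_of_real using vb(2) es by (intro mult_mono) (auto simp: unit_ball_def)
    finally show ?thesis using vb(1) by auto
  qed
  obtain n0 where n0: "\<And>n. n0 \<le> n \<Longrightarrow> Lp_norm p (\<lambda>x. ?H n x - ?G n x) < \<epsilon> ^ s"
    using power[OF es, of s] unfolding eventually_sequentially by blast
  \<comment> \<open>Finitely many net points serve infinitely many exponentials, so one of them
    serves infinitely many beyond \<open>n0\<close>.\<close>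
  obtain v where v: "v \<in> V" "infinite {n \<in> {n0..}. Lp_norm p (\<lambda>x. ?H n x - v x) \<le> \<epsilon> ^ s}"
    using pigeonhole_infinite_rel[of "{n0..}" V "\<lambda>n v. Lp_norm p (\<lambda>x. ?H n x - v x) \<le> \<epsilon> ^ s"] V(1) near
      infinite_Ici[of n0] by blast
  define S where "S = {n \<in> {n0..}. Lp_norm p (\<lambda>x. ?H n x - v x) \<le> \<epsilon> ^ s}"
  have S: "infinite S" using v(2) by (simp add: S_def)
  obtain n where n: "n \<in> S" using S by (metis finite.emptyI ex_in_conv)
  \<comment> \<open>A second index of \<open>S\<close> is taken so far out that the two frequencies
    differ by at least \<open>4 / (b - a)\<close>, as \<open>lower\<close> requires.\<close>
  obtain q :: int where q: "4 / (b - a) + \<bar>real_of_int (\<kappa> n)\<bar> < of_int q" using ex_less_of_int by blast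
  obtain n1 where n1: "\<And>m. n1 \<le> m \<Longrightarrow> q \<le> \<bar>\<kappa> m\<bar>"
    using \<kappa> unfolding filterlim_at_top eventually_sequentially by blast
  obtain m where m: "m \<in> S" "n1 \<le> m" using S infinite_nat_iff_unbounded_le by blast
  have sep: "4 / (b - a) \<le> \<bar>real_of_int (\<kappa> n - \<kappa> m)\<bar>"
  proof -
    have "real_of_int q \<le> of_int \<bar>\<kappa> m\<bar>" using n1[OF m(2)] by (simp only: of_int_le_iff)
    moreover have "of_int \<bar>\<kappa> m\<bar> \<le> \<bar>real_of_int (\<kappa> n)\<bar> + \<bar>real_of_int (\<kappa> n - \<kappa> m)\<bar>" by simp
    ultimately show ?thesis using q by linarith
  qed
  have i: "p_integrable p (?H k)" "p_integrable p (?G k)" for k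
    using HL modL[OF \<omega>s] by (auto simp: Lp_iff)
  have vi: "p_integrable p v" using v(1) V(2) by (auto simp: Lp_iff)
  have "Lp_norm p (\<lambda>x. ?G n x - ?G m x) \<le> 4 * \<epsilon> ^ s"
  proof -
    have "Lp_norm p (\<lambda>x. ?G k x - v x) \<le> 2 * \<epsilon> ^ s" if "k \<in> S" for k
    proof -
      have "Lp_norm p (\<lambda>x. ?G k x - v x) \<le> Lp_norm p (\<lambda>x. ?G k x - ?H k x) + Lp_norm p (\<lambda>x. ?H k x - v x)"
        by (intro Lp_norm_diff_triangle p1 i vi)
      then show ?thesis using that n0[of k] by (simp add: S_def Lp_norm_diff_commute[of p "?G k" "?H k"])
    qed
    from this[OF n] this[OF m(1)]
    have "Lp_norm p (\<lambda>x. ?G n x - v x) + Lp_norm p (\<lambda>x. v x - ?G m x) \<le> 4 * \<epsilon> ^ s"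
      by (simp add: Lp_norm_diff_commute[of p v "?G m"])
    moreover have "Lp_norm p (\<lambda>x. ?G n x - ?G m x) \<le> Lp_norm p (\<lambda>x. ?G n x - v x) + Lp_norm p (\<lambda>x. v x - ?G m x)"
      by (intro Lp_norm_diff_triangle p1 i vi)
    ultimately show ?thesis by linarith
  qed
  with lower[OF sep, of s] have "(\<eta> / 2) ^ s * c0 \<le> 4 * \<epsilon> ^ s" by linarith
  also have "\<epsilon> ^ s = (\<eta> / 2) ^ s * (c0 / 6) ^ s"
    by (simp add: \<epsilon>_def power_mult_distrib[symmetric] mult.commute)
  \<comment> \<open>Here \<open>s \<ge> 1\<close> and \<open>c0 \<le> 1\<close> are used; cancelling
    \<open>(\<eta> / 2) ^ s\<close> would leave \<open>c0\<close> at most two thirds of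
    itself.\<close>
  also have "(c0 / 6) ^ s \<le> (c0 / 6) ^ 1" using c0 s by (intro power_decreasing) auto
  finally have "(\<eta> / 2) ^ s * c0 \<le> (\<eta> / 2) ^ s * (4 * (c0 / 6))"
    using \<eta> by (simp add: mult_left_mono mult_ac)
  then have "c0 \<le> 4 * (c0 / 6)" using \<eta> by (simp add: mult_le_cancel_left_pos)
  then show False using c0 by simp
qed

end

theorem theorem2p4:
  fixes \<sigma> :: "real \<Rightarrow> int \<Rightarrow> complex" and p :: real
  assumes "\<sigma> \<in> symbol_class 0 1 0"
    and "1 < p"
  shows "riesz_operator (Lp p) (Lp_norm p) (pseudo_diff_op p \<sigma>) \<longleftrightarrow>
           ((\<lambda>k. SUP x. cmod (\<sigma> x k)) \<longlongrightarrow> 0) (filtercomap abs at_top)"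
proof -
  interpret zero_order_symbol \<sigma> by standard (rule assms)
  show ?thesis
    using riesz_imp_symbol_vanishing symbol_vanishing_imp_riesz assms(2) by blast
qed

end
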